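(* Let $N=3$. There exists a sequence $\mathbf U_n\in\mathcal D_{SO(2\times2)}$ of solutions to $\nabla\times\nabla\times\mathbf U=|\mathbf U|^4\mathbf U$ in $\mathbb{R}^3$ such that $E(\mathbf U_n)\to\infty$, where $E(\mathbf U)=\frac12\int|\nabla\times\mathbf U|^2dx-\frac16\int|\mathbf U|^6dx$, and each $\mathbf U_n$ has the form $\mathbf U_n(x)=\frac{u_n(x)}{\sqrt{x_1^2+x_2^2}}(-x_2,x_1,0)$ for some $u_n\colon\mathbb{R}^3\to\mathbb{R}$ invariant under $x\mapsto\tilde g x$ for all $g\in SO(2)$.
   Context: For $g\in SO(2)$, $\tilde g=\begin{pmatrix}g&0\\0&1\end{pmatrix}\in SO(3)$. $\mathcal D^{1,2}(\mathbb{R}^3,\mathbb{R}^3)$ is the completion of $C_c^\infty(\mathbb{R}^3,\mathbb{R}^3)$ w.r.t. $|\nabla\mathbf U|_2$; solutions are critical points of $E$ on it. Let $\pi\colon\mathbb{S}^3\setminus\{Q\}\to\mathbb{R}^3$ be the stereographic projection from the north pole $Q$, $\psi(x)=\sqrt{2/(1+|x|^2)}$. For $g_1,g_2\in SO(2)$ write $g=\mathrm{diag}(g_1,g_2)\in SO(4)$. $\mathbf U\in\mathcal D^{1,2}(\mathbb{R}^3,\mathbb{R}^3)$ is $SO(2\times2)$-symmetric if for all $g_1,g_2\in SO(2)$ and a.e. $x$: $\mathbf U(\pi(g\pi^{-1}(x)))/\psi(\pi(g\pi^{-1}(x)))=\tilde g_1\mathbf U(x)/\psi(x)$; $\mathcal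 D_{SO(2\times2)}$ is the subspace of such fields. *)

theory Defs
  imports "HOL-Analysis.Analysis"
begin

definition pd :: "(real^3 \<Rightarrow> real) \<Rightarrow> 3 \<Rightarrow> real^3 \<Rightarrow> real" where
  "pd f j x = deriv (\<lambda>t. f (x + t *\<^sub>R axis j 1)) 0"

definition iter_pd :: "3 list \<Rightarrow> (real^3 \<Rightarrow> real) \<Rightarrow> real^3 \<Rightarrow> real" where
  "iter_pd js f = foldr (\<lambda>j g. pd g j) js f"

definition smooth_fun :: "(real^3 \<Rightarrow> real) \<Rightarrow> bool" where
  "smooth_fun f \<longleftrightarrow> (\<forall>js x. iter_pd js f differentiable (at x))"

definition test_fun :: "(real^3 \<Rightarrow> real) \<Rightarrow> bool" where
  "test_fun f \<longleftrightarrow> smooth_fun f \<and> compact (closure {x. f x \<noteq> 0})"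

definition test_field :: "(real^3 \<Rightarrow> real^3) \<Rightarrow> bool" where
  "test_field F \<longleftrightarrow> (\<forall>i. test_fun (\<lambda>x. F x $ i))"

definition grad_sq :: "(real^3 \<Rightarrow> real^3) \<Rightarrow> real^3 \<Rightarrow> real" where
  "grad_sq F x = (\<Sum>i\<in>UNIV. \<Sum>j\<in>UNIV. (pd (\<lambda>y. F y $ i) j x)^2)"

text \<open>Completion of compactly supported smooth fields w.r.t. the L^2 norm of the gradient,
  realised (via the Sobolev embedding) as the L^6 limits of gradient-Cauchy sequences of test fields.\<close>
definition D12 :: "(real^3 \<Rightarrow> real^3) set" where
  "D12 = {U. U \<in> borel_measurable lborel \<and>
     (\<exists>\<phi> :: nat \<Rightarrow> real^3 \<Rightarrow> real^3.
        (\<forall>k. test_field (\<phi> k)) \<and>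
        (\<forall>k. integrable lborel (\<lambda>x. norm (\<phi> k x - U x) ^ 6)) \<and>
        (\<lambda>k. integral\<^sup>L lborel (\<lambda>x. norm (\<phi> k x - U x) ^ 6)) \<longlonglongrightarrow> 0 \<and>
        (\<forall>e>0. \<exists>N. \<forall>m\<ge>N. \<forall>n\<ge>N.
            integral\<^sup>L lborel (grad_sq (\<lambda>y. \<phi> m y - \<phi> n y)) < e))}"

definition weak_jac :: "(real^3 \<Rightarrow> real^3) \<Rightarrow> (real^3 \<Rightarrow> real^3^3) \<Rightarrow> bool" where
  "weak_jac U DU \<longleftrightarrow> DU \<in> borel_measurable lborel \<and>
     (\<forall>\<phi>. test_fun \<phi> \<longrightarrow> (\<forall>i j.
        integrable lborel (\<lambda>x. U x $ i * pd \<phi> j x) \<and>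
        integrable lborel (\<lambda>x. DU x $ i $ j * \<phi> x) \<and>
        integral\<^sup>L lborel (\<lambda>x. U x $ i * pd \<phi> j x) =
          - integral\<^sup>L lborel (\<lambda>x. DU x $ i $ j * \<phi> x)))"

definition wjac :: "(real^3 \<Rightarrow> real^3) \<Rightarrow> real^3 \<Rightarrow> real^3^3" where
  "wjac U = (SOME DU. weak_jac U DU)"

definition curl :: "(real^3 \<Rightarrow> real^3) \<Rightarrow> real^3 \<Rightarrow> real^3" where
  "curl U x = (let D = wjac U x in
     vector [D$3$2 - D$2$3, D$1$3 - D$3$1, D$2$1 - D$1$2])"

definition energy :: "(real^3 \<Rightarrow> real^3) \<Rightarrow> real" where
  "energy U = 1/2 * integral\<^sup>L lborel (\<lambda>x. norm (curl U x) ^ 2)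
             - 1/6 * integral\<^sup>L lborel (\<lambda>x. norm (U x) ^ 6)"

text \<open>Solutions = critical points of the energy on D^{1,2}: the derivative
  E'(U)[V] = int curl U . curl V - int |U|^4 U . V vanishes for all V in D^{1,2}.\<close>
definition curl_curl_solution :: "(real^3 \<Rightarrow> real^3) \<Rightarrow> bool" where
  "curl_curl_solution U \<longleftrightarrow> U \<in> D12 \<and>
     (\<forall>V\<in>D12. integral\<^sup>L lborel (\<lambda>x. curl U x \<bullet> curl V x)
               - integral\<^sup>L lborel (\<lambda>x. norm (U x) ^ 4 * (U x \<bullet> V x)) = 0)"

definition SO2 :: "(real^2^2) set" where
  "SO2 = {g. orthogonal_matrix g \<and> det g = 1}"

definition tilde :: "real^2^2 \<Rightarrow> real^3 \<Rightarrow> real^3" where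
  "tilde g x = (let y = g *v vector [x$1, x$2] in vector [y$1, y$2, x$3])"

definition diag_act :: "real^2^2 \<Rightarrow> real^2^2 \<Rightarrow> real^4 \<Rightarrow> real^4" where
  "diag_act g1 g2 \<xi> = (let a = g1 *v vector [\<xi>$1, \<xi>$2]; b = g2 *v vector [\<xi>$3, \<xi>$4]
                       in vector [a$1, a$2, b$1, b$2])"

definition stereo :: "real^4 \<Rightarrow> real^3" where
  "stereo \<xi> = vector [\<xi>$1 / (1 - \<xi>$4), \<xi>$2 / (1 - \<xi>$4), \<xi>$3 / (1 - \<xi>$4)]"

definition stereo_inv :: "real^3 \<Rightarrow> real^4" where
  "stereo_inv x = vector [2 * x$1 / (1 + norm x ^ 2), 2 * x$2 / (1 + norm x ^ 2),
                          2 * x$3 / (1 + norm x ^ 2), (norm x ^ 2 - 1) / (1 + norm x ^ 2)]"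

definition psi :: "real^3 \<Rightarrow> real" where
  "psi x = sqrt (2 / (1 + norm x ^ 2))"

definition D_SO22 :: "(real^3 \<Rightarrow> real^3) set" where
  "D_SO22 = {U \<in> D12. \<forall>g1\<in>SO2. \<forall>g2\<in>SO2. AE x in lborel.
      (let y = stereo (diag_act g1 g2 (stereo_inv x)) in
        (1 / psi y) *\<^sub>R U y = (1 / psi x) *\<^sub>R tilde g1 (U x))}"

end

(* The ansatz U = psi^3 w(s) (-x_2, x_1, 0), where s = 4 (x_1^2 + x_2^2) / (1 + |x|^2)^2 is the squared distance
   from an axis of the three-sphere, is symmetric and divergence free and turns the equation into
     4 s (1 - s) w'' + (8 - 12 s) w' = 15/4 w - s^2 w^5  on [0, 1],
   which is singular at both ends. Solutions regular at 0 form a one-parameter family, and shooting in the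
   initial value r^-3 selects those that are regular at 1: as r tends to 0, the rescaled solutions approach those of
   an equation all of whose solutions oscillate, so the angle of (w, flux) at a fixed time is unbounded in r,
   and by continuity the flux into the endpoint s = 1 vanishes for arbitrarily small r. The energy of a solution
   is a third of the integral of |U|^6, which is at least of order 1/r^2 because of the size of w near s = 0. *)

theory Submission
  imports Defs
begin

section \<open>Iterated partial derivatives and smooth functions\<close>

text \<open>For axially symmetric F the double curl of F (-x_2, x_1, 0) is -(Laplace F + (2/rho)
  d_rho F) (-x_2, x_1, 0), where rho is the distance to the axis, so a single scalar equation
  remains. The exponent is critical: s^2 w^5 scales like s w'' under w(s) -> l^(-3/4) w(s/l).
  Concentration at s = 0 therefore leaves a scale-invariant limit equation, which becomes autonomous
  in log s after multiplication by s^(3/4). At s = 1 the flux 4 s^2 (1 - s) w' still has a limit,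
  and regularity means that this limit is zero. The angle need not extend continuously to s = 1. The
  intermediate value theorem is therefore applied in r at times T_k < 1, and the parameter is a
  limit point of those found; a Hoelder bound for the flux, uniform on compact sets of parameters,
  carries the zero over to s = 1. The profile is only known to be C^2 on [0, 1], with one-sided
  derivatives at values that s attains in space, so the chain rule is needed relative to the range
  of s, and membership in the completion is shown through polynomial profiles times cutoffs.\<close>

lemma pd_eq:
  assumes "(f has_derivative f') (at x)"
  shows "pd f j x = f' (axis j 1)"
proof -
  have "((\<lambda>t. f (x + t *\<^sub>R axis j 1)) has_derivative (\<lambda>t. f' (t *\<^sub>R axis j 1))) (at 0)"
    by (rule has_derivative_compose[of "\<lambda>t. x + t *\<^sub>R axis j 1" "\<lambda>t. t *\<^sub>R axis j 1" 0 UNIV f f'])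
       (auto intro!: derivative_eq_intros simp: assms)
  moreover have "f' (t *\<^sub>R axis j 1) = t * f' (axis j 1)" for t
    using linear_cmul[OF has_derivative_linear[OF assms]] by simp
  ultimately have "((\<lambda>t. f (x + t *\<^sub>R axis j 1)) has_real_derivative f' (axis j 1)) (at 0)"
    by (simp add: has_field_derivative_def mult_commute_abs)
  then show ?thesis
    unfolding pd_def by (rule DERIV_imp_deriv)
qed

lemma has_derivative_pd:
  assumes "f differentiable (at x)"
  shows "(f has_derivative (\<lambda>h. \<Sum>j\<in>UNIV. h $ j * pd f j x)) (at x)"
proof -
  obtain f' where f': "(f has_derivative f') (at x)"
    using assms by (auto simp: differentiable_def)
  have lin: "linear f'" by (rule has_derivative_linear[OF f'])
  have "f' h = (\<Sum>j\<in>UNIV. h $ j * pd f j x)" for h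
  proof -
    have "f' h = f' (\<Sum>j\<in>UNIV. (h $ j) *\<^sub>R axis j 1)"
      by (simp add: scalar_mult_eq_scaleR[symmetric] basis_expansion)
    also have "\<dots> = (\<Sum>j\<in>UNIV. h $ j * f' (axis j 1))"
      by (simp add: linear_sum[OF lin] linear_cmul[OF lin])
    finally show ?thesis by (simp add: pd_eq[OF f'])
  qed
  then have "f' = (\<lambda>h. \<Sum>j\<in>UNIV. h $ j * pd f j x)" by auto
  with f' show ?thesis by simp
qed

lemma pd_const [simp]: "pd (\<lambda>x. c) j = (\<lambda>x. 0)"
  by (rule ext) (subst pd_eq, rule has_derivative_const, simp)

lemma has_derivative_nth:
  "((\<lambda>x::real^'n. x $ i) has_derivative (\<lambda>h. h $ i)) (at x within S)"
  by (intro bounded_linear_imp_has_derivative bounded_linear_vec_nth)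

lemma pd_nth: "pd (\<lambda>x. x $ i) j = (\<lambda>x. if i = j then 1 else 0)"
  by (rule ext) (subst pd_eq, rule has_derivative_nth, auto simp: axis_def)

lemma pd_add:
  assumes "f differentiable (at x)" "g differentiable (at x)"
  shows "pd (\<lambda>x. f x + g x) j x = pd f j x + pd g j x"
proof -
  obtain f' g' where d: "(f has_derivative f') (at x)" "(g has_derivative g') (at x)"
    using assms by (auto simp: differentiable_def)
  show ?thesis
    using pd_eq[OF has_derivative_add[OF d]] pd_eq[OF d(1)] pd_eq[OF d(2)] by simp
qed

lemma pd_diff:
  assumes "f differentiable (at x)" "g differentiable (at x)"
  shows "pd (\<lambda>x. f x - g x) j x = pd f j x - pd g j x"
proof -
  obtain f' g' where d: "(f has_derivative f') (at x)" "(g has_derivative g') (at x)"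
    using assms by (auto simp: differentiable_def)
  show ?thesis
    using pd_eq[OF has_derivative_diff[OF d]] pd_eq[OF d(1)] pd_eq[OF d(2)] by simp
qed

lemma pd_mult:
  assumes "f differentiable (at x)" "g differentiable (at x)"
  shows "pd (\<lambda>x. f x * g x) j x = f x * pd g j x + pd f j x * g x"
proof -
  obtain f' g' where d: "(f has_derivative f') (at x)" "(g has_derivative g') (at x)"
    using assms by (auto simp: differentiable_def)
  show ?thesis
    using pd_eq[OF has_derivative_mult[OF d]] pd_eq[OF d(1)] pd_eq[OF d(2)] by simp
qed

text \<open>The outer function may be differentiable only relative to the range of the inner one; this is what
  makes composition with profiles defined on a closed interval possible.\<close>

lemma
  assumes "(h has_real_derivative h') (at (f x) within range f)" "f differentiable (at x)"
  shows differentiable_compose_range: "(\<lambda>x. h (f x)) differentiable (at x)"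
    and pd_compose_range: "pd (\<lambda>x. h (f x)) j x = h' * pd f j x"
proof -
  obtain f' where d: "(f has_derivative f') (at x)"
    using assms by (auto simp: differentiable_def)
  have *: "((\<lambda>x. h (f x)) has_derivative (\<lambda>y. h' * f' y)) (at x)"
    by (rule has_derivative_in_compose[OF d assms(1)[unfolded has_field_derivative_def]])
  show "(\<lambda>x. h (f x)) differentiable (at x)" using * by (auto simp: differentiable_def)
  show "pd (\<lambda>x. h (f x)) j x = h' * pd f j x" by (simp add: pd_eq[OF *] pd_eq[OF d])
qed

lemma
  assumes "(h has_real_derivative h') (at (f x))" "f differentiable (at x)"
  shows differentiable_compose_real: "(\<lambda>x. h (f x)) differentiable (at x)"
    and pd_compose: "pd (\<lambda>x. h (f x)) j x = h' * pd f j x"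
  using differentiable_compose_range[OF has_field_derivative_at_within[OF assms(1)] assms(2)]
    pd_compose_range[OF has_field_derivative_at_within[OF assms(1)] assms(2)] by auto

text \<open>In \<open>iter_pd\<close> the head of the list is the outermost derivative; this
  recursion differentiates \<open>f\<close> itself first. The product and chain rules then apply to
  \<open>pd f j\<close>, and closure properties become inductions on the order.\<close>

fun smooth_n :: "nat \<Rightarrow> (real^3 \<Rightarrow> real) \<Rightarrow> bool" where
  "smooth_n 0 f \<longleftrightarrow> True"
| "smooth_n (Suc n) f \<longleftrightarrow> (\<forall>x. f differentiable (at x)) \<and> (\<forall>j. smooth_n n (pd f j))"

lemma iter_pd_snoc: "iter_pd (js @ [j]) f = iter_pd js (pd f j)"
  by (simp add: iter_pd_def)

lemma smooth_n_iff_iter_pd: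
  "smooth_n n f \<longleftrightarrow> (\<forall>js x. length js < n \<longrightarrow> iter_pd js f differentiable (at x))"
proof (induction n arbitrary: f)
  case (Suc n)
  show ?case (is "?L = ?R")
  proof
    assume L: ?L
    show ?R
    proof (intro allI impI)
      fix js :: "3 list" and x assume "length js < Suc n"
      then show "iter_pd js f differentiable (at x)"
        using L by (cases js rule: rev_cases) (auto simp: iter_pd_def Suc.IH)
    qed
  next
    assume R: ?R
    have "f differentiable (at x)" for x using R[rule_format, of "[]" x] by (simp add: iter_pd_def)
    moreover have "iter_pd js (pd f j) differentiable (at x)" if "length js < n" for js j x
      using R[rule_format, of "js @ [j]" x] that by (simp add: iter_pd_snoc)
    ultimately show ?L by (simp add: Suc.IH)
  qed
qed simp

lemma smooth_fun_iff: "smooth_fun f \<longleftrightarrow> (\<forall>n. smooth_n n f)"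
  unfolding smooth_fun_def smooth_n_iff_iter_pd by (meson lessI)

lemma smooth_n_Suc_imp: "smooth_n (Suc n) f \<Longrightarrow> smooth_n n f"
  by (auto simp: smooth_n_iff_iter_pd)

lemma smooth_n_const: "smooth_n n (\<lambda>x. c)"
  by (induction n arbitrary: c) auto

lemma smooth_n_nth: "smooth_n n (\<lambda>x. x $ i)"
proof (cases n)
  case (Suc m)
  have "(\<lambda>x::real^3. x $ i) differentiable (at x)" for x
    using has_derivative_nth by (auto simp: differentiable_def)
  with Suc show ?thesis by (simp add: pd_nth smooth_n_const)
qed simp

lemma smooth_n_add: "smooth_n n f \<Longrightarrow> smooth_n n g \<Longrightarrow> smooth_n n (\<lambda>x. f x + g x)"
proof (induction n arbitrary: f g)
  case (Suc n)
  have "pd (\<lambda>x. f x + g x) j = (\<lambda>x. pd f j x + pd g j x)" for j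
    using Suc.prems by (intro ext pd_add) auto
  with Suc show ?case by simp
qed simp

lemma smooth_n_mult: "smooth_n n f \<Longrightarrow> smooth_n n g \<Longrightarrow> smooth_n n (\<lambda>x. f x * g x)"
proof (induction n arbitrary: f g)
  case (Suc n)
  have "pd (\<lambda>x. f x * g x) j = (\<lambda>x. f x * pd g j x + pd f j x * g x)" for j
    using Suc.prems by (intro ext pd_mult) auto
  moreover have "smooth_n n f" "smooth_n n g" using Suc.prems smooth_n_Suc_imp by blast+
  ultimately show ?case using Suc by (auto intro!: smooth_n_add)
qed simp

lemma smooth_n_diff: "smooth_n n f \<Longrightarrow> smooth_n n g \<Longrightarrow> smooth_n n (\<lambda>x. f x - g x)"
  using smooth_n_add[of n f "\<lambda>x. (-1) * g x"] smooth_n_mult[of n "\<lambda>x. -1" g] smooth_n_const by simp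

lemma smooth_n_power: "smooth_n n f \<Longrightarrow> smooth_n n (\<lambda>x. f x ^ k)"
  by (induction k) (auto intro: smooth_n_const smooth_n_mult)

lemma smooth_n_powr:
  assumes "smooth_n n f" "\<And>x. f x > 0"
  shows "smooth_n n (\<lambda>x. f x powr c)"
  using assms
proof (induction n arbitrary: c)
  case (Suc n)
  have d: "((\<lambda>y. y powr c) has_real_derivative c * f x powr (c - 1)) (at (f x))" for x
    using Suc.prems(2)[of x] has_real_derivative_powr by simp
  have "pd (\<lambda>x. f x powr c) j = (\<lambda>x. (c * f x powr (c - 1)) * pd f j x)" for j
    using Suc.prems by (intro ext pd_compose[OF d]) auto
  moreover have "(\<lambda>x. f x powr c) differentiable (at x)" for x
    using Suc.prems by (intro differentiable_compose_real[OF d]) auto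
  ultimately show ?case
    using Suc.prems(1) Suc.IH[OF smooth_n_Suc_imp[OF Suc.prems(1)] Suc.prems(2)]
    by (auto intro!: smooth_n_mult smooth_n_const)
qed simp

lemma smooth_n_poly: "smooth_n n f \<Longrightarrow> smooth_n n (\<lambda>x. poly q (f x))"
  by (induction q) (auto intro: smooth_n_const smooth_n_add smooth_n_mult)

text \<open>The functions y^(-m) exp(-1/y), extended by zero, span a space closed under
  differentiation. The case \<open>m = 0\<close> is the standard flat function behind all bumps and
  cutoffs below.\<close>

definition flat_exp :: "nat \<Rightarrow> real \<Rightarrow> real" where
  "flat_exp m y = (if 0 < y then inverse y ^ m * exp (- inverse y) else 0)"

lemma flat_exp_tendsto_0: "(flat_exp m \<longlongrightarrow> 0) (at 0)"
proof -
  have "((\<lambda>y::real. inverse y ^ m * exp (- inverse y)) \<longlongrightarrow> 0) (at_right 0)"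
    using filterlim_compose[OF tendsto_power_div_exp_0[of m] filterlim_inverse_at_top_right]
    by (simp add: exp_minus divide_inverse)
  moreover have "eventually (\<lambda>y. inverse y ^ m * exp (- inverse y) = flat_exp m y) (at_right 0)"
    by (auto simp: eventually_at_filter flat_exp_def)
  ultimately have r: "(flat_exp m \<longlongrightarrow> 0) (at_right 0)"
    using tendsto_cong by force
  have "eventually (\<lambda>y. 0 = flat_exp m y) (at_left 0)"
    by (auto simp: eventually_at_filter flat_exp_def)
  then have l: "(flat_exp m \<longlongrightarrow> 0) (at_left 0)"
    using tendsto_cong[of "\<lambda>_. 0" "flat_exp m"] by force
  show ?thesis using l r by (simp add: filterlim_split_at)
qed

lemma DERIV_flat_exp:
  "(flat_exp m has_real_derivative (flat_exp (m+2) y - real m * flat_exp (m+1) y)) (at y)"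
proof -
  consider "y > 0" | "y < 0" | "y = 0" by linarith
  then show ?thesis
  proof cases
    case 1
    have "((\<lambda>y. inverse y ^ m) has_real_derivative real m * inverse y ^ (m - 1) * - (inverse y ^ 2)) (at y)"
      using 1 by (auto intro!: derivative_eq_intros simp: power2_eq_square)
    moreover have "real m * inverse y ^ (m - 1) * - (inverse y ^ 2) = - real m * inverse y ^ (m + 1)"
      by (cases m) (auto simp: power2_eq_square algebra_simps)
    moreover have "((\<lambda>y. exp (- inverse y)) has_real_derivative exp (- inverse y) * inverse y ^ 2) (at y)"
      using 1 by (auto intro!: derivative_eq_intros simp: power2_eq_square)
    ultimately have "((\<lambda>y. inverse y ^ m * exp (- inverse y)) has_real_derivative
        (flat_exp (m+2) y - real m * flat_exp (m+1) y)) (at y)"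
      using 1 by - (rule DERIV_mult[THEN DERIV_cong, of "\<lambda>y. inverse y ^ m" "- real m * inverse y ^ (m + 1)" y UNIV
          "\<lambda>y. exp (- inverse y)" "exp (- inverse y) * inverse y ^ 2"],
        simp_all only: flat_exp_def, simp_all add: algebra_simps power2_eq_square)
    moreover have "eventually (\<lambda>y. inverse y ^ m * exp (- inverse y) = flat_exp m y) (nhds y)"
      using 1 by (auto simp: flat_exp_def eventually_nhds intro!: exI[of _ "{0<..}"])
    ultimately show ?thesis by (rule DERIV_cong_ev[OF refl _ refl, THEN iffD1, rotated])
  next
    case 2
    have "((\<lambda>y. 0) has_real_derivative (flat_exp (m+2) y - real m * flat_exp (m+1) y)) (at y)"
      using 2 by (auto simp: flat_exp_def)
    moreover have "eventually (\<lambda>y. 0 = flat_exp m y) (nhds y)"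
      using 2 by (auto simp: flat_exp_def eventually_nhds intro!: exI[of _ "{..<0}"])
    ultimately show ?thesis by (rule DERIV_cong_ev[OF refl _ refl, THEN iffD1, rotated])
  next
    case 3
    \<comment> \<open>The difference quotient at the origin is itself a member of the family, and
      all members tend to 0 there.\<close>
    have "(\<lambda>h. (flat_exp m (0 + h) - flat_exp m 0) / h) = flat_exp (m + 1)"
      by (auto simp: flat_exp_def field_simps)
    moreover have "flat_exp (m + 2) 0 - real m * flat_exp (m + 1) 0 = 0" by (simp add: flat_exp_def)
    ultimately show ?thesis
      unfolding DERIV_def 3 using flat_exp_tendsto_0[of "m+1"] by simp
  qed
qed

lemma smooth_n_flat_exp: "smooth_n n f \<Longrightarrow> smooth_n n (\<lambda>x. flat_exp m (f x))"
proof (induction n arbitrary: m)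
  case (Suc n)
  have "pd (\<lambda>x. flat_exp m (f x)) j =
      (\<lambda>x. (flat_exp (m+2) (f x) - real m * flat_exp (m+1) (f x)) * pd f j x)" for j
    using Suc.prems by (intro ext pd_compose[OF DERIV_flat_exp]) auto
  moreover have "(\<lambda>x. flat_exp m (f x)) differentiable (at x)" for x
    using Suc.prems by (intro differentiable_compose_real[OF DERIV_flat_exp]) auto
  ultimately show ?case
    using Suc.prems Suc.IH[OF smooth_n_Suc_imp[OF Suc.prems]]
    by (auto intro!: smooth_n_mult smooth_n_const smooth_n_diff)
qed simp

lemma smooth_fun_add: "smooth_fun f \<Longrightarrow> smooth_fun g \<Longrightarrow> smooth_fun (\<lambda>x. f x + g x)"
  and smooth_fun_diff: "smooth_fun f \<Longrightarrow> smooth_fun g \<Longrightarrow> smooth_fun (\<lambda>x. f x - g x)"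
  and smooth_fun_mult: "smooth_fun f \<Longrightarrow> smooth_fun g \<Longrightarrow> smooth_fun (\<lambda>x. f x * g x)"
  and smooth_fun_const: "smooth_fun (\<lambda>x. c)"
  and smooth_fun_nth: "smooth_fun (\<lambda>x. x $ i)"
  and smooth_fun_power: "smooth_fun f \<Longrightarrow> smooth_fun (\<lambda>x. f x ^ k)"
  and smooth_fun_poly: "smooth_fun f \<Longrightarrow> smooth_fun (\<lambda>x. poly q (f x))"
  and smooth_fun_flat_exp: "smooth_fun f \<Longrightarrow> smooth_fun (\<lambda>x. flat_exp m (f x))"
  and smooth_fun_powr: "smooth_fun f \<Longrightarrow> (\<And>x. f x > 0) \<Longrightarrow> smooth_fun (\<lambda>x. f x powr r)"
  and smooth_fun_pd: "smooth_fun f \<Longrightarrow> smooth_fun (pd f j)"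
  and smooth_fun_differentiable: "smooth_fun f \<Longrightarrow> f differentiable (at x)"
  unfolding smooth_fun_iff
  by (auto intro: smooth_n_add smooth_n_diff smooth_n_mult smooth_n_const smooth_n_nth smooth_n_power
      smooth_n_poly smooth_n_flat_exp smooth_n_powr)
    (use smooth_n.simps(2) in blast)+

lemma smooth_fun_continuous: "smooth_fun f \<Longrightarrow> continuous_on S f"
  by (meson smooth_fun_differentiable differentiable_imp_continuous_within continuous_at_imp_continuous_on)

section \<open>Volterra equations with a regular singular point\<close>

text \<open>Moves an integral over the varying interval [0, x] to [0, 1], where continuity in
  parameters can be read off the integrand.\<close>

lemma integral_stretch_unit:
  fixes f :: "real \<Rightarrow> real"
  assumes "0 \<le> x" "continuous_on {0..x} f"
  shows "integral {0..1} (\<lambda>v. x * f (x * v)) = integral {0..x} f"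
proof (cases "x = 0")
  case False
  then have x: "x > 0" using assms by simp
  have "f integrable_on {0..x}" using assms(2) by (rule integrable_continuous_real)
  then have "(f has_integral integral {0..x} f) (cbox 0 x)" by (simp add: has_integral_integral)
  from has_integral_affinity[OF this, of x 0] x
  have "((\<lambda>v. f (x * v)) has_integral (1 / x) * integral {0..x} f) ((\<lambda>v. v / x) ` {0..x})"
    by (simp add: divide_inverse mult.commute)
  moreover have "(\<lambda>v. v / x) ` {0..x} = {0..1}"
    using x by (auto simp: image_iff field_simps intro!: bexI[of _ "_ * x"])
  ultimately have "((\<lambda>v. x * f (x * v)) has_integral x * ((1 / x) * integral {0..x} f)) {0..1}"
    by (intro has_integral_mult_right) simp
  then show ?thesis using integral_unique[of "\<lambda>v. x * f (x * v)" _ "{0..1}"] x by fastforce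
qed simp

text \<open>This is r^(-2) times the integral of rho f(rho) over [0, r], written on the unit
  interval so that it remains continuous at the singular point r = 0, with value f(0)/2.\<close>

definition avg :: "(real \<Rightarrow> real) \<Rightarrow> real \<Rightarrow> real" where
  "avg f r = integral {0..1} (\<lambda>u. u * f (r * u))"

lemma unit_scale_mem: "r \<in> {0..X} \<Longrightarrow> u \<in> {0..1} \<Longrightarrow> r * u \<in> {0..X}" for r :: real
  by (auto intro: order_trans[OF mult_left_le])

lemma continuous_on_integral_unit:
  fixes f :: "'a::topological_space \<Rightarrow> real \<Rightarrow> real"
  assumes "continuous_on (U \<times> {0..1}) (\<lambda>(x, t). f x t)"
  shows "continuous_on U (\<lambda>x. integral {0..1} (f x))"
  using integral_continuous_on_param[of U 0 1 f] assms by simp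

lemma continuous_on_slice:
  fixes f :: "'a::topological_space \<Rightarrow> 'b::topological_space \<Rightarrow> 'c::topological_space"
  assumes "continuous_on (A \<times> B) (\<lambda>(e, r). f e r)" "e \<in> A"
  shows "continuous_on B (f e)"
proof -
  have "continuous_on B (\<lambda>r. (e, r))" by (intro continuous_intros)
  from continuous_on_compose2[OF assms(1) this] assms(2) show ?thesis by auto
qed

lemma continuous_on_avg_param:
  fixes f :: "real \<Rightarrow> real \<Rightarrow> real"
  assumes "continuous_on (A \<times> {0..X}) (\<lambda>(e, r). f e r)"
  shows "continuous_on (A \<times> {0..X}) (\<lambda>(e, r). avg (f e) r)"
proof -
  have 1: "continuous_on ((A \<times> {0..X}) \<times> {0..1}) (\<lambda>x. (fst (fst x), snd (fst x) * snd x))"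
    by (intro continuous_intros)
  have "continuous_on ((A \<times> {0..X}) \<times> {0..1})
      (\<lambda>x. (\<lambda>(e, r). f e r) (fst (fst x), snd (fst x) * snd x))"
    by (rule continuous_on_compose2[OF assms 1]) (use unit_scale_mem in fastforce)
  then have "continuous_on ((A \<times> {0..X}) \<times> {0..1}) (\<lambda>(x, u). u * f (fst x) (snd x * u))"
    by (auto simp: case_prod_unfold intro!: continuous_intros)
  from continuous_on_integral_unit[OF this] show ?thesis
    by (simp add: avg_def case_prod_unfold)
qed

lemma continuous_on_avg: "continuous_on {0..X} f \<Longrightarrow> continuous_on {0..X} (avg f)"
proof -
  assume f: "continuous_on {0..X} f"
  have "continuous_on (UNIV \<times> {0..X}) (\<lambda>(e::real, r). f r)"
    unfolding case_prod_unfold by (rule continuous_on_compose2[OF f]) (auto intro: continuous_intros)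
  from continuous_on_avg_param[OF this]
  have c: "continuous_on (UNIV \<times> {0..X}) (\<lambda>(e::real, r). avg f r)" .
  show "continuous_on {0..X} (avg f)" using continuous_on_slice[OF c, of 0] by simp
qed

lemma avg_eq_integral:
  assumes "continuous_on {0..X} f" "r \<in> {0..X}"
  shows "r\<^sup>2 * avg f r = integral {0..r} (\<lambda>\<rho>. \<rho> * f \<rho>)"
proof -
  have c: "continuous_on {0..r} f"
    using assms by (auto intro: continuous_on_subset)
  have "r\<^sup>2 * avg f r = integral {0..1} (\<lambda>u. r\<^sup>2 * (u * f (r * u)))"
    unfolding avg_def by simp
  also have "\<dots> = integral {0..1} (\<lambda>u. r * ((r * u) * f (r * u)))"
    by (simp add: power2_eq_square mult_ac)
  also have "\<dots> = integral {0..r} (\<lambda>\<rho>. \<rho> * f \<rho>)"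
    using assms by (intro integral_stretch_unit) (auto intro!: continuous_intros c)
  finally show ?thesis .
qed

lemma DERIV_avg:
  assumes "continuous_on {0..X} f" "r \<in> {0..X}"
  shows "((\<lambda>r. r\<^sup>2 * avg f r) has_real_derivative r * f r) (at r within {0..X})"
proof -
  have "((\<lambda>r. integral {0..r} (\<lambda>\<rho>. \<rho> * f \<rho>)) has_real_derivative r * f r) (at r within {0..X})"
    using assms by (intro integral_has_real_derivative continuous_intros) auto
  then show ?thesis
    by (rule has_field_derivative_transform_within[of _ _ _ _ 1]) (use assms avg_eq_integral in auto)
qed

lemma avg_diff:
  assumes "continuous_on {0..X} f" "continuous_on {0..X} g" "r \<in> {0..X}"
  shows "avg f r - avg g r = avg (\<lambda>\<rho>. f \<rho> - g \<rho>) r"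
proof -
  have *: "(\<lambda>u. u * h (r * u)) integrable_on {0..1}" if "continuous_on {0..X} h" for h
    by (intro integrable_continuous_real continuous_intros continuous_on_compose2[OF that])
      (use unit_scale_mem assms in auto)
  have "avg f r - avg g r = integral {0..1} (\<lambda>u. u * f (r * u) - u * g (r * u))"
    unfolding avg_def by (rule integral_diff[symmetric]) (auto intro: * assms)
  then show ?thesis by (simp add: avg_def algebra_simps)
qed

lemma avg_bound:
  assumes "continuous_on {0..X} f" "r \<in> {0..X}" "\<And>\<rho>. \<rho> \<in> {0..r} \<Longrightarrow> \<bar>f \<rho>\<bar> \<le> B"
  shows "\<bar>avg f r\<bar> \<le> B"
proof -
  have "norm (integral {0..1} (\<lambda>u. u * f (r * u))) \<le> B * (1 - 0)"
  proof (rule integral_bound)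
    show "continuous_on {0..1} (\<lambda>u. u * f (r * u))"
      by (intro continuous_intros continuous_on_compose2[OF assms(1)]) (use unit_scale_mem assms in auto)
    fix u :: real assume u: "u \<in> {0..1}"
    have "r * u \<in> {0..r}" using unit_scale_mem[of r r u] u assms by auto
    then have "\<bar>f (r * u)\<bar> \<le> B" by (rule assms)
    then show "norm (u * f (r * u)) \<le> B"
      using u mult_mono[of u 1 "\<bar>f (r*u)\<bar>" B] by (auto simp: abs_mult)
  qed simp
  then show ?thesis by (simp add: avg_def)
qed

text \<open>Integrating the weight exp(l r) gains a factor 1/l. For large l this beats the bound C
  of the kernel and the Lipschitz constant entering through D, which makes the integral operator a
  contraction in the weighted norm.\<close>

lemma volterra_diff_bound:
  fixes c f g :: "real \<Rightarrow> real"
  assumes cont: "continuous_on {0..X} c" "continuous_on {0..X} f" "continuous_on {0..X} g"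
    and c: "\<And>r. r \<in> {0..X} \<Longrightarrow> \<bar>c r\<bar> \<le> C"
    and fg: "\<And>r. r \<in> {0..X} \<Longrightarrow> \<bar>f r - g r\<bar> \<le> D * exp (l * r)"
    and s: "s \<in> {0..X}" and l: "l > 0" and D: "D \<ge> 0"
  shows "\<bar>integral {0..s} (\<lambda>r. c r * avg f r) - integral {0..s} (\<lambda>r. c r * avg g r)\<bar> \<le> C * D / l * exp (l * s)"
proof -
  have C: "C \<ge> 0" using c[OF s] by linarith
  have sub: "{0..s} \<subseteq> {0..X}" using s by auto
  have int: "continuous_on {0..s} (\<lambda>r. c r * avg h r)" if "continuous_on {0..X} h" for h
    using sub by (intro continuous_intros continuous_on_subset[OF continuous_on_avg[OF that]]
        continuous_on_subset[OF cont(1)])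
  have h: "continuous_on {0..X} (\<lambda>r. f r - g r)" using cont by (intro continuous_intros)
  have e: "((\<lambda>r. C * D * exp (l * r)) has_integral (C * D * exp (l * s) / l - C * D * exp (l * 0) / l)) {0..s}"
    using s l by (intro fundamental_theorem_of_calculus)
      (auto intro!: derivative_eq_intros simp: has_real_derivative_iff_has_vector_derivative[symmetric])
  have "integral {0..s} (\<lambda>r. c r * avg f r) - integral {0..s} (\<lambda>r. c r * avg g r)
      = integral {0..s} (\<lambda>r. c r * avg f r - c r * avg g r)"
    by (rule integral_diff[symmetric]) (auto intro!: integrable_continuous_real int cont)
  also have "\<dots> = integral {0..s} (\<lambda>r. c r * avg (\<lambda>\<rho>. f \<rho> - g \<rho>) r)"
    by (rule integral_cong) (use sub in \<open>auto simp flip: avg_diff[OF cont(2,3)] simp: algebra_simps\<close>)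
  finally have "\<bar>integral {0..s} (\<lambda>r. c r * avg f r) - integral {0..s} (\<lambda>r. c r * avg g r)\<bar>
      = norm (integral {0..s} (\<lambda>r. c r * avg (\<lambda>\<rho>. f \<rho> - g \<rho>) r))" by simp
  also have "\<dots> \<le> integral {0..s} (\<lambda>r. C * D * exp (l * r))"
  proof (rule integral_norm_bound_integral)
    show "(\<lambda>r. c r * avg (\<lambda>\<rho>. f \<rho> - g \<rho>) r) integrable_on {0..s}"
      by (intro integrable_continuous_real int h)
    show "(\<lambda>r. C * D * exp (l * r)) integrable_on {0..s}" using e by blast
    fix r assume r: "r \<in> {0..s}"
    have "\<bar>avg (\<lambda>\<rho>. f \<rho> - g \<rho>) r\<bar> \<le> D * exp (l * r)"
    proof (rule avg_bound[OF h])
      show "r \<in> {0..X}" using r sub by auto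
      fix \<rho> assume \<rho>: "\<rho> \<in> {0..r}"
      have "\<bar>f \<rho> - g \<rho>\<bar> \<le> D * exp (l * \<rho>)" using \<rho> r sub by (intro fg) auto
      also have "\<dots> \<le> D * exp (l * r)" using \<rho> l D by (intro mult_left_mono) auto
      finally show "\<bar>f \<rho> - g \<rho>\<bar> \<le> D * exp (l * r)" .
    qed
    then show "norm (c r * avg (\<lambda>\<rho>. f \<rho> - g \<rho>) r) \<le> C * D * exp (l * r)"
      using mult_mono[OF c[of r] _ C] r sub by (auto simp: abs_mult mult.assoc)
  qed
  also have "\<dots> = C * D * exp (l * s) / l - C * D / l"
    using integral_unique[OF e] by simp
  also have "\<dots> \<le> C * D / l * exp (l * s)"
    using C D l by simp
  finally show ?thesis .
qed

text \<open>At the point where exp(-l r) |V r - W r| is largest, the two integral equations bound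
  this quantity by half of itself. The Lipschitz estimate is taken along the two given solutions,
  which suits locally Lipschitz nonlinearities.\<close>

lemma volterra_unique:
  fixes \<kappa> :: "real \<Rightarrow> real \<Rightarrow> real"
  assumes c: "continuous_on {0..X} c"
    and \<kappa>: "continuous_on ({0..X} \<times> UNIV) (\<lambda>(r, y). \<kappa> r y)"
    and lip: "\<And>r. r \<in> {0..X} \<Longrightarrow> \<bar>\<kappa> r (V r) - \<kappa> r (W r)\<bar> \<le> L * \<bar>V r - W r\<bar>"
    and V: "continuous_on {0..X} V" "\<And>s. s \<in> {0..X} \<Longrightarrow> V s = 1 + integral {0..s} (\<lambda>r. c r * avg (\<lambda>\<rho>. \<kappa> \<rho> (V \<rho>)) r)"
    and W: "continuous_on {0..X} W" "\<And>s. s \<in> {0..X} \<Longrightarrow> W s = 1 + integral {0..s} (\<lambda>r. c r * avg (\<lambda>\<rho>. \<kappa> \<rho> (W \<rho>)) r)"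
    and s: "s \<in> {0..X}"
  shows "V s = W s"
proof -
  have K: "continuous_on {0..X} (\<lambda>r. \<kappa> r (F r))" if "continuous_on {0..X} F" for F
  proof -
    have "continuous_on {0..X} (\<lambda>r. (r, F r))" using that by (intro continuous_intros)
    then have "continuous_on {0..X} (\<lambda>r. (\<lambda>(r, y). \<kappa> r y) (r, F r))"
      by (rule continuous_on_compose2[OF \<kappa>]) auto
    then show ?thesis by simp
  qed
  have "bounded (c ` {0..X})" by (intro compact_imp_bounded compact_continuous_image c) auto
  then obtain C where C: "\<And>r. r \<in> {0..X} \<Longrightarrow> \<bar>c r\<bar> \<le> C"
    unfolding bounded_iff by (metis image_eqI real_norm_def)
  have C0: "C \<ge> 0" using C[OF s] by linarith
  define l where "l = 2 * C * \<bar>L\<bar> + 1"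
  have l: "l > 0" "C * \<bar>L\<bar> / l \<le> 1/2" using C0 by (auto simp: l_def field_simps add_pos_nonneg)
  define d where "d r = exp (- l * r) * \<bar>V r - W r\<bar>" for r
  have "continuous_on {0..X} d" unfolding d_def by (intro continuous_intros V W)
  then obtain t where t: "t \<in> {0..X}" "\<And>r. r \<in> {0..X} \<Longrightarrow> d r \<le> d t"
    using continuous_attains_sup[of "{0..X}" d] s by auto
  have D0: "d t \<ge> 0" by (simp add: d_def)
  have le: "\<bar>V r - W r\<bar> \<le> d t * exp (l * r)" if "r \<in> {0..X}" for r
    using t(2)[OF that] by (simp add: d_def exp_minus field_simps)
  have "\<bar>V t - W t\<bar> \<le> C * (\<bar>L\<bar> * d t) / l * exp (l * t)"
    unfolding V(2)[OF t(1)] W(2)[OF t(1)] add_diff_cancel_left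
  proof (rule volterra_diff_bound[OF c K[OF V(1)] K[OF W(1)] C _ t(1) l(1)])
    fix r assume r: "r \<in> {0..X}"
    have "\<bar>\<kappa> r (V r) - \<kappa> r (W r)\<bar> \<le> \<bar>L\<bar> * \<bar>V r - W r\<bar>"
      using lip[OF r] mult_right_mono[of L "\<bar>L\<bar>" "\<bar>V r - W r\<bar>"] by linarith
    also have "\<dots> \<le> \<bar>L\<bar> * (d t * exp (l * r))" using le[OF r] by (rule mult_left_mono) simp
    finally show "\<bar>\<kappa> r (V r) - \<kappa> r (W r)\<bar> \<le> \<bar>L\<bar> * d t * exp (l * r)" by (simp add: mult_ac)
  qed (use D0 in auto)
  then have "d t \<le> C * \<bar>L\<bar> / l * d t" by (simp add: d_def exp_minus field_simps)
  also have "\<dots> \<le> 1/2 * d t" using l(2) D0 by (rule mult_right_mono)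
  finally have "d t = 0" using D0 by simp
  then show ?thesis using le[OF s] by simp
qed

section \<open>Existence and continuous dependence for Volterra equations with a parameter\<close>

lemma continuous_on_volterra_param:
  fixes c f :: "real \<Rightarrow> real \<Rightarrow> real"
  assumes c: "continuous_on (A \<times> {0..X}) (\<lambda>(e, r). c e r)"
    and f: "continuous_on (A \<times> {0..X}) (\<lambda>(e, r). f e r)"
  shows "continuous_on (A \<times> {0..X}) (\<lambda>(e, s). integral {0..s} (\<lambda>r. c e r * avg (f e) r))"
proof -
  have g: "continuous_on (A \<times> {0..X}) (\<lambda>(e, r). c e r * avg (f e) r)"
    using c continuous_on_avg_param[OF f] by (auto simp: case_prod_unfold intro!: continuous_intros)
  have 1: "continuous_on ((A \<times> {0..X}) \<times> {0..1}) (\<lambda>x. (fst (fst x), snd (fst x) * snd x))"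
    by (intro continuous_intros)
  have "continuous_on ((A \<times> {0..X}) \<times> {0..1})
      (\<lambda>x. (\<lambda>(e, r). c e r * avg (f e) r) (fst (fst x), snd (fst x) * snd x))"
    by (rule continuous_on_compose2[OF g 1]) (use unit_scale_mem in fastforce)
  then have "continuous_on ((A \<times> {0..X}) \<times> {0..1})
      (\<lambda>(x, v). snd x * (c (fst x) (snd x * v) * avg (f (fst x)) (snd x * v)))"
    by (auto simp: case_prod_unfold intro!: continuous_intros)
  from continuous_on_integral_unit[OF this]
  have 2: "continuous_on (A \<times> {0..X})
      (\<lambda>x. integral {0..1} (\<lambda>v. snd x * (c (fst x) (snd x * v) * avg (f (fst x)) (snd x * v))))" .
  have 3: "integral {0..1} (\<lambda>v. s * (c e (s * v) * avg (f e) (s * v))) = integral {0..s} (\<lambda>r. c e r * avg (f e) r)"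
    if "e \<in> A" "s \<in> {0..X}" for e s
    using that by (intro integral_stretch_unit) (auto intro: continuous_on_subset[OF continuous_on_slice[OF g]])
  show ?thesis
    by (rule continuous_on_cong[THEN iffD1, OF refl _ 2]) (use 3 in auto)
qed

text \<open>Contraction for the norm \<open>sup |exp (- l s) W e s|\<close> on the rectangle. Working with functions of the
  parameter and the time together gives joint continuity of the solutions for free.\<close>

lemma volterra_solution:
  fixes c :: "real \<Rightarrow> real \<Rightarrow> real" and \<kappa> :: "real \<Rightarrow> real \<Rightarrow> real \<Rightarrow> real"
  assumes X: "0 \<le> X" and E: "0 \<le> E"
    and c: "continuous_on ({0..E} \<times> {0..X}) (\<lambda>(e, r). c e r)"
    and \<kappa>: "continuous_on ({0..E} \<times> {0..X} \<times> UNIV) (\<lambda>(e, r, y). \<kappa> e r y)"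
    and lip: "\<And>e r y z. e \<in> {0..E} \<Longrightarrow> r \<in> {0..X} \<Longrightarrow> \<bar>\<kappa> e r y - \<kappa> e r z\<bar> \<le> L * \<bar>y - z\<bar>"
  obtains W where "continuous_on ({0..E} \<times> {0..X}) (\<lambda>(e, s). W e s)"
    "\<And>e s. e \<in> {0..E} \<Longrightarrow> s \<in> {0..X} \<Longrightarrow>
      W e s = 1 + integral {0..s} (\<lambda>r. c e r * avg (\<lambda>\<rho>. \<kappa> e \<rho> (W e \<rho>)) r)"
proof -
  define R where "R = {0..E} \<times> {0..X}"
  have R: "compact R" "R \<noteq> {}" using X E by (auto simp: R_def compact_Times)
  have "bounded ((\<lambda>(e, r). c e r) ` R)"
    using c R by (intro compact_imp_bounded compact_continuous_image) (auto simp: R_def)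
  then obtain C where C: "\<And>e r. e \<in> {0..E} \<Longrightarrow> r \<in> {0..X} \<Longrightarrow> \<bar>c e r\<bar> \<le> C"
    by (fastforce simp: bounded_iff R_def)
  have C0: "C \<ge> 0" using C[of 0 0] X E by simp
  define l where "l = 2 * C * \<bar>L\<bar> + 1"
  have l: "l > 0" "C * \<bar>L\<bar> / l \<le> 1/2" using C0 by (auto simp: l_def field_simps add_pos_nonneg)
  \<comment> \<open>Clamping retracts the plane onto the rectangle, so that bounded continuous
    functions on the whole plane can stand for functions on the rectangle.\<close>
  define q :: "real \<times> real \<Rightarrow> real \<times> real"
    where "q x = (max 0 (min E (fst x)), max 0 (min X (snd x)))" for x
  have q: "q x \<in> R" for x using X E by (auto simp: q_def R_def)
  have qid: "q x = x" if "x \<in> R" for x using that by (auto simp: q_def R_def)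
  have qc: "continuous_on UNIV q" unfolding q_def by (intro continuous_intros)
  \<comment> \<open>The unknown \<open>V\<close> is the solution times exp(-l r). The plain supremum
    distance of \<open>bcontfun\<close> is then the weighted norm, and \<open>F\<close> removes the
    weight.\<close>
  define F where "F V e r = exp (l * r) * apply_bcontfun V (e, r)"
    for V :: "(real \<times> real, real) bcontfun" and e r
  define T where "T V = (\<lambda>(e, s). exp (- (l * s)) *
      (1 + integral {0..s} (\<lambda>r. c e r * avg (\<lambda>\<rho>. \<kappa> e \<rho> (F V e \<rho>)) r)))" for V
  have Fc: "continuous_on R (\<lambda>(e, r). F V e r)" for V
    unfolding F_def case_prod_unfold by (intro continuous_intros) auto
  have \<kappa>F: "continuous_on R (\<lambda>(e, r). \<kappa> e r (F V e r))" for V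
  proof -
    have "continuous_on R (\<lambda>x. (fst x, snd x, F V (fst x) (snd x)))"
      using Fc[of V] by (auto simp: case_prod_unfold intro!: continuous_intros)
    then have "continuous_on R (\<lambda>x. (\<lambda>(e, r, y). \<kappa> e r y) (fst x, snd x, F V (fst x) (snd x)))"
      by (rule continuous_on_compose2[OF \<kappa>]) (auto simp: R_def)
    then show ?thesis by (simp add: case_prod_unfold)
  qed
  have Tc: "continuous_on R (T V)" for V
    using continuous_on_volterra_param[OF c \<kappa>F[of V, unfolded R_def]]
    unfolding T_def R_def case_prod_unfold by (intro continuous_intros) auto
  have Tq: "(\<lambda>x. T V (q x)) \<in> bcontfun" for V
  proof -
    have "bounded (T V ` R)" using Tc R by (intro compact_imp_bounded compact_continuous_image) auto
    then have "bounded (range (\<lambda>x. T V (q x)))" by (rule bounded_subset) (use q in auto)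
    moreover have "continuous_on UNIV (\<lambda>x. T V (q x))"
      by (rule continuous_on_compose2[OF Tc qc]) (use q in auto)
    ultimately show ?thesis by (simp add: bcontfun_def)
  qed
  define \<Phi> where "\<Phi> V = Bcontfun (\<lambda>x. T V (q x))" for V
  have \<Phi>: "apply_bcontfun (\<Phi> V) x = T V (q x)" for V x
    unfolding \<Phi>_def by (simp add: Bcontfun_inverse[OF Tq])
  have slice: "continuous_on {0..X} (\<lambda>r. h e r)" if "continuous_on R (\<lambda>(e, r). h e r)" "e \<in> {0..E}"
    for h :: "real \<Rightarrow> real \<Rightarrow> real" and e
    using continuous_on_slice that unfolding R_def .
  have contr: "dist (\<Phi> V) (\<Phi> V') \<le> 1/2 * dist V V'" for V V'
  proof (rule dist_bound)
    fix x
    obtain e s where es: "q x = (e, s)" "e \<in> {0..E}" "s \<in> {0..X}"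
      using q[of x] by (cases "q x") (auto simp: R_def)
    define D where "D = dist V V'"
    have "\<bar>integral {0..s} (\<lambda>r. c e r * avg (\<lambda>\<rho>. \<kappa> e \<rho> (F V e \<rho>)) r) -
        integral {0..s} (\<lambda>r. c e r * avg (\<lambda>\<rho>. \<kappa> e \<rho> (F V' e \<rho>)) r)\<bar> \<le> C * (\<bar>L\<bar> * D) / l * exp (l * s)"
    proof (rule volterra_diff_bound[OF _ _ _ _ _ es(3) l(1)])
      show "continuous_on {0..X} (c e)" using slice[of c e] c es by (auto simp: R_def)
      show "continuous_on {0..X} (\<lambda>\<rho>. \<kappa> e \<rho> (F V e \<rho>))" using slice[OF \<kappa>F es(2)] .
      show "continuous_on {0..X} (\<lambda>\<rho>. \<kappa> e \<rho> (F V' e \<rho>))" using slice[OF \<kappa>F es(2)] .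
      fix r assume r: "r \<in> {0..X}"
      show "\<bar>c e r\<bar> \<le> C" using C es r by auto
      have "\<bar>\<kappa> e r (F V e r) - \<kappa> e r (F V' e r)\<bar> \<le> L * \<bar>F V e r - F V' e r\<bar>"
        using lip es r by auto
      also have "\<dots> \<le> \<bar>L\<bar> * \<bar>F V e r - F V' e r\<bar>" by (rule mult_right_mono) auto
      also have "\<bar>F V e r - F V' e r\<bar> = exp (l * r) * \<bar>apply_bcontfun V (e, r) - apply_bcontfun V' (e, r)\<bar>"
        by (simp add: F_def abs_mult flip: right_diff_distrib)
      also have "\<bar>L\<bar> * (exp (l * r) * \<bar>apply_bcontfun V (e, r) - apply_bcontfun V' (e, r)\<bar>)
          \<le> \<bar>L\<bar> * (exp (l * r) * D)"
        using dist_bounded[of V "(e, r)" V'] by (intro mult_left_mono) (auto simp: D_def dist_real_def)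
      finally show "\<bar>\<kappa> e r (F V e r) - \<kappa> e r (F V' e r)\<bar> \<le> \<bar>L\<bar> * D * exp (l * r)"
        by (simp add: mult_left_mono mult_ac)
    qed (simp add: D_def)
    then have "exp (- (l * s)) * \<bar>integral {0..s} (\<lambda>r. c e r * avg (\<lambda>\<rho>. \<kappa> e \<rho> (F V e \<rho>)) r) -
        integral {0..s} (\<lambda>r. c e r * avg (\<lambda>\<rho>. \<kappa> e \<rho> (F V' e \<rho>)) r)\<bar> \<le> C * \<bar>L\<bar> / l * D"
      by (simp add: exp_minus field_simps)
    also have "\<dots> \<le> 1/2 * D" using l(2) by (intro mult_right_mono) (auto simp: D_def)
    finally show "dist (apply_bcontfun (\<Phi> V) x) (apply_bcontfun (\<Phi> V') x) \<le> 1/2 * dist V V'"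
      by (simp add: \<Phi> es T_def dist_real_def D_def abs_mult flip: right_diff_distrib)
  qed
  obtain V where V: "\<Phi> V = V" using banach_fix_type[of "1/2" \<Phi>] contr by auto
  show thesis
  proof (rule that[of "F V"])
    show "continuous_on ({0..E} \<times> {0..X}) (\<lambda>(e, s). F V e s)" using Fc[of V] by (simp add: R_def)
    fix e s assume es: "e \<in> {0..E}" "s \<in> {0..X}"
    then have "apply_bcontfun V (e, s) = T V (e, s)"
      using \<Phi>[of V "(e, s)"] V qid[of "(e, s)"] by (simp add: R_def)
    then show "F V e s = 1 + integral {0..s} (\<lambda>r. c e r * avg (\<lambda>\<rho>. \<kappa> e \<rho> (F V e \<rho>)) r)"
      by (simp add: F_def T_def exp_minus field_simps)
  qed
qed

text \<open>The rate \<open>k\<close> enters the bound only through the increment of a primitive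
  \<open>\<kappa>\<close>, so the bound stays uniform for integrable singular rates such as (1 -
  t)^(-1/2).\<close>

lemma gronwall_forward:
  fixes N N' k \<kappa> :: "real \<Rightarrow> real"
  assumes "a \<le> b" "continuous_on {a..b} N" "continuous_on {a..b} \<kappa>"
    and "\<And>x. a < x \<Longrightarrow> x < b \<Longrightarrow> (N has_real_derivative N' x) (at x)"
    and "\<And>x. a < x \<Longrightarrow> x < b \<Longrightarrow> (\<kappa> has_real_derivative k x) (at x)"
    and "\<And>x. a < x \<Longrightarrow> x < b \<Longrightarrow> N' x \<le> k x * N x"
  shows "N b \<le> N a * exp (\<kappa> b - \<kappa> a)"
proof -
  have "N b * exp (- \<kappa> b) \<le> N a * exp (- \<kappa> a)"
  proof (rule DERIV_nonpos_imp_decreasing_open[OF assms(1), where f = "\<lambda>x. N x * exp (- \<kappa> x)"])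
    fix x assume x: "a < x" "x < b"
    have "((\<lambda>x. N x * exp (- \<kappa> x)) has_real_derivative (N' x - k x * N x) * exp (- \<kappa> x)) (at x)"
      using assms(4,5)[OF x] by (auto intro!: derivative_eq_intros simp: algebra_simps)
    then show "\<exists>y. ((\<lambda>x. N x * exp (- \<kappa> x)) has_real_derivative y) (at x) \<and> y \<le> 0"
      using assms(6)[OF x] by (auto intro!: mult_nonpos_nonneg exI)
  qed (use assms in \<open>auto intro!: continuous_intros\<close>)
  then show ?thesis by (simp add: exp_minus exp_diff field_simps)
qed

lemma gronwall_backward:
  fixes N N' k \<kappa> :: "real \<Rightarrow> real"
  assumes "a \<le> b" "continuous_on {a..b} N" "continuous_on {a..b} \<kappa>"
    and "\<And>x. a < x \<Longrightarrow> x < b \<Longrightarrow> (N has_real_derivative N' x) (at x)"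
    and "\<And>x. a < x \<Longrightarrow> x < b \<Longrightarrow> (\<kappa> has_real_derivative k x) (at x)"
    and "\<And>x. a < x \<Longrightarrow> x < b \<Longrightarrow> - k x * N x \<le> N' x"
  shows "N a \<le> N b * exp (\<kappa> b - \<kappa> a)"
proof -
  have "- N b \<le> - N a * exp (- \<kappa> b - - \<kappa> a)"
  proof (rule gronwall_forward[of a b "\<lambda>x. - N x" "\<lambda>x. - \<kappa> x" "\<lambda>x. - N' x" "\<lambda>x. - k x"])
    fix x assume "a < x" "x < b"
    then show "- N' x \<le> - k x * - N x" using assms(6)[of x] by simp
  qed (use assms in \<open>auto intro!: continuous_intros derivative_intros\<close>)
  then show ?thesis by (simp add: exp_diff exp_minus field_simps)
qed

section \<open>The shooting problem\<close>

text \<open>The nonlinearity is a parameter because existence is first proved for truncations of the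
  fifth power.\<close>

definition rhs :: "(real \<Rightarrow> real) \<Rightarrow> real \<Rightarrow> real \<Rightarrow> real \<Rightarrow> real" where
  "rhs f e r y = 15/4 * e * y - r\<^sup>2 * f y"

text \<open>Integral form of \<open>(4 r^2 (1 - e r) W')' = (15/4) e r W - r^3 f W\<close>, \<open>W 0 = 1\<close>. For \<open>f y = y^5\<close> and
  \<open>e > 0\<close> the function \<open>e powr (- 3/4) * W (s / e)\<close> solves the equation with \<open>e = 1\<close>, so \<open>e\<close> replaces
  the initial value as shooting parameter, and large initial values correspond to \<open>e\<close> near \<open>0\<close>.\<close>

definition sol :: "(real \<Rightarrow> real) \<Rightarrow> real \<Rightarrow> real \<Rightarrow> (real \<Rightarrow> real) \<Rightarrow> bool" where
  "sol f e X W \<longleftrightarrow> continuous_on {0..X} W \<and>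
     (\<forall>s\<in>{0..X}. W s = 1 + integral {0..s} (\<lambda>r. 1 / (4 * (1 - e * r)) * avg (\<lambda>\<rho>. rhs f e \<rho> (W \<rho>)) r))"

text \<open>The derivative of a solution, read off the integral equation so that it makes sense at
  the singular point s = 0.\<close>

definition slope :: "(real \<Rightarrow> real) \<Rightarrow> real \<Rightarrow> (real \<Rightarrow> real) \<Rightarrow> real \<Rightarrow> real" where
  "slope f e W s = avg (\<lambda>\<rho>. rhs f e \<rho> (W \<rho>)) s / (4 * (1 - e * s))"

lemma sol_subset: "sol f e X W \<Longrightarrow> Y \<le> X \<Longrightarrow> sol f e Y W"
  unfolding sol_def by (auto intro: continuous_on_subset)

lemma one_minus_pos:
  fixes e X s :: real
  assumes "0 \<le> e" "e * X < 1" "s \<le> X"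
  shows "0 < 1 - e * s"
  using mult_left_mono[OF assms(3,1)] assms(2) by linarith

lemma continuous_on_rhs:
  assumes "continuous_on UNIV f" "continuous_on S W"
  shows "continuous_on S (\<lambda>r. rhs f e r (W r))"
  unfolding rhs_def by (intro continuous_intros assms continuous_on_compose2[OF assms]) auto

text \<open>The first two terms come from multiplying the equation by W', with \<open>F\<close> a
  primitive of \<open>f\<close>. The square of W is added because the linear term of the equation
  has the wrong sign; it makes the sum control W and lets that term be absorbed.\<close>

definition sol_energy ::
    "(real \<Rightarrow> real) \<Rightarrow> (real \<Rightarrow> real) \<Rightarrow> real \<Rightarrow> (real \<Rightarrow> real) \<Rightarrow> real \<Rightarrow> real" where
  "sol_energy F f e W s = 2 * s * (1 - e * s) * (slope f e W s)\<^sup>2 + s\<^sup>2 * F (W s) + (W s)\<^sup>2"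

context
  fixes f e X W
  assumes f: "continuous_on UNIV f" and e: "0 \<le> e" "e * X < 1" and W: "sol f e X W"
begin

lemma sol_cont: "continuous_on {0..X} W" using W by (simp add: sol_def)

lemma slope_cont: "continuous_on {0..X} (slope f e W)"
  unfolding slope_def[abs_def] using one_minus_pos[OF e]
  by (intro continuous_intros continuous_on_avg continuous_on_rhs f sol_cont) fastforce+

lemma sol_deriv: "s \<in> {0..X} \<Longrightarrow> (W has_real_derivative slope f e W s) (at s within {0..X})"
proof -
  assume s: "s \<in> {0..X}"
  have "((\<lambda>s. integral {0..s} (slope f e W)) has_real_derivative slope f e W s) (at s within {0..X})"
    by (rule integral_has_real_derivative[OF slope_cont s])
  then have "((\<lambda>s. 1 + integral {0..s} (slope f e W)) has_real_derivative slope f e W s) (at s within {0..X})"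
    by (auto intro!: derivative_eq_intros)
  then show ?thesis
    by (rule has_field_derivative_transform_within[of _ _ _ _ 1])
      (use W s in \<open>auto simp: sol_def slope_def[abs_def]\<close>)
qed

lemma flux_deriv: "s \<in> {0..X} \<Longrightarrow>
  ((\<lambda>s. 4 * s\<^sup>2 * (1 - e * s) * slope f e W s) has_real_derivative s * rhs f e s (W s)) (at s within {0..X})"
proof -
  assume s: "s \<in> {0..X}"
  have *: "x\<^sup>2 * avg (\<lambda>\<rho>. rhs f e \<rho> (W \<rho>)) x = 4 * x\<^sup>2 * (1 - e * x) * slope f e W x" if "x \<le> X" for x
  proof -
    have "1 - e * x \<noteq> 0" using one_minus_pos[OF e that] by simp
    then show ?thesis by (simp add: slope_def field_simps)
  qed
  have "((\<lambda>r. r\<^sup>2 * avg (\<lambda>\<rho>. rhs f e \<rho> (W \<rho>)) r) has_real_derivative s * rhs f e s (W s)) (at s within {0..X})"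
    by (rule DERIV_avg[OF continuous_on_rhs[OF f sol_cont] s])
  then show ?thesis
    by (rule has_field_derivative_transform_within[of _ _ _ _ 1]) (use s * in auto)
qed

lemma slope_deriv:
  assumes s: "s \<in> {0<..X}"
  shows "(slope f e W has_real_derivative
    (rhs f e s (W s) - (8 - 12 * e * s) * slope f e W s) / (4 * s * (1 - e * s))) (at s within {0..X})"
proof -
  have p: "0 < 1 - e * s" using one_minus_pos[OF e] s by auto
  define P where "P s = 4 * s\<^sup>2 * (1 - e * s) * slope f e W s" for s
  have P: "(P has_real_derivative s * rhs f e s (W s)) (at s within {0..X})"
    unfolding P_def using flux_deriv s by auto
  have "((\<lambda>s. P s / (4 * s\<^sup>2 * (1 - e * s))) has_real_derivative
      (s * rhs f e s (W s) * (4 * s\<^sup>2 * (1 - e * s)) - P s * (8 * s - 12 * e * s\<^sup>2)) / (4 * s\<^sup>2 * (1 - e * s))\<^sup>2) (at s within {0..X})"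
    using s p by (auto intro!: derivative_eq_intros P simp: power2_eq_square algebra_simps)
  also have "(s * rhs f e s (W s) * (4 * s\<^sup>2 * (1 - e * s)) - P s * (8 * s - 12 * e * s\<^sup>2)) / (4 * s\<^sup>2 * (1 - e * s))\<^sup>2
     = (rhs f e s (W s) - (8 - 12 * e * s) * slope f e W s) / (4 * s * (1 - e * s))"
    using s p unfolding P_def by (simp add: divide_simps power2_eq_square) (simp add: algebra_simps)
  finally show ?thesis
    by (rule has_field_derivative_transform_within[of _ _ _ _ s])
      (use s one_minus_pos[OF e] in \<open>fastforce simp: P_def dist_real_def\<close>)+
qed

text \<open>The products f(W) W' from the equation and from the potential cancel. What remains is
  quadratic in W and W' apart from the potential itself, whatever the growth of
  \<open>f\<close>.\<close>

lemma sol_energy_deriv: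
  assumes F: "\<And>y. (F has_real_derivative f y) (at y)" and s: "0 < s" "s < X"
  shows "(sol_energy F f e W has_real_derivative
    (8 * e * s - 6) * (slope f e W s)\<^sup>2 + (15/4 * e + 2) * W s * slope f e W s + 2 * s * F (W s)) (at s)"
proof -
  have p: "0 < 1 - e * s" using one_minus_pos[OF e] s by auto
  have at: "at s within {0..X} = at s" using s by (intro at_within_Icc_at) auto
  have dW: "(W has_real_derivative slope f e W s) (at s)" using sol_deriv[of s] s at by auto
  have dV: "(slope f e W has_real_derivative
    (rhs f e s (W s) - (8 - 12 * e * s) * slope f e W s) / (4 * s * (1 - e * s))) (at s)"
    using slope_deriv[of s] s at by auto
  define Q where "Q = (rhs f e s (W s) - (8 - 12 * e * s) * slope f e W s) / (4 * s * (1 - e * s))"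
  note dV = dV[folded Q_def]
  have dF: "((\<lambda>s. F (W s)) has_real_derivative f (W s) * slope f e W s) (at s)"
    by (rule DERIV_chain2[OF F dW])
  have "(sol_energy F f e W has_real_derivative (2 - 4 * e * s) * (slope f e W s)\<^sup>2 +
     (4 * s * (1 - e * s) * Q) * slope f e W s
     + 2 * s * F (W s) + s\<^sup>2 * (f (W s) * slope f e W s) + 2 * W s * slope f e W s) (at s)"
    unfolding sol_energy_def[abs_def]
    by (rule derivative_eq_intros refl dW dV dF | simp)+
  moreover have "4 * s * (1 - e * s) * Q = rhs f e s (W s) - (8 - 12 * e * s) * slope f e W s"
    using s p by (simp add: Q_def)
  ultimately have "(sol_energy F f e W has_real_derivative (2 - 4 * e * s) * (slope f e W s)\<^sup>2 +
     (rhs f e s (W s) - (8 - 12 * e * s) * slope f e W s) * slope f e W s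
     + 2 * s * F (W s) + s\<^sup>2 * (f (W s) * slope f e W s) + 2 * W s * slope f e W s) (at s)"
    by (simp only:)
  then show ?thesis by (simp add: rhs_def algebra_simps power2_eq_square)
qed

text \<open>On [c, X] the kinetic weight 2 s (1 - e s) is at least 2 c d, so K bounds the
  logarithmic derivative of the energy. K depends on c, d and E alone, hence one constant serves all
  truncations and all parameters up to E.\<close>

lemma
  assumes F: "\<And>y. (F has_real_derivative f y) (at y)" "\<And>y. F y \<ge> 0"
    and c: "0 < c" "c \<le> X" and d: "0 < d" "d \<le> 1 - e * X" and E: "e \<le> E"
    and K: "K = (8 + 15/4 * E) / (2 * c * d) + (15/4 * E + 2) + 2 / c" and t: "t \<in> {c..X}"
  shows sol_energy_forward: "sol_energy F f e W t \<le> sol_energy F f e W c * exp (K * (X - c))"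
    and sol_energy_backward: "sol_energy F f e W c \<le> sol_energy F f e W t * exp (K * (X - c))"
proof -
  let ?N' = "\<lambda>s. (8 * e * s - 6) * (slope f e W s)\<^sup>2 + (15/4 * e + 2) * W s * slope f e W s + 2 * s * F (W s)"
  have pos: "d \<le> 1 - e * s" "0 < 1 - e * s" if "s \<le> X" for s
    using mult_left_mono[OF that e(1)] d by linarith+
  have nonneg: "0 \<le> sol_energy F f e W s" if "s \<in> {c..X}" for s
    unfolding sol_energy_def using that pos[of s] c F(2)[of "W s"] by (intro add_nonneg_nonneg mult_nonneg_nonneg) auto
  \<comment> \<open>The three summands of K absorb the terms with W'^2, with W^2 and with the
    potential, in this order.\<close>
  have bound: "\<bar>?N' s\<bar> \<le> K * sol_energy F f e W s" if s: "s \<in> {c..X}" for s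
  proof -
    let ?V = "slope f e W s"
    have es: "0 \<le> e * s" "e * s \<le> 1" using e c s pos[of s] by auto
    have A: "2 * c * d * ?V\<^sup>2 \<le> 2 * s * (1 - e * s) * ?V\<^sup>2"
      using s c d pos[of s] by (intro mult_right_mono mult_mono) auto
    have B: "c * (2 * s * F (W s)) \<le> 2 * (s\<^sup>2 * F (W s))"
      using s c F(2)[of "W s"] mult_right_mono[of c s "s * F (W s)"] by (simp add: power2_eq_square mult_ac)
    have parts: "2 * c * d * ?V\<^sup>2 \<le> sol_energy F f e W s" "(W s)\<^sup>2 \<le> sol_energy F f e W s" "c * (2 * s * F (W s)) \<le> 2 * sol_energy F f e W s"
      using A B F(2)[of "W s"] s c pos[of s] unfolding sol_energy_def
      by (smt (verit) mult_nonneg_nonneg zero_le_power2 atLeastAtMost_iff)+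
    have "2 * \<bar>W s * ?V\<bar> \<le> (W s)\<^sup>2 + ?V\<^sup>2"
      using sum_squares_bound[of "\<bar>W s\<bar>" "\<bar>?V\<bar>"] by (simp add: abs_mult)
    then have WV: "\<bar>W s * ?V\<bar> \<le> (W s)\<^sup>2 + ?V\<^sup>2" by linarith
    have 1: "\<bar>(8 * e * s - 6) * ?V\<^sup>2\<bar> \<le> 6 * ?V\<^sup>2"
      using es by (auto simp: abs_mult intro!: mult_right_mono)
    have 2: "\<bar>(15/4 * e + 2) * W s * ?V\<bar> \<le> (15/4 * E + 2) * ((W s)\<^sup>2 + ?V\<^sup>2)"
      using mult_mono[OF _ WV, of "15/4 * e + 2" "15/4 * E + 2"] e E by (simp add: abs_mult mult.assoc)
    have 3: "\<bar>2 * s * F (W s)\<bar> = 2 * s * F (W s)" using s c F(2)[of "W s"] by simp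
    have "\<bar>?N' s\<bar> \<le> \<bar>(8 * e * s - 6) * ?V\<^sup>2\<bar> + \<bar>(15/4 * e + 2) * W s * ?V\<bar> + \<bar>2 * s * F (W s)\<bar>"
      by (rule order_trans[OF abs_triangle_ineq add_mono[OF abs_triangle_ineq order_refl]])
    also have "\<dots> \<le> (8 + 15/4 * E) * ?V\<^sup>2 + (15/4 * E + 2) * (W s)\<^sup>2 + 2 * s * F (W s)"
      using add_mono[OF 1 2] 3 by (simp add: algebra_simps)
    also have "\<dots> \<le> (8 + 15/4 * E) * (sol_energy F f e W s / (2 * c * d)) + (15/4 * E + 2) * sol_energy F f e W s + 2 / c * sol_energy F f e W s"
    proof (intro add_mono mult_left_mono)
      show "?V\<^sup>2 \<le> sol_energy F f e W s / (2 * c * d)" using parts(1) c d by (simp add: field_simps)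
      show "2 * s * F (W s) \<le> 2 / c * sol_energy F f e W s" using parts(3) c by (simp add: field_simps)
    qed (use parts e E in auto)
    also have "\<dots> = K * sol_energy F f e W s" unfolding K by (simp add: distrib_right)
    finally show ?thesis .
  qed
  have K0: "K \<ge> 0" unfolding K using c d e E by auto
  have cont: "continuous_on {a..b} (sol_energy F f e W)" if "c \<le> a" "b \<le> X" for a b
    unfolding sol_energy_def[abs_def] using c that
    by (intro continuous_intros continuous_on_subset[OF slope_cont] continuous_on_subset[OF sol_cont]
        continuous_on_compose2[OF DERIV_continuous_on[of UNIV F f, OF has_field_derivative_at_within[OF F(1)]]]) auto
  have KX: "exp (K * t - K * c) \<le> exp (K * (X - c))" using t K0 by (simp flip: right_diff_distrib add: mult_left_mono)
  have "sol_energy F f e W t \<le> sol_energy F f e W c * exp (K * t - K * c)"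
  proof (rule gronwall_forward[where k = "\<lambda>_. K" and N' = ?N'])
    fix x assume "c < x" "x < t"
    then show "?N' x \<le> K * sol_energy F f e W x" "(sol_energy F f e W has_real_derivative ?N' x) (at x)"
      using bound[of x] t c sol_energy_deriv[OF F(1), of x] by auto
  qed (use t in \<open>auto intro!: cont derivative_eq_intros continuous_intros\<close>)
  also have "\<dots> \<le> sol_energy F f e W c * exp (K * (X - c))"
    using KX nonneg[of c] c by (intro mult_left_mono) auto
  finally show "sol_energy F f e W t \<le> sol_energy F f e W c * exp (K * (X - c))" .
  have "sol_energy F f e W c \<le> sol_energy F f e W t * exp (K * t - K * c)"
  proof (rule gronwall_backward[where k = "\<lambda>_. K" and N' = ?N'])
    fix x assume "c < x" "x < t"
    then show "- K * sol_energy F f e W x \<le> ?N' x" "(sol_energy F f e W has_real_derivative ?N' x) (at x)"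
      using bound[of x] t c sol_energy_deriv[OF F(1), of x] by auto
  qed (use t in \<open>auto intro!: cont derivative_eq_intros continuous_intros\<close>)
  also have "\<dots> \<le> sol_energy F f e W t * exp (K * (X - c))"
    using KX nonneg[of t] t by (intro mult_left_mono) auto
  finally show "sol_energy F f e W c \<le> sol_energy F f e W t * exp (K * (X - c))" .
qed

end

text \<open>Continuity argument: at the first time at which |W| reaches 2 the step hypothesis
  applies and gives |W| < 2.\<close>

lemma bootstrap:
  fixes W :: "real \<Rightarrow> real"
  assumes cont: "continuous_on {0..c} W" and W0: "\<bar>W 0\<bar> < 2"
    and step: "\<And>t. t \<in> {0..c} \<Longrightarrow> (\<And>r. r \<in> {0..t} \<Longrightarrow> \<bar>W r\<bar> \<le> 2) \<Longrightarrow> \<bar>W t\<bar> < 2"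
    and t: "t \<in> {0..c}"
  shows "\<bar>W t\<bar> < 2"
proof (rule ccontr)
  assume nt: "\<not> \<bar>W t\<bar> < 2"
  define S where "S = {0..c} \<inter> (\<lambda>r. \<bar>W r\<bar>) -` {2..}"
  have "closed S" unfolding S_def by (intro continuous_closed_preimage continuous_intros cont)
  moreover have "S \<noteq> {}" "bdd_below S" using nt t by (auto simp: S_def intro: bdd_belowI[of _ 0])
  ultimately have m: "Inf S \<in> S" by (intro closed_contains_Inf)
  have below: "\<bar>W r\<bar> < 2" if "0 \<le> r" "r < Inf S" for r
    using that m cInf_lower[OF _ \<open>bdd_below S\<close>, of r] by (force simp: S_def)
  have "\<exists>r\<ge>0. r \<le> Inf S \<and> \<bar>W r\<bar> = 2"
    using m W0 by (intro IVT'[where f = "\<lambda>r. \<bar>W r\<bar>"]) (auto simp: S_def intro!: continuous_intros continuous_on_subset[OF cont])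
  then obtain r where r: "0 \<le> r" "r \<le> Inf S" "\<bar>W r\<bar> = 2" by auto
  then have "r = Inf S" using below[of r] by force
  then have "\<bar>W (Inf S)\<bar> < 2"
    using m r below by (intro step) (force simp: S_def)+
  with r \<open>r = Inf S\<close> show False by simp
qed

text \<open>On a short initial interval the integral equation itself controls the solution: |W| <= 2
  bounds the right-hand side, this bounds the slope, and \<open>c\<close> is so small that W moves
  by at most 1/4. The hypothesis on \<open>f\<close> covers the fifth power and its truncations at
  levels from 2 on.\<close>

lemma sol_initial:
  assumes f: "continuous_on UNIV f" "\<And>y. \<bar>y\<bar> \<le> 2 \<Longrightarrow> f y = y ^ 5"
    and e: "0 \<le> e" "e \<le> E" and X: "0 \<le> X" and d: "0 < d" "d \<le> 1 - E * X"
    and W: "sol f e X W" and c: "0 \<le> c" "c \<le> X" "(15/2 * E + 32 * X\<^sup>2) * c \<le> d" and s: "s \<in> {0..c}"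
  shows "\<bar>W s - 1\<bar> \<le> 1/4" and "\<bar>slope f e W s\<bar> \<le> (15/2 * E + 32 * X\<^sup>2) / (4 * d)"
proof -
  \<comment> \<open>For |W| <= 2 the linear term of \<open>rhs\<close> is at most 2 * 15/4 * E and
    the nonlinear one at most 2^5 X^2.\<close>
  define K where "K = 15/2 * E + 32 * X\<^sup>2"
  have K: "K \<ge> 0" using e by (simp add: K_def)
  have eX: "e * X < 1" using mult_right_mono[OF e(2) X] d by linarith
  have pos: "d \<le> 1 - e * r" if "r \<in> {0..X}" for r
    using mult_mono[of e E r X] that e X d by auto
  have slope: "\<bar>slope f e W r\<bar> \<le> K / (4 * d)" if "t \<in> {0..c}" "\<And>r. r \<in> {0..t} \<Longrightarrow> \<bar>W r\<bar> \<le> 2" "r \<in> {0..t}" for t r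
  proof -
    have "\<bar>avg (\<lambda>\<rho>. rhs f e \<rho> (W \<rho>)) r\<bar> \<le> K"
    proof (rule avg_bound)
      show "continuous_on {0..X} (\<lambda>\<rho>. rhs f e \<rho> (W \<rho>))"
        using W f(1) by (intro continuous_on_rhs) (auto simp: sol_def)
      show "r \<in> {0..X}" using that c by auto
      fix \<rho> assume \<rho>: "\<rho> \<in> {0..r}"
      then have W2: "\<bar>W \<rho>\<bar> \<le> 2" using that by auto
      have "\<bar>W \<rho>\<bar> ^ 5 \<le> 2 ^ 5" using W2 by (intro power_mono) auto
      moreover have "\<rho>\<^sup>2 \<le> X\<^sup>2" using \<rho> that c by (intro power_mono) auto
      ultimately have "\<bar>\<rho>\<^sup>2 * W \<rho> ^ 5\<bar> \<le> X\<^sup>2 * 2 ^ 5" unfolding abs_mult power_abs[symmetric] by (intro mult_mono) auto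
      moreover have "\<bar>15/4 * e * W \<rho>\<bar> \<le> 15/4 * E * 2" using W2 e unfolding abs_mult by (intro mult_mono) auto
      ultimately show "\<bar>rhs f e \<rho> (W \<rho>)\<bar> \<le> K"
        using abs_triangle_ineq4[of "15/4 * e * W \<rho>" "\<rho>\<^sup>2 * W \<rho> ^ 5"]
        unfolding rhs_def K_def f(2)[OF W2] by simp
    qed
    moreover have "d \<le> 1 - e * r" using pos[of r] that c by auto
    ultimately have "\<bar>avg (\<lambda>\<rho>. rhs f e \<rho> (W \<rho>)) r\<bar> / (4 * (1 - e * r)) \<le> K / (4 * d)" 
      using d K by (intro frac_le) auto
    then show ?thesis using \<open>d \<le> 1 - e * r\<close> d by (simp add: slope_def)
  qed
  have close: "\<bar>W t - 1\<bar> \<le> 1/4" if t: "t \<in> {0..c}" "\<And>r. r \<in> {0..t} \<Longrightarrow> \<bar>W r\<bar> \<le> 2" for t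
  proof -
    have "W t - 1 = integral {0..t} (slope f e W)"
      using W t c by (auto simp: sol_def slope_def[abs_def])
    also have "norm \<dots> \<le> K / (4 * d) * (t - 0)"
      using t c slope[OF t] by (intro integral_bound continuous_on_subset[OF slope_cont[OF f(1) e(1) eX W]]) auto
    also have "\<dots> \<le> K * c / (4 * d)" using t K d by (simp add: divide_right_mono mult_left_mono)
    also have "\<dots> \<le> 1/4" using c d by (simp add: K_def field_simps)
    finally show ?thesis by simp
  qed
  have le2: "\<bar>W t\<bar> < 2" if "t \<in> {0..c}" for t
  proof (rule bootstrap[OF _ _ _ that])
    show "continuous_on {0..c} W" using W c by (auto simp: sol_def intro: continuous_on_subset)
    show "\<bar>W 0\<bar> < 2" using W X by (auto simp: sol_def)
    fix t assume "t \<in> {0..c}" "\<And>r. r \<in> {0..t} \<Longrightarrow> \<bar>W r\<bar> \<le> 2"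
    from close[OF this] show "\<bar>W t\<bar> < 2" by linarith
  qed
  have le: "\<bar>W r\<bar> \<le> 2" if "r \<in> {0..s}" for r using le2[of r] s that by auto
  show "\<bar>W s - 1\<bar> \<le> 1/4" by (rule close[OF s le])
  show "\<bar>slope f e W s\<bar> \<le> (15/2 * E + 32 * X\<^sup>2) / (4 * d)"
    using slope[OF s le, of s] s by (simp add: K_def)
qed

section \<open>Truncated nonlinearity and global solutions of the integral equation\<close>

definition clip5 :: "real \<Rightarrow> real \<Rightarrow> real" where
  "clip5 M y = (max (- M) (min M y)) ^ 5"

lemma pow5_lipschitz:
  fixes a b M :: real
  assumes "\<bar>a\<bar> \<le> M" "\<bar>b\<bar> \<le> M"
  shows "\<bar>a ^ 5 - b ^ 5\<bar> \<le> 5 * M ^ 4 * \<bar>a - b\<bar>"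
proof -
  have le: "\<bar>a ^ i * b ^ j\<bar> \<le> M ^ i * M ^ j" for i j
    unfolding abs_mult power_abs using assms by (intro mult_mono power_mono) auto
  have "a ^ 5 - b ^ 5 = (a - b) * (a^4*b^0 + a^3*b^1 + a^2*b^2 + a^1*b^3 + a^0*b^4)"
    by (simp add: algebra_simps power_numeral_reduce)
  also have "\<bar>\<dots>\<bar> \<le> \<bar>a - b\<bar> * (M^4*M^0 + M^3*M^1 + M^2*M^2 + M^1*M^3 + M^0*M^4)"
    unfolding abs_mult by (intro mult_left_mono order_trans[OF abs_triangle_ineq] add_mono le) auto
  also have "\<dots> = 5 * M ^ 4 * \<bar>a - b\<bar>" by (simp add: algebra_simps power_numeral_reduce)
  finally show ?thesis .
qed

lemma clip5_lipschitz: "0 \<le> M \<Longrightarrow> \<bar>clip5 M y - clip5 M z\<bar> \<le> 5 * M ^ 4 * \<bar>y - z\<bar>"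
proof -
  assume M: "0 \<le> M"
  have "\<bar>clip5 M y - clip5 M z\<bar> \<le> 5 * M ^ 4 * \<bar>max (- M) (min M y) - max (- M) (min M z)\<bar>"
    unfolding clip5_def using M by (intro pow5_lipschitz) auto
  also have "\<dots> \<le> 5 * M ^ 4 * \<bar>y - z\<bar>" by (intro mult_left_mono) auto
  finally show ?thesis .
qed

lemma continuous_clip5: "continuous_on S (clip5 M)"
  unfolding clip5_def[abs_def] by (intro continuous_intros)

lemma clip5_eq: "\<bar>y\<bar> \<le> M \<Longrightarrow> clip5 M y = y ^ 5"
  by (auto simp: clip5_def max_def min_def)

lemma antiderivative_nonneg:
  fixes f :: "real \<Rightarrow> real"
  assumes f: "continuous_on UNIV f" and sgn: "\<And>y. 0 \<le> y \<Longrightarrow> 0 \<le> f y" "\<And>y. y \<le> 0 \<Longrightarrow> f y \<le> 0"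
  obtains F where "\<And>y. (F has_real_derivative f y) (at y)" "\<And>y. 0 \<le> F y" "F 0 = 0"
proof -
  define F where "F u = (LBINT y=0..u. f y)" for u :: real
  have F: "(F has_real_derivative f x) (at x)" for x
  proof -
    have "((\<lambda>u. LBINT y=ereal 0..ereal u. f y) has_vector_derivative f x) (at x within {- \<bar>x\<bar> - 1..\<bar>x\<bar> + 1})"
      using f by (intro interval_integral_FTC2) (auto intro: continuous_on_subset)
    then show ?thesis
      by (simp add: F_def[abs_def] has_real_derivative_iff_has_vector_derivative at_within_Icc_at flip: zero_ereal_def)
  qed
  have F0: "F 0 = 0" by (simp add: F_def zero_ereal_def)
  have "0 \<le> F y" for y
  proof (cases "0 \<le> y")
    case True
    have "F 0 \<le> F y" by (rule DERIV_nonneg_imp_nondecreasing[OF True]) (use F sgn(1) in blast)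
    then show ?thesis using F0 by simp
  next
    case False
    have "F 0 \<le> F y"
    proof (rule DERIV_nonpos_imp_nonincreasing[of y 0 F])
      show "y \<le> 0" using False by simp
      fix x :: real assume "x \<le> 0"
      then show "\<exists>y. (F has_real_derivative y) (at x) \<and> y \<le> 0" using F sgn(2) by blast
    qed
    then show ?thesis using F0 by simp
  qed
  with F F0 that show thesis by blast
qed

text \<open>Truncation makes the nonlinearity globally Lipschitz. The energy estimate does not see
  the truncation level, so the level B can be fixed in advance as the resulting a priori bound;
  solutions truncated at B then never reach the truncation and solve the original equation.\<close>

lemma sol_exists:
  assumes E: "0 \<le> E" and X: "0 < X" and EX: "E * X < 1"
  obtains W where "continuous_on ({0..E} \<times> {0..X}) (\<lambda>(e, s). W e s)"
    "\<And>e. e \<in> {0..E} \<Longrightarrow> sol (\<lambda>y. y ^ 5) e X (W e)"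
proof -
  define d where "d = 1 - E * X"
  have d: "d > 0" using EX by (simp add: d_def)
  define K0 where "K0 = 15/2 * E + 32 * X\<^sup>2"
  have K0: "K0 > 0" using E X by (simp add: K0_def add_nonneg_pos)
  define c where "c = min X (d / K0)"
  have c: "0 < c" "c \<le> X" "K0 * c \<le> d" using K0 d X by (auto simp: c_def min_def field_simps)
  define K where "K = (8 + 15/4 * E) / (2 * c * d) + (15/4 * E + 2) + 2 / c"
  \<comment> \<open>The bracket bounds the energy at time c, using |W'| <= K0/(4 d), a potential of
    at most 2 * 2^5 = 64 and W^2 <= 4. The 3 keeps B above the range of the initial estimate and
    absorbs the loss in |W| <= 1 + W^2.\<close>
  define B where "B = 3 + (2 * c * (K0 / (4 * d))\<^sup>2 + c\<^sup>2 * 64 + 4) * exp (K * (X - c))"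
  have B: "B \<ge> 3" using c by (simp add: B_def)
  have bound: "\<bar>W s\<bar> \<le> B" if W: "sol (clip5 B) e X W" and e: "e \<in> {0..E}" and s: "s \<in> {0..X}" for W e s
  proof -
    have f: "\<And>y. \<bar>y\<bar> \<le> 2 \<Longrightarrow> clip5 B y = y ^ 5" using B by (intro clip5_eq) auto
    have "e * X \<le> E * X" using e X by (intro mult_right_mono) auto
    then have eX: "e * X < 1" "d \<le> 1 - e * X" using EX by (auto simp: d_def)
    have init: "\<bar>W t - 1\<bar> \<le> 1/4" "\<bar>slope (clip5 B) e W t\<bar> \<le> K0 / (4 * d)" if "t \<in> {0..c}" for t
      using sol_initial[OF continuous_clip5 f, where E = E and c = c and s = t and X = X and d = d and W = W and e = e]
        that W e X d c by (auto simp: d_def K0_def)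
    obtain F where F: "\<And>y. (F has_real_derivative clip5 B y) (at y)" "\<And>y. 0 \<le> F y" "F 0 = 0"
      using antiderivative_nonneg[OF continuous_clip5, of B] B by (auto simp: clip5_def zero_le_power)
    show ?thesis
    proof (cases "s \<le> c")
      case True
      then have "\<bar>W s - 1\<bar> \<le> 1/4" using init(1)[of s] s by simp
      then show ?thesis using B by linarith
    next
      case False
      have Wc: "\<bar>W c - 1\<bar> \<le> 1/4" "\<bar>slope (clip5 B) e W c\<bar> \<le> K0 / (4 * d)"
        using init[of c] c by auto
      have W2: "0 < W c" "W c \<le> 2" using Wc(1) by linarith+
      have F64: "F (W c) \<le> 64"
      proof -
        have "\<exists>z>0. z < W c \<and> F (W c) - F 0 = (W c - 0) * clip5 B z"
          by (rule MVT2[OF W2(1)]) (rule F(1))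
        then obtain z where z: "0 < z" "z < W c" "F (W c) = W c * clip5 B z"
          unfolding F(3) diff_zero by blast
        have "z ^ 5 \<le> 2 ^ 5" using z W2 by (intro power_mono) linarith+
        moreover have "clip5 B z = z ^ 5" using z W2 by (intro f) linarith
        ultimately show ?thesis using z W2 mult_mono[of "W c" 2 "z ^ 5" "2 ^ 5"] by simp
      qed
      have "1 - e * c \<le> 1" using e c by simp
      then have A: "2 * c * (1 - e * c) * (slope (clip5 B) e W c)\<^sup>2 \<le> 2 * c * 1 * (K0 / (4 * d))\<^sup>2"
        using c power_mono[OF Wc(2), of 2] by (intro mult_mono mult_left_mono) simp_all
      have "(W c)\<^sup>2 \<le> 2\<^sup>2" using W2 by (intro power_mono) linarith+
      moreover have "c\<^sup>2 * F (W c) \<le> c\<^sup>2 * 64" using F64 by (intro mult_left_mono) auto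
      ultimately have "sol_energy F (clip5 B) e W c \<le> 2 * c * (K0 / (4 * d))\<^sup>2 + c\<^sup>2 * 64 + 4"
        unfolding sol_energy_def using A by simp
      then have "sol_energy F (clip5 B) e W c * exp (K * (X - c)) \<le> B - 3" by (simp add: B_def)
      moreover have "sol_energy F (clip5 B) e W s \<le> sol_energy F (clip5 B) e W c * exp (K * (X - c))"
        by (rule sol_energy_forward[OF continuous_clip5 _ eX(1) W F(1,2) c(1,2) d eX(2) _ K_def]) (use e s False in auto)
      moreover have "(W s)\<^sup>2 \<le> sol_energy F (clip5 B) e W s"
      proof -
        have "0 < 1 - e * s" using one_minus_pos[of e X s] e eX s by simp
        then have "0 \<le> 2 * s * (1 - e * s) * (slope (clip5 B) e W s)\<^sup>2" using s by simp
        moreover have "0 \<le> s\<^sup>2 * F (W s)" using F(2)[of "W s"] by simp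
        ultimately show ?thesis unfolding sol_energy_def by linarith
      qed
      moreover have "\<bar>W s\<bar> \<le> 1 + (W s)\<^sup>2"
        using sum_squares_bound[of 1 "\<bar>W s\<bar>"] by simp
      ultimately show ?thesis by linarith
    qed
  qed
  have lt: "1 - e * r \<noteq> 0" if "e \<in> {0..E}" "r \<in> {0..X}" for e r
    using mult_mono[of e E r X] that EX E by auto
  obtain W where W: "continuous_on ({0..E} \<times> {0..X}) (\<lambda>(e, s). W e s)"
    "\<And>e s. e \<in> {0..E} \<Longrightarrow> s \<in> {0..X} \<Longrightarrow>
      W e s = 1 + integral {0..s} (\<lambda>r. 1 / (4 * (1 - e * r)) * avg (\<lambda>\<rho>. rhs (clip5 B) e \<rho> (W e \<rho>)) r)"
  proof (rule volterra_solution[of X E "\<lambda>e r. 1 / (4 * (1 - e * r))" "rhs (clip5 B)" "15/4 * E + X\<^sup>2 * (5 * B ^ 4)"])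
    show "continuous_on ({0..E} \<times> {0..X}) (\<lambda>(e, r). 1 / (4 * (1 - e * r)))"
      unfolding case_prod_unfold using lt by (intro continuous_intros) auto
    show "continuous_on ({0..E} \<times> {0..X} \<times> UNIV) (\<lambda>(e, r, y). rhs (clip5 B) e r y)"
      unfolding case_prod_unfold rhs_def
      by (intro continuous_intros continuous_on_compose2[OF continuous_clip5[of UNIV]]) auto
    fix e r y z assume er: "e \<in> {0..E}" "r \<in> {0..X}"
    have "rhs (clip5 B) e r y - rhs (clip5 B) e r z = 15/4 * e * (y - z) - r\<^sup>2 * (clip5 B y - clip5 B z)"
      unfolding rhs_def right_diff_distrib by simp
    also have "\<bar>\<dots>\<bar> \<le> \<bar>15/4 * e * (y - z)\<bar> + \<bar>r\<^sup>2 * (clip5 B y - clip5 B z)\<bar>" by (rule abs_triangle_ineq4)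
    also have "\<dots> \<le> 15/4 * E * \<bar>y - z\<bar> + X\<^sup>2 * (5 * B ^ 4 * \<bar>y - z\<bar>)"
      unfolding abs_mult using er clip5_lipschitz[of B y z] B
      by (intro add_mono mult_mono) (auto intro!: power_mono)
    finally show "\<bar>rhs (clip5 B) e r y - rhs (clip5 B) e r z\<bar> \<le> (15/4 * E + X\<^sup>2 * (5 * B ^ 4)) * \<bar>y - z\<bar>"
      by (simp add: algebra_simps)
  qed (use E X in auto)
  have sol: "sol (clip5 B) e X (W e)" if "e \<in> {0..E}" for e
    unfolding sol_def using W(2)[OF that] continuous_on_slice[OF W(1) that] by simp
  have "sol (\<lambda>y. y ^ 5) e X (W e)" if e: "e \<in> {0..E}" for e
  proof -
    have "avg (\<lambda>\<rho>. rhs (clip5 B) e \<rho> (W e \<rho>)) r = avg (\<lambda>\<rho>. rhs (\<lambda>y. y ^ 5) e \<rho> (W e \<rho>)) r" if "r \<in> {0..X}" for r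
      unfolding avg_def
    proof (rule integral_cong)
      fix u :: real assume "u \<in> {0..1}"
      then have "\<bar>W e (r * u)\<bar> \<le> B" using bound[OF sol[OF e] e unit_scale_mem[OF that]] by simp
      then show "u * rhs (clip5 B) e (r * u) (W e (r * u)) = u * rhs (\<lambda>y. y ^ 5) e (r * u) (W e (r * u))"
        by (simp add: rhs_def clip5_eq)
    qed
    then show ?thesis using sol[OF e] unfolding sol_def by (auto intro!: integral_cong)
  qed
  with W(1) show thesis by (rule that)
qed

lemma sol_pow5_unique:
  assumes e: "0 \<le> e" "e * X < 1" and V: "sol (\<lambda>y. y ^ 5) e X V" and W: "sol (\<lambda>y. y ^ 5) e X W" and s: "s \<in> {0..X}"
  shows "V s = W s"
proof -
  have "bounded (V ` {0..X})" "bounded (W ` {0..X})"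
    using V W unfolding sol_def by (blast intro: compact_imp_bounded compact_continuous_image compact_Icc)+
  then obtain b1 b2 where b: "\<And>r. r \<in> {0..X} \<Longrightarrow> \<bar>V r\<bar> \<le> b1" "\<And>r. r \<in> {0..X} \<Longrightarrow> \<bar>W r\<bar> \<le> b2"
    unfolding bounded_iff by (metis image_eqI real_norm_def)
  define M where "M = max b1 b2"
  have M: "\<bar>V r\<bar> \<le> M" "\<bar>W r\<bar> \<le> M" if "r \<in> {0..X}" for r using b[OF that] by (auto simp: M_def)
  show ?thesis
  proof (rule volterra_unique[where c = "\<lambda>r. 1 / (4 * (1 - e * r))" and \<kappa> = "rhs (\<lambda>y. y ^ 5) e"
        and L = "15/4 * e + X\<^sup>2 * (5 * M ^ 4)" and V = V and W = W and X = X and s = s])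
    show "continuous_on {0..X} (\<lambda>r. 1 / (4 * (1 - e * r)))"
      using one_minus_pos[OF e] by (intro continuous_intros) force
    show "continuous_on ({0..X} \<times> UNIV) (\<lambda>(r, y). rhs (\<lambda>y. y ^ 5) e r y)"
      unfolding case_prod_unfold rhs_def by (intro continuous_intros)
    fix r assume r: "r \<in> {0..X}"
    have "rhs (\<lambda>y. y ^ 5) e r (V r) - rhs (\<lambda>y. y ^ 5) e r (W r) = 15/4 * e * (V r - W r) - r\<^sup>2 * (V r ^ 5 - W r ^ 5)"
      unfolding rhs_def right_diff_distrib by simp
    also have "\<bar>\<dots>\<bar> \<le> \<bar>15/4 * e * (V r - W r)\<bar> + \<bar>r\<^sup>2 * (V r ^ 5 - W r ^ 5)\<bar>" by (rule abs_triangle_ineq4)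
    also have "\<dots> \<le> 15/4 * e * \<bar>V r - W r\<bar> + X\<^sup>2 * (5 * M ^ 4 * \<bar>V r - W r\<bar>)"
      unfolding abs_mult using r e pow5_lipschitz[OF M[OF r]]
      by (intro add_mono mult_mono) (auto intro!: power_mono)
    finally show "\<bar>rhs (\<lambda>y. y ^ 5) e r (V r) - rhs (\<lambda>y. y ^ 5) e r (W r)\<bar>
        \<le> (15/4 * e + X\<^sup>2 * (5 * M ^ 4)) * \<bar>V r - W r\<bar>"
      by (simp add: algebra_simps)
  next
    show "continuous_on {0..X} V" "continuous_on {0..X} W" using V W by (simp_all only: sol_def)
    show "V t = 1 + integral {0..t} (\<lambda>r. 1 / (4 * (1 - e * r)) * avg (\<lambda>\<rho>. rhs (\<lambda>y. y ^ 5) e \<rho> (V \<rho>)) r)"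
      "W t = 1 + integral {0..t} (\<lambda>r. 1 / (4 * (1 - e * r)) * avg (\<lambda>\<rho>. rhs (\<lambda>y. y ^ 5) e \<rho> (W \<rho>)) r)"
      if "t \<in> {0..X}" for t
      using that by (rule V[unfolded sol_def, THEN conjunct2, rule_format] W[unfolded sol_def, THEN conjunct2, rule_format])+
  qed (rule s)
qed

text \<open>A solution on [0, s] is chosen separately for each s, which avoids a maximal interval of
  existence; by uniqueness these choices fit together.\<close>

definition shoot :: "real \<Rightarrow> real \<Rightarrow> real" where
  "shoot e s = (SOME W. sol (\<lambda>y. y ^ 5) e s W) s"

definition dshoot :: "real \<Rightarrow> real \<Rightarrow> real" where
  "dshoot e = slope (\<lambda>y. y ^ 5) e (shoot e)"

lemma shoot_eq:
  assumes "0 \<le> e" "e * X < 1" "sol (\<lambda>y. y ^ 5) e X W" "s \<in> {0..X}"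
  shows "shoot e s = W s"
proof -
  have W: "sol (\<lambda>y. y ^ 5) e s W" using assms by (auto intro: sol_subset)
  have "sol (\<lambda>y. y ^ 5) e s (SOME W. sol (\<lambda>y. y ^ 5) e s W)" by (rule someI[of _ W]) (rule W)
  then show ?thesis unfolding shoot_def
    by (rule sol_pow5_unique[OF assms(1) _ _ W, rotated]) (use assms one_minus_pos[of e X s] in auto)
qed

lemma sol_cong:
  assumes "\<And>s. s \<in> {0..X} \<Longrightarrow> V s = W s"
  shows "sol f e X V = sol f e X W"
proof -
  have "avg (\<lambda>\<rho>. rhs f e \<rho> (V \<rho>)) r = avg (\<lambda>\<rho>. rhs f e \<rho> (W \<rho>)) r" if "r \<in> {0..X}" for r
    unfolding avg_def using unit_scale_mem[OF that] assms by (intro integral_cong) simp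
  then have "integral {0..s} (\<lambda>r. 1 / (4 * (1 - e * r)) * avg (\<lambda>\<rho>. rhs f e \<rho> (V \<rho>)) r)
    = integral {0..s} (\<lambda>r. 1 / (4 * (1 - e * r)) * avg (\<lambda>\<rho>. rhs f e \<rho> (W \<rho>)) r)" if "s \<in> {0..X}" for s
    using that by (intro integral_cong) auto
  moreover have "continuous_on {0..X} V = continuous_on {0..X} W" by (intro continuous_on_cong) (auto simp: assms)
  ultimately show ?thesis using assms by (auto simp: sol_def)
qed

lemma sol_shoot:
  assumes "0 \<le> e" "0 < X" "e * X < 1"
  shows "sol (\<lambda>y. y ^ 5) e X (shoot e)"
proof -
  obtain W where W: "\<And>e'. e' \<in> {0..e} \<Longrightarrow> sol (\<lambda>y. y ^ 5) e' X (W e')"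
    using sol_exists[OF assms] by metis
  then have "sol (\<lambda>y. y ^ 5) e X (W e)" using assms by auto
  then show ?thesis using shoot_eq[OF assms(1,3)] sol_cong[of X "shoot e" "W e"] by auto
qed

text \<open>Uniqueness identifies \<open>shoot\<close> with the jointly continuous family of
  \<open>sol_exists\<close>. The derivative inherits joint continuity through its expression by
  averages.\<close>

lemma shoot_joint_cont:
  assumes "0 \<le> E" "0 < X" "E * X < 1"
  shows "continuous_on ({0..E} \<times> {0..X}) (\<lambda>(e, s). shoot e s)"
    and "continuous_on ({0..E} \<times> {0..X}) (\<lambda>(e, s). dshoot e s)"
proof -
  obtain W where W: "continuous_on ({0..E} \<times> {0..X}) (\<lambda>(e, s). W e s)"
    "\<And>e'. e' \<in> {0..E} \<Longrightarrow> sol (\<lambda>y. y ^ 5) e' X (W e')"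
    using sol_exists[OF assms] by metis
  have lt: "e * X < 1" if "e \<in> {0..E}" for e
  proof -
    have "e * X \<le> E * X" using that assms(2) by (intro mult_right_mono) auto
    then show ?thesis using assms(3) by linarith
  qed
  show 1: "continuous_on ({0..E} \<times> {0..X}) (\<lambda>(e, s). shoot e s)"
    by (rule continuous_on_cong[THEN iffD1, OF refl _ W(1)]) (use shoot_eq[OF _ lt W(2)] in auto)
  have "continuous_on ({0..E} \<times> {0..X}) (\<lambda>(e, r). rhs (\<lambda>y. y ^ 5) e r (shoot e r))"
    using 1 by (auto simp: rhs_def case_prod_unfold intro!: continuous_intros)
  from continuous_on_avg_param[OF this]
  show "continuous_on ({0..E} \<times> {0..X}) (\<lambda>(e, s). dshoot e s)"
    unfolding dshoot_def slope_def case_prod_unfold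
    using one_minus_pos[OF _ lt] by (intro continuous_intros) fastforce+
qed

text \<open>With E = 1/2, X = 1 and d = 1/2 the constant of the initial estimate is 15/4 + 32 < 40,
  so c = 1/80 is admissible.\<close>

lemma shoot_near_zero:
  assumes "0 \<le> e" "e \<le> 1/2" "0 \<le> s" "s \<le> 1/80"
  shows "\<bar>shoot e s - 1\<bar> \<le> 1/4"
proof (rule sol_initial(1)[of "\<lambda>y. y ^ 5" e "1/2" 1 "1/2" "shoot e" "1/80"])
  show "continuous_on UNIV (\<lambda>y::real. y ^ 5)" by (intro continuous_intros)
  show "sol (\<lambda>y. y ^ 5) e 1 (shoot e)" using assms by (intro sol_shoot) simp_all
qed (use assms in simp_all)

text \<open>If W and W' vanished at s, so would the energy; the backward estimate would make it
  vanish at an earlier time c, where W is still close to 1. This is what allows a polar angle to be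
  defined.\<close>

lemma shoot_nonzero:
  assumes e: "0 \<le> e" and s: "0 \<le> s" "e * s < 1"
  shows "shoot e s \<noteq> 0 \<or> dshoot e s \<noteq> 0"
proof (rule ccontr)
  assume "\<not> (shoot e s \<noteq> 0 \<or> dshoot e s \<noteq> 0)"
  then have z: "shoot e s = 0" "dshoot e s = 0" by auto
  have s0: "shoot e 0 = 1"
  proof -
    have "sol (\<lambda>y. y ^ 5) e (1 / (e + 1)) (shoot e)" using e by (intro sol_shoot) auto
    then show ?thesis using e by (auto simp: sol_def)
  qed
  have sp: "0 < s" using z s0 s by (cases "s = 0") auto
  have W: "sol (\<lambda>y. y ^ 5) e s (shoot e)" using e sp s by (intro sol_shoot) auto
  define K where "K = 15/2 * e + 32 * s\<^sup>2"
  have K: "K > 0" using e sp by (simp add: K_def add_nonneg_pos)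
  define d where "d = 1 - e * s"
  have d: "d > 0" using s by (simp add: d_def)
  define c where "c = min s (d / K)"
  have c: "0 < c" "c \<le> s" "K * c \<le> d" using K d sp by (auto simp: c_def min_def field_simps)
  have "\<bar>shoot e c - 1\<bar> \<le> 1/4"
    by (rule sol_initial(1)[OF _ _ e order_refl _ d _ W, where c = c]) (use c sp in \<open>auto simp: d_def K_def intro!: continuous_intros\<close>)
  then have "0 < (shoot e c)\<^sup>2" by auto
  also have "\<dots> \<le> sol_energy (\<lambda>y. y ^ 6 / 6) (\<lambda>y. y ^ 5) e (shoot e) c"
    unfolding sol_energy_def using c e s sp mult_left_mono[of c s e] by (auto intro!: add_nonneg_nonneg mult_nonneg_nonneg)
  also have "\<dots> \<le> sol_energy (\<lambda>y. y ^ 6 / 6) (\<lambda>y. y ^ 5) e (shoot e) s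
      * exp (((8 + 15/4 * e) / (2 * c * d) + (15/4 * e + 2) + 2 / c) * (s - c))"
  proof (rule sol_energy_backward[OF _ e s(2) W _ _ c(1,2) d _ order_refl refl])
    show "continuous_on UNIV (\<lambda>y::real. y ^ 5)" by (intro continuous_intros)
    show "((\<lambda>y. y ^ 6 / 6) has_real_derivative y ^ 5) (at y)" for y :: real
      by (auto intro!: derivative_eq_intros)
    show "s \<in> {c..s}" using c by simp
  qed (auto simp: d_def)
  also have "\<dots> = 0" using z by (simp add: sol_energy_def dshoot_def)
  finally show False by simp
qed

section \<open>Oscillation of the limit equation\<close>

text \<open>In the logarithmic variable the limit equation is autonomous with negative damping, so its energy
  \<open>2 y^2 + z^6/6 - 3/8 z^2\<close> increases. A trajectory of positive energy cannot settle in one of the two wells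
  and has to cross \<open>z = 0\<close> again.\<close>

context
  fixes z y :: "real \<Rightarrow> real" and a :: real
  assumes z: "\<And>t. a \<le> t \<Longrightarrow> (z has_real_derivative y t) (at t)"
    and y: "\<And>t. a \<le> t \<Longrightarrow> (y has_real_derivative (2 * y t + 3/4 * z t - z t ^ 5) / 4) (at t)"
begin

lemma osc_energy_mono:
  assumes "a \<le> s" "s \<le> t"
  shows "2 * (y s)\<^sup>2 + z s ^ 6 / 6 - 3/8 * (z s)\<^sup>2 \<le> 2 * (y t)\<^sup>2 + z t ^ 6 / 6 - 3/8 * (z t)\<^sup>2"
proof (rule DERIV_nonneg_imp_nondecreasing[OF assms(2)])
  fix x assume x: "s \<le> x" "x \<le> t"
  have "((\<lambda>t. 2 * (y t)\<^sup>2 + z t ^ 6 / 6 - 3/8 * (z t)\<^sup>2) has_real_derivative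
      (4 * y x * ((2 * y x + 3/4 * z x - z x ^ 5) / 4) + z x ^ 5 * y x - 3/4 * z x * y x)) (at x)"
    using assms x by (auto intro!: derivative_eq_intros z y)
  moreover have "4 * y x * ((2 * y x + 3/4 * z x - z x ^ 5) / 4) + z x ^ 5 * y x - 3/4 * z x * y x = 2 * (y x)\<^sup>2"
    by (simp add: field_simps power2_eq_square)
  ultimately have "((\<lambda>t. 2 * (y t)\<^sup>2 + z t ^ 6 / 6 - 3/8 * (z t)\<^sup>2) has_real_derivative 2 * (y x)\<^sup>2) (at x)"
    by (simp only:)
  then show "\<exists>d. ((\<lambda>t. 2 * (y t)\<^sup>2 + z t ^ 6 / 6 - 3/8 * (z t)\<^sup>2) has_real_derivative d) (at x) \<and> 0 \<le> d"
    by (intro exI[where x = "2 * (y x)\<^sup>2"] conjI) simp_all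
qed

lemma linear_growth:
  fixes f f' :: "real \<Rightarrow> real"
  assumes "\<And>t. s \<le> t \<Longrightarrow> (f has_real_derivative f' t) (at t)" "\<And>t. s \<le> t \<Longrightarrow> c \<le> f' t" "s \<le> t"
  shows "f s + c * (t - s) \<le> f t"
proof -
  have "f s - c * s \<le> f t - c * t"
  proof (rule DERIV_nonneg_imp_nondecreasing[OF assms(3)])
    fix x assume "s \<le> x"
    then have "((\<lambda>x. f x - c * x) has_real_derivative f' x - c) (at x)" "0 \<le> f' x - c"
      using assms(1,2)[of x] by (auto intro!: derivative_eq_intros)
    then show "\<exists>d. ((\<lambda>x. f x - c * x) has_real_derivative d) (at x) \<and> 0 \<le> d" by blast
  qed
  then show ?thesis by (simp add: algebra_simps)
qed

text \<open>The threshold w^2 = 3/2 is the zero of the potential w^6/6 - 3/8 w^2. Beyond it the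
  restoring force is bounded below; within it a trajectory of positive energy has a minimal
  speed.\<close>

lemma well_force:
  fixes w :: real
  assumes "3/2 \<le> w\<^sup>2" "0 < w"
  shows "2/3 * w\<^sup>2 \<le> w ^ 5 - 3/4 * w" "3/2 \<le> w ^ 5 - 3/4 * w"
proof -
  have w1: "1 < w" using assms power_le_one[of w 2] by (cases "w \<le> 1") auto
  have "(3/2) * (3/2) \<le> w\<^sup>2 * w\<^sup>2" using assms by (intro mult_mono) auto
  then have "9/4 \<le> w ^ 4" by (simp add: power_numeral_reduce algebra_simps)
  then have "w * (9/4) \<le> w * w ^ 4" using assms(2) by (intro mult_left_mono) auto
  then have 1: "9/4 * w \<le> w ^ 5" by (simp add: power_numeral_reduce algebra_simps)
  have "1 * w\<^sup>2 \<le> w ^ 3 * w\<^sup>2" using w1 by (intro mult_right_mono) (auto simp: one_le_power)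
  then have "w\<^sup>2 \<le> w ^ 5" by (simp add: power_numeral_reduce algebra_simps)
  with 1 show "2/3 * w\<^sup>2 \<le> w ^ 5 - 3/4 * w" by linarith
  show "3/2 \<le> w ^ 5 - 3/4 * w" using 1 w1 by linarith
qed

text \<open>Suppose z stays positive. If y >= 0 throughout, z leaves the region z^2 <= 3/2, and a
  Riccati inequality forces blow-up in finite time. Once y is negative it stays negative, z falls
  back into that region, and the minimal speed there takes it to 0.\<close>

lemma osc_not_positive:
  assumes H: "0 < 2 * (y a)\<^sup>2 + z a ^ 6 / 6 - 3/8 * (z a)\<^sup>2"
  shows "\<exists>t\<ge>a. z t \<le> 0"
proof (rule ccontr)
  assume "\<not> (\<exists>t\<ge>a. z t \<le> 0)"
  then have pos: "0 < z t" if "a \<le> t" for t using that by force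
  define h where "h = 2 * (y a)\<^sup>2 + z a ^ 6 / 6 - 3/8 * (z a)\<^sup>2"
  have h: "h > 0" using H by (simp add: h_def)
  define k where "k = sqrt (h / 2)"
  have k: "k > 0" using h by (simp add: k_def)
  \<comment> \<open>The potential is nonpositive here, so the kinetic part alone carries at least
    the initial energy.\<close>
  have fast: "k \<le> \<bar>y t\<bar>" if "a \<le> t" "(z t)\<^sup>2 \<le> 3/2" for t
  proof -
    have "(z t)\<^sup>2 * (z t)\<^sup>2 \<le> (3/2) * (3/2)" using that by (intro mult_mono) auto
    then have "(z t)\<^sup>2 * ((z t)\<^sup>2 * (z t)\<^sup>2) \<le> (z t)\<^sup>2 * (9/4)" by (intro mult_left_mono) auto
    then have "z t ^ 6 / 6 - 3/8 * (z t)\<^sup>2 \<le> 0" by (simp add: power_numeral_reduce algebra_simps)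
    then have "h / 2 \<le> (y t)\<^sup>2" using osc_energy_mono[OF order_refl that(1)] by (simp add: h_def)
    then show ?thesis unfolding k_def by (metis real_sqrt_abs real_sqrt_le_mono)
  qed
  have zc: "continuous_on {s..t} z" and yc: "continuous_on {s..t} y" if "a \<le> s" for s t
    using that by (auto intro!: continuous_at_imp_continuous_on DERIV_isCont[OF z] DERIV_isCont[OF y])
  have mono: "z s \<le> z t" if "\<And>r. s \<le> r \<Longrightarrow> r \<le> t \<Longrightarrow> 0 \<le> y r" "a \<le> s" "s \<le> t" for s t
    by (rule DERIV_nonneg_imp_nondecreasing[OF that(3)]) (use that z in \<open>meson order_trans\<close>)
  have "\<exists>t\<ge>a. y t < 0"
  proof (rule ccontr)
    assume "\<not> (\<exists>t\<ge>a. y t < 0)"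
    then have y0: "0 \<le> y t" if "a \<le> t" for t using that by force
    have "\<exists>t\<ge>a. 3/2 < (z t)\<^sup>2"
    proof (rule ccontr)
      assume "\<not> (\<exists>t\<ge>a. 3/2 < (z t)\<^sup>2)"
      then have small: "(z t)\<^sup>2 \<le> 3/2" if "a \<le> t" for t using that by force
      have "z a + k * (a + 2 / k - a) \<le> z (a + 2 / k)"
        by (rule linear_growth[where f' = y]) (use z fast small y0 k in \<open>force simp: abs_of_nonneg\<close>)+
      then have "2 \<le> z (a + 2 / k)" using pos[of a] k by simp
      then have "2\<^sup>2 \<le> (z (a + 2 / k))\<^sup>2" by (intro power_mono) auto
      then show False using small[of "a + 2 / k"] k by simp
    qed
    then obtain b where b: "a \<le> b" "3/2 < (z b)\<^sup>2" by auto
    have big: "3/2 \<le> (z t)\<^sup>2" if "b \<le> t" for t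
    proof -
      have "z b \<le> z t" using mono[of b t] y0 that b by auto
      then have "(z b)\<^sup>2 \<le> (z t)\<^sup>2" using pos[of b] b by (intro power_mono) auto
      then show ?thesis using b by linarith
    qed
    \<comment> \<open>This combination cancels the damping: its derivative is exactly the restoring
      force. As y >= 0, it is at most 2 z, so the force dominates q^2/6.\<close>
    define q where "q t = 2 * z t - 4 * y t" for t
    have q: "(q has_real_derivative (z t ^ 5 - 3/4 * z t)) (at t)" if "b \<le> t" for t
      unfolding q_def using that b by (auto intro!: derivative_eq_intros z y simp: field_simps)
    have force: "2/3 * (z t)\<^sup>2 \<le> z t ^ 5 - 3/4 * z t" "3/2 \<le> z t ^ 5 - 3/4 * z t" if "b \<le> t" for t
      using well_force[OF big[OF that] pos] that b by auto
    have grow: "q s + 3/2 * (t - s) \<le> q t" if "b \<le> s" "s \<le> t" for s t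
      using that q force by (intro linear_growth[where f' = "\<lambda>t. z t ^ 5 - 3/4 * z t"]) auto
    define c where "c = b + (\<bar>q b\<bar> + 1)"
    have bc: "b \<le> c" "c - b = \<bar>q b\<bar> + 1" by (auto simp: c_def)
    have "q b + 3/2 * (c - b) \<le> q c" by (rule grow[OF order_refl bc(1)])
    then have "q b + 3/2 * \<bar>q b\<bar> + 3/2 \<le> q c" unfolding bc(2) by (simp add: distrib_left)
    then have "1 \<le> q c" by linarith
    have q1: "1 \<le> q t" if "c \<le> t" for t using grow[OF bc(1) that] that \<open>1 \<le> q c\<close>
      by (simp add: right_diff_distrib)
    \<comment> \<open>From q' >= q^2/6 the reciprocal of q falls at rate at least 1/6. It starts at
      1 or below, so it cannot remain positive for a time span of 6.\<close>
    have "- inverse (q c) + 1/6 * (c + 6 - c) \<le> - inverse (q (c + 6))"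
    proof (rule linear_growth[where f = "\<lambda>t. - inverse (q t)" and f' = "\<lambda>t. (z t ^ 5 - 3/4 * z t) / (q t)\<^sup>2"])
      fix t assume t: "c \<le> t"
      then have bt: "b \<le> t" using bc by simp
      show "((\<lambda>t. - inverse (q t)) has_real_derivative (z t ^ 5 - 3/4 * z t) / (q t)\<^sup>2) (at t)"
        using q1[OF t] by (auto intro!: derivative_eq_intros q[OF bt] simp: field_simps power2_eq_square)
      have "q t \<le> 2 * z t" using y0[of t] bt b by (simp add: q_def)
      then have "(q t)\<^sup>2 \<le> (2 * z t)\<^sup>2" using q1[OF t] by (intro power_mono) auto
      then have "1/6 * (q t)\<^sup>2 \<le> z t ^ 5 - 3/4 * z t" using force(1)[OF bt] by (simp add: power_mult_distrib)
      then show "1/6 \<le> (z t ^ 5 - 3/4 * z t) / (q t)\<^sup>2" using q1[OF t] by (simp add: field_simps)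
    qed simp
    moreover have "inverse (q c) \<le> 1" using \<open>1 \<le> q c\<close> by (simp add: field_simps)
    moreover have "0 < inverse (q (c + 6))" using q1[of "c + 6"] by simp
    moreover have "1/6 * (c + 6 - c) = 1" by simp
    ultimately show False by linarith
  qed
  then obtain b where b: "a \<le> b" "y b < 0" by auto
  \<comment> \<open>At the first return to y = 0 the minimal speed forces z^2 > 3/2. There y' < 0,
    which is incompatible with y rising to 0.\<close>
  have neg: "y t < 0" if bt: "b \<le> t" for t
  proof (rule ccontr)
    assume "\<not> y t < 0"
    define S where "S = {b..t} \<inter> y -` {0..}"
    have "closed S" unfolding S_def by (intro continuous_closed_preimage yc b) auto
    moreover have "S \<noteq> {}" "bdd_below S" using \<open>\<not> y t < 0\<close> bt by (auto simp: S_def intro: bdd_belowI[of _ b])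
    ultimately have m: "Inf S \<in> S" by (intro closed_contains_Inf)
    define c where "c = Inf S"
    have c: "b \<le> c" "c \<le> t" "0 \<le> y c" using m by (auto simp: S_def c_def)
    have bc: "b < c" using c b by (cases "b = c") auto
    have below: "y r < 0" if "b \<le> r" "r < c" for r
      using that c cInf_lower[OF _ \<open>bdd_below S\<close>, of r] by (force simp: S_def c_def)
    have "\<exists>r\<ge>b. r \<le> c \<and> y r = 0" using b c by (intro IVT' yc) auto
    then have yc0: "y c = 0" using below by (metis less_irrefl order_le_less)
    have "3/2 < (z c)\<^sup>2" using fast[of c] yc0 k c b by force
    then have "(2 * y c + 3/4 * z c - z c ^ 5) / 4 < 0" using well_force(2)[of "z c"] pos[of c] yc0 c b by auto
    from DERIV_neg_dec_left[OF y this] c b obtain d where d: "d > 0" "\<And>h. 0 < h \<Longrightarrow> h < d \<Longrightarrow> y c < y (c - h)" by auto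
    define r where "r = c - min (d / 2) (c - b)"
    have "y c < y r" unfolding r_def using d bc by (intro d(2)) (auto simp: min_def)
    moreover have "b \<le> r" "r < c" using d bc by (auto simp: r_def min_def)
    ultimately show False using below[of r] yc0 by simp
  qed
  have dec: "z t \<le> z s" if "b \<le> s" "s \<le> t" for s t
  proof (rule DERIV_nonpos_imp_nonincreasing[OF that(2)])
    fix x assume "s \<le> x"
    then show "\<exists>d. (z has_real_derivative d) (at x) \<and> d \<le> 0" using z[of x] neg[of x] that b by (intro exI[of _ "y x"]) auto
  qed
  have "\<exists>t\<ge>b. (z t)\<^sup>2 \<le> 3/2"
  proof (rule ccontr)
    assume "\<not> (\<exists>t\<ge>b. (z t)\<^sup>2 \<le> 3/2)"
    then have big: "3/2 \<le> (z t)\<^sup>2" if "b \<le> t" for t using that by force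
    have force: "3/2 \<le> z t ^ 5 - 3/4 * z t" if "b \<le> t" for t
      using well_force(2)[OF big[OF that] pos] that b by auto
    have ydec: "- y b + 3/8 * (t - b) \<le> - y t" if "b \<le> t" for t
    proof (rule linear_growth[where f = "\<lambda>t. - y t" and f' = "\<lambda>t. - ((2 * y t + 3/4 * z t - z t ^ 5) / 4)"])
      fix t assume t: "b \<le> t"
      show "((\<lambda>t. - y t) has_real_derivative - ((2 * y t + 3/4 * z t - z t ^ 5) / 4)) (at t)"
        using t b by (intro DERIV_minus y) auto
      show "3/8 \<le> - ((2 * y t + 3/4 * z t - z t ^ 5) / 4)" using force[OF t] neg[OF t] by (simp add: field_simps)
    qed (rule that)
    have "- z (b + 8) + 3 * (b + 8 + z (b + 8) - (b + 8)) \<le> - z (b + 8 + z (b + 8))"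
    proof (rule linear_growth[where f = "\<lambda>t. - z t" and f' = "\<lambda>t. - y t"])
      fix t assume t: "b + 8 \<le> t"
      show "((\<lambda>t. - z t) has_real_derivative - y t) (at t)" using t b by (intro DERIV_minus z) auto
      have "- y b + 3/8 * t - 3/8 * b \<le> - y t" using ydec[of t] t by (simp add: right_diff_distrib)
      then show "3 \<le> - y t" using t b by linarith
    qed (use pos[of "b + 8"] b in auto)
    then show False using pos[of "b + 8 + z (b + 8)"] pos[of "b + 8"] b by auto
  qed
  then obtain c where c: "b \<le> c" "(z c)\<^sup>2 \<le> 3/2" by auto
  have small: "(z t)\<^sup>2 \<le> 3/2" if "c \<le> t" for t
  proof -
    have "(z t)\<^sup>2 \<le> (z c)\<^sup>2" using dec[OF c(1) that] pos[of t] that b c by (intro power_mono) auto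
    then show ?thesis using c by linarith
  qed
  have "- z c + k * (c + z c / k - c) \<le> - z (c + z c / k)"
  proof (rule linear_growth[where f = "\<lambda>t. - z t" and f' = "\<lambda>t. - y t"])
    fix t assume t: "c \<le> t"
    show "((\<lambda>t. - z t) has_real_derivative - y t) (at t)" using t b c by (intro DERIV_minus z) auto
    show "k \<le> - y t" using fast[OF _ small[OF t]] neg[of t] t b c by auto
  qed (use pos[of c] b c k in auto)
  moreover have "0 < z c / k" using pos[of c] b c k by simp
  ultimately show False using pos[of "c + z c / k"] b c k by simp
qed

text \<open>If z touched 0 without crossing, it would have a minimum there, so y and the energy
  would vanish; but the energy is positive and nondecreasing.\<close>

lemma osc_sign_change:
  assumes H: "0 < 2 * (y a)\<^sup>2 + z a ^ 6 / 6 - 3/8 * (z a)\<^sup>2" and za: "0 < z a"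
  shows "\<exists>t>a. z t < 0"
proof (rule ccontr)
  assume no: "\<not> (\<exists>t>a. z t < 0)"
  obtain t where t: "a \<le> t" "z t \<le> 0" using osc_not_positive[OF H] by auto
  then have at: "a < t" using za by (cases "a = t") auto
  then have zt: "z t = 0" using no t by force
  have "y t = 0"
  proof (rule DERIV_local_min[OF z[OF t(1)], of "t - a"])
    have "0 \<le> z x" if "a < x" for x using no that by force
    then show "\<forall>x. \<bar>t - x\<bar> < t - a \<longrightarrow> z t \<le> z x" using zt by auto
  qed (use at in simp)
  with zt osc_energy_mono[OF order_refl t(1)] H show False by simp
qed

end

section \<open>Regularity of the shooting family on its natural domain\<close>

lemma shoot_cont_domain:
  "continuous_on {(e, s). 0 \<le> e \<and> 0 \<le> s \<and> e * s < 1} (\<lambda>(e, s). shoot e s)" (is "continuous_on ?D _")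
  "continuous_on {(e, s). 0 \<le> e \<and> 0 \<le> s \<and> e * s < 1} (\<lambda>(e, s). dshoot e s)"
proof -
  have loc: "continuous_on ?D f"
    if f: "\<And>E X. 0 \<le> E \<Longrightarrow> 0 < X \<Longrightarrow> E * X < 1 \<Longrightarrow> continuous_on ({0..E} \<times> {0..X}) f"
    for f :: "real \<times> real \<Rightarrow> real"
  proof (clarsimp simp: continuous_on_eq_continuous_within)
    \<comment> \<open>The domain e s < 1 is not a rectangle, but near each of its points it
      coincides with a rectangle on which joint continuity is known.\<close>
    fix e s :: real assume es: "0 \<le> e" "0 \<le> s" "e * s < 1"
    have "((\<lambda>h. (e + h) * (s + h)) \<longlongrightarrow> (e + 0) * (s + 0)) (at_right 0)" by (intro tendsto_intros)
    then have "eventually (\<lambda>h. (e + h) * (s + h) < 1) (at_right 0)"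
      using es by (auto dest: order_tendstoD(2)[where a = 1])
    moreover have "eventually (\<lambda>h::real. 0 < h) (at_right 0)" by (simp add: eventually_at_right_less)
    ultimately obtain h where h: "(e + h) * (s + h) < 1" "0 < h"
      using eventually_happens[OF eventually_conj] by force
    have "continuous (at (e, s) within {0..e + h} \<times> {0..s + h}) f"
      using f[of "e + h" "s + h"] h es by (auto simp: continuous_on_eq_continuous_within)
    moreover have "at (e, s) within {0..e + h} \<times> {0..s + h} = at (e, s) within ?D"
    proof (rule at_within_nhd)
      show "open ({..<e + h} \<times> {..<s + h})" by (intro open_Times) auto
      show "({0..e + h} \<times> {0..s + h}) \<inter> ({..<e + h} \<times> {..<s + h}) - {(e, s)} = ?D \<inter> ({..<e + h} \<times> {..<s + h}) - {(e, s)}"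
      proof -
        have "a * b < 1" if "0 \<le> a" "0 \<le> b" "a < e + h" "b < s + h" for a b
          using mult_mono[of a "e + h" b "s + h"] that h(1) by linarith
        then show ?thesis by auto
      qed
    qed (use h in auto)
    ultimately show "continuous (at (e, s) within ?D) f" by (simp add: continuous_within)
  qed
  show "continuous_on ?D (\<lambda>(e, s). shoot e s)" "continuous_on ?D (\<lambda>(e, s). dshoot e s)"
    by (rule loc, rule shoot_joint_cont, assumption+)+
qed

lemma shoot_zero:
  assumes "0 \<le> e" shows "shoot e 0 = 1"
proof -
  have "e * (1 / (e + 1)) < 1" using assms by (simp add: field_simps)
  then have "sol (\<lambda>y. y ^ 5) e (1 / (e + 1)) (shoot e)" using assms by (intro sol_shoot) auto
  then show ?thesis using assms by (auto simp: sol_def)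
qed

lemma pow5_cont: "continuous_on UNIV (\<lambda>y::real. y ^ 5)"
  by (intro continuous_intros)

lemma
  assumes e: "0 \<le> e" and s: "0 < s" "e * s < 1"
  shows DERIV_shoot: "(shoot e has_real_derivative dshoot e s) (at s)"
    and DERIV_dshoot: "(dshoot e has_real_derivative
      (15/4 * e * shoot e s - s\<^sup>2 * shoot e s ^ 5 - (8 - 12 * e * s) * dshoot e s) / (4 * s * (1 - e * s))) (at s)"
    and DERIV_flux: "((\<lambda>s. 4 * s\<^sup>2 * (1 - e * s) * dshoot e s) has_real_derivative
      s * (15/4 * e * shoot e s - s\<^sup>2 * shoot e s ^ 5)) (at s)"
proof -
  \<comment> \<open>A larger endpoint makes s an interior point, so that the one-sided derivatives
    on [0, X] become ordinary ones.\<close>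
  obtain X where X: "s < X" "e * X < 1"
  proof (cases "e = 0")
    case True
    then show thesis using that[of "s + 1"] by simp
  next
    case False
    then have "e > 0" using e by simp
    then show thesis using that[of "(s + 1 / e) / 2"] s by (simp add: field_simps)
  qed
  have W: "sol (\<lambda>y. y ^ 5) e X (shoot e)" using e s X by (intro sol_shoot) auto
  have at: "at s within {0..X} = at s" using s X by (intro at_within_Icc_at) auto
  show "(shoot e has_real_derivative dshoot e s) (at s)"
    using sol_deriv[OF pow5_cont e X(2) W, of s] s X at by (simp add: dshoot_def)
  show "(dshoot e has_real_derivative
      (15/4 * e * shoot e s - s\<^sup>2 * shoot e s ^ 5 - (8 - 12 * e * s) * dshoot e s) / (4 * s * (1 - e * s))) (at s)"
    using slope_deriv[OF pow5_cont e X(2) W, of s] s X at unfolding dshoot_def rhs_def by simp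
  show "((\<lambda>s. 4 * s\<^sup>2 * (1 - e * s) * dshoot e s) has_real_derivative
      s * (15/4 * e * shoot e s - s\<^sup>2 * shoot e s ^ 5)) (at s)"
    using flux_deriv[OF pow5_cont e X(2) W, of s] s X at unfolding dshoot_def rhs_def by simp
qed

text \<open>With s = exp t and z = s^(3/4) W the equation for e = 0 becomes the autonomous
  oscillator treated before. The sign \<open>c\<close> handles both signs of W at once, since the
  nonlinearity is odd.\<close>

lemma limit_sign_change:
  assumes s: "1/800 \<le> s" and c: "c = 1 \<or> c = (-1::real)" and pos: "0 < c * shoot 0 s"
  shows "\<exists>s'>s. 0 < - c * shoot 0 s'"
proof -
  define z where "z t = c * exp (3/4 * t) * shoot 0 (exp t)" for t
  define y where "y t = 3/4 * z t + c * exp (7/4 * t) * dshoot 0 (exp t)" for t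
  have c2: "c\<^sup>2 = 1" "c ^ 5 = c" "c ^ 6 = 1" using c by auto
  have zd: "(z has_real_derivative y t) (at t)" for t
  proof -
    have "(z has_real_derivative c * (3/4 * exp (3/4 * t)) * shoot 0 (exp t)
        + c * exp (3/4 * t) * (dshoot 0 (exp t) * exp t)) (at t)"
      unfolding z_def[abs_def]
      by (auto intro!: derivative_eq_intros DERIV_chain2[OF DERIV_shoot])
    moreover have "exp (7/4 * t) = exp (3/4 * t) * exp t" by (simp flip: exp_add)
    ultimately show ?thesis by (simp add: y_def z_def algebra_simps)
  qed
  have yd: "(y has_real_derivative (2 * y t + 3/4 * z t - z t ^ 5) / 4) (at t)" for t
  proof -
    define D where "D = (- (exp t)\<^sup>2 * shoot 0 (exp t) ^ 5 - 8 * dshoot 0 (exp t)) / (4 * exp t)"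
    have "(dshoot 0 has_real_derivative D) (at (exp t))"
      using DERIV_dshoot[of 0 "exp t"] by (simp add: D_def)
    then have "(y has_real_derivative 3/4 * y t + (c * (7/4 * exp (7/4 * t)) * dshoot 0 (exp t)
        + c * exp (7/4 * t) * (D * exp t))) (at t)"
      unfolding y_def[abs_def]
      by (auto intro!: derivative_eq_intros zd DERIV_chain2[where f = "dshoot 0"] simp: y_def field_simps)
    moreover have "3/4 * y t + (c * (7/4 * exp (7/4 * t)) * dshoot 0 (exp t) + c * exp (7/4 * t) * (D * exp t))
        = (2 * y t + 3/4 * z t - z t ^ 5) / 4"
    proof -
      have "exp (3/4 * t) ^ 5 = exp (7/4 * t) * (exp t)\<^sup>2"
        by (simp flip: exp_of_nat_mult exp_add)
      then have z5: "z t ^ 5 = c * exp (7/4 * t) * ((exp t)\<^sup>2 * shoot 0 (exp t) ^ 5)"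
        by (simp add: z_def power_mult_distrib c2)
      have "D * exp t = - ((exp t)\<^sup>2 * shoot 0 (exp t) ^ 5) / 4 - 2 * dshoot 0 (exp t)"
        by (simp add: D_def field_simps)
      then have "c * exp (7/4 * t) * (D * exp t) = - (z t ^ 5) / 4 - 2 * (c * exp (7/4 * t) * dshoot 0 (exp t))"
        unfolding z5 by (simp add: right_diff_distrib)
      moreover have "c * (7/4 * exp (7/4 * t)) * dshoot 0 (exp t) = 7/4 * (c * exp (7/4 * t) * dshoot 0 (exp t))" by simp
      moreover have "c * exp (7/4 * t) * dshoot 0 (exp t) = y t - 3/4 * z t" by (simp add: y_def)
      ultimately show ?thesis by (simp add: field_simps)
    qed
    ultimately show ?thesis by (simp only:)
  qed
  define a where "a = ln (1/800 :: real)"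
  have a: "exp a = 1/800" by (simp add: a_def)
  \<comment> \<open>At s = 1/800 the solution is within 1/4 of 1 and |W'| <= 8, so s W' is at most
    1/100 and y is close to 3/4 z. The kinetic term then outweighs 3/8 z^2, and monotonicity carries
    positivity to later times.\<close>
  have H: "0 < 2 * (y a)\<^sup>2 + z a ^ 6 / 6 - 3/8 * (z a)\<^sup>2"
  proof -
    define w v k where "w = shoot 0 (1/800)" and "v = dshoot 0 (1/800)" and "k = exp (3/4 * a)"
    have "sol (\<lambda>y. y ^ 5) 0 1 (shoot 0)" by (intro sol_shoot) auto
    note init = sol_initial[OF pow5_cont _ _ _ _ _ _ this, of 0 1 "1/32" "1/800"]
    have w: "\<bar>w - 1\<bar> \<le> 1/4" and v: "\<bar>v\<bar> \<le> 8" using init by (simp_all add: w_def v_def dshoot_def)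
    have k: "k > 0" by (simp add: k_def)
    have za: "z a = c * k * w" by (simp add: z_def a w_def k_def)
    have "exp (7/4 * a) = k * (1/800)" unfolding k_def a[symmetric] by (simp flip: exp_add)
    then have ya: "y a = c * k * (3/4 * w + v / 800)" unfolding y_def za a by (simp add: v_def algebra_simps)
    have "0 \<le> (k * w) ^ 6 / 6" by simp
    moreover have "2 * (y a)\<^sup>2 - 3/8 * (z a)\<^sup>2 = k\<^sup>2 * (2 * (3/4 * w + v / 800)\<^sup>2 - 3/8 * w\<^sup>2)"
      unfolding ya za power_mult_distrib c2 right_diff_distrib by simp
    moreover have "0 < 2 * (3/4 * w + v / 800)\<^sup>2 - 3/8 * w\<^sup>2"
    proof -
      have "3/4 \<le> w" "- 8 \<le> v" using w v by linarith+
      then have "7/10 * w \<le> 3/4 * w + v / 800" "0 < w" by linarith+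
      then have "(7/10 * w)\<^sup>2 \<le> (3/4 * w + v / 800)\<^sup>2" by (intro power_mono) auto
      moreover have "0 < w\<^sup>2" using \<open>0 < w\<close> by simp
      moreover have "(7/10 * w)\<^sup>2 = 49/100 * w\<^sup>2" by (simp add: power2_eq_square)
      ultimately show ?thesis by linarith
    qed
    moreover have "z a ^ 6 = (k * w) ^ 6" unfolding za by (simp add: power_mult_distrib c2)
    ultimately show ?thesis using k by (smt (verit) mult_pos_pos zero_less_power)
  qed
  have la: "a \<le> ln s" unfolding a_def using s by (subst ln_le_cancel_iff) auto
  have "z (ln s) = exp (3/4 * ln s) * (c * shoot 0 s)" using s by (simp add: z_def mult_ac)
  then have "0 < z (ln s)" using pos by simp
  moreover have "0 < 2 * (y (ln s))\<^sup>2 + z (ln s) ^ 6 / 6 - 3/8 * (z (ln s))\<^sup>2"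
    using H osc_energy_mono[OF zd yd order_refl la] by linarith
  ultimately obtain t where t: "t > ln s" "z t < 0" using osc_sign_change[OF zd yd] by blast
  have "s < exp t" 
  proof -
    have "exp (ln s) < exp t" using t(1) by simp
    then show ?thesis using s by simp
  qed
  moreover have "0 < - c * shoot 0 (exp t)"
  proof -
    have "exp (3/4 * t) * (c * shoot 0 (exp t)) < 0" using t(2) by (simp add: z_def mult_ac)
    then have "c * shoot 0 (exp t) < 0" by (simp add: mult_less_0_iff)
    then show ?thesis by simp
  qed
  ultimately show ?thesis by blast
qed

lemma limit_oscillates:
  obtains \<sigma> :: "nat \<Rightarrow> real" where "strict_mono \<sigma>" "0 < \<sigma> 0" "\<And>n. 0 < (-1) ^ n * shoot 0 (\<sigma> n)"
proof -
  have "\<exists>\<sigma>. \<forall>n. (1/800 \<le> \<sigma> n \<and> 0 < (-1) ^ n * shoot 0 (\<sigma> n)) \<and> \<sigma> n < \<sigma> (Suc n)"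
  proof (rule dependent_nat_choice)
    have "\<bar>shoot 0 (1/800) - 1\<bar> \<le> 1/4" by (rule shoot_near_zero) auto
    then have "0 < shoot 0 (1/800)" by linarith
    then show "\<exists>x. 1/800 \<le> x \<and> 0 < (-1) ^ 0 * shoot 0 x" by (intro exI[of _ "1/800"]) simp
    fix x and n :: nat assume x: "1/800 \<le> x \<and> 0 < (-1) ^ n * shoot 0 x"
    have "(-1::real) ^ n = 1 \<or> (-1::real) ^ n = -1" by (cases "even n") auto
    from limit_sign_change[OF conjunct1[OF x] this conjunct2[OF x]] obtain s' where
      "s' > x" "0 < - ((-1) ^ n) * shoot 0 s'" by blast
    then show "\<exists>y. (1/800 \<le> y \<and> 0 < (-1) ^ Suc n * shoot 0 y) \<and> x < y" using x by (intro exI[of _ s']) auto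
  qed
  then obtain \<sigma> where \<sigma>: "\<And>n. 1/800 \<le> \<sigma> n" "\<And>n. 0 < (-1) ^ n * shoot 0 (\<sigma> n)" "\<And>n. \<sigma> n < \<sigma> (Suc n)" by blast
  show thesis
  proof (rule that)
    show "strict_mono \<sigma>" using \<sigma>(3) by (simp add: strict_mono_Suc_iff)
    show "0 < \<sigma> 0" using \<sigma>(1)[of 0] by linarith
  qed (rule \<sigma>(2))
qed

section \<open>Shooting to the second singular endpoint\<close>

text \<open>The solution with parameter \<open>e = r^4\<close>, rescaled to the equation with \<open>e = 1\<close>, and its flux
  \<open>4 t^2 (1 - t) w'\<close>.\<close>

definition wn :: "real \<Rightarrow> real \<Rightarrow> real" where "wn r t = shoot (r^4) (t / r^4) / r^3"
definition pn :: "real \<Rightarrow> real \<Rightarrow> real" where "pn r t = 4 * t\<^sup>2 * (1 - t) * dshoot (r^4) (t / r^4) / r^7"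

text \<open>The choice e = r^4 turns the scaling factors e^(-3/4) and e^(-7/4) into r^(-3) and
  r^(-7). The pair (w, p) satisfies the first-order system whose phase plane is studied
  next.\<close>

lemma
  assumes r: "0 < r" and t: "0 < t" "t < 1"
  shows DERIV_wn: "(wn r has_real_derivative pn r t / (4 * t\<^sup>2 * (1 - t))) (at t)"
    and DERIV_pn: "(pn r has_real_derivative 15/4 * t * wn r t - t^3 * wn r t ^ 5) (at t)"
proof -
  have r4: "0 \<le> r^4" "0 < t / r^4" "r^4 * (t / r^4) < 1" using r t by auto
  have g: "((\<lambda>t. t / r^4) has_real_derivative 1 / r^4) (at t)" by (rule DERIV_cdivide[OF DERIV_ident])
  have "(wn r has_real_derivative dshoot (r^4) (t / r^4) * (1 / r^4) / r^3) (at t)"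
    unfolding wn_def[abs_def]
    by (intro DERIV_cdivide DERIV_chain2[where f = "shoot (r^4)" and g = "\<lambda>t. t / r^4"] DERIV_shoot[OF r4] g)
  moreover have "dshoot (r^4) (t / r^4) * (1 / r^4) / r^3 = pn r t / (4 * t\<^sup>2 * (1 - t))"
  proof -
    have "pn r t / (4 * t\<^sup>2 * (1 - t)) = dshoot (r^4) (t / r^4) / r^7" using t by (simp add: pn_def)
    moreover have "r^4 * r^3 = r^7" by (simp flip: power_add)
    moreover have "dshoot (r^4) (t / r^4) * (1 / r^4) / r^3 = dshoot (r^4) (t / r^4) / (r^4 * r^3)" by simp
    ultimately show ?thesis by (simp only:)
  qed
  ultimately show "(wn r has_real_derivative pn r t / (4 * t\<^sup>2 * (1 - t))) (at t)" by simp
  define P where "P s = 4 * s\<^sup>2 * (1 - r^4 * s) * dshoot (r^4) s" for s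
  have P: "(P has_real_derivative t / r^4 * (15/4 * r^4 * shoot (r^4) (t / r^4) - (t / r^4)\<^sup>2 * shoot (r^4) (t / r^4) ^ 5)) (at (t / r^4))"
    unfolding P_def using DERIV_flux[OF r4] .
  have "((\<lambda>t. r * P (t / r^4)) has_real_derivative
      r * (t / r^4 * (15/4 * r^4 * shoot (r^4) (t / r^4) - (t / r^4)\<^sup>2 * shoot (r^4) (t / r^4) ^ 5) * (1 / r^4))) (at t)"
    by (intro DERIV_cmult DERIV_chain2[where f = P and g = "\<lambda>t. t / r^4"] P g)
  moreover have "(\<lambda>t. r * P (t / r^4)) = pn r"
  proof
    fix t show "r * P (t / r^4) = pn r t"
    proof -
      have rn: "r \<noteq> 0" using r by simp
      have sq: "r * (t / r^4)\<^sup>2 = t\<^sup>2 / r^7"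
        using rn by (simp add: power2_eq_square power_numeral_reduce)
      have "r * P (t / r^4) = 4 * (r * (t / r^4)\<^sup>2) * (1 - r^4 * (t / r^4)) * dshoot (r^4) (t / r^4)"
        unfolding P_def by (simp only: mult_ac)
      moreover have "r^4 * (t / r^4) = t" using rn by simp
      ultimately have "r * P (t / r^4) = 4 * (r * (t / r^4)\<^sup>2) * (1 - t) * dshoot (r^4) (t / r^4)" by (simp only:)
      then show ?thesis unfolding sq by (simp add: pn_def)
    qed
  qed
  moreover have "r * (t / r^4 * (15/4 * r^4 * shoot (r^4) (t / r^4) - (t / r^4)\<^sup>2 * shoot (r^4) (t / r^4) ^ 5) * (1 / r^4))
      = 15/4 * t * wn r t - t^3 * wn r t ^ 5"
  proof -
    define q W where "q = r^4" and "W = shoot q (t / q)"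
    have rq: "r \<noteq> 0" "q \<noteq> 0" using r by (auto simp: q_def)
    have "r * (t / q * (15/4 * q * W - (t / q)\<^sup>2 * W ^ 5) * (1 / q)) = 15/4 * t * (r / q * W) - t^3 * (r / q^4 * W ^ 5)"
      using rq by (simp add: field_simps power_numeral_reduce)
    moreover have "r / q = 1 / r^3" "r / q^4 = 1 / r^15" using rq by (simp_all add: q_def field_simps power_numeral_reduce)
    moreover have "wn r t = 1 / r^3 * W" "wn r t ^ 5 = 1 / r^15 * W ^ 5"
      by (simp_all add: wn_def W_def q_def power_divide)
    ultimately show ?thesis unfolding W_def q_def by (simp only:)
  qed
  ultimately show "(pn r has_real_derivative 15/4 * t * wn r t - t^3 * wn r t ^ 5) (at t)" by simp
qed

lemma
  shows wn_cont: "continuous_on ({0<..} \<times> {0..<1}) (\<lambda>(r, t). wn r t)"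
    and pn_cont: "continuous_on ({0<..} \<times> {0..<1}) (\<lambda>(r, t). pn r t)"
proof -
  have c: "continuous_on ({0<..} \<times> {0..<1}) (\<lambda>x::real\<times>real. (fst x ^ 4, snd x / fst x ^ 4))"
    by (intro continuous_intros) auto
  have m: "(\<lambda>x::real\<times>real. (fst x ^ 4, snd x / fst x ^ 4)) ` ({0<..} \<times> {0..<1}) \<subseteq> {(e, s). 0 \<le> e \<and> 0 \<le> s \<and> e * s < 1}"
    by auto
  note d = continuous_on_compose2[OF shoot_cont_domain(1) c m] continuous_on_compose2[OF shoot_cont_domain(2) c m]
  show "continuous_on ({0<..} \<times> {0..<1}) (\<lambda>(r, t). wn r t)"
    unfolding wn_def case_prod_unfold using d(1) by (intro continuous_intros) (auto simp: case_prod_unfold)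
  show "continuous_on ({0<..} \<times> {0..<1}) (\<lambda>(r, t). pn r t)"
    unfolding pn_def case_prod_unfold using d(2) by (intro continuous_intros) (auto simp: case_prod_unfold)
qed

lemma wn_zero: "0 < r \<Longrightarrow> wn r 0 = 1 / r^3" and pn_zero: "pn r 0 = 0"
  by (simp_all add: wn_def pn_def shoot_zero)

lemma wn_pn_nonzero:
  assumes "0 < r" "0 \<le> t" "t < 1"
  shows "wn r t \<noteq> 0 \<or> pn r t \<noteq> 0"
proof (cases "t = 0")
  case False
  then show ?thesis using shoot_nonzero[of "r^4" "t / r^4"] assms by (auto simp: wn_def pn_def)
qed (use assms wn_zero in auto)

lemma wn_near_zero:
  assumes "0 < r" "r \<le> 1/2" "0 \<le> t" "t \<le> r^4 / 80"
  shows "3/4 / r^3 \<le> wn r t"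
proof -
  have "r^4 \<le> (1/2)^4" using assms by (intro power_mono) auto
  then have "\<bar>shoot (r^4) (t / r^4) - 1\<bar> \<le> 1/4" using assms by (intro shoot_near_zero) (auto simp: field_simps)
  then have "3/4 \<le> shoot (r^4) (t / r^4)" by linarith
  then show ?thesis unfolding wn_def using assms by (intro divide_right_mono) auto
qed

text \<open>Strict sign alternation of the limit solution at finitely many times is an open
  condition, so it persists for small e > 0. Rescaling turns the times \<sigma> i into e * \<sigma>
  i, which are below 1.\<close>

lemma wn_oscillates:
  fixes n :: nat and r1 :: real
  assumes "0 < r1"
  obtains r \<tau> where "0 < r" "r < r1" "\<And>i. i \<le> n \<Longrightarrow> 0 \<le> \<tau> i \<and> \<tau> i < 1"
    "\<And>i. i < n \<Longrightarrow> \<tau> i < \<tau> (Suc i)" "\<And>i. i \<le> n \<Longrightarrow> 0 < (-1) ^ i * wn r (\<tau> i)"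
proof -
  obtain \<sigma> where \<sigma>: "strict_mono \<sigma>" "0 < \<sigma> 0" "\<And>n. 0 < (-1) ^ n * shoot 0 (\<sigma> n)"
    using limit_oscillates by blast
  have s0: "0 < \<sigma> i" for i using \<sigma>(1,2) by (metis le0 less_le_trans strict_mono_less_eq)
  have ev: "eventually (\<lambda>e. 0 < (-1) ^ i * shoot e (\<sigma> i) \<and> e * \<sigma> i < 1) (at_right 0)" for i
  proof -
    define E where "E = 1 / (2 * \<sigma> i)"
    have E: "0 < E" "E * \<sigma> i < 1" using s0[of i] by (auto simp: E_def)
    have "continuous_on ({0..E} \<times> {0..\<sigma> i}) (\<lambda>(e, s). (-1) ^ i * shoot e s)"
      using shoot_joint_cont(1)[of E "\<sigma> i"] E s0[of i] by (auto simp: case_prod_unfold intro!: continuous_intros)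
    then have "continuous_on ({0..E} \<times> {0..\<sigma> i}) (\<lambda>x. (-1) ^ i * shoot (fst x) (snd x))" by (simp add: case_prod_unfold)
    moreover have "continuous_on {0..E} (\<lambda>e. (e, \<sigma> i))" by (intro continuous_intros)
    ultimately have "continuous_on {0..E} (\<lambda>e. (-1) ^ i * shoot (fst (e, \<sigma> i)) (snd (e, \<sigma> i)))"
      by (rule continuous_on_compose2) (use s0[of i] in auto)
    then have "continuous_on {0..E} (\<lambda>e. (-1) ^ i * shoot e (\<sigma> i))" by simp
    then have "((\<lambda>e. (-1) ^ i * shoot e (\<sigma> i)) \<longlongrightarrow> (-1) ^ i * shoot 0 (\<sigma> i)) (at 0 within {0..E})"
      using E by (auto simp: continuous_on_def)
    then have "((\<lambda>e. (-1) ^ i * shoot e (\<sigma> i)) \<longlongrightarrow> (-1) ^ i * shoot 0 (\<sigma> i)) (at_right 0)"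
      using E by (simp add: at_within_Icc_at_right)
    then have "eventually (\<lambda>e. 0 < (-1) ^ i * shoot e (\<sigma> i)) (at_right 0)" using \<sigma>(3) by (rule order_tendstoD)
    moreover have "eventually (\<lambda>e. e \<in> {0<..<E}) (at_right 0)" by (rule eventually_at_right_real[OF E(1)])
    ultimately show ?thesis
    proof eventually_elim
      case (elim e)
      have "e * \<sigma> i \<le> E * \<sigma> i" using elim s0[of i] by (intro mult_right_mono) auto
      then show ?case using elim E by simp
    qed
  qed
  have "eventually (\<lambda>e. \<forall>i\<in>{..n}. 0 < (-1) ^ i * shoot e (\<sigma> i) \<and> e * \<sigma> i < 1) (at_right 0)"
    using ev by (intro eventually_ball_finite) auto
  moreover have "eventually (\<lambda>e. e \<in> {0<..<r1 ^ 4}) (at_right 0)" using assms by (intro eventually_at_right_real) simp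
  ultimately have "eventually (\<lambda>e. (\<forall>i\<in>{..n}. 0 < (-1) ^ i * shoot e (\<sigma> i) \<and> e * \<sigma> i < 1) \<and> e \<in> {0<..<r1 ^ 4}) (at_right 0)"
    by (rule eventually_conj)
  then obtain e where e: "\<And>i. i \<le> n \<Longrightarrow> 0 < (-1) ^ i * shoot e (\<sigma> i) \<and> e * \<sigma> i < 1" "0 < e" "e < r1 ^ 4"
    using eventually_happens[of _ "at_right (0::real)"] by fastforce
  define r where "r = root 4 e"
  have r: "0 < r" "r ^ 4 = e" using e by (auto simp: r_def)
  show thesis
  proof (rule that[of r "\<lambda>i. e * \<sigma> i"])
    show "r < r1" using r e assms power_less_imp_less_base[of r 4 r1] by auto
    fix i
    show "i \<le> n \<Longrightarrow> 0 \<le> e * \<sigma> i \<and> e * \<sigma> i < 1" using e s0[of i] by simp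
    show "i < n \<Longrightarrow> e * \<sigma> i < e * \<sigma> (Suc i)" using e(2) \<sigma>(1) by (simp add: strict_mono_Suc_iff)
    show "i \<le> n \<Longrightarrow> 0 < (-1) ^ i * wn r (e * \<sigma> i)" using e(1)[of i] e(2) r by (simp add: wn_def)
  qed (rule r)
qed

text \<open>A curve \<open>(w, p)\<close> with \<open>w' = k p\<close>, \<open>k > 0\<close>, crosses the axis \<open>w = 0\<close> only clockwise.\<close>

lemma angle_barrier:
  fixes \<theta> \<rho> w :: "real \<Rightarrow> real" and j :: int
  assumes \<theta>: "continuous_on {s0..s1} \<theta>" and \<rho>: "\<And>t. t \<in> {s0..s1} \<Longrightarrow> 0 < \<rho> t"
    and w: "\<And>t. t \<in> {s0..s1} \<Longrightarrow> w t = \<rho> t * cos (\<theta> t)"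
    and d: "\<And>t. s0 < t \<Longrightarrow> t \<le> s1 \<Longrightarrow> \<exists>k>0. (w has_real_derivative k * (\<rho> t * sin (\<theta> t))) (at t)"
    and le: "s0 \<le> s1" and start: "\<theta> s0 < pi/2 + of_int j * pi"
  shows "\<theta> s1 < pi/2 + of_int j * pi"
proof (rule ccontr)
  define b where "b = pi/2 + of_int j * pi"
  assume "\<not> \<theta> s1 < pi/2 + of_int j * pi"
  then have s1: "b \<le> \<theta> s1" by (simp add: b_def)
  define S where "S = {s0..s1} \<inter> \<theta> -` {b..}"
  have "closed S" unfolding S_def by (intro continuous_closed_preimage \<theta>) auto
  moreover have "S \<noteq> {}" "bdd_below S" using s1 le by (auto simp: S_def intro: bdd_belowI[of _ s0])
  ultimately have m: "Inf S \<in> S" by (intro closed_contains_Inf)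
  define c where "c = Inf S"
  have c: "s0 \<le> c" "c \<le> s1" "b \<le> \<theta> c" using m by (auto simp: S_def c_def)
  have s0c: "s0 < c" using c start by (cases "s0 = c") (auto simp: b_def)
  have below: "\<theta> r < b" if "s0 \<le> r" "r < c" for r
    using that c cInf_lower[OF _ \<open>bdd_below S\<close>, of r] by (force simp: S_def c_def)
  have "\<exists>r\<ge>s0. r \<le> c \<and> \<theta> r = b"
    using c start by (intro IVT') (auto simp: b_def intro: continuous_on_subset[OF \<theta>])
  then have \<theta>c: "\<theta> c = b" using below by (metis less_irrefl order_le_less)
  \<comment> \<open>\<open>u\<close> is the sign (-1)^j. An angle slightly below \<open>b\<close>
    means u w > 0, whereas a positive derivative of u w at the first contact would require u w < 0
    just before it.\<close>
  define u where "u = cos (of_int j * pi)"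
  have sj: "sin (of_int j * pi) = 0" by (simp add: sin_times_pi_eq_0)
  then have u: "u * u = 1" using sin_cos_squared_add[of "of_int j * pi"] by (simp add: u_def power2_eq_square)
  have cosb: "cos (b - x) = u * sin x" for x
    by (simp add: b_def u_def cos_diff cos_add sin_add sj)
  have sinb: "sin b = u" by (simp add: b_def u_def sin_add)
  obtain k where k: "k > 0" "(w has_real_derivative k * (\<rho> c * u)) (at c)" using d[OF s0c c(2)] \<theta>c sinb by auto
  have "((\<lambda>t. u * w t) has_real_derivative u * (k * (\<rho> c * u))) (at c)" by (rule DERIV_cmult[OF k(2)])
  moreover have "u * (k * (\<rho> c * u)) = k * \<rho> c" 
  proof -
    have "u * (k * (\<rho> c * u)) = (u * u) * (k * \<rho> c)" by (simp only: mult_ac)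
    then show ?thesis by (simp add: u)
  qed
  ultimately have "((\<lambda>t. u * w t) has_real_derivative k * \<rho> c) (at c)" by simp
  from DERIV_pos_inc_left[OF this] k(1) \<rho>[of c] c obtain e where
    e: "e > 0" "\<And>h. 0 < h \<Longrightarrow> h < e \<Longrightarrow> u * w (c - h) < u * w c" by auto
  have "(\<theta> \<longlongrightarrow> \<theta> c) (at c within {s0..s1})" using \<theta> c by (auto simp: continuous_on_def)
  then have "eventually (\<lambda>t. b - pi < \<theta> t) (at c within {s0..s1})" using \<theta>c by (intro order_tendstoD) auto
  then obtain e' where e': "e' > 0" "\<And>t. t \<in> {s0..s1} \<Longrightarrow> t \<noteq> c \<Longrightarrow> dist t c < e' \<Longrightarrow> b - pi < \<theta> t"
    by (auto simp: eventually_at)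
  define h where "h = min (min (e / 2) (e' / 2)) (c - s0)"
  have h: "0 < h" "h < e" "h < e'" "s0 \<le> c - h" using e e' s0c by (auto simp: h_def)
  have mem: "c - h \<in> {s0..s1}" using h c by auto
  have "u * w (c - h) < u * w c" using e h by auto
  also have "w c = 0" using w[of c] c \<theta>c cosb[of 0] by simp
  finally have neg: "u * w (c - h) < 0" by simp
  have "0 < b - \<theta> (c - h)" "b - \<theta> (c - h) < pi"
    using below[of "c - h"] e'(2)[OF mem] h by (auto simp: dist_real_def)
  then have "0 < sin (b - \<theta> (c - h))" by (rule sin_gt_zero)
  moreover have "cos (\<theta> (c - h)) = u * sin (b - \<theta> (c - h))" using cosb[of "b - \<theta> (c - h)"] by simp
  then have "u * w (c - h) = \<rho> (c - h) * sin (b - \<theta> (c - h))"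

  proof -
    have "u * w (c - h) = (u * u) * (\<rho> (c - h) * sin (b - \<theta> (c - h)))"
      unfolding w[OF mem] \<open>cos (\<theta> (c - h)) = u * sin (b - \<theta> (c - h))\<close> by (simp only: mult_ac)
    then show ?thesis by (simp add: u)
  qed
  ultimately show False using neg \<rho>[OF mem] by (simp add: mult_less_0_iff)
qed

text \<open>Each sign change costs a half turn. Having passed below pi/2 - i pi the angle cannot
  come back, and the sign of w at the next time excludes the half turn just entered.\<close>

lemma angle_sign_changes:
  fixes \<theta> \<rho> w :: "real \<Rightarrow> real" and n :: nat
  assumes \<theta>: "continuous_on {0..<1} \<theta>" and \<rho>: "\<And>t. t \<in> {0..<1} \<Longrightarrow> 0 < \<rho> t"
    and w: "\<And>t. t \<in> {0..<1} \<Longrightarrow> w t = \<rho> t * cos (\<theta> t)"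
    and d: "\<And>t. 0 < t \<Longrightarrow> t < 1 \<Longrightarrow> \<exists>k>0. (w has_real_derivative k * (\<rho> t * sin (\<theta> t))) (at t)"
    and start: "\<theta> 0 = 0"
    and \<tau>: "\<And>i. i \<le> n \<Longrightarrow> 0 \<le> \<tau> i \<and> \<tau> i < 1" "\<And>i. i < n \<Longrightarrow> \<tau> i < \<tau> (Suc i)"
      "\<And>i. i \<le> n \<Longrightarrow> 0 < (-1) ^ i * w (\<tau> i)"
    and t: "\<tau> n \<le> t" "t < 1"
  shows "\<theta> t < pi/2 - real n * pi"
proof -
  have barrier: "\<theta> b < pi/2 + of_int j * pi"
    if "\<theta> a < pi/2 + of_int j * pi" "0 \<le> a" "a \<le> b" "b < 1" for a b and j :: int
  proof (rule angle_barrier[of a b \<theta> \<rho> w])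
    show "continuous_on {a..b} \<theta>" using that by (intro continuous_on_subset[OF \<theta>]) auto
  qed (use that \<rho> w d in auto)
  have "\<theta> (\<tau> i) < pi/2 - real i * pi" if "i \<le> n" for i
    using that
  proof (induction i)
    case 0
    have "\<theta> (\<tau> 0) < pi/2 + of_int 0 * pi" by (rule barrier[where a = 0 and j = 0]) (use start \<tau>(1)[of 0] in simp_all)
    then show ?case by simp
  next
    case (Suc i)
    have "\<theta> (\<tau> (Suc i)) < pi/2 + of_int (- int i) * pi"
    proof (rule barrier)
      show "\<theta> (\<tau> i) < pi/2 + of_int (- int i) * pi" using Suc.IH Suc.prems by simp
    qed (use Suc.prems \<tau>(1)[of i] \<tau>(1)[of "Suc i"] \<tau>(2)[of i] in simp_all)
    then have up: "0 < (pi/2 - real i * pi) - \<theta> (\<tau> (Suc i))" by simp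
    show ?case
    proof (rule ccontr)
      assume "\<not> \<theta> (\<tau> (Suc i)) < pi/2 - real (Suc i) * pi"
      then have x: "(pi/2 - real i * pi) - \<theta> (\<tau> (Suc i)) \<le> pi" by (simp add: algebra_simps)
      define x where "x = (pi/2 - real i * pi) - \<theta> (\<tau> (Suc i))"
      have "0 \<le> sin x" using up x by (intro sin_ge_zero) (auto simp: x_def)
      have "cos (\<theta> (\<tau> (Suc i))) = cos (pi/2 - x - real i * pi)" by (simp add: x_def)
      also have "\<dots> = (-1) ^ i * sin x"
        by (simp add: cos_diff[of "pi/2 - x"] cos_diff sin_diff)
      finally have "(-1) ^ Suc i * w (\<tau> (Suc i)) = - (\<rho> (\<tau> (Suc i)) * sin x)"
        using w[of "\<tau> (Suc i)"] \<tau>(1)[OF Suc.prems] by simp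
      moreover have "0 \<le> \<rho> (\<tau> (Suc i)) * sin x"
        using \<rho>[of "\<tau> (Suc i)"] \<tau>(1)[OF Suc.prems] \<open>0 \<le> sin x\<close> by (simp add: less_imp_le)
      ultimately show False using \<tau>(3)[OF Suc.prems] by linarith
    qed
  qed
  from this[OF order_refl] have "\<theta> (\<tau> n) < pi/2 + of_int (- int n) * pi" by simp
  then have "\<theta> t < pi/2 + of_int (- int n) * pi" by (rule barrier) (use \<tau>(1)[of n] t in simp_all)
  then show ?thesis by simp
qed

text \<open>The set of parameters and times is contractible, so the nonvanishing complex function w
  + i p has a continuous logarithm on it. At t = 0 the curve lies on the positive real axis, so the
  argument there is a multiple of 2 pi; subtracting it changes neither cos nor sin.\<close>

lemma shooting_angle:
  obtains \<theta> \<rho> :: "real \<Rightarrow> real \<Rightarrow> real" where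
    "continuous_on ({0<..} \<times> {0..<1}) (\<lambda>(r, t). \<theta> r t)"
    "\<And>r t. 0 < r \<Longrightarrow> 0 \<le> t \<Longrightarrow> t < 1 \<Longrightarrow> 0 < \<rho> r t \<and> wn r t = \<rho> r t * cos (\<theta> r t) \<and> pn r t = \<rho> r t * sin (\<theta> r t)"
    "\<And>r. 0 < r \<Longrightarrow> \<theta> r 0 = 0"
proof -
  define S where "S = {0::real<..} \<times> {0..<1::real}"
  define Z where "Z x = Complex (wn (fst x) (snd x)) (pn (fst x) (snd x))" for x :: "real \<times> real"
  have "continuous_on S Z"
    unfolding Z_def S_def Complex_eq using wn_cont pn_cont
    by (intro continuous_intros) (simp_all add: case_prod_unfold)
  moreover have "contractible S" unfolding S_def by (intro convex_imp_contractible convex_Times) auto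
  moreover have "Z x \<noteq> 0" if "x \<in> S" for x
    using wn_pn_nonzero[of "fst x" "snd x"] that by (auto simp: Z_def S_def complex_eq_iff)
  ultimately obtain g where g: "continuous_on S g" "\<And>x. x \<in> S \<Longrightarrow> Z x = exp (g x)"
    using continuous_logarithm_on_contractible by metis
  define \<phi> where "\<phi> r = Im (g (r, 0))" for r
  have \<phi>c: "continuous_on {0<..} \<phi>"
    unfolding \<phi>_def by (intro continuous_intros continuous_on_compose2[OF g(1)]) (auto simp: S_def)
  have \<phi>: "cos (\<phi> r) = 1 \<and> sin (\<phi> r) = 0" if "0 < r" for r
  proof -
    have "Z (r, 0) = exp (g (r, 0))" using that by (intro g) (auto simp: S_def)
    then have "1 / r^3 = exp (Re (g (r, 0))) * cos (\<phi> r)" "0 = exp (Re (g (r, 0))) * sin (\<phi> r)"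
      using that by (auto simp: Z_def wn_zero pn_zero complex_eq_iff Re_exp Im_exp \<phi>_def)
    moreover have "0 < 1 / r^3" using that by simp
    ultimately have "0 < cos (\<phi> r)" "sin (\<phi> r) = 0" by (auto simp: zero_less_mult_iff)
    moreover from this have "(cos (\<phi> r))\<^sup>2 = 1" using sin_cos_squared_add[of "\<phi> r"] by simp
    ultimately show ?thesis by (auto simp: power2_eq_1_iff)
  qed
  define \<theta> where "\<theta> r t = Im (g (r, t)) - \<phi> r" for r t
  show thesis
  proof (rule that[of \<theta> "\<lambda>r t. exp (Re (g (r, t)))"])
    have "continuous_on S (\<lambda>x. \<phi> (fst x))" by (rule continuous_on_compose2[OF \<phi>c]) (auto simp: S_def intro!: continuous_intros)
    then show "continuous_on ({0<..} \<times> {0..<1}) (\<lambda>(r, t). \<theta> r t)"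
      using g(1) unfolding \<theta>_def S_def by (auto simp: case_prod_unfold intro!: continuous_intros)
    fix r t :: real assume rt: "0 < r" "0 \<le> t" "t < 1"
    have "Z (r, t) = exp (g (r, t))" using rt by (intro g) (auto simp: S_def)
    then show "0 < exp (Re (g (r, t))) \<and> wn r t = exp (Re (g (r, t))) * cos (\<theta> r t) \<and>
        pn r t = exp (Re (g (r, t))) * sin (\<theta> r t)"
      using \<phi>[OF rt(1)] by (simp add: Z_def complex_eq_iff Re_exp Im_exp \<theta>_def cos_diff sin_diff)
  qed (simp add: \<theta>_def \<phi>_def)
qed

text \<open>The energy \<open>p^2/2 + 2/3 t^5 (1 - t) w^6\<close> controls the solution up to the singular endpoint \<open>t = 1\<close>.\<close>

lemma endpoint_energy:
  fixes w p :: "real \<Rightarrow> real"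
  assumes cont: "continuous_on {1/2..<1} w" "continuous_on {1/2..<1} p"
    and w: "\<And>t. 1/2 < t \<Longrightarrow> t < 1 \<Longrightarrow> (w has_real_derivative p t / (4 * t\<^sup>2 * (1 - t))) (at t)"
    and p: "\<And>t. 1/2 < t \<Longrightarrow> t < 1 \<Longrightarrow> (p has_real_derivative 15/4 * t * w t - t^3 * w t ^ 5) (at t)"
    and B: "(p (1/2))\<^sup>2 + w (1/2) ^ 6 \<le> B" and t: "1/2 \<le> t" "t < 1"
  shows "w t ^ 6 * (1 - t) \<le> 48 * ((1 + B) * exp 202)"
proof -
  \<comment> \<open>The constant 1 lets |w| <= 1 + |w|^3 absorb the linear term of the equation. The
    w^5 p contributions of the two other terms cancel in the derivative.\<close>
  define N where "N t = 1 + (p t)\<^sup>2 / 2 + 2/3 * (t^5 * (1 - t)) * w t ^ 6" for t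
  define N' where "N' t = 15/4 * t * (w t * p t) + 2/3 * (5 * t^4 - 6 * t^5) * w t ^ 6" for t
  \<comment> \<open>Singular at t = 1 but integrable, with primitive 14 t - 188 sqrt (1 - t). The
    coefficients round up 15/4 + 10 and 25 * 15/4.\<close>
  define k where "k t = 14 + 94 / sqrt (1 - t)" for t :: real
  have pw: "w t ^ 6 * (1 - t) \<le> 48 * N t" if "1/2 \<le> t" "t < 1" for t
  proof -
    have "(1/2)^5 \<le> t^5" using that by (intro power_mono) auto
    moreover have "(1/2::real)^5 = 1/32" by (simp add: power_divide)
    moreover have "0 \<le> w t ^ 6 * (1 - t)" using that by simp
    ultimately have "1/32 * (w t ^ 6 * (1 - t)) \<le> t^5 * (w t ^ 6 * (1 - t))" by (intro mult_right_mono) auto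
    moreover have "2/3 * (t^5 * (w t ^ 6 * (1 - t))) \<le> N t" by (simp add: N_def mult_ac)
    ultimately show ?thesis by linarith
  qed
  have dN: "(N has_real_derivative N' t) (at t)" if t: "1/2 < t" "t < 1" for t
  proof -
    have d1: "((\<lambda>t. (p t)\<^sup>2 / 2) has_real_derivative p t * (15/4 * t * w t - t^3 * w t ^ 5)) (at t)"
      by (rule derivative_eq_intros p[OF t] refl | simp)+
    have d2: "((\<lambda>t::real. 2/3 * (t^5 * (1 - t))) has_real_derivative 2/3 * (5 * t^4 * (1 - t) - t^5)) (at t)"
      by (auto intro!: derivative_eq_intros simp: algebra_simps)
    have d3: "((\<lambda>t. w t ^ 6) has_real_derivative 6 * w t ^ 5 * (p t / (4 * t\<^sup>2 * (1 - t)))) (at t)"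
      by (rule derivative_eq_intros w[OF t] refl | simp)+
    have "(N has_real_derivative 0 + p t * (15/4 * t * w t - t^3 * w t ^ 5)
       + (2/3 * (5 * t^4 * (1 - t) - t^5) * w t ^ 6 + 6 * w t ^ 5 * (p t / (4 * t\<^sup>2 * (1 - t))) * (2/3 * (t^5 * (1 - t))))) (at t)"
      unfolding N_def[abs_def] by (rule DERIV_add[OF DERIV_add[OF DERIV_const d1] DERIV_mult[OF d2 d3]])
    moreover have "6 * w t ^ 5 * (p t / (4 * t\<^sup>2 * (1 - t))) * (2/3 * (t^5 * (1 - t))) = t^3 * w t ^ 5 * p t"
    proof -
      define D where "D = 4 * t\<^sup>2 * (1 - t)"
      have "D \<noteq> 0" using t by (simp add: D_def)
      moreover have X: "t^5 * (1 - t) = t^3 / 4 * D" by (simp add: D_def power_numeral_reduce algebra_simps)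
      ultimately show ?thesis unfolding X D_def[symmetric] by simp
    qed
    moreover have "0 + p t * (15/4 * t * w t - t^3 * w t ^ 5) + (2/3 * (5 * t^4 * (1 - t) - t^5) * w t ^ 6 + t^3 * w t ^ 5 * p t) = N' t"
      by (simp add: N'_def algebra_simps power_numeral_reduce)
    ultimately show ?thesis by (simp only:)
  qed
  have bound: "N' t \<le> k t * N t" if t: "1/2 < t" "t < 1" for t
  proof -
    define q where "q = sqrt (1 - t)"
    have q: "0 < q" "q\<^sup>2 = 1 - t" using t by (auto simp: q_def)
    have N1: "1 \<le> N t" using t by (simp add: N_def)
    have p2: "(p t)\<^sup>2 \<le> 2 * N t" using t by (simp add: N_def)
    have "\<bar>p t\<bar> \<le> N t"
    proof -
      have "2 * \<bar>p t\<bar> \<le> 1 + (p t)\<^sup>2" using sum_squares_bound[of 1 "\<bar>p t\<bar>"] by simp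
      moreover have "1 + (p t)\<^sup>2 / 2 \<le> N t" using t by (simp add: N_def)
      ultimately show ?thesis by simp
    qed
    have "\<bar>w t\<bar> \<le> 1 + \<bar>w t\<bar> ^ 3"
      using power_increasing[of 1 3 "\<bar>w t\<bar>"] by (cases "\<bar>w t\<bar> \<le> 1") (auto simp: add_increasing2)
    then have "\<bar>w t * p t\<bar> \<le> (1 + \<bar>w t\<bar> ^ 3) * \<bar>p t\<bar>" unfolding abs_mult by (rule mult_right_mono) simp
    also have "\<dots> = \<bar>p t\<bar> + (\<bar>w t\<bar> ^ 3 * q) * \<bar>p t\<bar> / q" using q by (simp add: field_simps)
    also have "(\<bar>w t\<bar> ^ 3 * q) * \<bar>p t\<bar> \<le> 25 * N t"
    proof -
      have "2 * (\<bar>w t\<bar> ^ 3 * q) * \<bar>p t\<bar> \<le> (\<bar>w t\<bar> ^ 3 * q)\<^sup>2 + \<bar>p t\<bar>\<^sup>2" by (rule sum_squares_bound)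
      also have "(\<bar>w t\<bar> ^ 3 * q)\<^sup>2 = w t ^ 6 * (1 - t)" by (simp add: power_mult_distrib q flip: power_mult)
      finally show ?thesis using pw[of t] p2 t by simp
    qed
    finally have "\<bar>w t * p t\<bar> \<le> N t + 25 * N t / q" using q \<open>\<bar>p t\<bar> \<le> N t\<close> by (simp add: divide_right_mono)
    then have "15/4 * t * (w t * p t) \<le> 15/4 * 1 * (N t + 25 * N t / q)"
      using t by (intro order_trans[OF abs_ge_self[of "15/4 * t * (w t * p t)"]]) (unfold abs_mult, intro mult_mono, auto)
    moreover have "2/3 * (5 * t^4 - 6 * t^5) * w t ^ 6 \<le> 10 * (2/3 * (t^5 * (1 - t)) * w t ^ 6)"
    proof -
      have "0 \<le> (2 * t - 1) * (5 - 5 * t) + t" using t by (intro add_nonneg_nonneg mult_nonneg_nonneg) auto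
      then have "5 - 6 * t \<le> 10 * (t * (1 - t))" by (simp add: algebra_simps)
      then have "t^4 * (5 - 6 * t) \<le> t^4 * (10 * (t * (1 - t)))" by (intro mult_left_mono) auto
      then have "5 * t^4 - 6 * t^5 \<le> 10 * (t^5 * (1 - t))" by (simp add: algebra_simps power_numeral_reduce)
      then have "2/3 * w t ^ 6 * (5 * t^4 - 6 * t^5) \<le> 2/3 * w t ^ 6 * (10 * (t^5 * (1 - t)))" by (intro mult_left_mono) auto
      then show ?thesis by (simp only: mult_ac)
    qed
    moreover have "10 * (2/3 * (t^5 * (1 - t)) * w t ^ 6) \<le> 10 * N t" by (simp add: N_def)
    ultimately have "N' t \<le> 55/4 * N t + 375/4 * (N t / q)" unfolding N'_def by (simp add: field_simps)
    also have "\<dots> \<le> 14 * N t + 94 * (N t / q)" using N1 q by (intro add_mono mult_right_mono) auto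
    also have "\<dots> = k t * N t" by (simp add: k_def q_def algebra_simps)
    finally show ?thesis .
  qed
  have "N t \<le> N (1/2) * exp ((14 * t - 188 * sqrt (1 - t)) - (14 * (1/2) - 188 * sqrt (1 - 1/2)))"
  proof (rule gronwall_forward[where N' = N' and k = k and \<kappa> = "\<lambda>t. 14 * t - 188 * sqrt (1 - t)"])
    show "continuous_on {1/2..t} N"
      unfolding N_def[abs_def] using t by (intro continuous_intros continuous_on_subset[OF cont(1)] continuous_on_subset[OF cont(2)]) auto
    fix x assume x: "1/2 < x" "x < t"
    show "(N has_real_derivative N' x) (at x)" "N' x \<le> k x * N x" using x t by (auto intro!: dN bound)
    show "((\<lambda>t. 14 * t - 188 * sqrt (1 - t)) has_real_derivative k x) (at x)"
      using x t by (auto intro!: derivative_eq_intros simp: k_def field_simps)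
  qed (use t in \<open>auto intro!: continuous_intros\<close>)
  also have "\<dots> \<le> (1 + B) * exp 202"
  proof (intro mult_mono)
    define a b where "a = sqrt (1 - 1/2 :: real)" and "b = sqrt (1 - t)"
    have "a \<le> 1" "0 \<le> b" using t by (simp_all add: a_def b_def real_sqrt_le_1_iff)
    then have "14 * t - 188 * b - (14 * (1/2) - 188 * a) \<le> 202" using t by simp
    then show "exp ((14 * t - 188 * sqrt (1 - t)) - (14 * (1/2) - 188 * sqrt (1 - 1/2))) \<le> exp 202"
      unfolding a_def b_def by (rule exp_le_cancel_iff[THEN iffD2])
    have "0 \<le> (p (1/2))\<^sup>2" "0 \<le> w (1/2) ^ 6" by simp_all
    moreover have "N (1/2) = 1 + (p (1/2))\<^sup>2 / 2 + w (1/2) ^ 6 / 96" by (simp add: N_def power_numeral_reduce)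
    ultimately show "N (1/2) \<le> 1 + B" using B by linarith
    then show "0 \<le> 1 + B" using \<open>0 \<le> (p (1/2))\<^sup>2\<close> \<open>0 \<le> w (1/2) ^ 6\<close> B by linarith
  qed simp
  finally show ?thesis using pw[OF t] by simp
qed

text \<open>The hypothesis says |w| <= M (1 - t)^(-1/6), so p' is O((1 - t)^(-5/6)) and integration
  leaves the power 1/6. The constant is 6 * 5, where 5 exceeds the sum 15/4 + 1 of the coefficients
  of p'.\<close>

lemma endpoint_flux:
  fixes w p :: "real \<Rightarrow> real"
  assumes w: "\<And>t. 1/2 \<le> t \<Longrightarrow> t < 1 \<Longrightarrow> w t ^ 6 * (1 - t) \<le> M ^ 6" and M: "1 \<le> M"
    and p: "\<And>t. 1/2 < t \<Longrightarrow> t < 1 \<Longrightarrow> (p has_real_derivative 15/4 * t * w t - t^3 * w t ^ 5) (at t)"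
    and t: "1/2 < t" "t \<le> t'" "t' < 1"
  shows "\<bar>p t - p t'\<bar> \<le> 30 * M^5 * (1 - t) powr (1/6)"
proof -
  define y where "y t = (1 - t) powr (1/6)" for t :: real
  have y0: "0 < y t" "y t \<le> 1" "y t ^ 6 = 1 - t" if "1/2 \<le> t" "t < 1" for t
    using that by (auto simp: y_def powr_power intro!: powr_le1)
  define g where "g t = 15/4 * t * w t - t^3 * w t ^ 5" for t
  have bound: "\<bar>g t\<bar> \<le> 5 * M^5 / y t ^ 5" if t: "1/2 \<le> t" "t < 1" for t
  proof -
    have "(\<bar>w t\<bar> * y t) ^ 6 \<le> M ^ 6" using w[OF t] y0[OF t] by (simp add: power_mult_distrib)
    then have wy: "\<bar>w t\<bar> * y t \<le> M" using M y0[OF t] by (subst (asm) power_mono_iff) auto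
    have A: "\<bar>w t\<bar> * y t ^ 5 \<le> M ^ 5"
    proof -
      have "\<bar>w t\<bar> * y t ^ 5 = (\<bar>w t\<bar> * y t) * y t ^ 4" by (simp add: power_numeral_reduce)
      also have "\<dots> \<le> M * 1" using wy y0[OF t] M by (intro mult_mono) (auto simp: power_le_one)
      also have "\<dots> \<le> M ^ 5" using power_increasing[of 1 5 M] M by simp
      finally show ?thesis .
    qed
    have "(\<bar>w t\<bar> * y t) ^ 5 \<le> M ^ 5" using wy y0[OF t] by (intro power_mono) auto
    then have B: "\<bar>w t\<bar> ^ 5 * y t ^ 5 \<le> M ^ 5" by (simp add: power_mult_distrib)
    have "\<bar>g t\<bar> \<le> 15/4 * t * \<bar>w t\<bar> + t^3 * \<bar>w t\<bar> ^ 5"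
      unfolding g_def using t abs_triangle_ineq4[of "15/4 * t * w t" "t^3 * w t ^ 5"] by (simp add: abs_mult power_abs)
    also have "\<dots> \<le> 15/4 * 1 * \<bar>w t\<bar> + 1 * \<bar>w t\<bar> ^ 5" using t by (intro add_mono mult_right_mono mult_left_mono) (auto simp: power_le_one)
    finally have "\<bar>g t\<bar> * y t ^ 5 \<le> (15/4 * \<bar>w t\<bar> + \<bar>w t\<bar> ^ 5) * y t ^ 5" using y0[OF t] by (intro mult_right_mono) auto
    also have "\<dots> = 15/4 * (\<bar>w t\<bar> * y t ^ 5) + \<bar>w t\<bar> ^ 5 * y t ^ 5" by (simp add: distrib_right)
    also have "\<dots> \<le> 15/4 * M ^ 5 + M ^ 5" using A B by (intro add_mono mult_left_mono) auto
    also have "\<dots> \<le> 5 * M ^ 5" using M by simp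
    finally show ?thesis using y0[OF t] by (simp add: field_simps)
  qed
  have dy: "(y has_real_derivative - (1 / (6 * y t ^ 5))) (at t)" if "1/2 < t" "t < 1" for t
  proof -
    have "(y has_real_derivative - (1/6 * (1 - t) powr (1/6 - 1))) (at t)"
      unfolding y_def[abs_def] using that by (auto intro!: derivative_eq_intros)
    moreover have "(1 - t) powr (1/6 - 1) = y t / y t ^ 6"
      using that y0(3)[of t] unfolding powr_diff by (simp add: y_def)
    ultimately show ?thesis using that y0[of t] by (elim DERIV_cong) (simp add: field_simps power_numeral_reduce)
  qed
  have yp: "0 < y t'" using y0[of t'] t by auto
  have "p t' + c * (30 * M^5 * y t') \<le> p t + c * (30 * M^5 * y t) \<and> c = 1 \<or> p t + c * (30 * M^5 * y t) \<le> p t' + c * (30 * M^5 * y t') \<and> c = -1" if "c = 1 \<or> c = -1" for c :: real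
  proof -
    have d: "((\<lambda>t. p t + c * (30 * M^5 * y t)) has_real_derivative g x - c * (5 * M^5 / y x ^ 5)) (at x)" if "1/2 < x" "x < 1" for x
      using that p[of x] dy[of x] by (auto intro!: derivative_eq_intros simp: g_def)
    show ?thesis using that
    proof
      assume c: "c = 1"
      have "p t' + c * (30 * M^5 * y t') \<le> p t + c * (30 * M^5 * y t)"
      proof (rule DERIV_nonpos_imp_nonincreasing[OF t(2)])
        fix x assume x: "t \<le> x" "x \<le> t'"
        then have "g x - c * (5 * M^5 / y x ^ 5) \<le> 0" using bound[of x] t c by auto
        then show "\<exists>d. ((\<lambda>t. p t + c * (30 * M^5 * y t)) has_real_derivative d) (at x) \<and> d \<le> 0"
          using d[of x] x t by (intro exI conjI) auto
      qed
      with c show ?thesis by simp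
    next
      assume c: "c = -1"
      have "p t + c * (30 * M^5 * y t) \<le> p t' + c * (30 * M^5 * y t')"
      proof (rule DERIV_nonneg_imp_nondecreasing[OF t(2)])
        fix x assume x: "t \<le> x" "x \<le> t'"
        then have "0 \<le> g x - c * (5 * M^5 / y x ^ 5)" using bound[of x] t c by auto
        then show "\<exists>d. ((\<lambda>t. p t + c * (30 * M^5 * y t)) has_real_derivative d) (at x) \<and> 0 \<le> d"
          using d[of x] x t by (intro exI conjI) auto
      qed
      with c show ?thesis by simp
    qed
  qed
  from this[of 1] this[of "-1"] have "p t' + 30 * M^5 * y t' \<le> p t + 30 * M^5 * y t" "p t - 30 * M^5 * y t \<le> p t' - 30 * M^5 * y t'" by auto
  moreover have "0 \<le> 30 * M^5 * y t'" using yp M by simp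
  ultimately show ?thesis unfolding y_def by linarith
qed

section \<open>Selection of parameters whose flux vanishes at the endpoint\<close>

lemma compact_abs_bound:
  fixes f :: "'a::topological_space \<Rightarrow> real"
  assumes "continuous_on S f" "compact S"
  obtains B where "\<And>x. x \<in> S \<Longrightarrow> \<bar>f x\<bar> \<le> B"
proof -
  have "bounded (f ` S)" by (rule compact_imp_bounded[OF compact_continuous_image[OF assms]])
  then obtain B where "\<And>y. y \<in> f ` S \<Longrightarrow> norm y \<le> B" by (auto simp: bounded_iff)
  then show thesis using that by force
qed

lemma DERIV_chain_within:
  assumes "(f has_real_derivative f') (at (g x) within T)" "(g has_real_derivative g') (at x within S)" "g ` S \<subseteq> T"
  shows "((\<lambda>x. f (g x)) has_real_derivative f' * g') (at x within S)"
  using DERIV_image_chain[OF has_field_derivative_subset[OF assms(1,3)] assms(2)] by (simp add: o_def)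

text \<open>The data at t = 1/2 depend continuously on r, hence are bounded on [r2, r1], and the
  endpoint estimates hold there with a single constant.\<close>

lemma flux_tail:
  assumes r2: "0 < r2"
  obtains C where "\<And>r t t'. r2 \<le> r \<Longrightarrow> r \<le> r1 \<Longrightarrow> 1/2 < t \<Longrightarrow> t \<le> t' \<Longrightarrow> t' < 1 \<Longrightarrow>
    \<bar>pn r t - pn r t'\<bar> \<le> C * (1 - t) powr (1/6)"
proof -
  have pair: "continuous_on {r2..r1} (\<lambda>r. (r, 1/2::real))" by (intro continuous_intros)
  have "continuous_on {r2..r1} (\<lambda>r. (\<lambda>(r, t). wn r t) (r, 1/2))" "continuous_on {r2..r1} (\<lambda>r. (\<lambda>(r, t). pn r t) (r, 1/2))"
    by (rule continuous_on_compose2[OF wn_cont pair], use r2 in force, rule continuous_on_compose2[OF pn_cont pair], use r2 in force)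
  then have "continuous_on {r2..r1} (\<lambda>r. (pn r (1/2))\<^sup>2 + wn r (1/2) ^ 6)" by (auto intro!: continuous_intros)
  then obtain B where B: "\<And>r. r \<in> {r2..r1} \<Longrightarrow> \<bar>(pn r (1/2))\<^sup>2 + wn r (1/2) ^ 6\<bar> \<le> B"
    using compact_abs_bound[OF _ compact_Icc] by blast
  define M where "M = 1 + 48 * ((1 + \<bar>B\<bar>) * exp 202)"
  have "0 \<le> 48 * ((1 + \<bar>B\<bar>) * exp 202)" by simp
  then have M: "1 \<le> M" "48 * ((1 + \<bar>B\<bar>) * exp 202) \<le> M" unfolding M_def by linarith+
  have M6: "M \<le> M ^ 6" using power_increasing[of 1 6 M] M by simp
  show thesis
  proof (rule that)
    fix r t t' assume r: "r2 \<le> r" "r \<le> r1" and t: "1/2 < t" "t \<le> t'" "t' < (1::real)"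
    have r0: "0 < r" using r r2 by simp
    have cont: "continuous_on {1/2..<1} (wn r)" "continuous_on {1/2..<1} (pn r)"
      using continuous_on_slice[OF wn_cont, of r] continuous_on_slice[OF pn_cont, of r] r0
      by (auto intro: continuous_on_subset)
    have "(pn r (1/2))\<^sup>2 + wn r (1/2) ^ 6 \<le> \<bar>B\<bar>" using B[of r] r by auto
    from endpoint_energy[OF cont DERIV_wn[OF r0] DERIV_pn[OF r0] this]
    have w: "wn r x ^ 6 * (1 - x) \<le> M ^ 6" if "1/2 \<le> x" "x < 1" for x
      using that M M6 by force
    show "\<bar>pn r t - pn r t'\<bar> \<le> 30 * M^5 * (1 - t) powr (1/6)"
      by (rule endpoint_flux[OF w M(1) DERIV_pn[OF r0] t]) auto
  qed
qed

text \<open>The conclusion is p(1) = 0 in quantitative form. If the flux of r1 has zeros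
  accumulating at 1, then r1 itself serves. Otherwise its angle is bounded below, some r2 < r1 has a
  smaller angle near 1, and for each k a parameter R k in between has zero flux at the time T k. A
  limit point of the R k inherits the bound from the uniform tail estimate.\<close>

lemma vanishing_flux:
  assumes r1: "0 < r1"
  obtains r C where "0 < r" "r \<le> r1" "\<And>t. 1/2 < t \<Longrightarrow> t < 1 \<Longrightarrow> \<bar>pn r t\<bar> \<le> C * (1 - t) powr (1/6)"
proof (cases "\<forall>s<1. \<exists>t>s. t < 1 \<and> pn r1 t = 0")
  case True
  obtain C where C: "\<And>r t t'. r1 \<le> r \<Longrightarrow> r \<le> r1 \<Longrightarrow> 1/2 < t \<Longrightarrow> t \<le> t' \<Longrightarrow> t' < 1 \<Longrightarrow>
    \<bar>pn r t - pn r t'\<bar> \<le> C * (1 - t) powr (1/6)" using flux_tail[OF r1, of r1] by blast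
  show thesis
  proof (rule that[OF r1 order_refl])
    fix t :: real assume t: "1/2 < t" "t < 1"
    then obtain t' where "t' > t" "t' < 1" "pn r1 t' = 0" using True by blast
    then show "\<bar>pn r1 t\<bar> \<le> C * (1 - t) powr (1/6)" using C[of r1 t t'] t by simp
  qed
next
  case False
  then obtain s where s: "s < 1" "\<And>t. s < t \<Longrightarrow> t < 1 \<Longrightarrow> pn r1 t \<noteq> 0" by blast
  obtain \<theta> \<rho> where \<theta>: "continuous_on ({0<..} \<times> {0..<1}) (\<lambda>(r, t). \<theta> r t)"
    and \<rho>: "\<And>r t. 0 < r \<Longrightarrow> 0 \<le> t \<Longrightarrow> t < 1 \<Longrightarrow> 0 < \<rho> r t \<and> wn r t = \<rho> r t * cos (\<theta> r t) \<and> pn r t = \<rho> r t * sin (\<theta> r t)"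
    and \<theta>0: "\<And>r. 0 < r \<Longrightarrow> \<theta> r 0 = 0"
    using shooting_angle by metis
  have \<theta>t: "continuous_on {0..<1} (\<theta> r)" if "0 < r" for r
    using continuous_on_slice[OF \<theta>, of r] that by simp
  define s' where "s' = (max s 0 + 1) / 2"
  have s': "s < s'" "0 \<le> s'" "s' < 1" using s by (auto simp: s'_def)
  have "continuous_on {0..s'} (\<theta> r1)" using s' by (intro continuous_on_subset[OF \<theta>t[OF r1]]) auto
  then obtain K0 where K0: "\<And>t. t \<in> {0..s'} \<Longrightarrow> \<bar>\<theta> r1 t\<bar> \<le> K0"
    using compact_abs_bound[OF _ compact_Icc] by blast
  \<comment> \<open>Beyond s' the flux has no zero, so the angle crosses no multiple of pi and drops
    by less than pi below its value at s'.\<close>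
  define K where "K = K0 + pi"
  have K: "- K \<le> \<theta> r1 t" if t: "0 \<le> t" "t < 1" for t
  proof (cases "t \<le> s'")
    case True
    then have "\<bar>\<theta> r1 t\<bar> \<le> K0" using K0[of t] t by simp
    then show ?thesis unfolding K_def using pi_ge_zero by linarith
  next
    case False
    show ?thesis
    proof (rule ccontr)
      assume "\<not> - K \<le> \<theta> r1 t"
      moreover have "- K0 \<le> \<theta> r1 s'" using K0[of s'] s' by (simp add: abs_le_iff)
      ultimately have less: "\<theta> r1 t < \<theta> r1 s' - pi" by (simp add: K_def)
      define v where "v = of_int \<lfloor>\<theta> r1 s' / pi\<rfloor> * pi"
      have "v \<le> \<theta> r1 s'" "\<theta> r1 s' - pi < v"
      proof -
        have "of_int \<lfloor>\<theta> r1 s' / pi\<rfloor> \<le> \<theta> r1 s' / pi" by (rule of_int_floor_le)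
        then show "v \<le> \<theta> r1 s'" unfolding v_def by (simp only: pos_le_divide_eq[OF pi_gt_zero])
        have "\<theta> r1 s' / pi < of_int \<lfloor>\<theta> r1 s' / pi\<rfloor> + 1" by linarith
        then have "\<theta> r1 s' < (of_int \<lfloor>\<theta> r1 s' / pi\<rfloor> + 1) * pi" by (simp only: pos_divide_less_eq[OF pi_gt_zero])
        then show "\<theta> r1 s' - pi < v" by (simp add: v_def distrib_right)
      qed
      then have "\<exists>x\<ge>s'. x \<le> t \<and> \<theta> r1 x = v"
        using less False s' t by (intro IVT2') (auto intro: continuous_on_subset[OF \<theta>t[OF r1]])
      then obtain x where x: "s' \<le> x" "x \<le> t" "\<theta> r1 x = v" by blast
      then have "pn r1 x = 0" using \<rho>[OF r1, of x] s' t by (simp add: v_def sin_times_pi_eq_0)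
      then show False using s(2)[of x] x s' t by simp
    qed
  qed
  obtain n :: nat where n: "(K + 3 * pi) / pi < real n" using reals_Archimedean2 by blast
  then have npi: "pi/2 - real n * pi < - K - pi" 
  proof -
    have "K + 3 * pi < real n * pi" using n by (simp only: pos_divide_less_eq[OF pi_gt_zero])
    then show ?thesis using pi_gt_zero by linarith
  qed
  obtain r2 \<tau> where r2: "0 < r2" "r2 < r1" and \<tau>: "\<And>i. i \<le> n \<Longrightarrow> 0 \<le> \<tau> i \<and> \<tau> i < 1"
    "\<And>i. i < n \<Longrightarrow> \<tau> i < \<tau> (Suc i)" "\<And>i. i \<le> n \<Longrightarrow> 0 < (-1) ^ i * wn r2 (\<tau> i)"
    using wn_oscillates[OF r1, of n] by blast
  have low: "\<theta> r2 t < - K - pi" if t: "\<tau> n \<le> t" "t < 1" for t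
  proof -
    have "\<theta> r2 t < pi/2 - real n * pi"
    proof (rule angle_sign_changes[where \<theta> = "\<theta> r2" and t = t and n = n and w = "wn r2" and \<rho> = "\<rho> r2" and \<tau> = \<tau>])
      fix t :: real assume t: "0 < t" "t < 1"
      have "0 < 1 / (4 * t\<^sup>2 * (1 - t))" using t by simp
      moreover have "pn r2 t / (4 * t\<^sup>2 * (1 - t)) = 1 / (4 * t\<^sup>2 * (1 - t)) * (\<rho> r2 t * sin (\<theta> r2 t))"
        using \<rho>[OF r2(1), of t] t by simp
      ultimately show "\<exists>k>0. (wn r2 has_real_derivative k * (\<rho> r2 t * sin (\<theta> r2 t))) (at t)"
        using DERIV_wn[OF r2(1) t] by (intro exI[of _ "1 / (4 * t\<^sup>2 * (1 - t))"] conjI) (simp_all only:)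
    qed (use \<theta>t[OF r2(1)] \<theta>0[OF r2(1)] \<rho>[OF r2(1)] \<tau> t in auto)
    then show ?thesis using npi by simp
  qed
  \<comment> \<open>A multiple of pi separating the angles of r2 near t = 1, all below -K - pi, from
    those of r1, all at least -K. The flux vanishes at this angle.\<close>
  define v where "v = of_int \<lfloor>- K / pi\<rfloor> * pi"
  have v: "v \<le> - K" "- K - pi < v"
  proof -
    have "of_int \<lfloor>- K / pi\<rfloor> \<le> - K / pi" by (rule of_int_floor_le)
    then show "v \<le> - K" unfolding v_def by (simp only: pos_le_divide_eq[OF pi_gt_zero])
    have "- K / pi < of_int \<lfloor>- K / pi\<rfloor> + 1" by linarith
    then have "- K < (of_int \<lfloor>- K / pi\<rfloor> + 1) * pi" by (simp only: pos_divide_less_eq[OF pi_gt_zero])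
    then show "- K - pi < v" by (simp add: v_def distrib_right)
  qed
  define m where "m = max (\<tau> n) (1/2)"
  have m: "\<tau> n \<le> m" "1/2 \<le> m" "m < 1" using \<tau>(1)[of n] by (auto simp: m_def)
  \<comment> \<open>These times tend to 1, and the shift by 2 keeps all of them strictly above
    \<open>m\<close>.\<close>
  define T where "T k = 1 - (1 - m) / (real k + 2)" for k :: nat
  have T: "m < T k" "T k < 1" for k
  proof -
    have "(1 - m) / (real k + 2) < 1 - m"
      using mult_pos_pos[of "1 - m" "real k + 1"] m by (subst pos_divide_less_eq) (simp_all add: algebra_simps)
    moreover have "0 < (1 - m) / (real k + 2)" using m by simp
    ultimately show "m < T k" "T k < 1" by (simp_all add: T_def)
  qed
  have "\<exists>r\<ge>r2. r \<le> r1 \<and> \<theta> r (T k) = v" for k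
  proof (rule IVT'[where f = "\<lambda>r. \<theta> r (T k)"])
    have "continuous_on {r2..r1} (\<lambda>r. (r, T k))" by (intro continuous_intros)
    then have "continuous_on {r2..r1} (\<lambda>r. (\<lambda>(r, t). \<theta> r t) (r, T k))"
      by (rule continuous_on_compose2[OF \<theta>]) (use r2 T[of k] m in auto)
    then show "continuous_on {r2..r1} (\<lambda>r. \<theta> r (T k))" by simp
    show "\<theta> r2 (T k) \<le> v" using low[of "T k"] T[of k] m v by simp
    show "v \<le> \<theta> r1 (T k)" using K[of "T k"] T[of k] m v by simp
  qed (use r2 in simp)
  then obtain R where R: "\<And>k. R k \<in> {r2..r1}" "\<And>k. \<theta> (R k) (T k) = v" by (metis atLeastAtMost_iff)
  have pz: "pn (R k) (T k) = 0" for k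
    using \<rho>[of "R k" "T k"] R[of k] r2 T[of k] m by (simp add: v_def sin_times_pi_eq_0)
  obtain r f where r: "r \<in> {r2..r1}" and f: "strict_mono (f :: nat \<Rightarrow> nat)" "(R \<circ> f) \<longlonglongrightarrow> r"
    using R(1) compact_Icc[of r2 r1] unfolding compact_def by metis
  obtain C where C: "\<And>r t t'. r2 \<le> r \<Longrightarrow> r \<le> r1 \<Longrightarrow> 1/2 < t \<Longrightarrow> t \<le> t' \<Longrightarrow> t' < 1 \<Longrightarrow>
    \<bar>pn r t - pn r t'\<bar> \<le> C * (1 - t) powr (1/6)" using flux_tail[OF r2(1), of r1] by blast
  show thesis
  proof (rule that)
    show "0 < r" "r \<le> r1" using r r2 by auto
    fix t :: real assume t: "1/2 < t" "t < 1"
    have "(\<lambda>k. (1 - m) / (real k + 2)) \<longlonglongrightarrow> 0" by real_asymp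
    then have "T \<longlonglongrightarrow> 1 - 0" unfolding T_def by (intro tendsto_intros)
    then have "(T \<circ> f) \<longlonglongrightarrow> 1" using f(1) by (simp add: LIMSEQ_subseq_LIMSEQ)
    then have ev: "eventually (\<lambda>k. t < T (f k)) sequentially" using t by (auto dest: order_tendstoD(1)[where a = t])
    have "continuous_on {r2..r1} (\<lambda>r. (r, t))" by (intro continuous_intros)
    then have "continuous_on {r2..r1} (\<lambda>r. (\<lambda>(r, t). pn r t) (r, t))"
      by (rule continuous_on_compose2[OF pn_cont]) (use r2 t in auto)
    then have "continuous_on {r2..r1} (\<lambda>r. pn r t)" by simp
    then have "(\<lambda>k. pn ((R \<circ> f) k) t) \<longlonglongrightarrow> pn r t"
      by (rule continuous_on_tendsto_compose[OF _ f(2) r]) (use R(1) in simp)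
    then have lim: "(\<lambda>k. \<bar>pn ((R \<circ> f) k) t\<bar>) \<longlonglongrightarrow> \<bar>pn r t\<bar>" by (rule tendsto_rabs)
    show "\<bar>pn r t\<bar> \<le> C * (1 - t) powr (1/6)"
    proof (rule tendsto_upperbound[OF lim])
      show "eventually (\<lambda>k. \<bar>pn ((R \<circ> f) k) t\<bar> \<le> C * (1 - t) powr (1/6)) sequentially"
        using ev
      proof eventually_elim
        case (elim k)
        then show ?case using C[of "R (f k)" t "T (f k)"] R(1)[of "f k"] t T[of "f k"] pz[of "f k"] by auto
      qed
    qed simp
  qed
qed

section \<open>Profiles that are twice continuously differentiable up to both endpoints\<close>

definition C2_on :: "real set \<Rightarrow> (real \<Rightarrow> real) \<Rightarrow> (real \<Rightarrow> real) \<Rightarrow> (real \<Rightarrow> real) \<Rightarrow> bool" where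
  "C2_on I w w1 w2 \<longleftrightarrow> (\<forall>t\<in>I. (w has_real_derivative w1 t) (at t within I)) \<and>
     (\<forall>t\<in>I. (w1 has_real_derivative w2 t) (at t within I)) \<and> continuous_on I w2"

lemma C2_onD:
  assumes "C2_on I w w1 w2" "t \<in> I"
  shows "(w has_real_derivative w1 t) (at t within I)" "(w1 has_real_derivative w2 t) (at t within I)"
  using assms by (auto simp: C2_on_def)

lemma C2_on_interior:
  assumes "C2_on {a..b} w w1 w2" "a < t" "t < b"
  shows "(w has_real_derivative w1 t) (at t)" "(w1 has_real_derivative w2 t) (at t)"
  using C2_onD[OF assms(1), of t] assms(2,3) at_within_Icc_at[of a t b] by simp_all

lemma C2_on_continuous:
  assumes "C2_on I w w1 w2"
  shows "continuous_on I w" "continuous_on I w1" "continuous_on I w2"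
  using DERIV_continuous_on[OF C2_onD(1)[OF assms]] DERIV_continuous_on[OF C2_onD(2)[OF assms]] assms
  by (simp_all add: C2_on_def)

text \<open>Averages over [0, r] of a C^1 function are C^1 up to r = 0, one-sided derivative
  included. This is what gains a derivative at both singular endpoints.\<close>

lemma weighted_avg_C1:
  fixes f f' \<omega> :: "real \<Rightarrow> real"
  assumes f: "\<And>r. r \<in> {0..X} \<Longrightarrow> (f has_real_derivative f' r) (at r within {0..X})"
    and f': "continuous_on {0..X} f'" and \<omega>: "continuous_on {0..1} \<omega>"
  shows "\<And>r. r \<in> {0..X} \<Longrightarrow> ((\<lambda>r. integral {0..1} (\<lambda>u. \<omega> u * f (r * u))) has_real_derivative
      integral {0..1} (\<lambda>u. \<omega> u * (u * f' (r * u)))) (at r within {0..X})"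
    and "continuous_on {0..X} (\<lambda>r. integral {0..1} (\<lambda>u. \<omega> u * (u * f' (r * u))))"
proof -
  have fc: "continuous_on {0..X} f" using f by (rule DERIV_continuous_on)
  have mem: "(\<lambda>x::real\<times>real. fst x * snd x) ` ({0..X} \<times> {0..1}) \<subseteq> {0..X}" using unit_scale_mem by fastforce
  have "continuous_on ({0..X} \<times> {0..1}) (\<lambda>x. f' (fst x * snd x))"
    by (rule continuous_on_compose2[OF f' _ mem]) (intro continuous_intros)
  moreover have "continuous_on ({0..X} \<times> {0..1}) (\<lambda>x. \<omega> (snd x))"
    by (rule continuous_on_compose2[OF \<omega>]) (auto intro: continuous_intros)
  ultimately have c: "continuous_on ({0..X} \<times> {0..1}) (\<lambda>(r, u). \<omega> u * (u * f' (r * u)))"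
    unfolding case_prod_unfold by (intro continuous_intros)
  show "continuous_on {0..X} (\<lambda>r. integral {0..1} (\<lambda>u. \<omega> u * (u * f' (r * u))))"
    by (rule continuous_on_integral_unit[OF c])
  fix r assume r: "r \<in> {0..X}"
  have "((\<lambda>r. integral (cbox 0 1) (\<lambda>u. \<omega> u * f (r * u))) has_real_derivative
      integral (cbox 0 1) (\<lambda>u. \<omega> u * (u * f' (r * u)))) (at r within {0..X})"
  proof (rule leibniz_rule_field_derivative)
    fix x t :: real assume x: "x \<in> {0..X}" and t: "t \<in> cbox 0 1"
    have "((\<lambda>x. f (x * t)) has_real_derivative f' (x * t) * t) (at x within {0..X})"
    proof (rule DERIV_chain_within[where f = f and g = "\<lambda>x. x * t" and T = "{0..X}"])
      show "(f has_real_derivative f' (x * t)) (at (x * t) within {0..X})" using x t unit_scale_mem by (intro f) auto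
      show "((\<lambda>x. x * t) has_real_derivative t) (at x within {0..X})" by (auto intro!: derivative_eq_intros)
      show "(\<lambda>x. x * t) ` {0..X} \<subseteq> {0..X}" using t unit_scale_mem by auto
    qed
    from DERIV_cmult[OF this, of "\<omega> t"]
    show "((\<lambda>x. \<omega> t * f (x * t)) has_real_derivative \<omega> t * (t * f' (x * t))) (at x within {0..X})"
      by (simp add: mult.commute)
  next
    fix x assume x: "x \<in> {0..X}"
    show "(\<lambda>u. \<omega> u * f (x * u)) integrable_on cbox 0 1"
      unfolding cbox_interval using x unit_scale_mem
      by (intro integrable_continuous_real continuous_intros \<omega> continuous_on_compose2[OF fc]) auto
  qed (use c r in \<open>auto simp: cbox_interval\<close>)
  then show "((\<lambda>r. integral {0..1} (\<lambda>u. \<omega> u * f (r * u))) has_real_derivative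
      integral {0..1} (\<lambda>u. \<omega> u * (u * f' (r * u)))) (at r within {0..X})" by (simp add: cbox_interval)
qed

text \<open>The slope is the average of the right-hand side divided by 4 (1 - e s). Since W is C^1,
  so is the right-hand side, hence so are its average and the slope. The interval [0, 3/(4 e)]
  becomes [0, 3/4] after rescaling.\<close>

lemma wn_C2_left:
  assumes r: "0 < r"
  obtains w1 w2 where "C2_on {0..3/4} (wn r) w1 w2"
proof -
  define e X where "e = r^4" and "X = 3 / (4 * e)"
  have e: "0 < e" using r by (simp add: e_def)
  have X: "0 < X" "e * X < 1" using e by (auto simp: X_def)
  have W: "sol (\<lambda>y. y ^ 5) e X (shoot e)" using e X by (intro sol_shoot) auto
  have dW: "(shoot e has_real_derivative dshoot e s) (at s within {0..X})" if "s \<in> {0..X}" for s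
    using sol_deriv[OF pow5_cont less_imp_le[OF e] X(2) W that] by (simp add: dshoot_def)
  have Wc: "continuous_on {0..X} (shoot e)" using W by (simp add: sol_def)
  have Vc: "continuous_on {0..X} (dshoot e)"
    unfolding dshoot_def by (rule slope_cont[OF pow5_cont less_imp_le[OF e] X(2) W])
  define f where "f s = rhs (\<lambda>y. y ^ 5) e s (shoot e s)" for s
  define f' where "f' s = 15/4 * e * dshoot e s - (2 * s * shoot e s ^ 5 + s\<^sup>2 * (5 * shoot e s ^ 4 * dshoot e s))" for s
  have f: "(f has_real_derivative f' s) (at s within {0..X})" if "s \<in> {0..X}" for s
    unfolding f_def[abs_def] rhs_def f'_def
    by (rule derivative_eq_intros dW[OF that] refl | simp)+
  have f'c: "continuous_on {0..X} f'" unfolding f'_def[abs_def] by (intro continuous_intros Wc Vc)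
  define a' where "a' s = integral {0..1} (\<lambda>u. u * (u * f' (s * u)))" for s
  have a: "(avg f has_real_derivative a' s) (at s within {0..X})" if "s \<in> {0..X}" for s
    unfolding avg_def[abs_def] a'_def using weighted_avg_C1(1)[OF f f'c continuous_on_id that] by simp
  have a'c: "continuous_on {0..X} a'"
    unfolding a'_def[abs_def] using weighted_avg_C1(2)[OF f f'c continuous_on_id] by simp
  have ne: "1 - e * s \<noteq> 0" if "s \<in> {0..X}" for s using one_minus_pos[of e X s] e X that by auto
  have V: "dshoot e = (\<lambda>s. avg f s / (4 * (1 - e * s)))" by (rule ext) (simp add: dshoot_def slope_def f_def[abs_def])
  define b where "b s = (a' s * (4 * (1 - e * s)) - avg f s * (- 4 * e)) / (4 * (1 - e * s))\<^sup>2" for s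
  have dV: "(dshoot e has_real_derivative b s) (at s within {0..X})" if "s \<in> {0..X}" for s
  proof -
    have "((\<lambda>s. 4 * (1 - e * s)) has_real_derivative - 4 * e) (at s within {0..X})" by (auto intro!: derivative_eq_intros)
    from DERIV_divide[OF a[OF that] this] show ?thesis using ne[OF that] unfolding V b_def by (simp add: power2_eq_square)
  qed
  have avc: "continuous_on {0..X} (avg f)" using a by (rule DERIV_continuous_on)
  have bc: "continuous_on {0..X} b" unfolding b_def[abs_def] using ne by (intro continuous_intros a'c avc) auto
  have scale: "((\<lambda>t. h (t / e) / c) has_real_derivative h' (t / e) / (c * e)) (at t within {0..3/4})"
    if h: "\<And>s. s \<in> {0..X} \<Longrightarrow> (h has_real_derivative h' s) (at s within {0..X})" and t: "t \<in> {0..3/4}" for h h' :: "real \<Rightarrow> real" and c t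
  proof -
    have "((\<lambda>t. h (t / e)) has_real_derivative h' (t / e) * (1 / e)) (at t within {0..3/4})"
    proof (rule DERIV_chain_within[where f = h and g = "\<lambda>t. t / e" and T = "{0..X}"])
      show "(h has_real_derivative h' (t / e)) (at (t / e) within {0..X})" using t e by (intro h) (auto simp: X_def field_simps)
      show "((\<lambda>t. t / e) has_real_derivative 1 / e) (at t within {0..3/4})" by (rule DERIV_cdivide[OF DERIV_ident])
      show "(\<lambda>t. t / e) ` {0..3/4} \<subseteq> {0..X}" using e by (auto simp: X_def field_simps)
    qed
    from DERIV_cdivide[OF this, of c] show ?thesis by (simp add: mult.commute)
  qed
  show thesis
  proof (rule that)
    have wn_eq: "wn r = (\<lambda>t. shoot e (t / e) / r^3)" by (rule ext) (simp add: wn_def e_def)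
    show "C2_on {0..3/4} (wn r) (\<lambda>t. dshoot e (t / e) / (r^3 * e)) (\<lambda>t. b (t / e) / (r^3 * e * e))"
      unfolding C2_on_def wn_eq
    proof (intro conjI ballI scale[OF dW] scale[OF dV])
      have "continuous_on {0..3/4} (\<lambda>t. b (t / e))"
        by (rule continuous_on_compose2[OF bc]) (use e in \<open>auto simp: X_def field_simps intro!: continuous_intros\<close>)
      then show "continuous_on {0..3/4} (\<lambda>t. b (t / e) / (r^3 * e * e))" using e r by (intro continuous_intros) auto
    qed
  qed
qed

lemma eq_integral_of_interior_deriv:
  fixes f h :: "real \<Rightarrow> real"
  assumes f: "continuous_on {0..b} f" and h: "continuous_on {0..b} h"
    and d: "\<And>x. 0 < x \<Longrightarrow> x < b \<Longrightarrow> (f has_real_derivative h x) (at x)" and x: "x \<in> {0..b}"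
  shows "f x = f 0 + integral {0..x} h"
proof -
  have "(h has_integral f x - f 0) {0..x}"
  proof (rule fundamental_theorem_of_calculus_interior)
    show "continuous_on {0..x} f" using x by (intro continuous_on_subset[OF f]) auto
    show "(f has_vector_derivative h y) (at y)" if "y \<in> {0<..<x}" for y
      using d[of y] that x by (simp add: has_real_derivative_iff_has_vector_derivative)
  qed (use x in auto)
  then show ?thesis by (simp add: integral_unique)
qed

text \<open>The bound makes f Cauchy along \<open>at_right 0\<close>, and completeness of the reals
  supplies the limit.\<close>

lemma endpoint_limit:
  fixes f :: "real \<Rightarrow> real"
  assumes "\<And>x y. 0 < x \<Longrightarrow> x \<le> y \<Longrightarrow> y < b \<Longrightarrow> \<bar>f x - f y\<bar> \<le> K * y powr (1/6)" and b: "0 < b"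
  obtains L where "(f \<longlongrightarrow> L) (at_right 0)"
proof -
  have p0: "((\<lambda>y. K * y powr (1/6)) \<longlongrightarrow> K * (0 powr (1/6))) (at_right 0)"
    by (intro tendsto_intros) (auto simp: eventually_at_filter)
  have cauchy: "\<exists>P. eventually P (at_right 0) \<and> (\<forall>x y. P x \<and> P y \<longrightarrow> dist (f x) (f y) < e)" if "0 < e" for e
  proof -
    have "eventually (\<lambda>y. \<bar>K * y powr (1/6)\<bar> < e) (at_right 0)"
      using tendsto_rabs[OF p0] that by (auto dest: order_tendstoD(2)[where a = e])
    moreover have "eventually (\<lambda>y. y \<in> {0<..<b}) (at_right 0)" by (rule eventually_at_right_real[OF b])
    ultimately have "eventually (\<lambda>y. \<bar>K * y powr (1/6)\<bar> < e \<and> y \<in> {0<..<b}) (at_right 0)" by (rule eventually_conj)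
    moreover have "dist (f x) (f y) < e"
      if "\<bar>K * x powr (1/6)\<bar> < e \<and> x \<in> {0<..<b}" "\<bar>K * y powr (1/6)\<bar> < e \<and> y \<in> {0<..<b}" for x y
      using assms(1)[of x y] assms(1)[of y x] that by (cases "x \<le> y") (auto simp: dist_real_def abs_minus_commute)
    ultimately show ?thesis by (intro exI conjI) auto
  qed
  have "cauchy_filter (filtermap f (at_right 0))"
    unfolding cauchy_filter_metric_filtermap using cauchy by blast
  moreover have "filtermap f (at_right 0) \<noteq> bot" by (simp add: filtermap_bot_iff)
  ultimately have "\<exists>L. filtermap f (at_right 0) \<le> nhds L"
    by (rule complete_uniform[where S = UNIV, THEN iffD1, rule_format, simplified, OF complete_UNIV, rotated -1])
  then show thesis using that by (auto simp: filterlim_def)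
qed

text \<open>In x = 1 - t the small flux gives w' = O(x^(-5/6)), so w has a limit at x = 0. As the
  flux vanishes there, it is x times an average of its own derivative, and this x cancels the one in
  the singular denominator. The slope is then continuous, and a further round gives C^2.\<close>

lemma flux_C2_right:
  fixes w p :: "real \<Rightarrow> real"
  assumes w: "\<And>t. 1/2 \<le> t \<Longrightarrow> t < 1 \<Longrightarrow> (w has_real_derivative p t / (4 * t\<^sup>2 * (1 - t))) (at t)"
    and p: "\<And>t. 1/2 \<le> t \<Longrightarrow> t < 1 \<Longrightarrow> (p has_real_derivative 15/4 * t * w t - t^3 * w t ^ 5) (at t)"
    and small: "\<And>t. 1/2 < t \<Longrightarrow> t < 1 \<Longrightarrow> \<bar>p t\<bar> \<le> C * (1 - t) powr (1/6)"
  obtains L w1 w2 where "C2_on {1/2..1} (\<lambda>t. if t < 1 then w t else L) w1 w2"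
proof -
  have C: "0 \<le> C"
  proof -
    have "0 \<le> C * (1 - 3/4) powr (1/6)" using small[of "3/4"] by simp
    then show ?thesis by (simp add: zero_le_mult_iff)
  qed
  have tail: "\<bar>w (1 - x) - w (1 - y)\<bar> \<le> 6 * C * y powr (1/6)" if xy: "0 < x" "x \<le> y" "y < 1/2" for x y
  proof -
    define Y where "Y x = x powr (1/6)" for x :: real
    have dY: "(Y has_real_derivative 1/6 * x powr (1/6 - 1)) (at x)" if "0 < x" for x
      unfolding Y_def[abs_def] using that by (auto intro!: derivative_eq_intros)
    have dw: "((\<lambda>x. w (1 - x)) has_real_derivative - (p (1 - x) / (4 * (1 - x)\<^sup>2 * x))) (at x)" if "0 < x" "x < 1/2" for x
    proof -
      have "((\<lambda>x. 1 - x) has_real_derivative - 1) (at x)" by (auto intro!: derivative_eq_intros)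
      from DERIV_chain2[OF w[of "1 - x"] this] that show ?thesis by simp
    qed
    have bound: "\<bar>p (1 - x) / (4 * (1 - x)\<^sup>2 * x)\<bar> \<le> C * x powr (1/6 - 1)" if "0 < x" "x < 1/2" for x
    proof -
      have "(1/2)\<^sup>2 \<le> (1 - x)\<^sup>2" using that by (intro power_mono) auto
      then have "1 * x \<le> 4 * (1 - x)\<^sup>2 * x" using that by (intro mult_right_mono) (auto simp: power2_eq_square)
      then have "\<bar>p (1 - x)\<bar> / (4 * (1 - x)\<^sup>2 * x) \<le> C * x powr (1/6) / x"
        using small[of "1 - x"] that by (intro frac_le) auto
      also have "\<dots> = C * x powr (1/6 - 1)" using that unfolding powr_diff by simp
      finally show ?thesis using that by (simp add: abs_mult)
    qed
    have "w (1 - y) - 6 * C * Y y \<le> w (1 - x) - 6 * C * Y x"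
    proof (rule DERIV_nonpos_imp_nonincreasing[OF xy(2), where f = "\<lambda>x. w (1 - x) - 6 * C * Y x"])
      fix z assume z: "x \<le> z" "z \<le> y"
      then have z: "0 < z" "z < 1/2" using xy by auto
      have "((\<lambda>x. w (1 - x) - 6 * C * Y x) has_real_derivative
          - (p (1 - z) / (4 * (1 - z)\<^sup>2 * z)) - 6 * C * (1/6 * z powr (1/6 - 1))) (at z)"
        by (intro DERIV_diff dw z DERIV_cmult dY)
      moreover have "6 * C * (1/6 * z powr (1/6 - 1)) = C * z powr (1/6 - 1)" by simp
      ultimately have d: "((\<lambda>x. w (1 - x) - 6 * C * Y x) has_real_derivative
          - (p (1 - z) / (4 * (1 - z)\<^sup>2 * z)) - C * z powr (1/6 - 1)) (at z)" by (simp only:)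
      show "\<exists>d. ((\<lambda>x. w (1 - x) - 6 * C * Y x) has_real_derivative d) (at z) \<and> d \<le> 0"
        by (rule exI, rule conjI, rule d) (use abs_le_D1[OF bound[OF z]] abs_le_D2[OF bound[OF z]] in linarith)
    qed
    moreover have "w (1 - x) + 6 * C * Y x \<le> w (1 - y) + 6 * C * Y y"
    proof (rule DERIV_nonneg_imp_nondecreasing[OF xy(2), where f = "\<lambda>x. w (1 - x) + 6 * C * Y x"])
      fix z assume z: "x \<le> z" "z \<le> y"
      then have z: "0 < z" "z < 1/2" using xy by auto
      have "((\<lambda>x. w (1 - x) + 6 * C * Y x) has_real_derivative
          - (p (1 - z) / (4 * (1 - z)\<^sup>2 * z)) + 6 * C * (1/6 * z powr (1/6 - 1))) (at z)"
        by (intro DERIV_add dw z DERIV_cmult dY)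
      moreover have "6 * C * (1/6 * z powr (1/6 - 1)) = C * z powr (1/6 - 1)" by simp
      ultimately have d: "((\<lambda>x. w (1 - x) + 6 * C * Y x) has_real_derivative
          - (p (1 - z) / (4 * (1 - z)\<^sup>2 * z)) + C * z powr (1/6 - 1)) (at z)" by (simp only:)
      show "\<exists>d. ((\<lambda>x. w (1 - x) + 6 * C * Y x) has_real_derivative d) (at z) \<and> 0 \<le> d"
        by (rule exI, rule conjI, rule d) (use abs_le_D1[OF bound[OF z]] abs_le_D2[OF bound[OF z]] in linarith)
    qed
    moreover have "0 \<le> 6 * C * Y x" using C by (simp add: Y_def)
    ultimately show ?thesis unfolding Y_def abs_le_iff by linarith
  qed
  obtain L where L: "((\<lambda>x. w (1 - x)) \<longlongrightarrow> L) (at_right 0)" 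
    by (rule endpoint_limit[where b = "1/2" and f = "\<lambda>x. w (1 - x)" and K = "6 * C"]) (auto intro!: tail)
  define v where "v x = (if x = 0 then L else w (1 - x))" for x
  define q where "q x = (if x = 0 then 0 else p (1 - x))" for x
  have dv: "(v has_real_derivative - (q x / (4 * (1 - x)\<^sup>2 * x))) (at x)" if "0 < x" "x \<le> 1/2" for x
  proof -
    have "((\<lambda>x. 1 - x) has_real_derivative - 1) (at x)" by (auto intro!: derivative_eq_intros)
    from DERIV_chain2[OF w[of "1 - x"] this] that
    have "((\<lambda>x. w (1 - x)) has_real_derivative - (q x / (4 * (1 - x)\<^sup>2 * x))) (at x)" by (simp add: q_def)
    then show ?thesis
      by (rule has_field_derivative_transform_within[of _ _ _ _ x]) (use that in \<open>auto simp: v_def dist_real_def\<close>)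
  qed
  have dq: "(q has_real_derivative - (15/4 * (1 - x) * v x - (1 - x)^3 * v x ^ 5)) (at x)" if "0 < x" "x \<le> 1/2" for x
  proof -
    have "((\<lambda>x. 1 - x) has_real_derivative - 1) (at x)" by (auto intro!: derivative_eq_intros)
    from DERIV_chain2[OF p[of "1 - x"] this] that
    have "((\<lambda>x. p (1 - x)) has_real_derivative - (15/4 * (1 - x) * v x - (1 - x)^3 * v x ^ 5)) (at x)" by (simp add: v_def)
    then show ?thesis
      by (rule has_field_derivative_transform_within[of _ _ _ _ x]) (use that in \<open>auto simp: q_def dist_real_def\<close>)
  qed
  have cont0: "continuous_on {0..1/2} f"
    if l: "(f \<longlongrightarrow> f 0) (at_right 0)" and d: "\<And>x. 0 < x \<Longrightarrow> x \<le> 1/2 \<Longrightarrow> isCont f x" for f :: "real \<Rightarrow> real"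
    unfolding continuous_on_def
  proof
    fix x :: real assume x: "x \<in> {0..1/2}"
    show "(f \<longlongrightarrow> f x) (at x within {0..1/2})"
    proof (cases "x = 0")
      case True
      then show ?thesis using l by (simp add: at_within_Icc_at_right)
    next
      case False
      then show ?thesis using d[of x] x by (auto simp: isCont_def intro: tendsto_within_subset)
    qed
  qed
  have pos: "eventually (\<lambda>x::real. x \<noteq> 0) (at_right 0)" by (auto simp: eventually_at_filter)
  have vc: "continuous_on {0..1/2} v"
  proof (rule cont0)
    have "eventually (\<lambda>x. w (1 - x) = v x) (at_right 0)" using pos by (rule eventually_mono) (simp add: v_def)
    then have "(v \<longlongrightarrow> L) (at_right 0)" by (rule Lim_transform_eventually[OF L])
    then show "(v \<longlongrightarrow> v 0) (at_right 0)" by (simp add: v_def)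
  qed (use dv DERIV_isCont in blast)
  have qc: "continuous_on {0..1/2} q"
  proof (rule cont0)
    have "((\<lambda>x. C * x powr (1/6)) \<longlongrightarrow> C * (0 powr (1/6))) (at_right 0)"
      by (intro tendsto_intros) (auto simp: eventually_at_filter)
    then have "((\<lambda>x. C * x powr (1/6)) \<longlongrightarrow> 0) (at_right 0)" by simp
    moreover have "eventually (\<lambda>x. norm (q x) \<le> C * x powr (1/6)) (at_right 0)"
    proof (rule eventually_mono[OF eventually_at_right_real[of 0 "1/2::real"]])
      fix x :: real assume "x \<in> {0<..<1/2}"
      then show "norm (q x) \<le> C * x powr (1/6)" using small[of "1 - x"] by (simp add: q_def)
    qed simp
    ultimately have "(q \<longlongrightarrow> 0) (at_right 0)" by (rule Lim_null_comparison[rotated])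
    then show "(q \<longlongrightarrow> q 0) (at_right 0)" by (simp add: q_def)
  qed (use dq DERIV_isCont in blast)
  define g where "g x = 15/4 * (1 - x) * v x - (1 - x)^3 * v x ^ 5" for x
  have gc: "continuous_on {0..1/2} g" unfolding g_def[abs_def] by (intro continuous_intros vc)
  have q_eq: "q x = - (x * integral {0..1} (\<lambda>u. 1 * g (x * u)))" if x: "x \<in> {0..1/2}" for x
  proof -
    have "q x = q 0 + integral {0..x} (\<lambda>x. - g x)"
    proof (rule eq_integral_of_interior_deriv[OF qc _ _ x])
      show "continuous_on {0..1/2} (\<lambda>x. - g x)" by (intro continuous_intros gc)
      show "(q has_real_derivative - g y) (at y)" if "0 < y" "y < 1/2" for y using dq[of y] that by (simp add: g_def)
    qed
    also have "integral {0..x} (\<lambda>x. - g x) = - integral {0..1} (\<lambda>u. x * g (x * u))"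
      using x by (subst integral_stretch_unit) (auto intro: continuous_on_subset[OF gc])
    finally show ?thesis by (simp add: q_def)
  qed
  define G where "G x = integral {0..1} (\<lambda>u. 1 * g (x * u))" for x
  define v1 where "v1 x = G x / (4 * (1 - x)\<^sup>2)" for x
  have Gc: "continuous_on {0..1/2} G"
  proof -
    have "continuous_on ({0..1/2} \<times> {0..1}) (\<lambda>x::real\<times>real. g (fst x * snd x))"
      by (rule continuous_on_compose2[OF gc]) (use unit_scale_mem in \<open>fastforce intro!: continuous_intros\<close>)+
    then have "continuous_on ({0..1/2} \<times> {0..1}) (\<lambda>(x, u). 1 * g (x * u))" by (simp add: case_prod_unfold)
    from continuous_on_integral_unit[OF this] show ?thesis by (simp add: G_def[abs_def])
  qed
  have v1c: "continuous_on {0..1/2} v1" unfolding v1_def[abs_def] by (intro continuous_intros Gc) auto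
  have dv1: "(v has_real_derivative v1 x) (at x within {0..1/2})" if x: "x \<in> {0..1/2}" for x
  proof -
    have d: "(v has_real_derivative v1 x) (at x)" if "0 < x" "x < 1/2" for x
      using dv[of x] q_eq[of x] that by (simp add: v1_def G_def)
    have eq: "v y = v 0 + integral {0..y} v1" if "y \<in> {0..1/2}" for y
      by (rule eq_integral_of_interior_deriv[OF vc v1c d that])
    have "((\<lambda>y. v 0 + integral {0..y} v1) has_real_derivative v1 x) (at x within {0..1/2})"
      using integral_has_real_derivative[OF v1c x] by (auto intro!: derivative_eq_intros)
    then show ?thesis
      by (rule has_field_derivative_transform_within[OF _ zero_less_one x]) (erule eq[symmetric])
  qed
  define g' where "g' x = 15/4 * (v1 x * (1 - x) - v x) - ((1 - x)^3 * (5 * v x ^ 4 * v1 x) - 3 * (1 - x)\<^sup>2 * v x ^ 5)" for x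
  have dg: "(g has_real_derivative g' x) (at x within {0..1/2})" if "x \<in> {0..1/2}" for x
    unfolding g_def[abs_def] g'_def
    by (rule derivative_eq_intros dv1[OF that] refl | simp)+
  have g'c: "continuous_on {0..1/2} g'" unfolding g'_def[abs_def] by (intro continuous_intros vc v1c)
  define G' where "G' x = integral {0..1} (\<lambda>u. 1 * (u * g' (x * u)))" for x
  have dG: "(G has_real_derivative G' x) (at x within {0..1/2})" if "x \<in> {0..1/2}" for x
    unfolding G_def[abs_def] G'_def by (rule weighted_avg_C1(1)[OF dg g'c continuous_on_const that])
  have G'c: "continuous_on {0..1/2} G'"
    unfolding G'_def[abs_def] by (rule weighted_avg_C1(2)[OF dg g'c continuous_on_const])
  define v2 where "v2 x = (G' x * (4 * (1 - x)\<^sup>2) - G x * (- 8 * (1 - x))) / (4 * (1 - x)\<^sup>2)\<^sup>2" for x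
  have dv2: "(v1 has_real_derivative v2 x) (at x within {0..1/2})" if "x \<in> {0..1/2}" for x
  proof -
    have "((\<lambda>x. 4 * (1 - x)\<^sup>2) has_real_derivative - 8 * (1 - x)) (at x within {0..1/2})"
      by (auto intro!: derivative_eq_intros)
    from DERIV_divide[OF dG[OF that] this] that show ?thesis
      unfolding v1_def[abs_def] v2_def by (simp add: power2_eq_square)
  qed
  have v2c: "continuous_on {0..1/2} v2" unfolding v2_def[abs_def] by (intro continuous_intros Gc G'c) auto
  have refl: "((\<lambda>t. h (1 - t)) has_real_derivative - h' (1 - t)) (at t within {1/2..1})"
    if h: "\<And>x. x \<in> {0..1/2} \<Longrightarrow> (h has_real_derivative h' x) (at x within {0..1/2})" and t: "t \<in> {1/2..1}" for h h' :: "real \<Rightarrow> real" and t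
  proof -
    have "((\<lambda>t. h (1 - t)) has_real_derivative h' (1 - t) * - 1) (at t within {1/2..1})"
    proof (rule DERIV_chain_within[where f = h and g = "\<lambda>t. 1 - t" and T = "{0..1/2}"])
      show "(h has_real_derivative h' (1 - t)) (at (1 - t) within {0..1/2})" using t by (intro h) auto
    qed (auto intro!: derivative_eq_intros)
    then show ?thesis by simp
  qed
  show thesis
  proof (rule that)
    have eq: "(\<lambda>t. if t < 1 then w t else L) t = v (1 - t)" if "t \<in> {1/2..1}" for t
      using that by (auto simp: v_def)
    show "C2_on {1/2..1} (\<lambda>t. if t < 1 then w t else L) (\<lambda>t. - v1 (1 - t)) (\<lambda>t. v2 (1 - t))"
      unfolding C2_on_def
    proof (intro conjI ballI)
      fix t :: real assume t: "t \<in> {1/2..1}"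
      show "((\<lambda>t. if t < 1 then w t else L) has_real_derivative - v1 (1 - t)) (at t within {1/2..1})"
        by (rule has_field_derivative_transform_within[OF refl[OF dv1 t], of 1]) (use t eq in auto)
      show "((\<lambda>t. - v1 (1 - t)) has_real_derivative v2 (1 - t)) (at t within {1/2..1})"
        using DERIV_minus[OF refl[OF dv2 t]] by simp
    next
      show "continuous_on {1/2..1} (\<lambda>t. v2 (1 - t))"
        by (rule continuous_on_compose2[OF v2c]) (auto intro!: continuous_intros)
    qed
  qed
qed

lemma C2_on_glue:
  assumes A: "C2_on {0..3/4} w a1 a2" and B: "C2_on {1/2..1} w b1 b2"
  obtains w1 w2 where "C2_on {0..1} w w1 w2"
proof -
  have d1: "a1 t = b1 t" if t: "1/2 < t" "t < 3/4" for t
    by (rule DERIV_unique[OF C2_on_interior(1)[OF A] C2_on_interior(1)[OF B]]) (use t in auto)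
  have d2: "a2 t = b2 t" if t: "1/2 < t" "t < 3/4" for t
  proof -
    have "(a1 has_real_derivative a2 t) (at t)" by (rule C2_on_interior(2)[OF A]) (use t in auto)
    moreover have b: "(b1 has_real_derivative b2 t) (at t)" by (rule C2_on_interior(2)[OF B]) (use t in auto)
    ultimately have "(a1 has_real_derivative a2 t) (at t)" by simp
    then have "(a1 has_real_derivative a2 t) (at t within {1/2<..<3/4})" by (simp add: has_field_derivative_at_within)
    then have "(b1 has_real_derivative a2 t) (at t within {1/2<..<3/4})"
      by (rule has_field_derivative_transform_within[of _ _ _ _ 1]) (use t d1 in auto)
    then have "(b1 has_real_derivative a2 t) (at t)" 
      using at_within_open[of t "{1/2<..<3/4}"] t by simp
    then show ?thesis using b by (rule DERIV_unique)
  qed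
  \<comment> \<open>On the overlap (1/2, 3/4) the two pairs of derivatives agree, and the switch at
    5/8 leaves a margin of 1/8 on either side.\<close>
  define w1 where "w1 t = (if t < 5/8 then a1 t else b1 t)" for t
  define w2 where "w2 t = (if t < 5/8 then a2 t else b2 t)" for t
  have left: "w1 t = a1 t" "w2 t = a2 t" if "t < 3/4" for t using d1[of t] d2[of t] that by (auto simp: w1_def w2_def)
  have right: "w1 t = b1 t" "w2 t = b2 t" if "1/2 < t" for t using d1[of t] d2[of t] that by (auto simp: w1_def w2_def)
  have nl: "at t within {0..1} = at t within {0..3/4}" if "t < 3/4" for t :: real
    by (rule at_within_nhd[of _ "{..<3/4}"]) (use that in auto)
  have nr: "at t within {0..1} = at t within {1/2..1}" if "1/2 < t" for t :: real
    by (rule at_within_nhd[of _ "{1/2<..}"]) (use that in auto)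
  have D: "(f has_real_derivative f' t) (at t within {0..1})"
    if l: "\<And>t. t \<in> {0..3/4} \<Longrightarrow> (fl has_real_derivative fl' t) (at t within {0..3/4})"
      and r: "\<And>t. t \<in> {1/2..1} \<Longrightarrow> (fr has_real_derivative fr' t) (at t within {1/2..1})"
      and el: "\<And>t. t < 3/4 \<Longrightarrow> f t = fl t" "\<And>t. t < 3/4 \<Longrightarrow> f' t = fl' t"
      and er: "\<And>t. 1/2 < t \<Longrightarrow> f t = fr t" "\<And>t. 1/2 < t \<Longrightarrow> f' t = fr' t"
      and t: "t \<in> {0..1}" for f f' fl fl' fr fr' :: "real \<Rightarrow> real" and t
  proof (cases "t < 5/8")
    case True
    have near: "fl x = f x" if "dist x t < 1/8" for x
      using that True unfolding dist_real_def by (intro el(1)[symmetric]) linarith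
    from True have "(fl has_real_derivative f' t) (at t within {0..1})" using l[of t] t nl[of t] el(2)[of t] by auto
    then show ?thesis
      by (rule has_field_derivative_transform_within[of _ _ _ _ "1/8"]) (use t near in auto)
  next
    case False
    have near: "fr x = f x" if "dist x t < 1/8" for x
      using that False unfolding dist_real_def by (intro er(1)[symmetric]) linarith
    from False have "(fr has_real_derivative f' t) (at t within {0..1})" using r[of t] t nr[of t] er(2)[of t] by auto
    then show ?thesis
      by (rule has_field_derivative_transform_within[of _ _ _ _ "1/8"]) (use t near in auto)
  qed
  show thesis
  proof (rule that)
    show "C2_on {0..1} w w1 w2"
      unfolding C2_on_def
    proof (intro conjI ballI)
      fix t :: real assume t: "t \<in> {0..1}"
      show "(w has_real_derivative w1 t) (at t within {0..1})"
        by (rule D[of w a1 w b1 w w1]) (use A B left right t in \<open>auto simp: C2_on_def\<close>)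
      show "(w1 has_real_derivative w2 t) (at t within {0..1})"
        by (rule D[of a1 a2 b1 b2 w1 w2]) (use A B left right t in \<open>auto simp: C2_on_def\<close>)
    next
      show "continuous_on {0..1} w2"
        unfolding continuous_on_def
      proof
        fix t :: real assume t: "t \<in> {0..1}"
        show "(w2 \<longlongrightarrow> w2 t) (at t within {0..1})"
        proof (cases "t < 5/8")
          case True
          have near: "a2 x = w2 x" if "dist x t < 1/8" for x
            using that True unfolding dist_real_def by (intro left(2)[symmetric]) linarith
          from True have "(a2 \<longlongrightarrow> w2 t) (at t within {0..1})"
            using A t nl[of t] left(2)[of t] by (auto simp: C2_on_def continuous_on_def)
          then show ?thesis
            by (rule Lim_transform_within[of _ _ _ _ "1/8"]) (use near in auto)
        next
          case False
          have near: "b2 x = w2 x" if "dist x t < 1/8" for x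
            using that False unfolding dist_real_def by (intro right(2)[symmetric]) linarith
          from False have "(b2 \<longlongrightarrow> w2 t) (at t within {0..1})"
            using B t nr[of t] right(2)[of t] by (auto simp: C2_on_def continuous_on_def)
          then show ?thesis
            by (rule Lim_transform_within[of _ _ _ _ "1/8"]) (use near in auto)
        qed
      qed
    qed
  qed
qed

theorem ode_solutions:
  assumes r1: "0 < r1" "r1 \<le> 1/2"
  obtains r w w1 w2 where "0 < r" "r \<le> r1" "C2_on {0..1} w w1 w2"
    "\<And>t. t \<in> {0..1} \<Longrightarrow> 4 * t * (1 - t) * w2 t + (8 - 12 * t) * w1 t = 15/4 * w t - t\<^sup>2 * w t ^ 5"
    "\<And>t. 0 \<le> t \<Longrightarrow> t \<le> r^4 / 80 \<Longrightarrow> 3/4 / r^3 \<le> w t"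
proof -
  obtain r C where r: "0 < r" "r \<le> r1" and C: "\<And>t. 1/2 < t \<Longrightarrow> t < 1 \<Longrightarrow> \<bar>pn r t\<bar> \<le> C * (1 - t) powr (1/6)"
    using vanishing_flux[OF r1(1)] by blast
  obtain a1 a2 where A: "C2_on {0..3/4} (wn r) a1 a2" using wn_C2_left[OF r(1)] by blast
  obtain L b1 b2 where B: "C2_on {1/2..1} (\<lambda>t. if t < 1 then wn r t else L) b1 b2"
    by (rule flux_C2_right[OF DERIV_wn[OF r(1)] DERIV_pn[OF r(1)] C]) auto
  define w where "w t = (if t < 1 then wn r t else L)" for t
  have A': "C2_on {0..3/4} w a1 a2"
    unfolding C2_on_def
  proof (intro conjI ballI)
    fix t :: real assume t: "t \<in> {0..3/4}"
    have "(wn r has_real_derivative a1 t) (at t within {0..3/4})" using A t by (simp add: C2_on_def)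
    then show "(w has_real_derivative a1 t) (at t within {0..3/4})"
      by (rule has_field_derivative_transform_within[of _ _ _ _ 1]) (use t in \<open>auto simp: w_def\<close>)
  qed (use A in \<open>auto simp: C2_on_def\<close>)
  obtain w1 w2 where W: "C2_on {0..1} w w1 w2" using C2_on_glue[OF A' B[folded w_def]] by blast
  \<comment> \<open>The defect of the equation: it vanishes in the open interval and is continuous
    because \<open>w2\<close> is, so it vanishes at both singular endpoints too.\<close>
  define D where "D t = 4 * t * (1 - t) * w2 t + (8 - 12 * t) * w1 t - (15/4 * w t - t\<^sup>2 * w t ^ 5)" for t
  have Dc: "continuous_on {0..1} D"
    unfolding D_def[abs_def] by (intro continuous_intros C2_on_continuous[OF W])
  have D0: "D t = 0" if t: "t \<in> {0<..<1}" for t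
  proof -
    have w1: "(w has_real_derivative w1 s) (at s)" if "s \<in> {0<..<1}" for s
      using that by (intro C2_on_interior(1)[OF W]) auto
    have w1p: "4 * s\<^sup>2 * (1 - s) * w1 s = pn r s" if s: "s \<in> {0<..<1}" for s
    proof -
      have "(w has_real_derivative pn r s / (4 * s\<^sup>2 * (1 - s))) (at s)"
        by (rule has_field_derivative_transform_within_open[OF DERIV_wn[OF r(1)], of s "{0<..<1}"]) (use s in \<open>auto simp: w_def\<close>)
      from DERIV_unique[OF w1[OF s] this] s show ?thesis by simp
    qed
    have "(w1 has_real_derivative w2 t) (at t)" using t by (intro C2_on_interior(2)[OF W]) auto
    then have "((\<lambda>s. 4 * s\<^sup>2 * (1 - s) * w1 s) has_real_derivative (8 * t - 12 * t\<^sup>2) * w1 t + 4 * t\<^sup>2 * (1 - t) * w2 t) (at t)"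
      by (auto intro!: derivative_eq_intros simp: algebra_simps power2_eq_square)
    then have "(pn r has_real_derivative (8 * t - 12 * t\<^sup>2) * w1 t + 4 * t\<^sup>2 * (1 - t) * w2 t) (at t)"
      by (rule has_field_derivative_transform_within_open[of _ _ _ "{0<..<1}"]) (use t w1p in auto)
    from DERIV_unique[OF this DERIV_pn[OF r(1), of t]] t
    have "(8 * t - 12 * t\<^sup>2) * w1 t + 4 * t\<^sup>2 * (1 - t) * w2 t = 15/4 * t * w t - t^3 * w t ^ 5" by (simp add: w_def)
    then have "t * D t = 0" by (simp add: D_def algebra_simps power2_eq_square power3_eq_cube)
    then show ?thesis using t by simp
  qed
  have D: "D t = 0" if "t \<in> {0..1}" for t
    using continuous_constant_on_closure[of "{0<..<1}" D 0 t] Dc D0 that by simp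
  show thesis
  proof (rule that[OF r W])
    fix t :: real assume "t \<in> {0..1}"
    from D[OF this] show "4 * t * (1 - t) * w2 t + (8 - 12 * t) * w1 t = 15/4 * w t - t\<^sup>2 * w t ^ 5" by (simp add: D_def)
  next
    fix t assume t: "0 \<le> t" "t \<le> r^4 / 80"
    have "r^4 \<le> 1" using r r1 by (intro power_le_one) auto
    then have "t < 1" using t by simp
    then show "3/4 / r^3 \<le> w t" using wn_near_zero[of r t] r r1 t by (simp add: w_def)
  qed
qed

section \<open>Integration by parts and weak limits\<close>

lemma norm3_sq: "(norm x)\<^sup>2 = (x$1)\<^sup>2 + (x$2)\<^sup>2 + (x$3)\<^sup>2" for x :: "real^3"
  unfolding power2_norm_eq_inner inner_vec_def by (simp add: sum_3 power2_eq_square)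

lemma smooth_fun_norm_sq: "smooth_fun (\<lambda>x. (norm x)\<^sup>2)"
  unfolding norm3_sq by (intro smooth_fun_add smooth_fun_power smooth_fun_nth)

lemma integrable_bounded_support:
  fixes f :: "'a::euclidean_space \<Rightarrow> real"
  assumes "f \<in> borel_measurable lborel" "\<And>x. \<bar>f x\<bar> \<le> B" "\<And>x. R < norm x \<Longrightarrow> f x = 0"
  shows "integrable lborel f"
proof (rule Bochner_Integration.integrable_bound)
  have "integrable lborel (\<lambda>x. indicator (cball 0 R) x *\<^sub>R B)"
    by (intro integrable_scaleR_left) (simp add: integrable_indicator_iff emeasure_lborel_cball_finite[unfolded infinity_ennreal_def])
  then show "integrable lborel (\<lambda>x::'a. indicator (cball 0 R) x *\<^sub>R B)" .
  show "AE x in lborel. norm (f x) \<le> norm (indicator (cball 0 R) x *\<^sub>R B)"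
  proof (rule AE_I2)
    fix x :: 'a
    show "norm (f x) \<le> norm (indicator (cball 0 R) x *\<^sub>R B)"
      using assms(2)[of x] assms(3)[of x] by (cases "norm x \<le> R") auto
  qed
qed (rule assms(1))

lemma integrable_continuous_support:
  fixes f :: "'a::euclidean_space \<Rightarrow> real"
  assumes f: "continuous_on UNIV f" and R: "\<And>x. R < norm x \<Longrightarrow> f x = 0"
  shows "integrable lborel f"
proof -
  have "bounded (f ` cball 0 R)"
    using f by (intro compact_imp_bounded compact_continuous_image) (auto intro: continuous_on_subset)
  then obtain B where B: "\<And>x. norm x \<le> R \<Longrightarrow> \<bar>f x\<bar> \<le> B" by (force simp: bounded_iff)
  show ?thesis
  proof (rule integrable_bounded_support[OF _ _ R])
    show "f \<in> borel_measurable lborel" using f by (simp add: borel_measurable_continuous_onI)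
    fix x show "\<bar>f x\<bar> \<le> max B 0" using B[of x] R[of x] by (cases "norm x \<le> R") auto
  qed
qed

lemma pd_outside_support:
  assumes "\<And>x. R < norm x \<Longrightarrow> f x = 0" "R < norm x"
  shows "pd f j x = 0"
proof -
  have "(f has_derivative (\<lambda>h. 0)) (at x)"
  proof (rule has_derivative_transform_within_open[of "\<lambda>x. 0" "\<lambda>h. 0" x UNIV "- cball 0 R"])
    show "x \<in> - cball 0 R" using assms by simp
  qed (use assms in auto)
  then show ?thesis by (rule pd_eq)
qed

text \<open>The integral of a difference quotient vanishes by translation invariance.\<close>

lemma integral_pd_zero:
  assumes d: "\<And>x. h differentiable (at x)" and B: "\<And>x. \<bar>pd h j x\<bar> \<le> B" and R: "\<And>x. R < norm x \<Longrightarrow> h x = 0"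
  shows "integrable lborel (pd h j)" "integral\<^sup>L lborel (pd h j) = 0"
proof -
  define a :: "real^3" where "a = axis j 1"
  have a: "norm a = 1" by (simp add: a_def norm_axis_1)
  define t where "t n = 1 / (real n + 1)" for n :: nat
  have t: "0 < t n" "t n \<le> 1" for n by (auto simp: t_def)
  define D where "D n x = (h (t n *\<^sub>R a + x) - h x) / t n" for n x
  have hc: "continuous_on UNIV h"
    using d by (meson continuous_at_imp_continuous_on differentiable_imp_continuous_within)
  have hm: "h \<in> borel_measurable borel" by (rule borel_measurable_continuous_onI[OF hc])
  have hi: "integrable lborel h" by (rule integrable_continuous_support[OF hc R])
  have D0: "integral\<^sup>L lborel (D n) = 0" for n
  proof -
    have "integrable (distr lborel borel ((+) (t n *\<^sub>R a))) h" unfolding lborel_distr_plus by (rule hi)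
    then have i: "integrable lborel (\<lambda>x. h (t n *\<^sub>R a + x))" by (subst (asm) integrable_distr_eq) (auto intro: hm)
    have "integral\<^sup>L (distr lborel borel ((+) (t n *\<^sub>R a))) h = integral\<^sup>L lborel (\<lambda>x. h (t n *\<^sub>R a + x))"
      by (rule integral_distr) (auto intro: hm)
    then have "integral\<^sup>L lborel (\<lambda>x. h (t n *\<^sub>R a + x)) = integral\<^sup>L lborel h" unfolding lborel_distr_plus by simp
    then show ?thesis unfolding D_def using i hi by (simp add: Bochner_Integration.integral_diff)
  qed
  have line: "((\<lambda>s. h (x + s *\<^sub>R a)) has_real_derivative pd h j (x + s *\<^sub>R a)) (at s)" for x s
  proof -
    have "((\<lambda>s. h (x + s *\<^sub>R a)) has_derivative (\<lambda>u. \<Sum>k\<in>UNIV. (u *\<^sub>R a) $ k * pd h k (x + s *\<^sub>R a))) (at s)"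
      by (rule has_derivative_compose[of "\<lambda>s. x + s *\<^sub>R a" "\<lambda>u. u *\<^sub>R a" s UNIV h, OF _ has_derivative_pd[OF d]])
         (auto intro!: derivative_eq_intros)
    moreover have "(\<Sum>k\<in>UNIV. (u *\<^sub>R a) $ k * pd h k (x + s *\<^sub>R a)) = u * pd h j (x + s *\<^sub>R a)" for u
      by (simp add: a_def axis_def if_distrib[of "\<lambda>y. _ * y * _"] mult_if_delta sum.delta cong: if_cong)
    ultimately show ?thesis by (simp add: has_field_derivative_def mult_commute_abs)
  qed
  have lim: "(\<lambda>n. D n x) \<longlonglongrightarrow> pd h j x" for x
  proof -
    have "((\<lambda>s. (h (x + s *\<^sub>R a) - h x) / s) \<longlongrightarrow> pd h j x) (at 0)"
      using line[of x 0] by (simp add: DERIV_def)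
    moreover have "filterlim t (at 0) sequentially"
    proof (rule filterlim_atI)
      show "t \<longlonglongrightarrow> 0" unfolding t_def using LIMSEQ_inverse_real_of_nat by (simp add: inverse_eq_divide add.commute)
      show "\<forall>\<^sub>F n in sequentially. t n \<noteq> 0" using t by (simp add: less_imp_neq[symmetric])
    qed
    ultimately have "(\<lambda>n. (h (x + t n *\<^sub>R a) - h x) / t n) \<longlonglongrightarrow> pd h j x" by (rule filterlim_compose)
    then show ?thesis by (simp add: D_def add.commute)
  qed
  have Dm: "D n \<in> borel_measurable lborel" for n
    unfolding D_def using hm by (auto intro!: borel_measurable_continuous_onI continuous_intros continuous_on_compose2[OF hc])
  have Db: "norm (D n x) \<le> indicator (cball 0 (R + 1)) x *\<^sub>R B" for n x
  proof (cases "norm x \<le> R + 1")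
    case True
    obtain z where "h (x + t n *\<^sub>R a) - h (x + 0 *\<^sub>R a) = (t n - 0) * pd h j (x + z *\<^sub>R a)"
      using MVT2[OF t(1)[of n], of "\<lambda>s. h (x + s *\<^sub>R a)" "\<lambda>s. pd h j (x + s *\<^sub>R a)"] line by blast
    then have "D n x = pd h j (x + z *\<^sub>R a)" using t[of n] by (simp add: D_def add.commute)
    then show ?thesis using True B by simp
  next
    case False
    have "norm x \<le> norm (t n *\<^sub>R a + x) + norm (t n *\<^sub>R a)" using norm_triangle_ineq4[of "t n *\<^sub>R a + x" "t n *\<^sub>R a"] by simp
    then have "R < norm (t n *\<^sub>R a + x)" using False t[of n] a by simp
    then show ?thesis using False R by (simp add: D_def)
  qed
  have m: "pd h j \<in> borel_measurable lborel" by (rule borel_measurable_LIMSEQ_real[OF lim Dm])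
  have w: "integrable lborel (\<lambda>x::real^3. indicator (cball 0 (R + 1)) x *\<^sub>R B)"
    by (intro integrable_scaleR_left) (simp add: integrable_indicator_iff emeasure_lborel_cball_finite[unfolded infinity_ennreal_def])
  have AE: "AE x in lborel. (\<lambda>n. D n x) \<longlonglongrightarrow> pd h j x" "\<And>n. AE x in lborel. norm (D n x) \<le> indicator (cball 0 (R + 1)) x *\<^sub>R B"
    using lim Db by auto
  show "integrable lborel (pd h j)" by (rule integrable_dominated_convergence[OF m Dm w AE])
  have "(\<lambda>n. integral\<^sup>L lborel (D n)) \<longlonglongrightarrow> integral\<^sup>L lborel (pd h j)"
    by (rule integral_dominated_convergence[OF m Dm w AE])
  then show "integral\<^sup>L lborel (pd h j) = 0" unfolding D0 by (simp add: LIMSEQ_const_iff)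
qed

section \<open>Calculus of test functions\<close>

lemma test_funI:
  assumes "smooth_fun \<phi>" "\<And>x. R < norm x \<Longrightarrow> \<phi> x = 0"
  shows "test_fun \<phi>"
proof -
  have "bounded {x. \<phi> x \<noteq> 0}" using assms(2) by (intro boundedI[of _ R]) (force simp: not_less)
  then show ?thesis using assms(1) by (simp add: test_fun_def)
qed

lemma test_funE:
  assumes "test_fun \<phi>"
  obtains R where "0 \<le> R" "\<And>x. R < norm x \<Longrightarrow> \<phi> x = 0"
proof -
  have "bounded (closure {x. \<phi> x \<noteq> 0})" using assms by (simp add: test_fun_def compact_imp_bounded)
  then obtain R where "\<And>x. x \<in> closure {x. \<phi> x \<noteq> 0} \<Longrightarrow> norm x \<le> R" by (auto simp: bounded_iff)
  then have "\<phi> x = 0" if "max R 0 < norm x" for x using that closure_subset[of "{x. \<phi> x \<noteq> 0}"] by force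
  then show thesis using that[of "max R 0"] by auto
qed

lemma test_fun_smooth: "test_fun \<phi> \<Longrightarrow> smooth_fun \<phi>" by (simp add: test_fun_def)

lemma test_fun_pd:
  assumes "test_fun \<phi>" shows "test_fun (pd \<phi> j)"
proof -
  obtain R where "\<And>x. R < norm x \<Longrightarrow> \<phi> x = 0" using test_funE[OF assms] by blast
  then show ?thesis
    by (rule test_funI[OF smooth_fun_pd[OF test_fun_smooth[OF assms]] pd_outside_support])
qed

lemma test_fun_mult:
  assumes "smooth_fun f" "test_fun \<phi>" shows "test_fun (\<lambda>x. f x * \<phi> x)"
proof -
  obtain R where "\<And>x. R < norm x \<Longrightarrow> \<phi> x = 0" using test_funE[OF assms(2)] by blast
  then show ?thesis
    by (intro test_funI[where R = R, OF smooth_fun_mult[OF assms(1) test_fun_smooth[OF assms(2)]]]) simp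
qed

lemma test_fun_diff:
  assumes "test_fun f" "test_fun g" shows "test_fun (\<lambda>x. f x - g x)"
proof -
  obtain R S where "\<And>x. R < norm x \<Longrightarrow> f x = 0" "\<And>x. S < norm x \<Longrightarrow> g x = 0"
    using assms by (meson test_funE)
  then show ?thesis
    by (intro test_funI[where R = "max R S", OF smooth_fun_diff[OF assms[THEN test_fun_smooth]]]) auto
qed

lemma integrable_mult_test:
  assumes "continuous_on UNIV f" "test_fun \<phi>"
  shows "integrable lborel (\<lambda>x. f x * \<phi> x)"
proof -
  obtain R where "\<And>x. R < norm x \<Longrightarrow> \<phi> x = 0" using test_funE[OF assms(2)] by blast
  then show ?thesis
    by (intro integrable_continuous_support[of _ R] continuous_intros assms(1) smooth_fun_continuous
        test_fun_smooth[OF assms(2)]) simp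
qed

text \<open>The product with a test function has compact support, so the integral of its derivative
  vanishes. C^1 is the regularity known for the curl of a profile field, to which this is
  applied.\<close>

lemma integral_by_parts:
  assumes d: "\<And>x. f differentiable (at x)" and c: "continuous_on UNIV (pd f j)" and \<phi>: "test_fun \<phi>"
  shows "integral\<^sup>L lborel (\<lambda>x. f x * pd \<phi> j x) = - integral\<^sup>L lborel (\<lambda>x. pd f j x * \<phi> x)"
proof -
  obtain R where R: "\<And>x. R < norm x \<Longrightarrow> \<phi> x = 0" using test_funE[OF \<phi>] by blast
  have fc: "continuous_on UNIV f"
    using d by (meson continuous_at_imp_continuous_on differentiable_imp_continuous_within)
  have \<phi>d: "\<phi> differentiable (at x)" for x using \<phi> by (simp add: test_fun_smooth smooth_fun_differentiable)
  have \<phi>c: "continuous_on UNIV \<phi>" "continuous_on UNIV (pd \<phi> j)"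
    using \<phi> by (auto intro!: smooth_fun_continuous test_fun_smooth test_fun_pd)
  define h where "h x = f x * \<phi> x" for x
  have pdh: "pd h j = (\<lambda>x. f x * pd \<phi> j x + pd f j x * \<phi> x)" unfolding h_def by (rule ext) (rule pd_mult[OF d \<phi>d])
  have h0: "h x = 0" if "R < norm x" for x using R[OF that] by (simp add: h_def)
  have "continuous_on (cball 0 R) (pd h j)"
    unfolding pdh using fc c \<phi>c by (intro continuous_intros) (auto intro: continuous_on_subset)
  then have "bounded (pd h j ` cball 0 R)" by (intro compact_imp_bounded compact_continuous_image) auto
  then obtain B where B: "\<And>x. norm x \<le> R \<Longrightarrow> \<bar>pd h j x\<bar> \<le> B" by (force simp: bounded_iff)
  have "integral\<^sup>L lborel (pd h j) = 0"
  proof (rule integral_pd_zero(2)[where B = "max B 0"])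
    show "h differentiable (at x)" for x unfolding h_def by (intro differentiable_mult d \<phi>d)
    show "\<bar>pd h j x\<bar> \<le> max B 0" for x
      using B[of x] pd_outside_support[of R h x j] h0 by (cases "norm x \<le> R") auto
  qed (rule h0)
  then show ?thesis
    unfolding pdh using integrable_mult_test[OF fc test_fun_pd[OF \<phi>, of j]] integrable_mult_test[OF c \<phi>]
    by (simp add: Bochner_Integration.integral_add)
qed

section \<open>Functions whose integrals against all test functions vanish\<close>

definition ball_bump :: "real \<Rightarrow> real^3 \<Rightarrow> real" where
  "ball_bump R x = flat_exp 0 (R\<^sup>2 - (norm x)\<^sup>2)"

lemma test_fun_ball_bump: "0 \<le> R \<Longrightarrow> test_fun (ball_bump R)"
  unfolding ball_bump_def[abs_def]
proof (rule test_funI[where R = R])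
  show "smooth_fun (\<lambda>x. flat_exp 0 (R\<^sup>2 - (norm x)\<^sup>2))"
    by (intro smooth_fun_flat_exp smooth_fun_diff smooth_fun_const smooth_fun_norm_sq)
  fix x :: "real^3" assume "0 \<le> R" "R < norm x"
  then have "R\<^sup>2 < (norm x)\<^sup>2" by (intro power_strict_mono) auto
  then show "flat_exp 0 (R\<^sup>2 - (norm x)\<^sup>2) = 0" by (simp add: flat_exp_def)
qed

lemma ball_bump_pos: "norm x < R \<Longrightarrow> 0 < ball_bump R x"
  using power_strict_mono[of "norm x" R 2] by (simp add: ball_bump_def flat_exp_def)

lemma flat_exp_0_bounds: "0 \<le> flat_exp 0 y" "flat_exp 0 y \<le> 1"
  by (auto simp: flat_exp_def)

text \<open>If F is smooth with values in [0, 1] and positive exactly on the box, then 1 - (1 - F)^k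
  tends to 1 on the box and is 0 elsewhere.\<close>

lemma box_approx:
  fixes a b :: "real^3"
  obtains \<psi> :: "nat \<Rightarrow> real^3 \<Rightarrow> real" where "\<And>k. smooth_fun (\<psi> k)" "\<And>k x. \<bar>\<psi> k x\<bar> \<le> 1"
    "\<And>x. (\<lambda>k. \<psi> k x) \<longlonglongrightarrow> indicator (box a b) x"
proof -
  define e where "e i x = flat_exp 0 (x$i - a$i) * flat_exp 0 (b$i - x$i)" for i :: 3 and x :: "real^3"
  define F where "F x = e 1 x * e 2 x * e 3 x" for x
  have es: "smooth_fun (e i)" for i
    unfolding e_def[abs_def] by (intro smooth_fun_mult smooth_fun_flat_exp smooth_fun_diff smooth_fun_nth smooth_fun_const)
  have Fs: "smooth_fun F" unfolding F_def[abs_def] by (intro smooth_fun_mult es)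
  have e01: "0 \<le> e i x" "e i x \<le> 1" for i x
    unfolding e_def by (auto intro!: mult_nonneg_nonneg mult_le_one flat_exp_0_bounds)
  have F01: "0 \<le> F x" "F x \<le> 1" for x
    unfolding F_def by (auto intro!: mult_nonneg_nonneg mult_le_one e01)
  have epos: "0 < e i x \<longleftrightarrow> a$i < x$i \<and> x$i < b$i" for i x
    by (auto simp: e_def flat_exp_def zero_less_mult_iff)
  have Fpos: "0 < F x \<longleftrightarrow> x \<in> box a b" for x
  proof -
    have "0 < F x \<longleftrightarrow> 0 < e 1 x \<and> 0 < e 2 x \<and> 0 < e 3 x"
      using e01(1)[of 1 x] e01(1)[of 2 x] e01(1)[of 3 x] by (auto simp: F_def zero_less_mult_iff)
    then show ?thesis by (simp add: epos mem_box_cart forall_3)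
  qed
  show thesis
  proof (rule that[of "\<lambda>k x. 1 - (1 - F x) ^ k"])
    show "smooth_fun (\<lambda>x. 1 - (1 - F x) ^ k)" for k by (intro smooth_fun_diff smooth_fun_const smooth_fun_power Fs)
    show "\<bar>1 - (1 - F x) ^ k\<bar> \<le> 1" for k x
      using power_le_one[of "1 - F x" k] zero_le_power[of "1 - F x" k] F01[of x] by auto
    show "(\<lambda>k. 1 - (1 - F x) ^ k) \<longlonglongrightarrow> indicator (box a b) x" for x
    proof (cases "x \<in> box a b")
      case True
      then have "0 < F x" by (simp add: Fpos)
      then have "(\<lambda>k. (1 - F x) ^ k) \<longlonglongrightarrow> 0" 
        by (intro LIMSEQ_realpow_zero) (use F01[of x] in linarith)+
      then have "(\<lambda>k. 1 - (1 - F x) ^ k) \<longlonglongrightarrow> 1 - 0" by (rule tendsto_diff[OF tendsto_const])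
      then show ?thesis using True by simp
    next
      case False
      then have "F x = 0" using Fpos[of x] F01(1)[of x] by simp
      then show ?thesis using False by simp
    qed
  qed
qed

text \<open>The measures with densities the positive and the negative part of g agree on boxes, a
  generator stable under intersection. Hence they coincide, and so do the densities almost
  everywhere.\<close>

lemma AE_zero_of_box_integrals:
  fixes g :: "'a::euclidean_space \<Rightarrow> real"
  assumes g: "integrable lborel g" and box: "\<And>a b. integral\<^sup>L lborel (\<lambda>x. g x * indicator (box a b) x) = 0"
  shows "AE x in lborel. g x = 0"
proof -
  have gm: "g \<in> borel_measurable lborel" using g by simp
  define P where "P x = max (g x) 0" for x
  define N where "N x = max (- g x) 0" for x
  have iP: "integrable lborel P" and iN: "integrable lborel N"
    unfolding P_def[abs_def] N_def[abs_def] using g by (auto intro!: integrable_max)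
  have fin: "(\<integral>\<^sup>+x. ennreal (P x) \<partial>lborel) < \<infinity>" "(\<integral>\<^sup>+x. ennreal (N x) \<partial>lborel) < \<infinity>"
    by (subst nn_integral_eq_integral[OF iP] nn_integral_eq_integral[OF iN], simp add: P_def N_def, simp)+
  have eq: "density lborel (\<lambda>x. ennreal (P x)) = density lborel (\<lambda>x. ennreal (N x))"
  proof (rule measure_eqI_generator_eq)
    let ?E = "range (\<lambda>(a, b). box a b :: 'a set)"
    show "Int_stable ?E" by (auto simp: Int_stable_def box_Int_box)
    show "?E \<subseteq> Pow UNIV" "sets (density lborel (\<lambda>x. ennreal (P x))) = sigma_sets UNIV ?E"
      "sets (density lborel (\<lambda>x. ennreal (N x))) = sigma_sets UNIV ?E" by (simp_all add: borel_eq_box)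
    let ?A = "\<lambda>n::nat. box (- (real n *\<^sub>R One)) (real n *\<^sub>R One) :: 'a set"
    show "range ?A \<subseteq> ?E" "(\<Union>i. ?A i) = UNIV" unfolding UN_box_eq_UNIV by auto
    have em: "emeasure (density lborel (\<lambda>x. ennreal (h x))) (box a b) = ennreal (integral\<^sup>L lborel (\<lambda>x. h x * indicator (box a b) x))"
      if "integrable lborel h" "\<And>x. 0 \<le> h x" for h :: "'a \<Rightarrow> real" and a b
    proof -
      have "emeasure (density lborel (\<lambda>x. ennreal (h x))) (box a b) = (\<integral>\<^sup>+x. ennreal (h x * indicator (box a b) x) \<partial>lborel)"
        using that by (subst emeasure_density) (auto intro!: nn_integral_cong simp: indicator_def)
      also have "\<dots> = ennreal (integral\<^sup>L lborel (\<lambda>x. h x * indicator (box a b) x))"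
        using that by (intro nn_integral_eq_integral integrable_real_mult_indicator) auto
      finally show ?thesis .
    qed
    show "emeasure (density lborel (\<lambda>x. ennreal (P x))) (?A i) \<noteq> \<infinity>" for i
      by (subst em[OF iP]) (auto simp: P_def)
    fix X assume "X \<in> ?E"
    then obtain a b where X: "X = box a b" by auto
    have i: "integrable lborel (\<lambda>x. P x * indicator X x)" "integrable lborel (\<lambda>x. N x * indicator X x)"
      unfolding X by (intro integrable_real_mult_indicator iP iN; simp)+
    have "g x * indicator X x = P x * indicator X x - N x * indicator X x" for x by (auto simp: P_def N_def indicator_def)
    then have "integral\<^sup>L lborel (\<lambda>x. P x * indicator X x) - integral\<^sup>L lborel (\<lambda>x. N x * indicator X x) = 0"
      using box[of a b] i by (simp add: X flip: Bochner_Integration.integral_diff)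
    then have PN: "integral\<^sup>L lborel (\<lambda>x. P x * indicator X x) = integral\<^sup>L lborel (\<lambda>x. N x * indicator X x)" by simp
    then show "emeasure (density lborel (\<lambda>x. ennreal (P x))) X = emeasure (density lborel (\<lambda>x. ennreal (N x))) X"
      using em[OF iP, of a b] em[OF iN, of a b] PN by (simp add: X P_def N_def)
  qed
  then have "AE x in lborel. ennreal (P x) = ennreal (N x)"
    by (subst (asm) finite_density_unique) (use fin gm in \<open>auto simp: P_def N_def\<close>)
  then show ?thesis by eventually_elim (auto simp: P_def N_def max_def split: if_splits)
qed

text \<open>A bump positive on a ball turns f into an integrable function whose integrals over boxes
  are limits of integrals against test functions. Countably many balls exhaust the space.\<close>

lemma fundamental_lemma:
  assumes f: "\<And>\<phi>. test_fun \<phi> \<Longrightarrow> integrable lborel (\<lambda>x. f x * \<phi> x)"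
    "\<And>\<phi>. test_fun \<phi> \<Longrightarrow> integral\<^sup>L lborel (\<lambda>x. f x * \<phi> x) = 0"
  shows "AE x in lborel. f x = 0"
proof -
  have "AE x in lborel. f x * ball_bump (real n) x = 0" for n
  proof (rule AE_zero_of_box_integrals)
    have \<phi>: "test_fun (ball_bump (real n))" by (rule test_fun_ball_bump) simp
    show g: "integrable lborel (\<lambda>x. f x * ball_bump (real n) x)" by (rule f(1)[OF \<phi>])
    fix a b :: "real^3"
    obtain \<psi> :: "nat \<Rightarrow> real^3 \<Rightarrow> real" where \<psi>: "\<And>k. smooth_fun (\<psi> k)" "\<And>k x. \<bar>\<psi> k x\<bar> \<le> 1"
      "\<And>x. (\<lambda>k. \<psi> k x) \<longlonglongrightarrow> indicator (box a b) x" using box_approx by blast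
    have z: "integral\<^sup>L lborel (\<lambda>x. f x * ball_bump (real n) x * \<psi> k x) = 0" for k
      using f(2)[OF test_fun_mult[OF \<psi>(1)[of k] \<phi>]] by (simp add: mult_ac)
    have "(\<lambda>k. integral\<^sup>L lborel (\<lambda>x. f x * ball_bump (real n) x * \<psi> k x)) \<longlonglongrightarrow>
        integral\<^sup>L lborel (\<lambda>x. f x * ball_bump (real n) x * indicator (box a b) x)"
    proof (rule integral_dominated_convergence[where w = "\<lambda>x. \<bar>f x * ball_bump (real n) x\<bar>"])
      show "integrable lborel (\<lambda>x. \<bar>f x * ball_bump (real n) x\<bar>)" using g by simp
      have m: "(\<lambda>x. f x * ball_bump (real n) x) \<in> borel_measurable lborel" using g by simp
      show "(\<lambda>x. f x * ball_bump (real n) x * indicator (box a b) x) \<in> borel_measurable lborel"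
        by (intro borel_measurable_times m) simp
      have "\<psi> k \<in> borel_measurable lborel" for k
        using smooth_fun_continuous[OF \<psi>(1)] by (simp add: borel_measurable_continuous_onI)
      then show "(\<lambda>x. f x * ball_bump (real n) x * \<psi> k x) \<in> borel_measurable lborel" for k
        by (intro borel_measurable_times m)
      show "AE x in lborel. (\<lambda>k. f x * ball_bump (real n) x * \<psi> k x) \<longlonglongrightarrow> f x * ball_bump (real n) x * indicator (box a b) x"
        by (intro AE_I2 tendsto_intros \<psi>)
      show "AE x in lborel. norm (f x * ball_bump (real n) x * \<psi> k x) \<le> \<bar>f x * ball_bump (real n) x\<bar>" for k
        using \<psi>(2) by (intro AE_I2) (auto simp: abs_mult mult_left_le)
    qed
    then show "integral\<^sup>L lborel (\<lambda>x. f x * ball_bump (real n) x * indicator (box a b) x) = 0"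
      unfolding z by (simp add: LIMSEQ_const_iff)
  qed
  then have "AE x in lborel. \<forall>n. f x * ball_bump (real n) x = 0" unfolding AE_all_countable by blast
  then show ?thesis
  proof eventually_elim
    case (elim x)
    obtain n :: nat where "norm x < real n" using reals_Archimedean2 by blast
    then show ?case using elim[rule_format, of n] ball_bump_pos[of x "real n"] by simp
  qed
qed

text \<open>By a rapidly converging subsequence.\<close>

lemma L2_complete:
  fixes f :: "nat \<Rightarrow> 'a \<Rightarrow> real"
  assumes m: "\<And>n. f n \<in> borel_measurable M"
    and i: "\<And>m n. integrable M (\<lambda>x. (f m x - f n x)\<^sup>2)"
    and c: "\<And>e. 0 < e \<Longrightarrow> \<exists>N. \<forall>m\<ge>N. \<forall>n\<ge>N. integral\<^sup>L M (\<lambda>x. (f m x - f n x)\<^sup>2) < e"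
  obtains g where "g \<in> borel_measurable M" "\<And>n. integrable M (\<lambda>x. (f n x - g x)\<^sup>2)"
    "(\<lambda>n. integral\<^sup>L M (\<lambda>x. (f n x - g x)\<^sup>2)) \<longlonglongrightarrow> 0"
proof -
  obtain N where N: "\<And>e m n. 0 < e \<Longrightarrow> N e \<le> m \<Longrightarrow> N e \<le> n \<Longrightarrow> integral\<^sup>L M (\<lambda>x. (f m x - f n x)\<^sup>2) < e"
    using c by metis
  \<comment> \<open>Indices along which the squared increments are at most 4^(-k) in the mean.
    Summing makes them monotone, and the \<open>+ 1\<close> makes them at least k.\<close>
  define r where "r k = (\<Sum>j\<le>k. N ((1/4) ^ j) + 1)" for k :: nat
  have rN: "N ((1/4) ^ k) \<le> r k" for k
    unfolding r_def using member_le_sum[of k "{..k}" "\<lambda>j. N ((1/4) ^ j) + 1"] by auto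
  have rS: "r k \<le> r (Suc k)" for k by (simp add: r_def)
  \<comment> \<open>The weight 2^k leaves a convergent series of integrals of 2^k u_k^2. Together
    with |u_k| <= 2^k u_k^2 + 2^(-k) this makes the telescoping series converge absolutely almost
    everywhere.\<close>
  define u where "u k x = f (r (Suc k)) x - f (r k) x" for k x
  have um: "u k \<in> borel_measurable M" for k unfolding u_def[abs_def] by (intro borel_measurable_diff m)
  have ui: "integral\<^sup>L M (\<lambda>x. (u k x)\<^sup>2) \<le> (1/4) ^ k" for k
    unfolding u_def using N[of "(1/4) ^ k" "r (Suc k)" "r k"] rN[of k] rS[of k] by simp
  have "(\<integral>\<^sup>+x. (\<Sum>k. ennreal (2 ^ k * (u k x)\<^sup>2)) \<partial>M) = (\<Sum>k. \<integral>\<^sup>+x. ennreal (2 ^ k * (u k x)\<^sup>2) \<partial>M)"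
    by (rule nn_integral_suminf) (use um in measurable)
  also have "\<dots> \<le> (\<Sum>k. ennreal ((1/2) ^ k))"
  proof (rule suminf_le)
    fix k
    have "integrable M (\<lambda>x. 2 ^ k * (u k x)\<^sup>2)" unfolding u_def by (intro integrable_mult_right i)
    then have "(\<integral>\<^sup>+x. ennreal (2 ^ k * (u k x)\<^sup>2) \<partial>M) = ennreal (2 ^ k * integral\<^sup>L M (\<lambda>x. (u k x)\<^sup>2))"
      by (subst nn_integral_eq_integral) auto
    also have "2 ^ k * integral\<^sup>L M (\<lambda>x. (u k x)\<^sup>2) \<le> 2 ^ k * (1/4) ^ k" using ui[of k] by (rule mult_left_mono) simp
    also have "2 ^ k * (1/4) ^ k = (1/2::real) ^ k" by (simp flip: power_mult_distrib)
    finally show "(\<integral>\<^sup>+x. ennreal (2 ^ k * (u k x)\<^sup>2) \<partial>M) \<le> ennreal ((1/2) ^ k)" by (simp add: ennreal_leI)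
  qed auto
  also have "\<dots> = ennreal (\<Sum>k. (1/2) ^ k)" by (rule suminf_ennreal2) auto
  finally have "(\<integral>\<^sup>+x. (\<Sum>k. ennreal (2 ^ k * (u k x)\<^sup>2)) \<partial>M) \<noteq> \<infinity>" by (auto simp: top_unique)
  then have "AE x in M. (\<Sum>k. ennreal (2 ^ k * (u k x)\<^sup>2)) \<noteq> \<infinity>"
    by (intro nn_integral_PInf_AE) (use um in measurable)
  then have "AE x in M. convergent (\<lambda>k. f (r k) x)"
  proof eventually_elim
    case (elim x)
    have "summable (\<lambda>k. 2 ^ k * (u k x)\<^sup>2)"
      by (rule summable_suminf_not_top) (use elim in auto)
    then have "summable (\<lambda>k. 2 ^ k * (u k x)\<^sup>2 + (1/2) ^ k)" by (intro summable_add) auto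
    then have "summable (\<lambda>k. u k x)"
    proof (rule summable_comparison_test'[of _ 0])
      fix k :: nat
      define s where "s = sqrt (2 ^ k)"
      have s: "0 < s" "s\<^sup>2 = 2 ^ k" by (auto simp: s_def)
      have "2 * (s * \<bar>u k x\<bar>) * (1 / s) \<le> (s * \<bar>u k x\<bar>)\<^sup>2 + (1 / s)\<^sup>2" by (rule sum_squares_bound)
      also have "\<dots> = 2 ^ k * (u k x)\<^sup>2 + (1/2) ^ k" by (simp add: power_mult_distrib power_divide s)
      finally show "norm (u k x) \<le> 2 ^ k * (u k x)\<^sup>2 + (1/2) ^ k" using s by simp
    qed
    then have "(\<lambda>n. \<Sum>k<n. u k x) \<longlonglongrightarrow> (\<Sum>k. u k x)" by (rule summable_LIMSEQ)
    then have "(\<lambda>n. f (r 0) x + (\<Sum>k<n. u k x)) \<longlonglongrightarrow> f (r 0) x + (\<Sum>k. u k x)" by (intro tendsto_intros)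
    moreover have "f (r 0) x + (\<Sum>k<n. u k x) = f (r n) x" for n
      unfolding u_def by (subst sum_lessThan_telescope) simp
    ultimately show ?case by (auto simp: convergent_def)
  qed
  then have conv: "AE x in M. (\<lambda>k. f (r k) x) \<longlonglongrightarrow> lim (\<lambda>k. f (r k) x)" by eventually_elim (simp add: convergent_LIMSEQ_iff)
  define g where "g x = lim (\<lambda>k. f (r k) x)" for x
  have gm: "g \<in> borel_measurable M" unfolding g_def[abs_def] by (rule borel_measurable_lim_metric) (rule m)
  have rk: "k \<le> r k" for k by (induction k) (auto simp: r_def)
  \<comment> \<open>Fatou along the subsequence. Only differences are estimated, since the functions
    themselves need not be square integrable.\<close>
  have fat: "(\<integral>\<^sup>+x. ennreal ((f n x - g x)\<^sup>2) \<partial>M) \<le> ennreal e" if e: "0 < e" "N e \<le> n" for e n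
  proof -
    have "(\<integral>\<^sup>+x. ennreal ((f n x - g x)\<^sup>2) \<partial>M) = (\<integral>\<^sup>+x. liminf (\<lambda>k. ennreal ((f n x - f (r k) x)\<^sup>2)) \<partial>M)"
    proof (rule nn_integral_cong_AE)
      show "AE x in M. ennreal ((f n x - g x)\<^sup>2) = liminf (\<lambda>k. ennreal ((f n x - f (r k) x)\<^sup>2))"
        using conv
      proof eventually_elim
        case (elim x)
        then have "(\<lambda>k. ennreal ((f n x - f (r k) x)\<^sup>2)) \<longlonglongrightarrow> ennreal ((f n x - g x)\<^sup>2)"
          unfolding g_def by (intro tendsto_intros)
        then show ?case by (rule lim_imp_Liminf[OF sequentially_bot, symmetric])
      qed
    qed
    also have "\<dots> \<le> liminf (\<lambda>k. \<integral>\<^sup>+x. ennreal ((f n x - f (r k) x)\<^sup>2) \<partial>M)"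
      by (rule nn_integral_liminf) (use m in measurable)
    also have "\<dots> \<le> ennreal e"
    proof (rule Liminf_le)
      show "\<forall>\<^sub>F k in sequentially. (\<integral>\<^sup>+x. ennreal ((f n x - f (r k) x)\<^sup>2) \<partial>M) \<le> ennreal e"
        using eventually_ge_at_top[of "N e"]
      proof eventually_elim
        case (elim k)
        then have "integral\<^sup>L M (\<lambda>x. (f n x - f (r k) x)\<^sup>2) < e" using e rk[of k] by (intro N) auto
        then show ?case by (subst nn_integral_eq_integral[OF i]) (auto intro: ennreal_leI)
      qed
    qed simp
    finally show ?thesis .
  qed
  have big: "integrable M (\<lambda>x. (f n x - g x)\<^sup>2)" if "N 1 \<le> n" for n
  proof (rule integrableI_bounded)
    show "(\<lambda>x. (f n x - g x)\<^sup>2) \<in> borel_measurable M" using m gm by measurable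
    show "(\<integral>\<^sup>+x. ennreal (norm ((f n x - g x)\<^sup>2)) \<partial>M) < \<infinity>" using fat[OF _ that] by (auto intro: le_less_trans)
  qed
  show thesis
  proof (rule that[OF gm])
    show int: "integrable M (\<lambda>x. (f n x - g x)\<^sup>2)" for n
    proof (rule Bochner_Integration.integrable_bound)
      show "integrable M (\<lambda>x. 2 * (f n x - f (N 1) x)\<^sup>2 + 2 * (f (N 1) x - g x)\<^sup>2)"
        using i big[OF order_refl] by auto
      show "(\<lambda>x. (f n x - g x)\<^sup>2) \<in> borel_measurable M" using m gm by measurable
      have "(a - b)\<^sup>2 \<le> 2 * (a - c)\<^sup>2 + 2 * (c - b)\<^sup>2" for a b c :: real
        using sum_squares_bound[of "a - c" "c - b"] by (simp add: power2_eq_square algebra_simps)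
      then show "AE x in M. norm ((f n x - g x)\<^sup>2) \<le> norm (2 * (f n x - f (N 1) x)\<^sup>2 + 2 * (f (N 1) x - g x)\<^sup>2)"
        by (intro AE_I2) simp
    qed
    show "(\<lambda>n. integral\<^sup>L M (\<lambda>x. (f n x - g x)\<^sup>2)) \<longlonglongrightarrow> 0"
    proof (rule LIMSEQ_I)
      fix e :: real assume e: "0 < e"
      have "norm (integral\<^sup>L M (\<lambda>x. (f n x - g x)\<^sup>2) - 0) < e" if "N (e / 2) \<le> n" for n
      proof -
        have "ennreal (integral\<^sup>L M (\<lambda>x. (f n x - g x)\<^sup>2)) \<le> ennreal (e / 2)"
          using fat[OF _ that] e by (subst nn_integral_eq_integral[OF int, symmetric]) auto
        then have "integral\<^sup>L M (\<lambda>x. (f n x - g x)\<^sup>2) \<le> e / 2" using e by (simp add: ennreal_le_iff)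
        moreover have "0 \<le> integral\<^sup>L M (\<lambda>x. (f n x - g x)\<^sup>2)" by simp
        ultimately show ?thesis using e by simp
      qed
      then show "\<exists>n0. \<forall>n\<ge>n0. norm (integral\<^sup>L M (\<lambda>x. (f n x - g x)\<^sup>2) - 0) < e" by blast
    qed
  qed
qed

text \<open>Young's inequality with a free parameter replaces the Hoelder inequalities.\<close>

lemma L2_weak_limit:
  fixes f :: "nat \<Rightarrow> 'a \<Rightarrow> real"
  assumes m: "\<And>n. f n \<in> borel_measurable M" "g \<in> borel_measurable M" "h \<in> borel_measurable M"
    and i: "\<And>n. integrable M (\<lambda>x. (f n x - g x)\<^sup>2)" and lim: "(\<lambda>n. integral\<^sup>L M (\<lambda>x. (f n x - g x)\<^sup>2)) \<longlonglongrightarrow> 0"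
    and h: "integrable M (\<lambda>x. (h x)\<^sup>2)" and f: "\<And>n. integrable M (\<lambda>x. h x * f n x)"
  shows "integrable M (\<lambda>x. h x * g x)" "(\<lambda>n. integral\<^sup>L M (\<lambda>x. h x * f n x)) \<longlonglongrightarrow> integral\<^sup>L M (\<lambda>x. h x * g x)"
proof -
  have young: "\<bar>a * b\<bar> \<le> e * a\<^sup>2 + b\<^sup>2 / e" if "0 < e" for a b e :: real
  proof -
    have "2 * (sqrt e * \<bar>a\<bar>) * (\<bar>b\<bar> / sqrt e) \<le> (sqrt e * \<bar>a\<bar>)\<^sup>2 + (\<bar>b\<bar> / sqrt e)\<^sup>2" by (rule sum_squares_bound)
    then have "2 * \<bar>a * b\<bar> \<le> e * a\<^sup>2 + b\<^sup>2 / e" using that by (simp add: power_mult_distrib power_divide abs_mult)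
    then show ?thesis using abs_ge_zero[of "a * b"] by linarith
  qed
  have di: "integrable M (\<lambda>x. h x * (f n x - g x))" for n
  proof (rule Bochner_Integration.integrable_bound)
    show "integrable M (\<lambda>x. (h x)\<^sup>2 + (f n x - g x)\<^sup>2)" using h i by auto
    show "(\<lambda>x. h x * (f n x - g x)) \<in> borel_measurable M" using m by measurable
    show "AE x in M. norm (h x * (f n x - g x)) \<le> norm ((h x)\<^sup>2 + (f n x - g x)\<^sup>2)"
      using young[of 1] by (intro AE_I2) simp
  qed
  have "integrable M (\<lambda>x. h x * f 0 x - h x * (f 0 x - g x))" by (intro Bochner_Integration.integrable_diff f di)
  then show gi: "integrable M (\<lambda>x. h x * g x)" by (simp add: algebra_simps)
  show "(\<lambda>n. integral\<^sup>L M (\<lambda>x. h x * f n x)) \<longlonglongrightarrow> integral\<^sup>L M (\<lambda>x. h x * g x)"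
  proof (rule LIMSEQ_I)
    fix e :: real assume e: "0 < e"
    define H where "H = integral\<^sup>L M (\<lambda>x. (h x)\<^sup>2)"
    have H: "0 \<le> H" by (simp add: H_def)
    define c where "c = e / (2 * (H + 1))"
    have c: "0 < c" "c * H \<le> e / 2" using e H by (auto simp: c_def field_simps)
    have "0 < c * e / 2" using c e by simp
    then obtain N where N: "\<And>n. N \<le> n \<Longrightarrow> norm (integral\<^sup>L M (\<lambda>x. (f n x - g x)\<^sup>2) - 0) < c * e / 2"
      using LIMSEQ_D[OF lim] by blast
    have "norm (integral\<^sup>L M (\<lambda>x. h x * f n x) - integral\<^sup>L M (\<lambda>x. h x * g x)) < e" if "N \<le> n" for n
    proof -
      have "integral\<^sup>L M (\<lambda>x. h x * f n x) - integral\<^sup>L M (\<lambda>x. h x * g x) = integral\<^sup>L M (\<lambda>x. h x * (f n x - g x))"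
        unfolding right_diff_distrib by (rule Bochner_Integration.integral_diff[symmetric, OF f gi])
      also have "norm \<dots> \<le> integral\<^sup>L M (\<lambda>x. norm (h x * (f n x - g x)))" by (rule integral_norm_bound)
      also have "\<dots> \<le> integral\<^sup>L M (\<lambda>x. c * (h x)\<^sup>2 + (f n x - g x)\<^sup>2 / c)"
        using young[OF c(1)] di h i by (intro integral_mono) auto
      also have "\<dots> = c * H + integral\<^sup>L M (\<lambda>x. (f n x - g x)\<^sup>2) / c" using h i by (simp add: H_def)
      also have "\<dots> < e / 2 + e / 2"
      proof (rule add_le_less_mono[OF c(2)])
        have "integral\<^sup>L M (\<lambda>x. (f n x - g x)\<^sup>2) < c * e / 2" using N[OF that] by simp
        then show "integral\<^sup>L M (\<lambda>x. (f n x - g x)\<^sup>2) / c < e / 2" using c by (simp add: field_simps)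
      qed
      finally show ?thesis by simp
    qed
    then show "\<exists>n0. \<forall>n\<ge>n0. norm (integral\<^sup>L M (\<lambda>x. h x * f n x) - integral\<^sup>L M (\<lambda>x. h x * g x)) < e" by blast
  qed
qed

text \<open>Either y <= e or y <= y^6/e^5, so h y <= e h + B y^6/e^5. The first integral is small
  with e, and the second tends to 0 for fixed e.\<close>

lemma L6_weak_limit:
  fixes d :: "nat \<Rightarrow> 'a \<Rightarrow> real"
  assumes m: "\<And>n. d n \<in> borel_measurable M" "h \<in> borel_measurable M"
    and d0: "\<And>n x. 0 \<le> d n x" and i: "\<And>n. integrable M (\<lambda>x. d n x ^ 6)"
    and lim: "(\<lambda>n. integral\<^sup>L M (\<lambda>x. d n x ^ 6)) \<longlonglongrightarrow> 0"
    and h: "integrable M h" "\<And>x. 0 \<le> h x" "\<And>x. h x \<le> B"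
  shows "integrable M (\<lambda>x. h x * d n x)" "(\<lambda>n. integral\<^sup>L M (\<lambda>x. h x * d n x)) \<longlonglongrightarrow> 0"
proof -
  have B: "0 \<le> B" using h(2,3)[of undefined] by linarith
  have young: "h x * y \<le> e * h x + B * y ^ 6 / e ^ 5" if "0 < e" "0 \<le> y" for y e :: real and x
  proof (cases "y \<le> e")
    case True
    have "h x * y \<le> h x * e" using True h(2) by (rule mult_left_mono)
    moreover have "0 \<le> B * y ^ 6 / e ^ 5" using B that by simp
    ultimately show ?thesis by (simp add: mult.commute)
  next
    case False
    have "e ^ 5 \<le> y ^ 5" using False that by (intro power_mono) auto
    then have "y * e ^ 5 \<le> y ^ 6" using that mult_left_mono[of "e^5" "y^5" y] by (simp add: power_numeral_reduce)
    then have "y \<le> y ^ 6 / e ^ 5" using that by (simp add: field_simps)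
    then have "h x * y \<le> B * (y ^ 6 / e ^ 5)" using h that B by (intro mult_mono) auto
    moreover have "0 \<le> e * h x" using that h(2) by simp
    ultimately show ?thesis by simp
  qed
  show di: "integrable M (\<lambda>x. h x * d n x)" for n
  proof (rule Bochner_Integration.integrable_bound)
    show "integrable M (\<lambda>x. 1 * h x + B * d n x ^ 6 / 1 ^ 5)" using h i by auto
    show "(\<lambda>x. h x * d n x) \<in> borel_measurable M" using m by measurable
    show "AE x in M. norm (h x * d n x) \<le> norm (1 * h x + B * d n x ^ 6 / 1 ^ 5)"
      using young[of 1] d0 h(2) B by (intro AE_I2) (simp add: abs_mult)
  qed
  show "(\<lambda>n. integral\<^sup>L M (\<lambda>x. h x * d n x)) \<longlonglongrightarrow> 0"
  proof (rule LIMSEQ_I)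
    fix e :: real assume e: "0 < e"
    define H where "H = integral\<^sup>L M h"
    have H: "0 \<le> H" using h(2) by (simp add: H_def)
    define c where "c = e / (2 * (H + 1))"
    have c: "0 < c" "c * H \<le> e / 2" using e H by (auto simp: c_def field_simps)
    have "0 < e * c ^ 5 / (2 * (B + 1))" using c e B by simp
    then obtain N where N: "\<And>n. N \<le> n \<Longrightarrow> norm (integral\<^sup>L M (\<lambda>x. d n x ^ 6) - 0) < e * c ^ 5 / (2 * (B + 1))"
      using LIMSEQ_D[OF lim] by blast
    have "norm (integral\<^sup>L M (\<lambda>x. h x * d n x) - 0) < e" if n: "N \<le> n" for n
    proof -
      have "0 \<le> integral\<^sup>L M (\<lambda>x. h x * d n x)" using d0 h(2) by simp
      then have "norm (integral\<^sup>L M (\<lambda>x. h x * d n x) - 0) = integral\<^sup>L M (\<lambda>x. h x * d n x)" by simp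
      also have "\<dots> \<le> integral\<^sup>L M (\<lambda>x. c * h x + B * d n x ^ 6 / c ^ 5)"
        using young[OF c(1)] d0 di h i by (intro integral_mono) auto
      also have "\<dots> = c * H + B * integral\<^sup>L M (\<lambda>x. d n x ^ 6) / c ^ 5" using h i by (simp add: H_def)
      also have "\<dots> < e / 2 + e / 2"
      proof (rule add_le_less_mono[OF c(2)])
        define I where "I = integral\<^sup>L M (\<lambda>x. d n x ^ 6)"
        have I: "0 \<le> I" "I < e * c ^ 5 / (2 * (B + 1))" using N[OF n] d0 by (auto simp: I_def)
        have "B * I \<le> (B + 1) * I" using I by (intro mult_right_mono) auto
        also have "\<dots> < (B + 1) * (e * c ^ 5 / (2 * (B + 1)))" using I B by (intro mult_strict_left_mono) auto
        also have "\<dots> = c ^ 5 * (e / 2)" using B by (simp add: field_simps)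
        finally have "B * I < c ^ 5 * (e / 2)" .
        then show "B * integral\<^sup>L M (\<lambda>x. d n x ^ 6) / c ^ 5 < e / 2"
          unfolding I_def[symmetric] using c by (simp add: pos_divide_less_eq mult.commute)
      qed
      finally show ?thesis by simp
    qed
    then show "\<exists>n0. \<forall>n\<ge>n0. norm (integral\<^sup>L M (\<lambda>x. h x * d n x) - 0) < e" by blast
  qed
qed

section \<open>Weak Jacobians of fields in the completion\<close>

lemma test_fieldD:
  assumes "test_field F"
  shows "test_fun (\<lambda>x. F x $ i)" "smooth_fun (\<lambda>x. F x $ i)" "(\<lambda>x. F x $ i) differentiable (at x)"
    "test_fun (pd (\<lambda>x. F x $ i) j)" "F \<in> borel_measurable lborel"
proof -
  show 1: "test_fun (\<lambda>x. F x $ i)" for i using assms by (simp add: test_field_def)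
  then show "smooth_fun (\<lambda>x. F x $ i)" "(\<lambda>x. F x $ i) differentiable (at x)" "test_fun (pd (\<lambda>x. F x $ i) j)"
    by (auto intro: test_fun_smooth smooth_fun_differentiable test_fun_pd)
  have "continuous_on UNIV (\<lambda>x. \<chi> i. F x $ i)"
    by (intro continuous_on_vec_lambda smooth_fun_continuous[OF test_fun_smooth[OF 1]])
  then have "continuous_on UNIV F" by simp
  then show "F \<in> borel_measurable lborel" by (simp add: borel_measurable_continuous_onI)
qed

lemma borel_measurable_matrix:
  fixes D :: "'a \<Rightarrow> real^3^3"
  assumes "\<And>i j. (\<lambda>x. D x $ i $ j) \<in> borel_measurable M"
  shows "D \<in> borel_measurable M"
  by (subst borel_measurable_euclidean_space) (auto simp: Basis_vec_def inner_axis assms)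

lemma borel_measurable_nth: "F \<in> borel_measurable M \<Longrightarrow> (\<lambda>x. (F x :: real^3) $ i) \<in> borel_measurable M"
  using borel_measurable_inner[of F M "\<lambda>_. axis i 1"] by (simp add: inner_axis)

lemma borel_measurable_nth_nth: "D \<in> borel_measurable M \<Longrightarrow> (\<lambda>x. (D x :: real^3^3) $ i $ j) \<in> borel_measurable M"
  using borel_measurable_inner[of D M "\<lambda>_. axis i (axis j 1)"] by (simp add: inner_axis)

lemma pd_field_diff:
  assumes "test_field F" "test_field G"
  shows "pd (\<lambda>y. (F y - G y) $ i) j x = pd (\<lambda>y. F y $ i) j x - pd (\<lambda>y. G y $ i) j x"
  unfolding vector_minus_component by (rule pd_diff[OF test_fieldD(3)[OF assms(1)] test_fieldD(3)[OF assms(2)]])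

lemma integrable_test_sq: "test_fun f \<Longrightarrow> integrable lborel (\<lambda>x. (f x)\<^sup>2)"
  unfolding power2_eq_square by (intro integrable_mult_test smooth_fun_continuous test_fun_smooth)

text \<open>The partial derivatives of an approximating sequence are Cauchy in L^2. Their limits
  form the weak Jacobian, since integration by parts passes to the limit under L^6 convergence of
  the fields. The sequence is returned too, for later limit passages.\<close>

lemma D12_weak_jac:
  assumes V: "V \<in> D12"
  obtains \<phi> J where "\<And>k. test_field (\<phi> k)" "\<And>k. integrable lborel (\<lambda>x. norm (\<phi> k x - V x) ^ 6)"
    "(\<lambda>k. integral\<^sup>L lborel (\<lambda>x. norm (\<phi> k x - V x) ^ 6)) \<longlonglongrightarrow> 0" "weak_jac V J"
    "\<And>k i j. integrable lborel (\<lambda>x. (pd (\<lambda>y. \<phi> k y $ i) j x - J x $ i $ j)\<^sup>2)"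
    "\<And>i j. (\<lambda>k. integral\<^sup>L lborel (\<lambda>x. (pd (\<lambda>y. \<phi> k y $ i) j x - J x $ i $ j)\<^sup>2)) \<longlonglongrightarrow> 0"
    "\<And>i j. (\<lambda>x. J x $ i $ j) \<in> borel_measurable lborel"
proof -
  obtain \<phi> where t: "\<And>k. test_field (\<phi> k)"
    and i6: "\<And>k. integrable lborel (\<lambda>x. norm (\<phi> k x - V x) ^ 6)"
    and l6: "(\<lambda>k. integral\<^sup>L lborel (\<lambda>x. norm (\<phi> k x - V x) ^ 6)) \<longlonglongrightarrow> 0"
    and cau: "\<And>e. 0 < e \<Longrightarrow> \<exists>N. \<forall>m\<ge>N. \<forall>n\<ge>N. integral\<^sup>L lborel (grad_sq (\<lambda>y. \<phi> m y - \<phi> n y)) < e"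
    and Vm: "V \<in> borel_measurable lborel"
    using V unfolding D12_def by blast
  define P where "P i j k = pd (\<lambda>y. \<phi> k y $ i) j" for i j k
  have Pt: "test_fun (P i j k)" for i j k unfolding P_def by (rule test_fieldD(4)[OF t])
  have Pm: "P i j k \<in> borel_measurable lborel" for i j k
    using smooth_fun_continuous[OF test_fun_smooth[OF Pt]] by (simp add: borel_measurable_continuous_onI)
  have Pi: "integrable lborel (\<lambda>x. (P i j m x - P i j n x)\<^sup>2)" for i j m n
    by (rule integrable_test_sq[OF test_fun_diff[OF Pt Pt]])
  have gs: "grad_sq (\<lambda>y. \<phi> m y - \<phi> n y) = (\<lambda>x. \<Sum>i\<in>UNIV. \<Sum>j\<in>UNIV. (P i j m x - P i j n x)\<^sup>2)" for m n
    unfolding grad_sq_def P_def pd_field_diff[OF t t] ..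
  define Q where "Q i j g \<longleftrightarrow> g \<in> borel_measurable lborel \<and> (\<forall>n. integrable lborel (\<lambda>x. (P i j n x - g x)\<^sup>2)) \<and>
      (\<lambda>n. integral\<^sup>L lborel (\<lambda>x. (P i j n x - g x)\<^sup>2)) \<longlonglongrightarrow> 0" for i j g
  have "\<exists>g. Q i j g" for i j
  proof -
    have c: "\<exists>N. \<forall>m\<ge>N. \<forall>n\<ge>N. integral\<^sup>L lborel (\<lambda>x. (P i j m x - P i j n x)\<^sup>2) < e" if "0 < e" for e
    proof -
      have "integral\<^sup>L lborel (\<lambda>x. (P i j m x - P i j n x)\<^sup>2) \<le> integral\<^sup>L lborel (grad_sq (\<lambda>y. \<phi> m y - \<phi> n y))" for m n
        unfolding gs
      proof (rule integral_mono)
        show "integrable lborel (\<lambda>x. \<Sum>i\<in>UNIV. \<Sum>j\<in>UNIV. (P i j m x - P i j n x)\<^sup>2)" by (intro Bochner_Integration.integrable_sum Pi)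
        fix x
        have "(P i j m x - P i j n x)\<^sup>2 \<le> (\<Sum>j\<in>UNIV. (P i j m x - P i j n x)\<^sup>2)" by (rule member_le_sum) auto
        also have "\<dots> \<le> (\<Sum>i\<in>UNIV. \<Sum>j\<in>UNIV. (P i j m x - P i j n x)\<^sup>2)"
          by (rule member_le_sum[of i UNIV "\<lambda>i. \<Sum>j\<in>UNIV. (P i j m x - P i j n x)\<^sup>2"]) (auto intro: sum_nonneg)
        finally show "(P i j m x - P i j n x)\<^sup>2 \<le> (\<Sum>i\<in>UNIV. \<Sum>j\<in>UNIV. (P i j m x - P i j n x)\<^sup>2)" .
      qed (rule Pi)
      then show ?thesis using cau[OF that] by (meson le_less_trans)
    qed
    obtain g where "g \<in> borel_measurable lborel" "\<And>n. integrable lborel (\<lambda>x. (P i j n x - g x)\<^sup>2)"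
      "(\<lambda>n. integral\<^sup>L lborel (\<lambda>x. (P i j n x - g x)\<^sup>2)) \<longlonglongrightarrow> 0"
      by (rule L2_complete[OF Pm Pi c]) (assumption | rule that; assumption)+
    then have "Q i j g" unfolding Q_def by blast
    then show ?thesis by blast
  qed
  then obtain g where "\<And>i j. Q i j (g i j)" by metis
  then have gm: "\<And>i j. g i j \<in> borel_measurable lborel"
    and gi: "\<And>i j n. integrable lborel (\<lambda>x. (P i j n x - g i j x)\<^sup>2)"
    and gl: "\<And>i j. (\<lambda>n. integral\<^sup>L lborel (\<lambda>x. (P i j n x - g i j x)\<^sup>2)) \<longlonglongrightarrow> 0" unfolding Q_def by blast+
  define J :: "real^3 \<Rightarrow> real^3^3" where "J x = (\<chi> i j. g i j x)" for x
  have Jc: "J x $ i $ j = g i j x" for x i j by (simp add: J_def)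
  have d: "(\<lambda>x. norm (\<phi> k x - V x)) \<in> borel_measurable lborel" for k
    by (rule measurable_compose[OF borel_measurable_diff[OF test_fieldD(5)[OF t] Vm] borel_measurable_norm])
  have "weak_jac V J"
    unfolding weak_jac_def
  proof (intro conjI allI impI)
    show "J \<in> borel_measurable lborel" by (rule borel_measurable_matrix, unfold Jc, rule gm)
    fix \<psi> i j assume \<psi>: "test_fun \<psi>"
    have \<psi>c: "continuous_on UNIV \<psi>" and p\<psi>: "test_fun (pd \<psi> j)" and p\<psi>c: "continuous_on UNIV (pd \<psi> j)"
      using \<psi> by (auto intro!: smooth_fun_continuous test_fun_smooth test_fun_pd)
    have p\<psi>m: "pd \<psi> j \<in> borel_measurable lborel" and \<psi>m: "\<psi> \<in> borel_measurable lborel"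
      using \<psi>c p\<psi>c by (simp_all add: borel_measurable_continuous_onI)
    have i1: "integrable lborel (\<lambda>x. \<psi> x * P i j k x)" for k by (rule integrable_mult_test[OF \<psi>c Pt])
    note L2 = L2_weak_limit[OF Pm gm \<psi>m gi gl integrable_test_sq[OF \<psi>] i1]
    show "integrable lborel (\<lambda>x. J x $ i $ j * \<psi> x)" using L2(1) by (simp add: Jc mult.commute)
    obtain R where R: "\<And>x. R < norm x \<Longrightarrow> pd \<psi> j x = 0" using test_funE[OF p\<psi>] by blast
    have "bounded (pd \<psi> j ` cball 0 R)"
      using p\<psi>c by (intro compact_imp_bounded compact_continuous_image) (auto intro: continuous_on_subset)
    then obtain B where "\<And>x. norm x \<le> R \<Longrightarrow> \<bar>pd \<psi> j x\<bar> \<le> B" by (force simp: bounded_iff)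
    then have B: "\<bar>pd \<psi> j x\<bar> \<le> max B 0" for x using R[of x] by (cases "norm x \<le> R") (auto simp: le_max_iff_disj)
    have ip: "integrable lborel (\<lambda>x. \<bar>pd \<psi> j x\<bar>)"
      using R p\<psi>c by (intro integrable_continuous_support[of _ R] continuous_intros) auto
    have abs_m: "(\<lambda>x. \<bar>pd \<psi> j x\<bar>) \<in> borel_measurable lborel" by (intro borel_measurable_abs p\<psi>m)
    note L6 = L6_weak_limit[OF d abs_m norm_ge_zero i6 l6 ip abs_ge_zero B]
    have dm: "(\<lambda>x. (\<phi> k x - V x) $ i * pd \<psi> j x) \<in> borel_measurable lborel" for k
      by (intro borel_measurable_times p\<psi>m borel_measurable_nth borel_measurable_diff test_fieldD(5)[OF t] Vm)
    have dle: "norm ((\<phi> k x - V x) $ i * pd \<psi> j x) \<le> \<bar>pd \<psi> j x\<bar> * norm (\<phi> k x - V x)" for k x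
      using component_le_norm_cart[of "\<phi> k x - V x" i] by (simp add: abs_mult mult.commute mult_left_mono)
    have di: "integrable lborel (\<lambda>x. (\<phi> k x - V x) $ i * pd \<psi> j x)" for k
      by (rule Bochner_Integration.integrable_bound[OF L6(1)[of k] dm]) (use dle in \<open>auto intro!: AE_I2 order_trans[OF dle]\<close>)
    have dlim: "(\<lambda>k. integral\<^sup>L lborel (\<lambda>x. (\<phi> k x - V x) $ i * pd \<psi> j x)) \<longlonglongrightarrow> 0"
    proof (rule Lim_null_comparison[OF _ L6(2)], intro always_eventually allI)
      fix k
      have "norm (integral\<^sup>L lborel (\<lambda>x. (\<phi> k x - V x) $ i * pd \<psi> j x)) \<le> integral\<^sup>L lborel (\<lambda>x. norm ((\<phi> k x - V x) $ i * pd \<psi> j x))"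
        by (rule integral_norm_bound)
      also have "\<dots> \<le> integral\<^sup>L lborel (\<lambda>x. \<bar>pd \<psi> j x\<bar> * norm (\<phi> k x - V x))"
        using di L6(1) dle by (intro integral_mono) auto
      finally show "norm (integral\<^sup>L lborel (\<lambda>x. (\<phi> k x - V x) $ i * pd \<psi> j x)) \<le> integral\<^sup>L lborel (\<lambda>x. \<bar>pd \<psi> j x\<bar> * norm (\<phi> k x - V x))" .
    qed
    have fi: "integrable lborel (\<lambda>x. \<phi> k x $ i * pd \<psi> j x)" for k
      by (rule integrable_mult_test[OF smooth_fun_continuous[OF test_fieldD(2)[OF t]] p\<psi>])
    have "integrable lborel (\<lambda>x. \<phi> 0 x $ i * pd \<psi> j x - (\<phi> 0 x - V x) $ i * pd \<psi> j x)"
      by (intro Bochner_Integration.integrable_diff fi di)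
    then show Vi: "integrable lborel (\<lambda>x. V x $ i * pd \<psi> j x)" by (simp add: algebra_simps)
    have eq: "integral\<^sup>L lborel (\<lambda>x. V x $ i * pd \<psi> j x) =
        - integral\<^sup>L lborel (\<lambda>x. \<psi> x * P i j k x) - integral\<^sup>L lborel (\<lambda>x. (\<phi> k x - V x) $ i * pd \<psi> j x)" for k
    proof -
      have "integral\<^sup>L lborel (\<lambda>x. (\<phi> k x - V x) $ i * pd \<psi> j x) = integral\<^sup>L lborel (\<lambda>x. \<phi> k x $ i * pd \<psi> j x - V x $ i * pd \<psi> j x)"
        by (simp add: algebra_simps)
      also have "\<dots> = integral\<^sup>L lborel (\<lambda>x. \<phi> k x $ i * pd \<psi> j x) - integral\<^sup>L lborel (\<lambda>x. V x $ i * pd \<psi> j x)"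
        by (rule Bochner_Integration.integral_diff[OF fi Vi])
      also have "integral\<^sup>L lborel (\<lambda>x. \<phi> k x $ i * pd \<psi> j x) = - integral\<^sup>L lborel (\<lambda>x. P i j k x * \<psi> x)"
        unfolding P_def by (rule integral_by_parts[OF test_fieldD(3)[OF t] smooth_fun_continuous[OF test_fun_smooth[OF test_fieldD(4)[OF t]]] \<psi>])
      finally show ?thesis by (simp add: mult.commute)
    qed
    have "(\<lambda>k. - integral\<^sup>L lborel (\<lambda>x. \<psi> x * P i j k x) - integral\<^sup>L lborel (\<lambda>x. (\<phi> k x - V x) $ i * pd \<psi> j x))
        \<longlonglongrightarrow> - integral\<^sup>L lborel (\<lambda>x. \<psi> x * g i j x) - 0"
      by (intro tendsto_diff tendsto_minus L2(2) dlim)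
    then have "(\<lambda>k. integral\<^sup>L lborel (\<lambda>x. V x $ i * pd \<psi> j x)) \<longlonglongrightarrow> - integral\<^sup>L lborel (\<lambda>x. \<psi> x * g i j x) - 0"
      by (simp only: eq[symmetric])
    then show "integral\<^sup>L lborel (\<lambda>x. V x $ i * pd \<psi> j x) = - integral\<^sup>L lborel (\<lambda>x. J x $ i $ j * \<psi> x)"
      by (simp add: LIMSEQ_const_iff Jc mult.commute)
  qed
  show thesis
    by (rule that[of \<phi> J, OF t i6 l6 \<open>weak_jac V J\<close>]) (use gi gl gm in \<open>simp_all add: Jc P_def[abs_def]\<close>)
qed

lemma weak_jac_unique:
  assumes "weak_jac U J" "weak_jac U K"
  shows "AE x in lborel. J x = K x"
proof -
  have "AE x in lborel. J x $ i $ j - K x $ i $ j = 0" for i j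
  proof (rule fundamental_lemma)
    fix \<phi> :: "real^3 \<Rightarrow> real" assume \<phi>: "test_fun \<phi>"
    have J: "integrable lborel (\<lambda>x. J x $ i $ j * \<phi> x)" "integral\<^sup>L lborel (\<lambda>x. U x $ i * pd \<phi> j x) = - integral\<^sup>L lborel (\<lambda>x. J x $ i $ j * \<phi> x)"
      using assms(1) \<phi> unfolding weak_jac_def by blast+
    have K: "integrable lborel (\<lambda>x. K x $ i $ j * \<phi> x)" "integral\<^sup>L lborel (\<lambda>x. U x $ i * pd \<phi> j x) = - integral\<^sup>L lborel (\<lambda>x. K x $ i $ j * \<phi> x)"
      using assms(2) \<phi> unfolding weak_jac_def by blast+
    show "integrable lborel (\<lambda>x. (J x $ i $ j - K x $ i $ j) * \<phi> x)"
      unfolding left_diff_distrib by (rule Bochner_Integration.integrable_diff[OF J(1) K(1)])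
    show "integral\<^sup>L lborel (\<lambda>x. (J x $ i $ j - K x $ i $ j) * \<phi> x) = 0"
      unfolding left_diff_distrib using J(2) K(2) by (subst Bochner_Integration.integral_diff[OF J(1) K(1)]) simp
  qed
  then have "AE x in lborel. \<forall>i\<in>UNIV. \<forall>j\<in>UNIV. J x $ i $ j - K x $ i $ j = 0"
    by (intro AE_finite_allI) auto
  then show ?thesis by eventually_elim (simp add: vec_eq_iff)
qed

text \<open>\<open>wjac\<close> is a Hilbert choice; by uniqueness any explicitly known weak
  Jacobian may replace it almost everywhere.\<close>

lemma curl_AE:
  assumes "weak_jac U J"
  shows "AE x in lborel. curl U x = vector [J x$3$2 - J x$2$3, J x$1$3 - J x$3$1, J x$2$1 - J x$1$2]"
proof -
  have "weak_jac U (wjac U)" unfolding wjac_def by (rule someI[of "weak_jac U"]) (rule assms)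
  from weak_jac_unique[OF this assms] show ?thesis by eventually_elim (simp add: curl_def Let_def)
qed

lemma curl_measurable:
  assumes "weak_jac U J"
  shows "(\<lambda>x. curl U x $ i) \<in> borel_measurable lborel"
proof -
  have "weak_jac U (wjac U)" unfolding wjac_def by (rule someI[of "weak_jac U"]) (rule assms)
  then have "(\<lambda>x. wjac U x $ i $ j) \<in> borel_measurable lborel" for i j
    by (intro borel_measurable_nth_nth) (simp add: weak_jac_def)
  then show ?thesis using exhaust_3[of i] by (auto simp: curl_def Let_def intro!: borel_measurable_diff)
qed

lemma weak_jac_C1:
  assumes U: "U \<in> borel_measurable lborel" and d: "\<And>i x. (\<lambda>y. U y $ i) differentiable (at x)"
    and c: "\<And>i j. continuous_on UNIV (pd (\<lambda>y. U y $ i) j)"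
  shows "weak_jac U (\<lambda>x. \<chi> i j. pd (\<lambda>y. U y $ i) j x)"
  unfolding weak_jac_def
proof (intro conjI allI impI)
  show "(\<lambda>x. \<chi> i j. pd (\<lambda>y. U y $ i) j x) \<in> borel_measurable lborel"
    using c by (intro borel_measurable_matrix) (simp add: borel_measurable_continuous_onI)
  fix \<phi> i j assume \<phi>: "test_fun \<phi>"
  have "continuous_on UNIV (\<lambda>y. U y $ i)"
    using d by (meson continuous_at_imp_continuous_on differentiable_imp_continuous_within)
  then show "integrable lborel (\<lambda>x. U x $ i * pd \<phi> j x)" by (rule integrable_mult_test[OF _ test_fun_pd[OF \<phi>]])
  show "integrable lborel (\<lambda>x. (\<chi> i j. pd (\<lambda>y. U y $ i) j x) $ i $ j * \<phi> x)"
    using integrable_mult_test[OF c \<phi>] by simp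
  show "integral\<^sup>L lborel (\<lambda>x. U x $ i * pd \<phi> j x) = - integral\<^sup>L lborel (\<lambda>x. (\<chi> i j. pd (\<lambda>y. U y $ i) j x) $ i $ j * \<phi> x)"
    using integral_by_parts[OF d c \<phi>] by simp
qed

text \<open>The classical curl, in contrast to \<open>curl\<close>, which goes through the chosen
  weak Jacobian.\<close>

definition rot :: "(real^3 \<Rightarrow> real^3) \<Rightarrow> real^3 \<Rightarrow> real^3" where
  "rot F x = vector [pd (\<lambda>y. F y $ 3) 2 x - pd (\<lambda>y. F y $ 2) 3 x,
                     pd (\<lambda>y. F y $ 1) 3 x - pd (\<lambda>y. F y $ 3) 1 x,
                     pd (\<lambda>y. F y $ 2) 1 x - pd (\<lambda>y. F y $ 1) 2 x]"

lemma inner3: "x \<bullet> y = x$1 * y$1 + x$2 * y$2 + x$3 * y$3" for x y :: "real^3"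
  unfolding inner_vec_def by (simp add: sum_3)

lemma inner_vector3: "x \<bullet> vector [a, b, c] = x$1 * a + x$2 * b + x$3 * c" for x :: "real^3"
  by (simp add: inner3)

text \<open>A critical point only has to be tested against smooth fields: both sides of the weak equation pass to
  the limit along the approximating sequence of an arbitrary \<open>V\<close> in the completion.\<close>

lemma weak_solutionI:
  fixes U c :: "real^3 \<Rightarrow> real^3"
  assumes UJ: "weak_jac U DU" and cU: "AE x in lborel. curl U x = c x"
    and cd: "\<And>i x. (\<lambda>y. c y $ i) differentiable (at x)" and cc: "\<And>i j. continuous_on UNIV (pd (\<lambda>y. c y $ i) j)"
    and c2: "\<And>i. integrable lborel (\<lambda>x. (c x $ i)\<^sup>2)"
    and Uc: "continuous_on UNIV U" and U5: "integrable lborel (\<lambda>x. norm (U x) ^ 5)" "\<And>x. norm (U x) ^ 5 \<le> B"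
    and eq: "\<And>x. rot c x = norm (U x) ^ 4 *\<^sub>R U x" and V: "V \<in> D12"
  shows "integral\<^sup>L lborel (\<lambda>x. curl U x \<bullet> curl V x) = integral\<^sup>L lborel (\<lambda>x. norm (U x) ^ 4 * (U x \<bullet> V x))"
proof -
  obtain \<phi> J where t: "\<And>k. test_field (\<phi> k)" and i6: "\<And>k. integrable lborel (\<lambda>x. norm (\<phi> k x - V x) ^ 6)"
    and l6: "(\<lambda>k. integral\<^sup>L lborel (\<lambda>x. norm (\<phi> k x - V x) ^ 6)) \<longlonglongrightarrow> 0" and J: "weak_jac V J"
    and gi: "\<And>k i j. integrable lborel (\<lambda>x. (pd (\<lambda>y. \<phi> k y $ i) j x - J x $ i $ j)\<^sup>2)"
    and gl: "\<And>i j. (\<lambda>k. integral\<^sup>L lborel (\<lambda>x. (pd (\<lambda>y. \<phi> k y $ i) j x - J x $ i $ j)\<^sup>2)) \<longlonglongrightarrow> 0"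
    and Jm: "\<And>i j. (\<lambda>x. J x $ i $ j) \<in> borel_measurable lborel"
    by (rule D12_weak_jac[OF V]) (rule that; assumption)
  have Vm: "V \<in> borel_measurable lborel" using V by (simp add: D12_def)
  have Um: "U \<in> borel_measurable lborel" using Uc by (simp add: borel_measurable_continuous_onI)
  have ccont: "continuous_on UNIV (\<lambda>y. c y $ i)" for i
    using cd by (meson continuous_at_imp_continuous_on differentiable_imp_continuous_within)
  have cm: "(\<lambda>y. c y $ i) \<in> borel_measurable lborel" for i using ccont by (simp add: borel_measurable_continuous_onI)
  have Pm: "pd (\<lambda>y. \<phi> k y $ i) j \<in> borel_measurable lborel" for k i j
    using smooth_fun_continuous[OF test_fun_smooth[OF test_fieldD(4)[OF t]]] by (simp add: borel_measurable_continuous_onI)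
  define I where "I k l i j = integral\<^sup>L lborel (\<lambda>x. c x $ l * pd (\<lambda>y. \<phi> k y $ i) j x)" for k l i j
  define I' where "I' l i j = integral\<^sup>L lborel (\<lambda>x. c x $ l * J x $ i $ j)" for l i j
  have fi: "integrable lborel (\<lambda>x. c x $ l * pd (\<lambda>y. \<phi> k y $ i) j x)" for k l i j
    by (rule integrable_mult_test[OF ccont test_fieldD(4)[OF t]])
  have Ji: "integrable lborel (\<lambda>x. c x $ l * J x $ i $ j)" for l i j
    by (rule L2_weak_limit(1)[OF Pm Jm cm gi gl c2 fi])
  have Ilim: "(\<lambda>k. I k l i j) \<longlonglongrightarrow> I' l i j" for l i j
    unfolding I_def I'_def by (rule L2_weak_limit(2)[OF Pm Jm cm gi gl c2 fi])
  have fJ: "integrable lborel (\<lambda>x. pd (\<lambda>y. c y $ i) j x * \<phi> k x $ l)" for i j k l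
    by (rule integrable_mult_test[OF cc test_fieldD(1)[OF t]])
  have parts: "I k l i j = - integral\<^sup>L lborel (\<lambda>x. pd (\<lambda>y. c y $ l) j x * \<phi> k x $ i)" for k l i j
    unfolding I_def by (rule integral_by_parts[OF cd cc test_fieldD(1)[OF t]])
  \<comment> \<open>The curl is formally self-adjoint: integrating the six terms by parts moves it
    from \<open>\<phi> k\<close> onto \<open>c\<close>, where the pointwise equation
    applies.\<close>
  have test: "(I k 1 3 2 - I k 1 2 3) + (I k 2 1 3 - I k 2 3 1) + (I k 3 2 1 - I k 3 1 2)
      = integral\<^sup>L lborel (\<lambda>x. norm (U x) ^ 4 * (U x \<bullet> \<phi> k x))" for k
  proof -
    have "norm (U x) ^ 4 * (U x \<bullet> \<phi> k x) = rot c x \<bullet> \<phi> k x" for x unfolding eq by simp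
    then have "integral\<^sup>L lborel (\<lambda>x. norm (U x) ^ 4 * (U x \<bullet> \<phi> k x)) = integral\<^sup>L lborel (\<lambda>x.
        (pd (\<lambda>y. c y $ 3) 2 x * \<phi> k x $ 1 - pd (\<lambda>y. c y $ 2) 3 x * \<phi> k x $ 1)
        + (pd (\<lambda>y. c y $ 1) 3 x * \<phi> k x $ 2 - pd (\<lambda>y. c y $ 3) 1 x * \<phi> k x $ 2)
        + (pd (\<lambda>y. c y $ 2) 1 x * \<phi> k x $ 3 - pd (\<lambda>y. c y $ 1) 2 x * \<phi> k x $ 3))"
      by (simp add: inner3 rot_def left_diff_distrib)
    also have "\<dots> = (- I k 3 1 2 + I k 2 1 3) + (- I k 1 2 3 + I k 3 2 1) + (- I k 2 3 1 + I k 1 3 2)"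
      unfolding parts
      by (subst Bochner_Integration.integral_add Bochner_Integration.integral_diff,
          (intro Bochner_Integration.integrable_add Bochner_Integration.integrable_diff fJ)+)+ simp
    finally show ?thesis by simp
  qed
  have d: "(\<lambda>x. norm (\<phi> k x - V x)) \<in> borel_measurable lborel" for k
    by (rule measurable_compose[OF borel_measurable_diff[OF test_fieldD(5)[OF t] Vm] borel_measurable_norm])
  have hm: "(\<lambda>x. norm (U x) ^ 5) \<in> borel_measurable lborel" using Um by measurable
  note L6 = L6_weak_limit[OF d hm norm_ge_zero i6 l6 U5(1) zero_le_power[OF norm_ge_zero] U5(2)]
  have dle: "norm (norm (U x) ^ 4 * (U x \<bullet> (\<phi> k x - V x))) \<le> norm (U x) ^ 5 * norm (\<phi> k x - V x)" for k x
  proof -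
    have "norm (U x) ^ 4 * \<bar>U x \<bullet> (\<phi> k x - V x)\<bar> \<le> norm (U x) ^ 4 * (norm (U x) * norm (\<phi> k x - V x))"
      by (intro mult_left_mono Cauchy_Schwarz_ineq2) auto
    then show ?thesis by (simp add: abs_mult power_numeral_reduce mult_ac)
  qed
  have dm: "(\<lambda>x. norm (U x) ^ 4 * (U x \<bullet> (\<phi> k x - V x))) \<in> borel_measurable lborel" for k
    using Um Vm test_fieldD(5)[OF t] by measurable
  have di: "integrable lborel (\<lambda>x. norm (U x) ^ 4 * (U x \<bullet> (\<phi> k x - V x)))" for k
    by (rule Bochner_Integration.integrable_bound[OF L6(1)[of k] dm], rule AE_I2, rule order_trans[OF dle]) simp
  have dlim: "(\<lambda>k. integral\<^sup>L lborel (\<lambda>x. norm (U x) ^ 4 * (U x \<bullet> (\<phi> k x - V x)))) \<longlonglongrightarrow> 0"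
  proof (rule Lim_null_comparison[OF _ L6(2)], intro always_eventually allI)
    fix k
    have "norm (integral\<^sup>L lborel (\<lambda>x. norm (U x) ^ 4 * (U x \<bullet> (\<phi> k x - V x)))) \<le> integral\<^sup>L lborel (\<lambda>x. norm (norm (U x) ^ 4 * (U x \<bullet> (\<phi> k x - V x))))"
      by (rule integral_norm_bound)
    also have "\<dots> \<le> integral\<^sup>L lborel (\<lambda>x. norm (U x) ^ 5 * norm (\<phi> k x - V x))"
      using di L6(1) dle by (intro integral_mono) auto
    finally show "norm (integral\<^sup>L lborel (\<lambda>x. norm (U x) ^ 4 * (U x \<bullet> (\<phi> k x - V x)))) \<le> integral\<^sup>L lborel (\<lambda>x. norm (U x) ^ 5 * norm (\<phi> k x - V x))" .
  qed
  have fU: "integrable lborel (\<lambda>x. norm (U x) ^ 4 * (U x \<bullet> \<phi> k x))" for k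
  proof -
    have "integrable lborel (\<lambda>x. (norm (U x) ^ 4 * U x $ 1) * \<phi> k x $ 1 + (norm (U x) ^ 4 * U x $ 2) * \<phi> k x $ 2 + (norm (U x) ^ 4 * U x $ 3) * \<phi> k x $ 3)"
      by (intro Bochner_Integration.integrable_add integrable_mult_test test_fieldD(1)[OF t] continuous_intros Uc)
    then show ?thesis by (simp add: inner3 algebra_simps)
  qed
  have "integrable lborel (\<lambda>x. norm (U x) ^ 4 * (U x \<bullet> \<phi> 0 x) - norm (U x) ^ 4 * (U x \<bullet> (\<phi> 0 x - V x)))"
    by (intro Bochner_Integration.integrable_diff fU di)
  then have VU: "integrable lborel (\<lambda>x. norm (U x) ^ 4 * (U x \<bullet> V x))" by (simp add: inner_diff_right right_diff_distrib)
  have Ulim: "(\<lambda>k. integral\<^sup>L lborel (\<lambda>x. norm (U x) ^ 4 * (U x \<bullet> \<phi> k x))) \<longlonglongrightarrow> integral\<^sup>L lborel (\<lambda>x. norm (U x) ^ 4 * (U x \<bullet> V x))"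
  proof -
    have "integral\<^sup>L lborel (\<lambda>x. norm (U x) ^ 4 * (U x \<bullet> (\<phi> k x - V x))) =
      integral\<^sup>L lborel (\<lambda>x. norm (U x) ^ 4 * (U x \<bullet> \<phi> k x)) - integral\<^sup>L lborel (\<lambda>x. norm (U x) ^ 4 * (U x \<bullet> V x))" for k
      unfolding inner_diff_right right_diff_distrib by (rule Bochner_Integration.integral_diff[OF fU VU])
    then show ?thesis using dlim by (subst LIM_zero_iff[symmetric]) simp
  qed
  have "(\<lambda>k. (I k 1 3 2 - I k 1 2 3) + (I k 2 1 3 - I k 2 3 1) + (I k 3 2 1 - I k 3 1 2)) \<longlonglongrightarrow>
     (I' 1 3 2 - I' 1 2 3) + (I' 2 1 3 - I' 2 3 1) + (I' 3 2 1 - I' 3 1 2)"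
    by (intro tendsto_intros Ilim)
  then have "(I' 1 3 2 - I' 1 2 3) + (I' 2 1 3 - I' 2 3 1) + (I' 3 2 1 - I' 3 1 2) = integral\<^sup>L lborel (\<lambda>x. norm (U x) ^ 4 * (U x \<bullet> V x))"
    unfolding test using Ulim by (rule LIMSEQ_unique)
  moreover have "integral\<^sup>L lborel (\<lambda>x. curl U x \<bullet> curl V x) = integral\<^sup>L lborel (\<lambda>x.
      (c x $ 1 * J x $ 3 $ 2 - c x $ 1 * J x $ 2 $ 3) + (c x $ 2 * J x $ 1 $ 3 - c x $ 2 * J x $ 3 $ 1) + (c x $ 3 * J x $ 2 $ 1 - c x $ 3 * J x $ 1 $ 2))"
  proof (rule integral_cong_AE)
    show "(\<lambda>x. curl U x \<bullet> curl V x) \<in> borel_measurable lborel"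
      unfolding inner3 by (intro borel_measurable_add borel_measurable_times curl_measurable[OF UJ] curl_measurable[OF J])
    show "(\<lambda>x. (c x $ 1 * J x $ 3 $ 2 - c x $ 1 * J x $ 2 $ 3) + (c x $ 2 * J x $ 1 $ 3 - c x $ 2 * J x $ 3 $ 1)
        + (c x $ 3 * J x $ 2 $ 1 - c x $ 3 * J x $ 1 $ 2)) \<in> borel_measurable lborel"
      by (intro borel_measurable_add borel_measurable_diff borel_measurable_times cm Jm)
    show "AE x in lborel. curl U x \<bullet> curl V x =
      (c x $ 1 * J x $ 3 $ 2 - c x $ 1 * J x $ 2 $ 3) + (c x $ 2 * J x $ 1 $ 3 - c x $ 2 * J x $ 3 $ 1) + (c x $ 3 * J x $ 2 $ 1 - c x $ 3 * J x $ 1 $ 2)"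
      using cU curl_AE[OF J] by eventually_elim (simp add: inner_vector3 right_diff_distrib)
  qed
  moreover have "\<dots> = (I' 1 3 2 - I' 1 2 3) + (I' 2 1 3 - I' 2 3 1) + (I' 3 2 1 - I' 3 1 2)"
    unfolding I'_def
    by (subst Bochner_Integration.integral_add Bochner_Integration.integral_diff,
        (intro Bochner_Integration.integrable_add Bochner_Integration.integrable_diff Ji)+)+ simp
  ultimately show ?thesis by simp
qed

section \<open>Fields of a profile\<close>

text \<open>In the coordinates below \<open>nn = 1 + |x|^2\<close>, \<open>amp = psi^3\<close>, and \<open>sph x = xi_1^2 + xi_2^2\<close> for the point
  \<open>xi\<close> of the sphere over \<open>x\<close>. The field of a profile \<open>w\<close> is \<open>psi^3 w(sph) (- x_2, x_1, 0)\<close>.\<close>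

definition nn :: "real^3 \<Rightarrow> real" where "nn x = 1 + ((x$1)\<^sup>2 + (x$2)\<^sup>2 + (x$3)\<^sup>2)"
definition qq :: "real^3 \<Rightarrow> real" where "qq x = (x$1)\<^sup>2 + (x$2)\<^sup>2"
definition amp :: "real^3 \<Rightarrow> real" where "amp x = sqrt 8 * nn x powr (- 3/2)"
definition inn :: "real^3 \<Rightarrow> real" where "inn x = nn x powr (- 1)"
definition sph :: "real^3 \<Rightarrow> real" where "sph x = 4 * qq x * (inn x)\<^sup>2"

lemma nn_ge1: "1 \<le> nn x" by (simp add: nn_def)
lemma nn_pos: "0 < nn x" using nn_ge1[of x] by linarith
lemma nn_norm: "nn x = 1 + (norm x)\<^sup>2" by (simp add: nn_def norm3_sq)
lemma inn_eq: "inn x = 1 / nn x" using nn_pos[of x] by (simp add: inn_def powr_minus inverse_eq_divide)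
lemma nn_inn: "nn x * inn x = 1" using nn_pos[of x] by (simp add: inn_eq)
lemma inn_bounds: "0 < inn x" "inn x \<le> 1" using nn_ge1[of x] by (auto simp: inn_eq)
lemma amp_pos: "0 < amp x" using nn_pos[of x] by (simp add: amp_def)

lemma amp_sq: "(amp x)\<^sup>2 = 8 * inn x ^ 3"
proof -
  have "(nn x powr (- 3/2))\<^sup>2 = nn x powr (- 3)" using nn_pos[of x] by (simp add: power2_eq_square flip: powr_add)
  also have "\<dots> = (nn x powr (- 1)) ^ 3" using nn_pos[of x] by (simp add: powr_minus powr_numeral inverse_eq_divide power_one_over)
  finally show ?thesis by (simp add: amp_def inn_def power_mult_distrib)
qed

lemma qq_le: "0 \<le> qq x" "qq x \<le> nn x" "qq x * inn x \<le> 1"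
proof -
  show "0 \<le> qq x" "qq x \<le> nn x" by (auto simp: qq_def nn_def)
  then show "qq x * inn x \<le> 1" using nn_pos[of x] by (simp add: inn_eq)
qed

text \<open>With q = \<open>qq x\<close>, 4 q <= (1 + q)^2 by the inequality of arithmetic and
  geometric means, and 1 + q <= \<open>nn x\<close>.\<close>

lemma sph_mem: "sph x \<in> {0..1}"
proof -
  have "4 * qq x \<le> (1 + qq x)\<^sup>2" using zero_le_power2[of "1 - qq x"] by (simp add: power2_eq_square algebra_simps)
  also have "\<dots> \<le> (nn x)\<^sup>2" using qq_le(1)[of x] by (intro power_mono) (auto simp: qq_def nn_def)
  finally have "4 * qq x * (inn x)\<^sup>2 \<le> (nn x)\<^sup>2 * (inn x)\<^sup>2" by (rule mult_right_mono) simp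
  also have "\<dots> = 1" by (simp add: nn_inn flip: power_mult_distrib)
  finally show ?thesis using qq_le(1)[of x] by (simp add: sph_def)
qed

lemma smooth_nn: "smooth_fun nn" and smooth_qq: "smooth_fun qq" and smooth_inn: "smooth_fun inn"
  and smooth_amp: "smooth_fun amp" and smooth_sph: "smooth_fun sph"
proof -
  show n: "smooth_fun nn" and q: "smooth_fun qq" unfolding nn_def[abs_def] qq_def[abs_def]
    by (intro smooth_fun_add smooth_fun_power smooth_fun_nth smooth_fun_const)+
  show i: "smooth_fun inn" unfolding inn_def[abs_def] by (intro smooth_fun_powr n nn_pos)
  show "smooth_fun amp" unfolding amp_def[abs_def] by (intro smooth_fun_mult smooth_fun_const smooth_fun_powr n nn_pos)
  show "smooth_fun sph" unfolding sph_def[abs_def] by (intro smooth_fun_mult smooth_fun_power smooth_fun_const q i)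
qed

lemma pd_power2_nth: "pd (\<lambda>x. (x$i)\<^sup>2) j x = (if i = j then 2 * x$i else 0)"
  unfolding power2_eq_square
  by (subst pd_mult) (auto simp: pd_nth intro: smooth_fun_differentiable[OF smooth_fun_nth])

lemma diff_nth: "(\<lambda>x::real^3. x $ i) differentiable (at x)"
  by (rule smooth_fun_differentiable[OF smooth_fun_nth])

lemma diff_nth_sq: "(\<lambda>x::real^3. (x $ i)\<^sup>2) differentiable (at x)"
  by (intro smooth_fun_differentiable smooth_fun_power smooth_fun_nth)

definition dqq :: "3 \<Rightarrow> real^3 \<Rightarrow> real" where "dqq j x = (if j = 3 then 0 else 2 * x$j)"

lemma pd_qq: "pd qq j x = dqq j x"
  unfolding qq_def[abs_def] using exhaust_3[of j]
  by (subst pd_add[OF diff_nth_sq diff_nth_sq]) (auto simp: pd_power2_nth dqq_def)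

lemma pd_nn: "pd nn j x = 2 * x$j"
  unfolding nn_def[abs_def]
  by (subst pd_add, simp, intro smooth_fun_differentiable smooth_fun_add smooth_fun_power smooth_fun_nth,
      subst pd_add, intro smooth_fun_differentiable smooth_fun_add smooth_fun_power smooth_fun_nth, rule diff_nth_sq,
      subst pd_add[OF diff_nth_sq diff_nth_sq]) (use exhaust_3[of j] in \<open>auto simp: pd_power2_nth\<close>)

lemma pd_nn_powr: "pd (\<lambda>x. nn x powr a) j x = a * nn x powr (a - 1) * (2 * x$j)"
  using pd_compose[OF has_real_derivative_powr[OF nn_pos, of a x] smooth_fun_differentiable[OF smooth_nn], of j]
  by (simp add: pd_nn)

lemma pd_inn: "pd inn j x = - 2 * x$j * (inn x)\<^sup>2"
proof -
  have "nn x powr (- 1 - 1) = (nn x powr (- 1))\<^sup>2" unfolding power2_eq_square powr_add[symmetric] by simp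
  then show ?thesis unfolding inn_def[abs_def] pd_nn_powr by simp
qed

lemma pd_amp: "pd amp j x = - 3 * x$j * amp x * inn x"
proof -
  have "pd amp j x = sqrt 8 * pd (\<lambda>x. nn x powr (- 3/2)) j x"
    unfolding amp_def[abs_def]
    by (subst pd_mult) (auto intro: smooth_fun_differentiable smooth_fun_const smooth_fun_powr smooth_nn nn_pos)
  also have "\<dots> = sqrt 8 * (- 3/2 * nn x powr (- 3/2 - 1) * (2 * x$j))" by (simp only: pd_nn_powr)
  also have "nn x powr (- 3/2 - 1) = nn x powr (- 3/2) * nn x powr (- 1)" unfolding powr_add[symmetric] by simp
  finally have "pd amp j x = sqrt 8 * (- 3/2 * (nn x powr (- 3/2) * nn x powr (- 1)) * (2 * x$j))" .
  moreover have "sqrt 8 * (- 3/2 * (a * b) * (2 * x$j)) = - 3 * x$j * (sqrt 8 * a) * b" for a b by simp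
  ultimately show ?thesis unfolding amp_def[of x] inn_def[of x] by simp
qed

definition dsph :: "3 \<Rightarrow> real^3 \<Rightarrow> real" where
  "dsph j x = 4 * dqq j x * (inn x)\<^sup>2 - 16 * qq x * x$j * (inn x)^3"

lemma smooth_diff: "smooth_fun f \<Longrightarrow> f differentiable (at x)" by (rule smooth_fun_differentiable)

lemma pd_inn_power: "pd (\<lambda>x. inn x ^ Suc b) j x = - 2 * real (Suc b) * x$j * inn x ^ (b + 2)"
proof (induction b)
  case (Suc b)
  have "pd (\<lambda>x. inn x ^ Suc (Suc b)) j x = pd (\<lambda>x. inn x * inn x ^ Suc b) j x" by simp
  also have "\<dots> = inn x * pd (\<lambda>x. inn x ^ Suc b) j x + pd inn j x * inn x ^ Suc b"
    by (rule pd_mult) (intro smooth_diff smooth_inn smooth_fun_power)+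
  finally show ?case unfolding Suc.IH pd_inn by (simp add: algebra_simps power2_eq_square)
qed (simp add: pd_inn power2_eq_square)

lemma pd_sph: "pd sph j x = dsph j x"
proof -
  have "pd sph j x = (4 * qq x) * pd (\<lambda>x. inn x ^ Suc 1) j x + pd (\<lambda>x. 4 * qq x) j x * (inn x)\<^sup>2"
    unfolding sph_def[abs_def] numeral_2_eq_2 One_nat_def[symmetric]
    by (rule pd_mult) (intro smooth_diff smooth_inn smooth_qq smooth_fun_power smooth_fun_mult smooth_fun_const)+
  also have "pd (\<lambda>x. 4 * qq x) j x = 4 * dqq j x"
    by (subst pd_mult) (auto intro: smooth_diff smooth_qq smooth_fun_const simp: pd_qq)
  finally show ?thesis unfolding pd_inn_power by (simp add: dsph_def power3_eq_cube power2_eq_square)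
qed

text \<open>The monomials \<open>amp * qq * inn^b\<close> and \<open>amp * inn^b\<close> span the coefficients of all derivatives that occur.\<close>

definition mnm :: "nat \<Rightarrow> nat \<Rightarrow> real^3 \<Rightarrow> real" where "mnm a b x = amp x * qq x ^ a * inn x ^ b"

lemma smooth_mnm: "smooth_fun (mnm a b)"
  unfolding mnm_def[abs_def] by (intro smooth_fun_mult smooth_fun_power smooth_amp smooth_qq smooth_inn)

lemma pd_mnm0: "pd (mnm 0 b) j x = - (3 + 2 * real b) * x$j * (amp x * inn x ^ Suc b)"
proof (cases b)
  case 0
  then show ?thesis by (simp add: mnm_def[abs_def] pd_amp)
next
  case (Suc c)
  have "pd (\<lambda>x. amp x * inn x ^ Suc c) j x = amp x * pd (\<lambda>x. inn x ^ Suc c) j x + pd amp j x * inn x ^ Suc c"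
    by (rule pd_mult) (intro smooth_diff smooth_amp smooth_inn smooth_fun_power)+
  then show ?thesis unfolding Suc pd_inn_power pd_amp by (simp add: mnm_def[abs_def] algebra_simps)
qed

lemma pd_mnm1: "pd (mnm 1 b) j x = dqq j x * (amp x * inn x ^ b) - (3 + 2 * real b) * x$j * (amp x * qq x * inn x ^ Suc b)"
proof -
  have "pd (\<lambda>x. qq x * mnm 0 b x) j x = qq x * pd (mnm 0 b) j x + pd qq j x * mnm 0 b x"
    by (rule pd_mult) (intro smooth_diff smooth_qq smooth_mnm)+
  moreover have "(\<lambda>x. qq x * mnm 0 b x) = mnm 1 b" by (auto simp: mnm_def fun_eq_iff)
  ultimately show ?thesis unfolding pd_mnm0 pd_qq by (simp add: mnm_def algebra_simps)
qed

lemma diff_cmult: "f differentiable (at x) \<Longrightarrow> (\<lambda>x. c * f x) differentiable (at x)" for f :: "real^3 \<Rightarrow> real" and c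
  by (intro differentiable_mult differentiable_const)

lemma pd_cmult: "f differentiable (at x) \<Longrightarrow> pd (\<lambda>x. c * f x) j x = c * pd f j x" for f :: "real^3 \<Rightarrow> real" and c
  by (subst pd_mult) auto

lemma pd_nth_mult: "f differentiable (at x) \<Longrightarrow> pd (\<lambda>x. x$i * f x) j x = x$i * pd f j x + (if i = j then 1 else 0) * f x"
  for f :: "real^3 \<Rightarrow> real"
  by (subst pd_mult[OF diff_nth]) (auto simp: pd_nth)

lemma pd_uminus: "f differentiable (at x) \<Longrightarrow> pd (\<lambda>x. - f x) j x = - pd f j x" for f :: "real^3 \<Rightarrow> real"
  using pd_cmult[of f x "-1" j] by simp

lemma diff_nth_mult: "f differentiable (at x) \<Longrightarrow> (\<lambda>x. x$i * f x) differentiable (at x)" for f :: "real^3 \<Rightarrow> real"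
  by (intro differentiable_mult diff_nth)

lemma diff_uminus: "f differentiable (at x) \<Longrightarrow> (\<lambda>x. - f x) differentiable (at x)" for f :: "real^3 \<Rightarrow> real"
  by (rule differentiable_minus)

section \<open>Derivatives of a profile field and of its curl\<close>

context
  fixes w w1 w2 :: "real \<Rightarrow> real"
begin

definition FF :: "real^3 \<Rightarrow> real" where "FF x = mnm 0 0 x * w (sph x)"
text \<open>\<open>aa\<close> and \<open>bb\<close> are the coefficients of the gradient of
  \<open>FF\<close>: its component in direction j is x_j \<open>aa\<close> for j = 1, 2 and x_3
  \<open>bb\<close> for j = 3. They differ by the derivative of the factor \<open>qq\<close> inside
  \<open>sph\<close>.\<close>

definition bb :: "real^3 \<Rightarrow> real" where
  "bb x = - 16 * (mnm 1 3 x * w1 (sph x)) - 3 * (mnm 0 1 x * w (sph x))"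
definition aa :: "real^3 \<Rightarrow> real" where "aa x = 8 * (mnm 0 2 x * w1 (sph x)) + bb x"
definition dbb :: "3 \<Rightarrow> real^3 \<Rightarrow> real" where
  "dbb j x = - 16 * (pd (mnm 1 3) j x * w1 (sph x) + mnm 1 3 x * (w2 (sph x) * dsph j x))
     - 3 * (pd (mnm 0 1) j x * w (sph x) + mnm 0 1 x * (w1 (sph x) * dsph j x))"
definition daa :: "3 \<Rightarrow> real^3 \<Rightarrow> real" where
  "daa j x = 8 * (pd (mnm 0 2) j x * w1 (sph x) + mnm 0 2 x * (w2 (sph x) * dsph j x)) + dbb j x"
definition field :: "real^3 \<Rightarrow> real^3" where "field x = vector [- x$2 * FF x, x$1 * FF x, 0]"
text \<open>The curl of \<open>field\<close>. For F = \<open>FF\<close> it is (-x_1 d_3 F, -x_2 d_3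
  F, 2 F + x_1 d_1 F + x_2 d_2 F), and \<open>rot_field\<close> verifies this.\<close>

definition rfield :: "real^3 \<Rightarrow> real^3" where
  "rfield x = vector [x$1 * (- x$3 * bb x), x$2 * (- x$3 * bb x), 2 * FF x + qq x * aa x]"

lemma field_nth: "field x $ 1 = - (x$2 * FF x)" "field x $ 2 = x$1 * FF x" "field x $ 3 = 0"
  by (simp_all add: field_def)

lemma rfield_nth: "rfield x $ 1 = - (x$1 * (x$3 * bb x))" "rfield x $ 2 = - (x$2 * (x$3 * bb x))" "rfield x $ 3 = 2 * FF x + qq x * aa x"
  by (simp_all add: rfield_def)

lemma norm_field_sq: "(norm (field x))\<^sup>2 = qq x * (FF x)\<^sup>2"
  unfolding norm3_sq by (simp add: field_nth qq_def power_mult_distrib algebra_simps)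

context
  assumes W: "C2_on {0..1} w w1 w2"
begin

text \<open>At 0 and 1 the profile has one-sided derivatives only, and \<open>sph\<close> attains
  these values on the axis and on a unit circle. The chain rule relative to the range of
  \<open>sph\<close> covers these points.\<close>

lemma comp_sph:
  assumes h: "\<And>t. t \<in> {0..1} \<Longrightarrow> (h has_real_derivative h' t) (at t within {0..1})" and g: "smooth_fun g"
  shows "(\<lambda>x. g x * h (sph x)) differentiable (at x)"
    "pd (\<lambda>x. g x * h (sph x)) j x = pd g j x * h (sph x) + g x * (h' (sph x) * dsph j x)"
proof -
  have r: "range sph \<subseteq> {0..1}" using sph_mem by auto
  have d: "(h has_real_derivative h' (sph x)) (at (sph x) within range sph)"
    by (rule has_field_derivative_subset[OF h[OF sph_mem] r])
  note c = differentiable_compose_range[OF d smooth_diff[OF smooth_sph]]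
  show "(\<lambda>x. g x * h (sph x)) differentiable (at x)" by (intro differentiable_mult smooth_diff g c)
  show "pd (\<lambda>x. g x * h (sph x)) j x = pd g j x * h (sph x) + g x * (h' (sph x) * dsph j x)"
    by (subst pd_mult[OF smooth_diff[OF g] c]) (simp add: pd_compose_range[OF d smooth_diff[OF smooth_sph]] pd_sph)
qed

lemma cont_comp_sph: "continuous_on {0..1} h \<Longrightarrow> continuous_on UNIV (\<lambda>x. h (sph x))"
  by (rule continuous_on_compose2[of "{0..1}" h]) (use sph_mem smooth_fun_continuous[OF smooth_sph] in auto)

lemma FF_diff: "FF differentiable (at x)"
  unfolding FF_def[abs_def] by (rule comp_sph(1)[OF C2_onD(1)[OF W] smooth_mnm])

lemma pd_FF: "pd FF j x = (if j = 3 then x$j * bb x else x$j * aa x)"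
proof -
  have "pd FF j x = pd (mnm 0 0) j x * w (sph x) + mnm 0 0 x * (w1 (sph x) * dsph j x)"
    unfolding FF_def[abs_def] by (rule comp_sph(2)[OF C2_onD(1)[OF W] smooth_mnm])
  then show ?thesis unfolding pd_mnm0 dsph_def dqq_def bb_def aa_def
    by (auto simp: mnm_def algebra_simps power_numeral_reduce)
qed

lemmas pd_profile = comp_sph[OF C2_onD(1)[OF W] smooth_mnm] and pd_profile1 = comp_sph[OF C2_onD(2)[OF W] smooth_mnm]

lemma bb_diff: "bb differentiable (at x)"
  unfolding bb_def[abs_def] by (intro differentiable_diff diff_cmult pd_profile(1) pd_profile1(1))

lemma pd_bb: "pd bb j x = dbb j x"
  unfolding bb_def[abs_def] dbb_def
  by (simp only: pd_diff[OF diff_cmult[OF pd_profile1(1)] diff_cmult[OF pd_profile(1)]] pd_cmult[OF pd_profile(1)] pd_cmult[OF pd_profile1(1)] pd_profile(2) pd_profile1(2))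

lemma aa_diff: "aa differentiable (at x)"
  unfolding aa_def[abs_def] by (intro differentiable_add diff_cmult pd_profile1(1) bb_diff)

lemma pd_aa: "pd aa j x = daa j x"
  unfolding aa_def[abs_def] daa_def
  by (simp only: pd_add[OF diff_cmult[OF pd_profile1(1)] bb_diff] pd_cmult[OF pd_profile1(1)] pd_profile1(2) pd_bb)

lemma cont_pieces: "continuous_on UNIV (\<lambda>x. w (sph x))" "continuous_on UNIV (\<lambda>x. w1 (sph x))" "continuous_on UNIV (\<lambda>x. w2 (sph x))"
  by (rule cont_comp_sph[OF C2_on_continuous(1)[OF W]], rule cont_comp_sph[OF C2_on_continuous(2)[OF W]], rule cont_comp_sph[OF C2_on_continuous(3)[OF W]])

lemma cont_dsph: "continuous_on UNIV (dsph j)"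
proof -
  have "dsph j = pd sph j" by (simp add: pd_sph fun_eq_iff)
  then show ?thesis using smooth_fun_continuous[OF smooth_fun_pd[OF smooth_sph]] by simp
qed

lemmas cont_mnm = smooth_fun_continuous[OF smooth_mnm] smooth_fun_continuous[OF smooth_fun_pd[OF smooth_mnm]]

lemma cont_aabb: "continuous_on UNIV aa" "continuous_on UNIV bb" "continuous_on UNIV FF"
    "continuous_on UNIV (daa j)" "continuous_on UNIV (dbb j)"
  unfolding aa_def[abs_def] bb_def[abs_def] FF_def[abs_def] daa_def[abs_def] dbb_def[abs_def]
  by (intro continuous_intros cont_pieces cont_dsph cont_mnm)+

lemma pd_field:
  "pd (\<lambda>y. field y $ 1) j x = - (x$2 * pd FF j x + (if 2 = j then 1 else 0) * FF x)"
  "pd (\<lambda>y. field y $ 2) j x = x$1 * pd FF j x + (if 1 = j then 1 else 0) * FF x"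
  "pd (\<lambda>y. field y $ 3) j x = 0"
  unfolding field_nth
  by (simp_all only: pd_uminus[OF diff_nth_mult[OF FF_diff]] pd_nth_mult[OF FF_diff] pd_const)

lemma field_diff: "(\<lambda>y. field y $ i) differentiable (at x)"
  using exhaust_3[of i] by (auto simp: field_nth intro!: diff_uminus diff_nth_mult FF_diff)

lemma cont_pd_FF: "continuous_on UNIV (pd FF j)"
proof -
  have "pd FF j = (\<lambda>x. if j = 3 then x$j * bb x else x$j * aa x)" by (simp add: pd_FF fun_eq_iff)
  then show ?thesis by (cases "j = 3") (auto intro!: continuous_intros cont_aabb)
qed

lemma cont_pd_field: "continuous_on UNIV (pd (\<lambda>y. field y $ i) j)"
proof -
  have "continuous_on UNIV (\<lambda>x. pd (\<lambda>y. field y $ 1) j x)" "continuous_on UNIV (\<lambda>x. pd (\<lambda>y. field y $ 2) j x)"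
    "continuous_on UNIV (\<lambda>x. pd (\<lambda>y. field y $ 3) j x)"
    unfolding pd_field by (intro continuous_intros cont_pd_FF cont_aabb)+
  then show ?thesis using exhaust_3[of i] by auto
qed

lemma field_cont: "continuous_on UNIV field"
proof -
  have "continuous_on UNIV (\<lambda>x. \<chi> i. field x $ i)"
    using field_diff by (intro continuous_on_vec_lambda) (meson continuous_at_imp_continuous_on differentiable_imp_continuous_within)
  then show ?thesis by simp
qed

lemma rot_field: "rot field x = rfield x"
  unfolding rot_def rfield_def pd_field pd_FF by (simp add: qq_def power2_eq_square algebra_simps)

lemma nth3_bb_diff: "(\<lambda>x. x$3 * bb x) differentiable (at x)" by (rule diff_nth_mult[OF bb_diff])

lemma qq_aa_diff: "(\<lambda>x. qq x * aa x) differentiable (at x)" by (intro differentiable_mult smooth_diff smooth_qq aa_diff)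

lemma pd_qq_aa: "pd (\<lambda>x. qq x * aa x) j x = qq x * daa j x + dqq j x * aa x"
  by (subst pd_mult[OF smooth_diff[OF smooth_qq] aa_diff]) (simp add: pd_aa pd_qq)

lemma pd_rfield:
  "pd (\<lambda>y. rfield y $ 1) j x = - (x$1 * (x$3 * dbb j x + (if 3 = j then 1 else 0) * bb x) + (if 1 = j then 1 else 0) * (x$3 * bb x))"
  "pd (\<lambda>y. rfield y $ 2) j x = - (x$2 * (x$3 * dbb j x + (if 3 = j then 1 else 0) * bb x) + (if 2 = j then 1 else 0) * (x$3 * bb x))"
  "pd (\<lambda>y. rfield y $ 3) j x = 2 * pd FF j x + (qq x * daa j x + dqq j x * aa x)"
  unfolding rfield_nth
  by (simp_all only: pd_uminus[OF diff_nth_mult[OF nth3_bb_diff]] pd_nth_mult[OF nth3_bb_diff] pd_nth_mult[OF bb_diff] pd_bb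
      pd_add[OF diff_cmult[OF FF_diff] qq_aa_diff] pd_cmult[OF FF_diff] pd_qq_aa)

lemma rfield_diff: "(\<lambda>y. rfield y $ i) differentiable (at x)"
  using exhaust_3[of i] by (auto simp: rfield_nth intro!: diff_uminus diff_nth_mult bb_diff differentiable_add qq_aa_diff diff_cmult FF_diff)

lemma cont_pd_rfield: "continuous_on UNIV (pd (\<lambda>y. rfield y $ i) j)"
proof -
  have dq: "continuous_on UNIV (dqq j)" by (cases "j = 3") (auto simp: dqq_def[abs_def] intro!: continuous_intros)
  have "continuous_on UNIV (\<lambda>x. pd (\<lambda>y. rfield y $ 1) j x)" "continuous_on UNIV (\<lambda>x. pd (\<lambda>y. rfield y $ 2) j x)"
    "continuous_on UNIV (\<lambda>x. pd (\<lambda>y. rfield y $ 3) j x)"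
    unfolding pd_rfield by (intro continuous_intros cont_pd_FF cont_aabb dq smooth_fun_continuous[OF smooth_qq])+
  then show ?thesis using exhaust_3[of i] by auto
qed

end

end

text \<open>Here n, i, q and z2 stand for \<open>nn\<close>, \<open>inn\<close>, \<open>qq\<close>
  and x_3^2. The left side is the scalar of the double curl divided by \<open>amp\<close>. After
  elimination of z2 it equals 4 i^2 times the left side of the profile equation minus 15/4 w, taken
  at s = 4 q i^2.\<close>

lemma reduced_equation:
  fixes n i q z2 w w1 w2 :: real
  assumes i: "n * i = 1" and z: "z2 = n - 1 - q"
    and ode: "4 * (4*q*i^2) * (1 - 4*q*i^2) * w2 + (8 - 12 * (4*q*i^2)) * w1 = 15/4 * w - (4*q*i^2)^2 * w^5"
  shows "4 * (8*i^2*w1 - 16*q*i^3*w1 - 3*i*w) + (- 16*q*i^3*w1 - 3*i*w)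
    + q * (8 * (- 7*i^3*w1 + i^2*w2*(8*i^2 - 16*q*i^3)) - 16 * ((2*i^3 - 9*q*i^4)*w1 + q*i^3*w2*(8*i^2 - 16*q*i^3))
           - 3 * (- 5*i^2*w + i*w1*(8*i^2 - 16*q*i^3)))
    + z2 * (- 16 * (- 9*q*i^4*w1 + q*i^3*w2*(- 16*q*i^3)) - 3 * (- 5*i^2*w + i*w1*(- 16*q*i^3)))
    = - 64 * q^2 * i^6 * w^5"
proof -
  have "4 * (8*i^2*w1 - 16*q*i^3*w1 - 3*i*w) + (- 16*q*i^3*w1 - 3*i*w)
    + q * (8 * (- 7*i^3*w1 + i^2*w2*(8*i^2 - 16*q*i^3)) - 16 * ((2*i^3 - 9*q*i^4)*w1 + q*i^3*w2*(8*i^2 - 16*q*i^3))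
           - 3 * (- 5*i^2*w + i*w1*(8*i^2 - 16*q*i^3)))
    + z2 * (- 16 * (- 9*q*i^4*w1 + q*i^3*w2*(- 16*q*i^3)) - 3 * (- 5*i^2*w + i*w1*(- 16*q*i^3)))
    = 4*i^2 * (4 * (4*q*i^2) * (1 - 4*q*i^2) * w2 + (8 - 12 * (4*q*i^2)) * w1 - 15/4 * w)"
    using i unfolding z by algebra
  also have "\<dots> = - 64 * q^2 * i^6 * w^5" using ode by algebra
  finally show ?thesis .
qed

lemma integrable_inverse_square: "integrable lborel (\<lambda>t::real. 1 / (1 + t\<^sup>2))"
proof -
  have d: "(arctan has_real_derivative 1 / (1 + t\<^sup>2)) (at t)" for t
    using DERIV_arctan[of t] by (simp add: inverse_eq_divide)
  have m: "(\<lambda>t::real. 1 / (1 + t\<^sup>2)) \<in> borel_measurable borel" by measurable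
  have half: "(\<integral>\<^sup>+t. ennreal (1 / (1 + t\<^sup>2)) * indicator {0..} t \<partial>lborel) = ennreal (pi / 2 - arctan 0)"
    by (rule nn_integral_FTC_atLeast[OF m d _ tendsto_arctan_at_top]) simp
  have refl': "(\<integral>\<^sup>+t. ennreal (1 / (1 + t\<^sup>2)) * indicator {..0} t \<partial>lborel)
      = (\<integral>\<^sup>+t. ennreal (1 / (1 + t\<^sup>2)) * indicator {0..} t \<partial>lborel)"
    by (subst nn_integral_real_affine[where c = "-1" and t = 0]) (auto intro!: nn_integral_cong simp: indicator_def)
  have "(\<integral>\<^sup>+t. ennreal (1 / (1 + t\<^sup>2)) \<partial>lborel)
      \<le> (\<integral>\<^sup>+t. ennreal (1 / (1 + t\<^sup>2)) * indicator {0..} t + ennreal (1 / (1 + t\<^sup>2)) * indicator {..0} t \<partial>lborel)"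
    by (intro nn_integral_mono) (auto simp: indicator_def)
  also have "\<dots> = ennreal (pi / 2 - arctan 0) + ennreal (pi / 2 - arctan 0)"
    by (subst nn_integral_add) (simp_all add: half refl')
  also have "\<dots> < \<infinity>" by simp
  finally show ?thesis by (simp add: integrable_iff_bounded)
qed

text \<open>(1 + |x|^2)^(-3) is at most the product of 1/(1 + x_b^2) over the three coordinates,
  which is integrable by Fubini. This function is the common majorant for squared gradients and
  sixth powers below.\<close>

lemma integrable_inn3: "integrable lborel (\<lambda>x. inn x ^ 3)"
proof (rule Bochner_Integration.integrable_bound)
  let ?h = "\<lambda>t::real. 1 / (1 + t\<^sup>2)"
  interpret product_sigma_finite "\<lambda>_::real^3. lborel :: real measure" ..
  have 1: "integrable (\<Pi>\<^sub>M b\<in>Basis. lborel) (\<lambda>f. \<Prod>b\<in>(Basis::(real^3) set). ?h (f b))"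
    by (rule product_integrable_prod) (use integrable_inverse_square in auto)
  have m: "(\<lambda>x::real^3. \<Prod>b\<in>Basis. ?h (x \<bullet> b)) \<in> borel_measurable borel" by measurable
  show "integrable lborel (\<lambda>x::real^3. \<Prod>b\<in>Basis. ?h (x \<bullet> b))"
    unfolding lborel_eq[where 'a = "real^3"]
  proof (subst integrable_distr_eq[OF _ m])
    show "(\<lambda>f. \<Sum>b\<in>(Basis::(real^3) set). f b *\<^sub>R b) \<in> measurable (\<Pi>\<^sub>M b\<in>Basis. lborel) borel" by measurable
    have "(\<Prod>b\<in>(Basis::(real^3) set). ?h ((\<Sum>c\<in>Basis. f c *\<^sub>R c) \<bullet> b)) = (\<Prod>b\<in>Basis. ?h (f b))" for f
      by (rule prod.cong) (simp_all add: inner_sum_left_Basis)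
    then show "integrable (\<Pi>\<^sub>M b\<in>Basis. lborel) (\<lambda>f. \<Prod>b\<in>(Basis::(real^3) set). ?h ((\<Sum>c\<in>Basis. f c *\<^sub>R c) \<bullet> b))"
      using 1 by simp
  qed
  show "(\<lambda>x. inn x ^ 3) \<in> borel_measurable lborel"
    using smooth_fun_continuous[OF smooth_fun_power[OF smooth_inn], of UNIV] by (simp add: borel_measurable_continuous_onI)
  show "AE x in lborel. norm (inn x ^ 3) \<le> norm (\<Prod>b\<in>(Basis::(real^3) set). ?h (x \<bullet> b))"
  proof (rule AE_I2)
    fix x :: "real^3"
    have "inn x ^ card (Basis :: (real^3) set) \<le> (\<Prod>b\<in>(Basis::(real^3) set). ?h (x \<bullet> b))"
      unfolding prod_constant[symmetric]
    proof (rule prod_mono)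
      fix b :: "real^3" assume b: "b \<in> Basis"
      have "(x \<bullet> b)\<^sup>2 \<le> (norm x)\<^sup>2" using Basis_le_norm[OF b, of x] by (metis abs_ge_zero power2_abs power_mono)
      then have "1 + (x \<bullet> b)\<^sup>2 \<le> nn x" by (simp add: nn_norm)
      moreover have "0 < 1 + (x \<bullet> b)\<^sup>2" by (simp add: add_pos_nonneg)
      ultimately show "0 \<le> inn x \<and> inn x \<le> ?h (x \<bullet> b)" using inn_bounds[of x] by (simp add: inn_eq frac_le)
    qed
    then show "norm (inn x ^ 3) \<le> norm (\<Prod>b\<in>(Basis::(real^3) set). ?h (x \<bullet> b))" using inn_bounds(1)[of x] by simp
  qed
qed

lemma nth_sq_le_nn: "\<bar>x$i\<bar> * \<bar>x$j\<bar> \<le> nn x" "(x$i)\<^sup>2 \<le> nn x"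
proof -
  have "\<bar>x$i\<bar> \<le> norm x" for i by (rule component_le_norm_cart)
  then show "\<bar>x$i\<bar> * \<bar>x$j\<bar> \<le> nn x" for j
    using mult_mono[of "\<bar>x$i\<bar>" "norm x" "\<bar>x$j\<bar>" "norm x"] by (simp add: nn_norm power2_eq_square)
  from this[of i] show "(x$i)\<^sup>2 \<le> nn x" by (simp add: power2_eq_square flip: abs_mult)
qed

text \<open>The double curl is -T (-x_2, x_1, 0) with T = Laplace F + (2/rho) d_rho F, where F =
  \<open>FF\<close> and rho^2 = \<open>qq\<close>. The reduced equation gives T = -rho^4 F^5, which
  is -|U|^4 F.\<close>

lemma rot_rfield:
  assumes W: "C2_on {0..1} w w1 w2"
    and ode: "\<And>t. t \<in> {0..1} \<Longrightarrow> 4 * t * (1 - t) * w2 t + (8 - 12 * t) * w1 t = 15/4 * w t - t\<^sup>2 * w t ^ 5"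
  shows "rot (rfield w w1) x = norm (field w x) ^ 4 *\<^sub>R field w x"
proof -
  define v v1 v2 q i A B where d: "v = w (sph x)" "v1 = w1 (sph x)" "v2 = w2 (sph x)" "q = qq x" "i = inn x"
    "A = 8 * (- 7*i^3 * v1 + i^2 * v2*(8*i^2 - 16*q*i^3)) - 16 * ((2*i^3 - 9*q*i^4) * v1 + q*i^3 * v2*(8*i^2 - 16*q*i^3))
           - 3 * (- 5*i^2 * v + i * v1*(8*i^2 - 16*q*i^3))"
    "B = - 16 * (- 9*q*i^4 * v1 + q*i^3 * v2*(- 16*q*i^3)) - 3 * (- 5*i^2 * v + i * v1*(- 16*q*i^3))"
  have s: "sph x = 4*q*i^2" by (simp add: d sph_def)
  have n: "nn x * i = 1" "(x$3)^2 = nn x - 1 - q" using nn_inn[of x] by (simp_all add: d) (simp add: nn_def qq_def)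
  have daa: "daa w w1 w2 j x = x$j * (amp x * A)" if "j \<noteq> 3" for j
    unfolding daa_def dbb_def pd_mnm0 pd_mnm1 dsph_def dqq_def using that
    by (simp add: d mnm_def algebra_simps power_numeral_reduce)
  have dbb: "dbb w w1 w2 3 x = x$3 * (amp x * B)"
    unfolding dbb_def pd_mnm0 pd_mnm1 dsph_def dqq_def
    by (simp add: d mnm_def algebra_simps power_numeral_reduce)
  \<comment> \<open>This symmetry makes the third component of the double curl vanish.\<close>
  have dbb': "dbb w w1 w2 j x * x$k = dbb w w1 w2 k x * x$j" if "j \<noteq> 3" "k \<noteq> 3" for j k
    unfolding dbb_def pd_mnm0 pd_mnm1 dsph_def dqq_def using that
    by (simp add: d mnm_def algebra_simps power_numeral_reduce)
  have aa: "aa w w1 x = amp x * (8*i^2 * v1 - 16*q*i^3 * v1 - 3*i * v)" and bb: "bb w w1 x = amp x * (- 16*q*i^3 * v1 - 3*i * v)"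
    unfolding aa_def bb_def by (simp_all add: d mnm_def algebra_simps power_numeral_reduce)
  have FF: "FF w x = amp x * v" by (simp add: FF_def mnm_def d)
  have red: "4 * (8*i^2 * v1 - 16*q*i^3 * v1 - 3*i * v) + (- 16*q*i^3 * v1 - 3*i * v) + q * A + (x$3)^2 * B = - 64 * q^2 * i^6 * v^5"
    unfolding d(6,7) by (rule reduced_equation[OF n]) (use ode[OF sph_mem, of x, folded d(1-3)] in \<open>unfold s\<close>)
  have "amp x ^ 5 = amp x * ((amp x)\<^sup>2)\<^sup>2" by (simp add: power_numeral_reduce)
  then have F5: "q^2 * FF w x ^ 5 = amp x * (64 * q^2 * i^6 * v^5)"
    unfolding FF power_mult_distrib amp_sq by (simp add: d(5) power_mult_distrib)
  \<comment> \<open>The summand 4 \<open>aa\<close> collects 2 \<open>aa\<close> from the Laplacian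
    and 2 \<open>aa\<close> from (2/rho) d_rho F.\<close>
  define T where "T = 4 * aa w w1 x + bb w w1 x + q * (amp x * A) + (x$3)^2 * (amp x * B)"
  have "T = amp x * (4 * (8*i^2 * v1 - 16*q*i^3 * v1 - 3*i * v) + (- 16*q*i^3 * v1 - 3*i * v) + q * A + (x$3)^2 * B)"
    unfolding T_def aa bb by (simp add: algebra_simps)
  then have T: "T = - (q^2 * FF w x ^ 5)" unfolding red F5 by simp
  have "(norm (field w x))\<^sup>2 = q * (FF w x)\<^sup>2" by (simp add: norm_field_sq d)
  then have n4: "norm (field w x) ^ 4 = (q * (FF w x)\<^sup>2)\<^sup>2"
    by (metis mult_2_right numeral_Bit0 power_add power2_eq_square)
  have "rot (rfield w w1) x = vector [x$2 * T, - (x$1 * T), 0]"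
  proof -
    have a: "dqq 2 x = 2 * x$2" "dqq 1 x = 2 * x$1" "pd (FF w) 2 x = x$2 * aa w w1 x" "pd (FF w) 1 x = x$1 * aa w w1 x"
      by (simp_all add: dqq_def pd_FF[OF W])
    have "x$1 * (x$3 * dbb w w1 w2 2 x) = x$2 * (x$3 * dbb w w1 w2 1 x)" using dbb'[of 1 2] by (simp add: algebra_simps)
    then have b: "x$1 * (x$3 * dbb w w1 w2 2 x) - x$2 * (x$3 * dbb w w1 w2 1 x) = 0" by simp
    show ?thesis unfolding rot_def pd_rfield[OF W] a
      by (simp add: daa dbb T_def d(4)[symmetric] b algebra_simps power2_eq_square)
  qed
  also have "\<dots> = norm (field w x) ^ 4 *\<^sub>R field w x"
    unfolding n4 T
    by (simp add: field_def vec_eq_iff forall_3 power_numeral_reduce)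
  finally show ?thesis .
qed

section \<open>Decay of a profile field, its gradient and its curl\<close>

context
  fixes w w1 w2 :: "real \<Rightarrow> real" and M :: real
  assumes W: "C2_on {0..1} w w1 w2" and M: "\<And>t. t \<in> {0..1} \<Longrightarrow> \<bar>w t\<bar> \<le> M" "\<And>t. t \<in> {0..1} \<Longrightarrow> \<bar>w1 t\<bar> \<le> M"
begin

lemma bound_nonneg: "0 \<le> M" using M(1)[of 0] by auto

lemma FF_bound: "\<bar>FF w x\<bar> \<le> M * amp x"
  using M(1)[OF sph_mem, of x] amp_pos[of x] by (simp add: FF_def mnm_def abs_mult mult.commute)

lemma qq_inn_bounds: "0 \<le> qq x * inn x" "qq x * inn x \<le> 1" using qq_le[of x] inn_bounds[of x] by auto

lemma inn_pow_le: "inn x ^ Suc k \<le> inn x"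
  using inn_bounds[of x] by (simp add: mult_le_cancel_left1 power_le_one)

lemma mnm_bounds: "\<bar>mnm 1 3 x\<bar> \<le> amp x * inn x" "\<bar>mnm 0 1 x\<bar> \<le> amp x * inn x" "\<bar>mnm 0 2 x\<bar> \<le> amp x * inn x"
proof -
  have p: "0 < amp x" "0 < inn x" "0 \<le> qq x" using amp_pos inn_bounds qq_le by auto
  have "qq x * inn x ^ 3 = (qq x * inn x) * inn x ^ Suc 1" by (simp add: power_numeral_reduce)
  also have "\<dots> \<le> 1 * inn x" by (intro mult_mono qq_inn_bounds inn_pow_le) (use p in auto)
  finally show "\<bar>mnm 1 3 x\<bar> \<le> amp x * inn x" using p by (simp add: mnm_def abs_mult)
  show "\<bar>mnm 0 1 x\<bar> \<le> amp x * inn x" "\<bar>mnm 0 2 x\<bar> \<le> amp x * inn x"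
    using p inn_pow_le[of x 1] by (auto simp: mnm_def abs_mult numeral_2_eq_2)
qed

lemma bb_bound: "\<bar>bb w w1 x\<bar> \<le> 19 * M * (amp x * inn x)" and aa_bound: "\<bar>aa w w1 x\<bar> \<le> 27 * M * (amp x * inn x)"
proof -
  have p: "0 \<le> amp x * inn x" using amp_pos[of x] inn_bounds[of x] by simp
  have 1: "\<bar>mnm 1 3 x * w1 (sph x)\<bar> \<le> (amp x * inn x) * M" "\<bar>mnm 0 1 x * w (sph x)\<bar> \<le> (amp x * inn x) * M"
    "\<bar>mnm 0 2 x * w1 (sph x)\<bar> \<le> (amp x * inn x) * M"
    unfolding abs_mult by (intro mult_mono mnm_bounds M sph_mem p; simp)+
  show b: "\<bar>bb w w1 x\<bar> \<le> 19 * M * (amp x * inn x)" unfolding bb_def using 1 by (intro abs_leI) (auto simp: abs_le_iff algebra_simps)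
  show "\<bar>aa w w1 x\<bar> \<le> 27 * M * (amp x * inn x)" unfolding aa_def using 1(3) b by (intro abs_leI) (auto simp: abs_le_iff algebra_simps)
qed

text \<open>A factor quadratic in x is at most \<open>nn\<close>, so it uses up exactly the factor
  \<open>inn\<close> in the bounds for \<open>aa\<close> and \<open>bb\<close>.\<close>

lemma quad_bound:
  assumes "\<bar>f\<bar> \<le> C * M * (amp x * inn x)" "\<bar>p\<bar> \<le> nn x" "0 \<le> C"
  shows "\<bar>p * f\<bar> \<le> C * M * amp x"
proof -
  have "\<bar>p * f\<bar> \<le> nn x * (C * M * (amp x * inn x))"
    unfolding abs_mult by (intro mult_mono assms) (use nn_pos[of x] in auto)
  also have "\<dots> = C * M * amp x * (nn x * inn x)" by simp
  finally show ?thesis by (simp add: nn_inn)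
qed

lemma pd_FF_bound: "\<bar>x$i * pd (FF w) j x\<bar> \<le> 27 * M * amp x"
proof -
  have p: "\<bar>x$i * x$j\<bar> \<le> nn x" using nth_sq_le_nn(1)[of x i j] by (simp add: abs_mult)
  have "\<bar>bb w w1 x\<bar> \<le> 27 * M * (amp x * inn x)"
    using bound_nonneg amp_pos[of x] inn_bounds[of x] mult_right_mono[of "19 * M" "27 * M" "amp x * inn x"] by (intro order_trans[OF bb_bound]) simp
  then show ?thesis using quad_bound[OF _ p, of "bb w w1 x" 27] quad_bound[OF aa_bound p]
    by (auto simp: pd_FF[OF W] mult.assoc)
qed

lemma pd_field_bound: "\<bar>pd (\<lambda>y. field w y $ i) j x\<bar> \<le> 28 * M * amp x"
proof -
  have p: "0 \<le> M * amp x" using bound_nonneg amp_pos[of x] by simp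
  note f = pd_FF_bound[of x 1 j] pd_FF_bound[of x 2 j] FF_bound[of x] p
  consider "i = 1" | "i = 2" | "i = 3" using exhaust_3 by blast
  then show ?thesis
  proof cases
    case 1 then show ?thesis using f(2-4) unfolding 1 pd_field(1)[OF W] by (cases "2 = j") (simp_all add: abs_le_iff)
  next
    case 2 then show ?thesis using f unfolding 2 pd_field(2)[OF W] by (cases "1 = j") (simp_all add: abs_le_iff)
  next
    case 3 then show ?thesis using f(4) unfolding 3 pd_field(3)[OF W] by simp
  qed
qed

lemma rfield_bound: "\<bar>rfield w w1 x $ i\<bar> \<le> 29 * M * amp x"
proof -
  have p: "0 \<le> M * amp x" using bound_nonneg amp_pos[of x] by simp
  have "\<bar>qq x\<bar> \<le> nn x" using qq_le[of x] by simp
  from quad_bound[OF aa_bound this] have 3: "\<bar>qq x * aa w w1 x\<bar> \<le> 27 * M * amp x" by simp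
  have 1: "\<bar>(x$k * x$3) * bb w w1 x\<bar> \<le> 19 * M * amp x" for k
    using nth_sq_le_nn(1)[of x k 3] by (intro quad_bound bb_bound) (auto simp: abs_mult)
  consider "i = 1" | "i = 2" | "i = 3" using exhaust_3 by blast
  then show ?thesis
    by cases (use 1[of 1] 1[of 2] 3 p FF_bound[of x] in \<open>simp_all add: rfield_nth mult.assoc abs_le_iff\<close>)
qed

text \<open>The squared norm is \<open>qq\<close> F^2, and \<open>qq * inn\<close> <= 1 trades the
  growth of \<open>qq\<close> for one of the three factors \<open>inn\<close> in the square of
  \<open>amp\<close>. The 3 rounds up sqrt 8.\<close>

lemma field_bound: "norm (field w x) \<le> 3 * M * inn x"
proof -
  have "(norm (field w x))\<^sup>2 = qq x * (FF w x)\<^sup>2" by (rule norm_field_sq)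
  also have "\<dots> \<le> qq x * (M * amp x)\<^sup>2"
    using FF_bound[of x] qq_le[of x] by (intro mult_left_mono) (auto simp: abs_le_square_iff[symmetric])
  also have "\<dots> = 8 * (M * inn x)\<^sup>2 * (qq x * inn x)" unfolding power_mult_distrib amp_sq by (simp add: power_numeral_reduce)
  also have "\<dots> \<le> 9 * (M * inn x)\<^sup>2 * 1" by (intro mult_mono qq_inn_bounds) auto
  also have "\<dots> = (3 * M * inn x)\<^sup>2" by (simp add: power_mult_distrib)
  finally show ?thesis using bound_nonneg inn_bounds[of x] by (simp add: power2_le_iff_abs_le)
qed

lemma amp_bound_sq: "\<bar>f\<bar> \<le> C * M * amp x \<Longrightarrow> f\<^sup>2 \<le> 8 * (C * M)\<^sup>2 * inn x ^ 3"
  using power_mono[of "\<bar>f\<bar>" "C * M * amp x" 2] by (simp add: power_mult_distrib amp_sq)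

text \<open>Three factors \<open>inn\<close> are kept because they make the bound integrable; the
  others are at most 1.\<close>

lemma field_pow_bound: "norm (field w x) ^ (3 + k) \<le> (3 * M) ^ (3 + k) * inn x ^ 3"
proof -
  have "norm (field w x) ^ (3 + k) \<le> (3 * M * inn x) ^ (3 + k)" by (intro power_mono field_bound) simp
  also have "\<dots> = (3 * M) ^ (3 + k) * (inn x ^ 3 * inn x ^ k)" unfolding power_mult_distrib power_add by simp
  also have "\<dots> \<le> (3 * M) ^ (3 + k) * (inn x ^ 3 * 1)"
    using bound_nonneg inn_bounds[of x] by (intro mult_left_mono power_le_one) auto
  finally show ?thesis by simp
qed

end

section \<open>Approximation by test fields\<close>

lemma poly_primitive: obtains P :: "real poly" where "pderiv P = p" "poly P 0 = c"
proof -
  define P where "P = [:c:] + (\<Sum>i\<le>degree p. monom (coeff p i / real (Suc i)) (Suc i))"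
  have "pderiv P = (\<Sum>i\<le>degree p. monom (coeff p i) i)"
    unfolding P_def pderiv_add
    by (simp add: sum_comp_morphism[of pderiv, symmetric] pderiv_add o_def pderiv_monom pderiv_pCons del: sum_comp_morphism)
  moreover have "poly P 0 = c" by (simp add: P_def poly_sum poly_monom)
  ultimately show ?thesis using that by (simp add: poly_as_sum_of_monoms)
qed

text \<open>The derivative is approximated uniformly and then integrated from 0. Polynomials in
  \<open>sph\<close> are smooth on the whole space, while the profile is only known to be
  C^2.\<close>

lemma poly_C1_approx:
  assumes W: "C2_on {0..1} w w1 w2" and e: "0 < e"
  obtains p where "\<And>t. t \<in> {0..1} \<Longrightarrow> \<bar>poly p t - w t\<bar> \<le> e" "\<And>t. t \<in> {0..1} \<Longrightarrow> \<bar>poly (pderiv p) t - w1 t\<bar> \<le> e"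
proof -
  obtain g where g: "real_polynomial_function g" "\<And>t. t \<in> {0..1} \<Longrightarrow> \<bar>w1 t - g t\<bar> < e"
    using Stone_Weierstrass_real_polynomial_function[OF compact_Icc C2_on_continuous(2)[OF W] e] by blast
  then obtain a n where ga: "g = (\<lambda>x. \<Sum>i\<le>n. a i * x ^ i)" by (auto simp: real_polynomial_function_iff_sum)
  obtain p where p: "pderiv p = (\<Sum>i\<le>n. monom (a i) i)" "poly p 0 = w 0" by (rule poly_primitive)
  have d: "\<bar>poly (pderiv p) t - w1 t\<bar> \<le> e" if "t \<in> {0..1}" for t
    using g(2)[OF that] by (simp add: p(1) poly_sum poly_monom ga)
  have "\<bar>poly p t - w t\<bar> \<le> e" if t: "t \<in> {0..1}" for t
  proof -
    have "((\<lambda>t. poly p t - w t) has_real_derivative (poly (pderiv p) s - w1 s)) (at s within {0..1})" if "s \<in> {0..1}" for s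
      by (intro derivative_intros DERIV_subset[OF poly_DERIV] C2_onD(1)[OF W] that) simp
    then have "norm ((poly p t - w t) - (poly p 0 - w 0)) \<le> e * norm (t - 0)"
      using d t by (intro field_differentiable_bound[of "{0..1}" "\<lambda>t. poly p t - w t" "\<lambda>s. poly (pderiv p) s - w1 s" e]) auto
    also have "\<dots> \<le> e * 1" using t e by (intro mult_left_mono) auto
    finally show ?thesis by (simp add: p(2))
  qed
  then show ?thesis using d by (rule that)
qed

lemma C2_on_poly: "C2_on {0..1} (poly p) (poly (pderiv p)) (poly (pderiv (pderiv p)))"
  unfolding C2_on_def by (auto intro: DERIV_subset[OF poly_DERIV] continuous_intros)

lemma smooth_field_poly: "smooth_fun (\<lambda>x. field (poly p) x $ i)"
proof -
  have F: "smooth_fun (FF (poly p))" unfolding FF_def[abs_def]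
    by (intro smooth_fun_mult smooth_mnm smooth_fun_poly smooth_sph)
  have "smooth_fun (\<lambda>x. (-1) * (x$2 * FF (poly p) x))" "smooth_fun (\<lambda>x. x$1 * FF (poly p) x)" "smooth_fun (\<lambda>x. 0)"
    by (intro smooth_fun_mult smooth_fun_const smooth_fun_nth F)+
  then show ?thesis using exhaust_3[of i] by (auto simp: field_nth)
qed

text \<open>The factor \<open>exp 1\<close> normalises the value at the origin to 1.\<close>

definition cutoff :: "nat \<Rightarrow> real^3 \<Rightarrow> real" where
  "cutoff k x = exp 1 * flat_exp 0 (1 - inverse ((real k + 1)\<^sup>2) * (norm x)\<^sup>2)"

lemma test_fun_cutoff: "test_fun (cutoff k)"
proof (rule test_funI)
  show "smooth_fun (cutoff k)" unfolding cutoff_def[abs_def]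
    by (intro smooth_fun_mult smooth_fun_flat_exp smooth_fun_diff smooth_fun_const smooth_fun_norm_sq)
  fix x :: "real^3" assume "real k + 1 < norm x"
  then have "(real k + 1)\<^sup>2 < (norm x)\<^sup>2" by (intro power_strict_mono) auto
  then have "inverse ((real k + 1)\<^sup>2) * (real k + 1)\<^sup>2 < inverse ((real k + 1)\<^sup>2) * (norm x)\<^sup>2"
    by (intro mult_strict_left_mono) (auto simp: add_nonneg_pos)
  then have "1 < inverse ((real k + 1)\<^sup>2) * (norm x)\<^sup>2" by (simp add: add_nonneg_eq_0_iff)
  then show "cutoff k x = 0" by (simp add: cutoff_def flat_exp_def)
qed

lemma cutoff_bounds: "0 \<le> cutoff k x" "cutoff k x \<le> 1"
proof -
  show "0 \<le> cutoff k x" by (simp add: cutoff_def flat_exp_0_bounds)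
  define y where "y = 1 - inverse ((real k + 1)\<^sup>2) * (norm x)\<^sup>2"
  have "y \<le> 1" by (simp add: y_def)
  then have "exp 1 * flat_exp 0 y \<le> 1"
    by (auto simp: flat_exp_def exp_minus[symmetric] simp flip: exp_add intro: one_le_inverse)
  then show "cutoff k x \<le> 1" by (simp add: cutoff_def y_def)
qed

lemma inverse_Suc_sq_tendsto: "(\<lambda>k. inverse ((real k + 1)\<^sup>2)) \<longlonglongrightarrow> 0"
  using tendsto_power[OF LIMSEQ_inverse_real_of_nat, of 2] by (simp add: power_inverse add.commute)

lemma cutoff_tendsto: "(\<lambda>k. cutoff k x) \<longlonglongrightarrow> 1"
proof -
  have "(\<lambda>k. 1 - inverse ((real k + 1)\<^sup>2) * (norm x)\<^sup>2) \<longlonglongrightarrow> 1 - 0 * (norm x)\<^sup>2"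
    by (intro tendsto_intros inverse_Suc_sq_tendsto)
  then have "(\<lambda>k. flat_exp 0 (1 - inverse ((real k + 1)\<^sup>2) * (norm x)\<^sup>2)) \<longlonglongrightarrow> flat_exp 0 1"
    using DERIV_isCont[OF DERIV_flat_exp[of 0 1]] by (intro isCont_tendsto_compose[of 1 "flat_exp 0"]) simp_all
  then have "(\<lambda>k. cutoff k x) \<longlonglongrightarrow> exp 1 * flat_exp 0 1" unfolding cutoff_def by (rule tendsto_mult_left)
  then show ?thesis by (simp add: flat_exp_def flip: exp_add)
qed

lemma flat_exp_2_le: "\<bar>flat_exp 2 y\<bar> \<le> 2"
proof (cases "0 < y")
  case True
  define u where "u = inverse y"
  have "u\<^sup>2 / 2 \<le> exp u" using True exp_lower_Taylor_quadratic[of u] by (smt (verit) inverse_positive_iff_positive u_def)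
  then have "u\<^sup>2 * exp (- u) \<le> 2" by (simp add: exp_minus field_simps)
  then show ?thesis using True by (simp add: flat_exp_def u_def)
qed (simp add: flat_exp_def)

lemma pd_norm_sq: "pd (\<lambda>x. (norm x)\<^sup>2) j x = 2 * x$j"
proof -
  have e: "(\<lambda>x. (norm x)\<^sup>2) = (\<lambda>x. nn x - 1)" by (simp add: nn_norm)
  show ?thesis unfolding e by (subst pd_diff) (auto simp: pd_nn intro: smooth_diff smooth_nn)
qed

text \<open>With r = k + 1, the 12 is 3 * 2 * 2, from exp 1 <= 3, \<open>flat_exp 2\<close> <= 2 and
  2 |x_j| <= 2 r on the support. There also \<open>nn\<close> <= 2 r^2, which turns (12/r)^2 into
  288 \<open>inn\<close>, a bound free of k as dominated convergence requires.\<close>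

lemma pd_cutoff_bounds:
  "\<bar>pd (cutoff k) j x\<bar> \<le> 12 * inverse (real k + 1)" "(pd (cutoff k) j x)\<^sup>2 \<le> 288 * inn x"
proof -
  define r y where d: "r = real k + 1" "y = 1 - inverse (r\<^sup>2) * (norm x)\<^sup>2"
  have r: "1 \<le> r" by (simp add: d)
  have sm: "smooth_fun (\<lambda>x. 1 - inverse (r\<^sup>2) * (norm x)\<^sup>2)"
    by (intro smooth_fun_diff smooth_fun_mult smooth_fun_const smooth_fun_norm_sq)
  have sn: "(\<lambda>x::real^3. (norm x)\<^sup>2) differentiable (at x)" by (rule smooth_diff[OF smooth_fun_norm_sq])
  have i: "pd (\<lambda>x. 1 - inverse (r\<^sup>2) * (norm x)\<^sup>2) j x = - inverse (r\<^sup>2) * (2 * x$j)"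
    by (subst pd_diff[OF _ diff_cmult[OF sn]]) (simp_all add: pd_cmult[OF sn] pd_norm_sq)
  have "pd (cutoff k) j x = exp 1 * pd (\<lambda>x. flat_exp 0 (1 - inverse (r\<^sup>2) * (norm x)\<^sup>2)) j x"
    unfolding cutoff_def[abs_def] d(1)[symmetric] by (rule pd_cmult) (intro smooth_diff smooth_fun_flat_exp sm)
  also have "pd (\<lambda>x. flat_exp 0 (1 - inverse (r\<^sup>2) * (norm x)\<^sup>2)) j x = flat_exp 2 y * (- inverse (r\<^sup>2) * (2 * x$j))"
    using pd_compose[OF DERIV_flat_exp[of 0 y, unfolded d(2)] smooth_diff[OF sm], of j] unfolding i d(2)[symmetric] by (simp add: numeral_2_eq_2)
  finally have e: "pd (cutoff k) j x = exp 1 * (flat_exp 2 y * (- inverse (r\<^sup>2) * (2 * x$j)))" .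
  have bound: "\<bar>pd (cutoff k) j x\<bar> \<le> 12 * inverse r" and bound2: "(pd (cutoff k) j x)\<^sup>2 \<le> 288 * inn x"
  proof -
    have "\<bar>pd (cutoff k) j x\<bar> \<le> 12 * inverse r \<and> (pd (cutoff k) j x)\<^sup>2 \<le> 288 * inn x" if "norm x \<ge> r" 
    proof -
      have "r\<^sup>2 \<le> (norm x)\<^sup>2" using that r by (intro power_mono) auto
      then have "y \<le> 0" using r by (simp add: d(2) field_simps)
      then show ?thesis using r inn_bounds[of x] unfolding e by (simp add: flat_exp_def)
    qed
    moreover have "\<bar>pd (cutoff k) j x\<bar> \<le> 12 * inverse r \<and> (pd (cutoff k) j x)\<^sup>2 \<le> 288 * inn x" if "norm x < r"
    proof
      have "\<bar>x$j\<bar> \<le> r" using component_le_norm_cart[of x j] that by simp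
      have "\<bar>pd (cutoff k) j x\<bar> = exp 1 * (\<bar>flat_exp 2 y\<bar> * (inverse (r\<^sup>2) * (2 * \<bar>x$j\<bar>)))"
        unfolding e by (simp add: abs_mult)
      also have "\<dots> \<le> 3 * (2 * (inverse (r\<^sup>2) * (2 * r)))"
        using \<open>\<bar>x$j\<bar> \<le> r\<close> r by (intro mult_mono exp_le flat_exp_2_le) auto
      also have "\<dots> = 12 * inverse r" using r by (simp add: power2_eq_square)
      finally show 1: "\<bar>pd (cutoff k) j x\<bar> \<le> 12 * inverse r" .
      have "(norm x)\<^sup>2 \<le> r\<^sup>2" "1 \<le> r\<^sup>2" using that r by (auto intro!: power_mono)
      then have n: "nn x \<le> 2 * r\<^sup>2" by (simp add: nn_norm)
      have "(pd (cutoff k) j x)\<^sup>2 \<le> (12 * inverse r)\<^sup>2" using power_mono[OF 1, of 2] by simp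
      also have "\<dots> = 288 / (2 * r\<^sup>2)" using r by (simp add: power_divide inverse_eq_divide)
      also have "\<dots> \<le> 288 / nn x" using n nn_pos[of x] r by (intro divide_left_mono) auto
      finally show "(pd (cutoff k) j x)\<^sup>2 \<le> 288 * inn x" by (simp add: inn_eq)
    qed
    ultimately show "\<bar>pd (cutoff k) j x\<bar> \<le> 12 * inverse r" "(pd (cutoff k) j x)\<^sup>2 \<le> 288 * inn x"
      by (meson not_le)+
  qed
  then show "\<bar>pd (cutoff k) j x\<bar> \<le> 12 * inverse (real k + 1)" "(pd (cutoff k) j x)\<^sup>2 \<le> 288 * inn x" by (simp_all add: d)
qed

lemma pd_cutoff_tendsto: "(\<lambda>k. pd (cutoff k) j x) \<longlonglongrightarrow> 0"
proof (rule tendsto_rabs_zero_cancel, rule tendsto_sandwich[OF _ _ tendsto_const])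
  show "(\<lambda>k. 12 * inverse (real k + 1)) \<longlonglongrightarrow> 0"
    using tendsto_mult_right_zero[OF LIMSEQ_inverse_real_of_nat, of 12] by (simp add: add.commute)
qed (use pd_cutoff_bounds(1) in auto)

lemma integrable_inn3_bound:
  fixes f :: "real^3 \<Rightarrow> real"
  assumes "continuous_on UNIV f" "\<And>x. \<bar>f x\<bar> \<le> C * inn x ^ 3" shows "integrable lborel f"
proof (rule Bochner_Integration.integrable_bound[of lborel "\<lambda>x. C * inn x ^ 3"])
  show "integrable lborel (\<lambda>x. C * inn x ^ 3)" by (intro integrable_mult_right integrable_inn3)
  show "f \<in> borel_measurable lborel" using borel_measurable_continuous_onI[OF assms(1)] by simp
qed (use assms(2) in \<open>auto intro!: AE_I2 intro: order_trans[OF _ abs_ge_self]\<close>)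

lemma dominated_inn3:
  fixes s :: "nat \<Rightarrow> real^3 \<Rightarrow> real"
  assumes "\<And>k. continuous_on UNIV (s k)" "\<And>k x. \<bar>s k x\<bar> \<le> C * inn x ^ 3" "\<And>x. (\<lambda>k. s k x) \<longlonglongrightarrow> 0"
  shows "integrable lborel (s k)" "(\<lambda>k. integral\<^sup>L lborel (s k)) \<longlonglongrightarrow> 0"
proof -
  have m: "s k \<in> borel_measurable lborel" for k using borel_measurable_continuous_onI[OF assms(1)[of k]] by simp
  have C: "integrable lborel (\<lambda>x. C * inn x ^ 3)" by (intro integrable_mult_right integrable_inn3)
  show "integrable lborel (s k)" by (rule integrable_inn3_bound[OF assms(1,2)])
  have "(\<lambda>k. integral\<^sup>L lborel (s k)) \<longlonglongrightarrow> integral\<^sup>L lborel (\<lambda>x::real^3. 0::real)"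
    by (rule integral_dominated_convergence[OF _ m C]) (use assms in auto)
  then show "(\<lambda>k. integral\<^sup>L lborel (s k)) \<longlonglongrightarrow> 0" by simp
qed

lemma tendsto_eventually_close:
  fixes f :: "nat \<Rightarrow> real"
  assumes "\<And>k. \<bar>f k - l\<bar> \<le> inverse (real k + 1)" shows "f \<longlonglongrightarrow> l"
proof -
  have "(\<lambda>k. f k - l) \<longlonglongrightarrow> 0"
    by (rule tendsto_rabs_zero_cancel, rule tendsto_sandwich[OF _ _ tendsto_const LIMSEQ_inverse_real_of_nat])
       (use assms in \<open>auto simp: add.commute\<close>)
  then show ?thesis by (simp add: LIM_zero_iff)
qed

lemma sq_sum3_le: "(a + b - c)\<^sup>2 \<le> 3 * (a\<^sup>2 + b\<^sup>2 + c\<^sup>2)" for a b c :: real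
  using zero_le_power2[of "a - b"] zero_le_power2[of "a + c"] zero_le_power2[of "b + c"] by (simp add: power2_eq_square algebra_simps)

text \<open>The approximants are cutoffs of fields with polynomial profiles. The squared errors of
  their gradients and the sixth powers of their errors tend to 0 pointwise below a multiple of
  \<open>inn ^ 3\<close>, so dominated convergence applies to both.\<close>

lemma field_D12:
  assumes W: "C2_on {0..1} w w1 w2"
  shows "field w \<in> D12"
proof -
  obtain B1 B2 where B: "\<And>t. t \<in> {0..1} \<Longrightarrow> \<bar>w t\<bar> \<le> B1" "\<And>t. t \<in> {0..1} \<Longrightarrow> \<bar>w1 t\<bar> \<le> B2"
    using compact_abs_bound[OF C2_on_continuous(1)[OF W] compact_Icc] compact_abs_bound[OF C2_on_continuous(2)[OF W] compact_Icc] by metis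
  \<comment> \<open>The 1 makes room for the polynomial profiles and their derivatives, which stay
    within 1 of the given ones.\<close>
  define M where "M = max B1 B2 + 1"
  have wM: "\<bar>w t\<bar> \<le> M" "\<bar>w1 t\<bar> \<le> M" if "t \<in> {0..1}" for t using B[OF that] by (auto simp: M_def)
  have "\<exists>p. \<forall>t\<in>{0..1}. \<bar>poly p t - w t\<bar> \<le> inverse (real k + 1) \<and> \<bar>poly (pderiv p) t - w1 t\<bar> \<le> inverse (real k + 1)" for k
    using poly_C1_approx[OF W, of "inverse (real k + 1)"] by (metis add_nonneg_pos inverse_positive_iff_positive of_nat_0_le_iff zero_less_one)
  then obtain p where p: "\<And>k t. t \<in> {0..1} \<Longrightarrow> \<bar>poly (p k) t - w t\<bar> \<le> inverse (real k + 1)"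
    "\<And>k t. t \<in> {0..1} \<Longrightarrow> \<bar>poly (pderiv (p k)) t - w1 t\<bar> \<le> inverse (real k + 1)" by metis
  have le1: "inverse (real k + 1) \<le> 1" for k by (simp add: inverse_le_1_iff)
  have pM: "\<bar>poly (p k) t\<bar> \<le> M" "\<bar>poly (pderiv (p k)) t\<bar> \<le> M" if "t \<in> {0..1}" for t k
    using B[OF that] p[OF that, of k] le1[of k] by (auto simp: M_def)
  define f where "f k = field (poly (p k))" for k
  define \<phi> where "\<phi> k x = cutoff k x *\<^sub>R f k x" for k x
  define G where "G i j = pd (\<lambda>y. field w y $ i) j" for i j
  define D where "D k i j x = pd (\<lambda>y. \<phi> k y $ i) j x - G i j x" for k i j x
  note P = C2_on_poly
  have fs: "smooth_fun (\<lambda>x. f k x $ i)" for k i unfolding f_def by (rule smooth_field_poly)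
  have cs: "smooth_fun (cutoff k)" for k by (rule test_fun_smooth[OF test_fun_cutoff])
  have tf: "test_field (\<phi> k)" for k
    unfolding test_field_def \<phi>_def using test_fun_mult[OF fs test_fun_cutoff] by (simp add: mult.commute)
  have pt: "(\<lambda>k. poly (p k) (sph x)) \<longlonglongrightarrow> w (sph x)" "(\<lambda>k. poly (pderiv (p k)) (sph x)) \<longlonglongrightarrow> w1 (sph x)" for x
    by (rule tendsto_eventually_close, rule p, rule sph_mem)+
  have FFt: "(\<lambda>k. FF (poly (p k)) x) \<longlonglongrightarrow> FF w x" for x
    unfolding FF_def FF_def by (intro tendsto_intros pt)
  have bbt: "(\<lambda>k. bb (poly (p k)) (poly (pderiv (p k))) x) \<longlonglongrightarrow> bb w w1 x" for x
    unfolding bb_def bb_def by (intro tendsto_intros pt)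
  have aat: "(\<lambda>k. aa (poly (p k)) (poly (pderiv (p k))) x) \<longlonglongrightarrow> aa w w1 x" for x
    unfolding aa_def aa_def by (intro tendsto_intros pt bbt)
  have pdt: "(\<lambda>k. pd (FF (poly (p k))) j x) \<longlonglongrightarrow> pd (FF w) j x" for j x
    unfolding pd_FF[OF P] pd_FF[OF W] by (cases "j = 3") (simp_all add: tendsto_mult_left aat bbt)
  have ft: "(\<lambda>k. f k x $ i) \<longlonglongrightarrow> field w x $ i" for i x
  proof -
    have "(\<lambda>k. f k x $ 1) \<longlonglongrightarrow> field w x $ 1" "(\<lambda>k. f k x $ 2) \<longlonglongrightarrow> field w x $ 2" "(\<lambda>k. f k x $ 3) \<longlonglongrightarrow> field w x $ 3"
      unfolding f_def field_nth field_nth by (intro tendsto_intros FFt)+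
    then show ?thesis using exhaust_3[of i] by auto
  qed
  have pft: "(\<lambda>k. pd (\<lambda>y. f k y $ i) j x) \<longlonglongrightarrow> G i j x" for i j x
  proof -
    have "(\<lambda>k. pd (\<lambda>y. f k y $ 1) j x) \<longlonglongrightarrow> G 1 j x" "(\<lambda>k. pd (\<lambda>y. f k y $ 2) j x) \<longlonglongrightarrow> G 2 j x"
      "(\<lambda>k. pd (\<lambda>y. f k y $ 3) j x) \<longlonglongrightarrow> G 3 j x"
      unfolding f_def G_def pd_field[OF P] pd_field[OF W] by (intro tendsto_intros FFt pdt)+
    then show ?thesis using exhaust_3[of i] by auto
  qed
  have D: "D k i j x = cutoff k x * pd (\<lambda>y. f k y $ i) j x + pd (cutoff k) j x * f k x $ i - G i j x" for k i j x
    unfolding D_def \<phi>_def vector_scaleR_component real_scaleR_def by (subst pd_mult[OF smooth_diff[OF cs] smooth_diff[OF fs]]) simp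
  have Dt: "(\<lambda>k. (D k i j x)\<^sup>2) \<longlonglongrightarrow> 0" for i j x
  proof -
    have "(\<lambda>k. (D k i j x)\<^sup>2) \<longlonglongrightarrow> (1 * G i j x + 0 * field w x $ i - G i j x)\<^sup>2"
      unfolding D by (intro tendsto_intros cutoff_tendsto pft pd_cutoff_tendsto ft)
    then show ?thesis by simp
  qed
  have Dc: "continuous_on UNIV (\<lambda>x. (D k i j x)\<^sup>2)" for k i j
    unfolding D_def G_def
    by (intro continuous_intros cont_pd_field[OF W] smooth_fun_continuous test_fun_smooth test_fieldD(4)[OF tf])
  \<comment> \<open>The summands majorise the cut-off gradient, the term with the derivative of the
    cutoff (2592 = 288 * 3^2) and the limit gradient; the factor 3 comes from squaring a sum of
    three.\<close>
  have Db: "\<bar>(D k i j x)\<^sup>2\<bar> \<le> 3 * (8 * (28 * M)\<^sup>2 + 2592 * M\<^sup>2 + 8 * (28 * M)\<^sup>2) * inn x ^ 3" for k i j x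
  proof -
    have a: "(pd (\<lambda>y. f k y $ i) j x)\<^sup>2 \<le> 8 * (28 * M)\<^sup>2 * inn x ^ 3"
      unfolding f_def by (rule amp_bound_sq[OF P pM pd_field_bound[OF P pM]])
    have c: "(G i j x)\<^sup>2 \<le> 8 * (28 * M)\<^sup>2 * inn x ^ 3"
      unfolding G_def by (rule amp_bound_sq[OF W wM pd_field_bound[OF W wM]])
    have "(cutoff k x)\<^sup>2 \<le> 1" using cutoff_bounds by (simp add: power_le_one)
    then have a': "(cutoff k x * pd (\<lambda>y. f k y $ i) j x)\<^sup>2 \<le> 8 * (28 * M)\<^sup>2 * inn x ^ 3"
      using a mult_mono[of "(cutoff k x)\<^sup>2" 1 "(pd (\<lambda>y. f k y $ i) j x)\<^sup>2" "8 * (28 * M)\<^sup>2 * inn x ^ 3"] by (simp add: power_mult_distrib)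
    have "\<bar>f k x $ i\<bar> \<le> 3 * M * inn x"
      unfolding f_def by (rule order_trans[OF component_le_norm_cart field_bound[OF P pM]])
    then have "(f k x $ i)\<^sup>2 \<le> (3 * M * inn x)\<^sup>2" using power_mono[of "\<bar>f k x $ i\<bar>" _ 2] by simp
    then have "(pd (cutoff k) j x)\<^sup>2 * (f k x $ i)\<^sup>2 \<le> 288 * inn x * (3 * M * inn x)\<^sup>2"
      by (intro mult_mono pd_cutoff_bounds) (use inn_bounds[of x] in auto)
    then have b: "(pd (cutoff k) j x * f k x $ i)\<^sup>2 \<le> 2592 * M\<^sup>2 * inn x ^ 3"
      by (simp add: power_mult_distrib power_numeral_reduce algebra_simps)
    show ?thesis using sq_sum3_le[of "cutoff k x * pd (\<lambda>y. f k y $ i) j x" "pd (cutoff k) j x * f k x $ i" "G i j x"] a' b c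
      unfolding D[symmetric] by (simp add: algebra_simps)
  qed
  note D2 = dominated_inn3[OF Dc Db Dt]
  define S where "S k = integral\<^sup>L lborel (\<lambda>x. \<Sum>i\<in>UNIV. \<Sum>j\<in>UNIV. (D k i j x)\<^sup>2)" for k
  have Si: "integrable lborel (\<lambda>x. \<Sum>i\<in>UNIV. \<Sum>j\<in>UNIV. (D k i j x)\<^sup>2)" for k by (intro Bochner_Integration.integrable_sum D2)
  have "S = (\<lambda>k. \<Sum>i\<in>UNIV. \<Sum>j\<in>UNIV. integral\<^sup>L lborel (\<lambda>x. (D k i j x)\<^sup>2))"
    unfolding S_def by (simp add: Bochner_Integration.integral_sum D2(1))
  then have "S \<longlonglongrightarrow> (\<Sum>i::3\<in>UNIV. \<Sum>j::3\<in>UNIV. 0)" using D2(2) by (auto intro!: tendsto_sum tendsto_null_sum)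
  then have S0: "S \<longlonglongrightarrow> 0" by simp
  \<comment> \<open>Comparing both approximants with the classical gradient \<open>G\<close> turns
    convergence into the Cauchy condition of the completion.\<close>
  have grad: "integral\<^sup>L lborel (grad_sq (\<lambda>y. \<phi> m y - \<phi> n y)) \<le> 2 * S m + 2 * S n" for m n
  proof -
    have "integral\<^sup>L lborel (grad_sq (\<lambda>y. \<phi> m y - \<phi> n y))
      \<le> integral\<^sup>L lborel (\<lambda>x. 2 * (\<Sum>i\<in>UNIV. \<Sum>j\<in>UNIV. (D m i j x)\<^sup>2) + 2 * (\<Sum>i\<in>UNIV. \<Sum>j\<in>UNIV. (D n i j x)\<^sup>2))"
    proof (rule integral_mono')
      show "integrable lborel (\<lambda>x. 2 * (\<Sum>i\<in>UNIV. \<Sum>j\<in>UNIV. (D m i j x)\<^sup>2) + 2 * (\<Sum>i\<in>UNIV. \<Sum>j\<in>UNIV. (D n i j x)\<^sup>2))"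
        by (intro Bochner_Integration.integrable_add integrable_mult_right Si)
      fix x :: "real^3"
      have "(a - b)\<^sup>2 \<le> 2 * (a - c)\<^sup>2 + 2 * (b - c)\<^sup>2" for a b c :: real
        using zero_le_power2[of "(a - c) + (b - c)"] by (simp add: power2_eq_square algebra_simps)
      then show "grad_sq (\<lambda>y. \<phi> m y - \<phi> n y) x
          \<le> 2 * (\<Sum>i\<in>UNIV. \<Sum>j\<in>UNIV. (D m i j x)\<^sup>2) + 2 * (\<Sum>i\<in>UNIV. \<Sum>j\<in>UNIV. (D n i j x)\<^sup>2)"
        unfolding grad_sq_def pd_field_diff[OF tf tf] D_def sum_distrib_left sum.distrib[symmetric] by (intro sum_mono)
      show "0 \<le> 2 * (\<Sum>i\<in>UNIV. \<Sum>j\<in>UNIV. (D m i j x)\<^sup>2) + 2 * (\<Sum>i\<in>UNIV. \<Sum>j\<in>UNIV. (D n i j x)\<^sup>2)"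
        by (intro add_nonneg_nonneg mult_nonneg_nonneg sum_nonneg) auto
    qed
    also have "\<dots> = 2 * S m + 2 * S n" unfolding S_def using Si by (simp add: Bochner_Integration.integral_add)
    finally show ?thesis .
  qed
  have cau: "\<exists>N. \<forall>m\<ge>N. \<forall>n\<ge>N. integral\<^sup>L lborel (grad_sq (\<lambda>y. \<phi> m y - \<phi> n y)) < e" if "0 < e" for e
  proof -
    obtain N where N: "\<And>n. n \<ge> N \<Longrightarrow> \<bar>S n\<bar> < e / 4" using LIMSEQ_D[OF S0, of "e / 4", unfolded diff_zero real_norm_def] \<open>0 < e\<close> by fastforce
    have "integral\<^sup>L lborel (grad_sq (\<lambda>y. \<phi> m y - \<phi> n y)) < e" if "N \<le> m" "N \<le> n" for m n
      using grad[of m n] N[OF that(1)] N[OF that(2)] by linarith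
    then show ?thesis by blast
  qed
  have fb: "norm (f k x) \<le> 3 * M * inn x" for k x unfolding f_def by (rule field_bound[OF P pM])
  have Ub: "norm (field w x) \<le> 3 * M * inn x" for x by (rule field_bound[OF W wM])
  have 6: "\<bar>norm (\<phi> k x - field w x) ^ 6\<bar> \<le> (6 * M) ^ 6 * inn x ^ 3" for k x
  proof -
    have "norm (\<phi> k x) \<le> 1 * norm (f k x)" using cutoff_bounds unfolding \<phi>_def norm_scaleR by (intro mult_right_mono) auto
    then have "norm (\<phi> k x - field w x) \<le> 6 * M * inn x"
      using fb[of k x] Ub[of x] norm_triangle_ineq4[of "\<phi> k x" "field w x"] by linarith
    then have "norm (\<phi> k x - field w x) ^ 6 \<le> (6 * M * inn x) ^ 6" by (intro power_mono) auto
    also have "\<dots> = (6 * M) ^ 6 * (inn x ^ 3 * inn x ^ 3)" by (simp add: power_mult_distrib power_add[symmetric])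
    also have "\<dots> \<le> (6 * M) ^ 6 * (inn x ^ 3 * 1)"
      using inn_bounds[of x] by (intro mult_left_mono power_le_one) auto
    finally show ?thesis by simp
  qed
  have Uc: "continuous_on UNIV (field w)" by (rule field_cont[OF W])
  have c6: "continuous_on UNIV (\<lambda>x. norm (\<phi> k x - field w x) ^ 6)" for k
  proof -
    have "continuous_on UNIV (\<lambda>x. \<chi> i. f k x $ i)" by (intro continuous_on_vec_lambda smooth_fun_continuous fs)
    then have "continuous_on UNIV (f k)" by simp
    then show ?thesis unfolding \<phi>_def by (intro continuous_intros Uc smooth_fun_continuous[OF cs]) 
  qed
  have t6: "(\<lambda>k. norm (\<phi> k x - field w x) ^ 6) \<longlonglongrightarrow> 0" for x
  proof -
    have "(\<lambda>k. f k x) \<longlonglongrightarrow> field w x" by (rule vec_tendstoI) (rule ft)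
    then have "(\<lambda>k. norm (\<phi> k x - field w x) ^ 6) \<longlonglongrightarrow> norm (1 *\<^sub>R field w x - field w x) ^ 6"
      unfolding \<phi>_def by (intro tendsto_intros cutoff_tendsto)
    then show ?thesis by simp
  qed
  have m: "field w \<in> borel_measurable lborel" using borel_measurable_continuous_onI[OF Uc] by simp
  show ?thesis unfolding D12_def
    by (intro CollectI conjI exI[of _ \<phi>] allI impI m tf dominated_inn3[OF c6 6 t6] cau)
qed

section \<open>Solutions and their energy\<close>

lemma C2_on_unit_bound:
  assumes W: "C2_on {0..1} w w1 w2"
  obtains M where "\<And>t. t \<in> {0..1} \<Longrightarrow> \<bar>w t\<bar> \<le> M" "\<And>t. t \<in> {0..1} \<Longrightarrow> \<bar>w1 t\<bar> \<le> M"
proof -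
  obtain B1 where 1: "\<And>t. t \<in> {0..1} \<Longrightarrow> \<bar>w t\<bar> \<le> B1" using compact_abs_bound[OF C2_on_continuous(1)[OF W] compact_Icc] by metis
  obtain B2 where 2: "\<And>t. t \<in> {0..1} \<Longrightarrow> \<bar>w1 t\<bar> \<le> B2" using compact_abs_bound[OF C2_on_continuous(2)[OF W] compact_Icc] by metis
  show ?thesis by (rule that[of "max B1 B2"]) (use 1 2 in \<open>force simp: le_max_iff_disj\<close>)+
qed

lemma integrable_field_pow:
  assumes W: "C2_on {0..1} w w1 w2" shows "integrable lborel (\<lambda>x. norm (field w x) ^ (3 + k))"
proof -
  obtain M where M: "\<And>t. t \<in> {0..1} \<Longrightarrow> \<bar>w t\<bar> \<le> M" "\<And>t. t \<in> {0..1} \<Longrightarrow> \<bar>w1 t\<bar> \<le> M" using C2_on_unit_bound[OF W] by blast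
  show ?thesis
    using field_pow_bound[OF W M, of _ k] by (intro integrable_inn3_bound[of _ "(3 * M) ^ (3 + k)"] continuous_intros field_cont[OF W]) simp
qed

text \<open>Testing the weak equation with the field itself shows that the two integrals in the
  energy are equal, and 1/2 - 1/6 = 1/3.\<close>

lemma field_solution:
  assumes W: "C2_on {0..1} w w1 w2"
    and ode: "\<And>t. t \<in> {0..1} \<Longrightarrow> 4 * t * (1 - t) * w2 t + (8 - 12 * t) * w1 t = 15/4 * w t - t\<^sup>2 * w t ^ 5"
  shows "curl_curl_solution (field w)" "energy (field w) = 1/3 * integral\<^sup>L lborel (\<lambda>x. norm (field w x) ^ 6)"
proof -
  obtain M where M: "\<And>t. t \<in> {0..1} \<Longrightarrow> \<bar>w t\<bar> \<le> M" "\<And>t. t \<in> {0..1} \<Longrightarrow> \<bar>w1 t\<bar> \<le> M" using C2_on_unit_bound[OF W] by blast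
  have Uc: "continuous_on UNIV (field w)" by (rule field_cont[OF W])
  have m: "field w \<in> borel_measurable lborel" using borel_measurable_continuous_onI[OF Uc] by simp
  note J = weak_jac_C1[OF m field_diff[OF W] cont_pd_field[OF W]]
  have cU: "AE x in lborel. curl (field w) x = rfield w w1 x"
    using curl_AE[OF J] by eventually_elim (simp add: rot_def flip: rot_field[OF W])
  have rc: "continuous_on UNIV (\<lambda>x. rfield w w1 x $ i)" for i
    using rfield_diff[OF W] by (meson continuous_at_imp_continuous_on differentiable_imp_continuous_within)
  have r2: "integrable lborel (\<lambda>x. (rfield w w1 x $ i)\<^sup>2)" for i
    using amp_bound_sq[OF W M rfield_bound[OF W M]] by (intro integrable_inn3_bound[of _ "8 * (29 * M)\<^sup>2"] continuous_intros rc) simp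
  have U5: "integrable lborel (\<lambda>x. norm (field w x) ^ 5)" using integrable_field_pow[OF W, of 2] by simp
  have bound_nonneg: "0 \<le> M" using M(1)[of 0] by auto
  have B5: "norm (field w x) ^ 5 \<le> (3 * M) ^ 5" for x
  proof -
    have "3 * M * inn x \<le> 3 * M * 1" using bound_nonneg inn_bounds[of x] by (intro mult_left_mono) auto
    then show ?thesis using field_bound[OF W M, of x] by (intro power_mono) auto
  qed
  have rot: "rot (rfield w w1) x = norm (field w x) ^ 4 *\<^sub>R field w x" for x by (rule rot_rfield[OF W]) (rule ode)
  note sol = weak_solutionI[OF J cU rfield_diff[OF W] cont_pd_rfield[OF W] r2 Uc U5 B5 rot]
  have U: "field w \<in> D12" by (rule field_D12[OF W])
  show "curl_curl_solution (field w)" unfolding curl_curl_solution_def using U sol by simp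
  have "u ^ 4 * u\<^sup>2 = u ^ 6" for u :: real by (simp flip: power_add)
  then have "integral\<^sup>L lborel (\<lambda>x. norm (curl (field w) x) ^ 2) = integral\<^sup>L lborel (\<lambda>x. norm (field w x) ^ 6)"
    using sol[OF U] by (simp flip: power2_norm_eq_inner)
  then show "energy (field w) = 1/3 * integral\<^sup>L lborel (\<lambda>x. norm (field w x) ^ 6)" by (simp add: energy_def)
qed

section \<open>Lower bound for the energy\<close>

lemma prod_UNIV_3: "prod f (UNIV :: 3 set) = f 1 * f 2 * f 3"
  unfolding UNIV_3 by (simp add: mult.assoc)

lemma measure_box3:
  assumes "a \<le> a'" "b \<le> b'" "c \<le> (c'::real)"
  shows "measure lborel (cbox (vector [a, b, c]) (vector [a', b', c']) :: (real^3) set) = (a' - a) * (b' - b) * (c' - c)"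
proof -
  have "vector [a, b, c] \<in> (cbox (vector [a, b, c]) (vector [a', b', c']) :: (real^3) set)"
    using assms by (simp add: mem_box_cart forall_3)
  then have "cbox (vector [a, b, c]) (vector [a', b', c']) \<noteq> ({} :: (real^3) set)" by blast
  from content_cbox_cart[OF this] show ?thesis unfolding prod_UNIV_3 vector_3 .
qed

text \<open>On a box of side lengths of order \<open>r^2\<close> next to the \<open>x_3\<close>-axis the field has size at least of order \<open>1/r\<close>.\<close>

lemma energy_lower_bound:
  assumes W: "C2_on {0..1} w w1 w2" and r: "0 < r" "r \<le> 1/2" and lo: "\<And>t. 0 \<le> t \<Longrightarrow> t \<le> r^4 / 80 \<Longrightarrow> 3/4 / r^3 \<le> w t"
  shows "1 / (6912 * 40 ^ 8) / r \<le> integral\<^sup>L lborel (\<lambda>x. norm (field w x) ^ 6)"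
proof -
  \<comment> \<open>On the box \<open>qq\<close> <= 2 d^2, hence \<open>sph\<close> <= 8 d^2 =
    r^4/200, which lies in the range where w is known to be large.\<close>
  define d where "d = r\<^sup>2 / 40"
  have d: "0 < d" "d \<le> 1/2" using r power_mono[OF r(2), of 2] by (auto simp: d_def power_numeral_reduce)
  define Q :: "(real^3) set" where "Q = cbox (vector [d/2, d/2, 0]) (vector [d, d, 1])"
  \<comment> \<open>From \<open>qq\<close> >= d^2/2, squared \<open>amp\<close> >= 8/27 and w >=
    (3/4) r^(-3) the squared norm of the field is at least d^2/(12 r^6).\<close>
  define K where "K = (d\<^sup>2 / (12 * r ^ 6)) ^ 3"
  have vol: "measure lborel Q = d\<^sup>2 / 4" unfolding Q_def using d by (subst measure_box3) (auto simp: power2_eq_square)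
  have low: "K \<le> norm (field w x) ^ 6" if "x \<in> Q" for x
  proof -
    have x: "d/2 \<le> x$1" "x$1 \<le> d" "d/2 \<le> x$2" "x$2 \<le> d" "0 \<le> x$3" "x$3 \<le> 1"
      using that by (auto simp: Q_def mem_box_cart forall_3)
    have sq: "(d/2)\<^sup>2 \<le> (x$1)\<^sup>2" "(x$1)\<^sup>2 \<le> d\<^sup>2" "(d/2)\<^sup>2 \<le> (x$2)\<^sup>2" "(x$2)\<^sup>2 \<le> d\<^sup>2" "(x$3)\<^sup>2 \<le> 1"
      using x d by (auto intro!: power_mono simp: power_le_one)
    have d2: "d\<^sup>2 \<le> 1/4" using power_mono[OF d(2), of 2] d by (simp add: power2_eq_square)
    have q: "d\<^sup>2 / 2 \<le> qq x" "qq x \<le> 2 * d\<^sup>2" using sq by (simp_all add: qq_def power_divide)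
    have "nn x \<le> 3" using sq d2 by (simp add: nn_def)
    then have i: "1/3 \<le> inn x" using nn_pos[of x] by (simp add: inn_eq frac_le)
    have "sph x \<le> 4 * (2 * d\<^sup>2) * 1"
      unfolding sph_def using q qq_le[of x] inn_bounds[of x] by (intro mult_mono power_le_one) auto
    also have "\<dots> \<le> r ^ 4 / 80" by (simp add: d_def power_divide power_mult_distrib flip: power_mult)
    finally have w: "3/4 / r^3 \<le> w (sph x)" using sph_mem[of x] by (intro lo) auto
    have "(1/3) ^ 3 \<le> inn x ^ 3" using i by (intro power_mono) auto
    then have a: "8/27 \<le> (amp x)\<^sup>2" unfolding amp_sq by (simp add: power_divide)
    have "(3/4 / r^3)\<^sup>2 \<le> (w (sph x))\<^sup>2" using w r by (intro power_mono) auto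
    then have "d\<^sup>2 / 2 * (8/27 * (3/4 / r^3)\<^sup>2) \<le> qq x * ((amp x)\<^sup>2 * (w (sph x))\<^sup>2)"
      using q a d by (intro mult_mono) auto
    also have "d\<^sup>2 / 2 * (8/27 * (3/4 / r^3)\<^sup>2) = d\<^sup>2 / (12 * r ^ 6)" by (simp add: power_divide flip: power_mult)
    also have "qq x * ((amp x)\<^sup>2 * (w (sph x))\<^sup>2) = (norm (field w x))\<^sup>2"
      unfolding norm_field_sq by (simp add: FF_def mnm_def power_mult_distrib)
    finally have "(d\<^sup>2 / (12 * r ^ 6)) ^ 3 \<le> ((norm (field w x))\<^sup>2) ^ 3" using r by (intro power_mono) auto
    then show ?thesis by (simp add: K_def flip: power_mult)
  qed
  \<comment> \<open>K times the volume of the box is r^(-2)/(6912 * 40^8), with 6912 = 4 * 12^3; one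
    power of 1/r suffices and the other is given away.\<close>
  have "1 / (6912 * 40 ^ 8) / r \<le> 1 / (6912 * 40 ^ 8) / r\<^sup>2"
    using r by (intro divide_left_mono) (auto simp: power2_eq_square)
  also have "\<dots> = K * (d\<^sup>2 / 4)"
    using r by (simp add: K_def d_def power_divide power_mult_distrib field_simps flip: power_mult power_add)
  also have "\<dots> = integral\<^sup>L lborel (\<lambda>x. K * indicator Q x)" by (simp add: vol)
  also have "\<dots> \<le> integral\<^sup>L lborel (\<lambda>x. norm (field w x) ^ 6)"
  proof (rule integral_mono')
    show "integrable lborel (\<lambda>x. norm (field w x) ^ 6)" using integrable_field_pow[OF W, of 3] by simp
    show "K * indicator Q x \<le> norm (field w x) ^ 6" for x using low[of x] by (auto simp: indicator_def)
  qed simp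
  finally show ?thesis .
qed

section \<open>Symmetry\<close>

text \<open>For a matrix with columns (a, b) and (c, d), orthogonality and unit determinant give (a
  - d)^2 + (b + c)^2 = 1 + 1 - 2 = 0.\<close>

lemma SO2E:
  assumes "g \<in> SO2"
  obtains a b where "a\<^sup>2 + b\<^sup>2 = 1" "\<And>x y. g *v vector [x, y] = vector [a * x - b * y, b * x + a * y]"
proof -
  define a b c d where m: "a = g$1$1" "b = g$2$1" "c = g$1$2" "d = g$2$2"
  have "transpose g ** g = mat 1" "det g = 1" using assms by (auto simp: SO2_def orthogonal_matrix_def)
  then have e: "a*a + b*b = 1" "c*c + d*d = 1" "a*d - c*b = 1"
    by (auto simp: vec_eq_iff forall_2 matrix_matrix_mult_def transpose_def mat_def sum_2 det_2 m)
  have "(a - d)\<^sup>2 + (b + c)\<^sup>2 = (a*a + b*b) + (c*c + d*d) - 2 * (a*d - c*b)" by (simp add: power2_eq_square algebra_simps)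
  then have "(a - d)\<^sup>2 + (b + c)\<^sup>2 = 0" unfolding e by simp
  then have "d = a" "c = - b" by (auto simp: sum_power2_eq_zero_iff)
  then have "g *v vector [x, y] = vector [a * x - b * y, b * x + a * y]" for x y
    by (simp add: vec_eq_iff forall_2 matrix_vector_mult_def sum_2 flip: m)
  then show ?thesis using e(1) by (intro that) (auto simp: power2_eq_square)
qed

lemma vector_4: "(vector [a, b, c, d] :: real^4) $ 1 = a" "(vector [a, b, c, d] :: real^4) $ 2 = b"
  "(vector [a, b, c, d] :: real^4) $ 3 = c" "(vector [a, b, c, d] :: real^4) $ 4 = d"
  unfolding vector_def by simp_all

lemma norm4_sq: "(norm x)\<^sup>2 = (x$1)\<^sup>2 + (x$2)\<^sup>2 + (x$3)\<^sup>2 + (x$4)\<^sup>2" for x :: "real^4"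
  unfolding power2_norm_eq_inner inner_vec_def by (simp add: sum_4 power2_eq_square)

lemma rotation_sum_sq: "a\<^sup>2 + b\<^sup>2 = 1 \<Longrightarrow> (a * x - b * y)\<^sup>2 + (b * x + a * y)\<^sup>2 = x\<^sup>2 + y\<^sup>2" for a b x y :: real
proof -
  assume "a\<^sup>2 + b\<^sup>2 = 1"
  moreover have "(a * x - b * y)\<^sup>2 + (b * x + a * y)\<^sup>2 = (a\<^sup>2 + b\<^sup>2) * (x\<^sup>2 + y\<^sup>2)"
    by (simp add: power2_eq_square algebra_simps)
  ultimately show ?thesis by simp
qed

lemma norm_diag_act:
  assumes "g1 \<in> SO2" "g2 \<in> SO2" shows "norm (diag_act g1 g2 \<xi>) = norm \<xi>"
proof -
  obtain a b where 1: "a\<^sup>2 + b\<^sup>2 = 1" "\<And>x y. g1 *v vector [x, y] = vector [a * x - b * y, b * x + a * y]" by (rule SO2E[OF assms(1)]) (rule that; assumption)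
  obtain c d where 2: "c\<^sup>2 + d\<^sup>2 = 1" "\<And>x y. g2 *v vector [x, y] = vector [c * x - d * y, d * x + c * y]" by (rule SO2E[OF assms(2)]) (rule that; assumption)
  have "(norm (diag_act g1 g2 \<xi>))\<^sup>2 = (norm \<xi>)\<^sup>2"
    using rotation_sum_sq[OF 1(1), of "\<xi>$1" "\<xi>$2"] rotation_sum_sq[OF 2(1), of "\<xi>$3" "\<xi>$4"]
    by (simp add: norm4_sq diag_act_def 1(2) 2(2) vector_4)
  then show ?thesis by simp
qed

section \<open>Stereographic projection and the field on the sphere\<close>

lemma stereo_inv_nth: "stereo_inv x $ 1 = 2 * x$1 * inn x" "stereo_inv x $ 2 = 2 * x$2 * inn x"
  "stereo_inv x $ 3 = 2 * x$3 * inn x" "stereo_inv x $ 4 = ((norm x)\<^sup>2 - 1) * inn x"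
  by (simp_all add: stereo_inv_def vector_4 inn_eq nn_norm)

lemma norm_stereo_inv: "norm (stereo_inv x) = 1"
proof -
  have "(norm (stereo_inv x))\<^sup>2 = (4 * (norm x)\<^sup>2 + ((norm x)\<^sup>2 - 1)\<^sup>2) * (inn x)\<^sup>2"
    unfolding norm4_sq stereo_inv_nth norm3_sq by (simp add: power2_eq_square algebra_simps)
  also have "\<dots> = (nn x * inn x)\<^sup>2" by (simp add: nn_norm power2_eq_square algebra_simps)
  finally have "(norm (stereo_inv x))\<^sup>2 = 1" by (simp add: nn_inn)
  then show ?thesis unfolding power2_eq_1_iff using norm_ge_zero[of "stereo_inv x"] by linarith
qed

lemma stereo_inv_stereo:
  assumes "norm \<xi> = 1" "\<xi>$4 \<noteq> 1" shows "stereo_inv (stereo \<xi>) = \<xi>"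
proof -
  define s where "s = 1 - \<xi>$4"
  have s: "s \<noteq> 0" using assms(2) by (simp add: s_def)
  have "(\<xi>$1)\<^sup>2 + (\<xi>$2)\<^sup>2 + (\<xi>$3)\<^sup>2 + (\<xi>$4)\<^sup>2 = 1" using norm4_sq[of \<xi>] assms(1) by simp
  then have e: "(\<xi>$1)\<^sup>2 + (\<xi>$2)\<^sup>2 + (\<xi>$3)\<^sup>2 = s * (2 - s)" by (simp add: s_def power2_eq_square algebra_simps)
  have x: "stereo \<xi> $ 1 = \<xi>$1 / s" "stereo \<xi> $ 2 = \<xi>$2 / s" "stereo \<xi> $ 3 = \<xi>$3 / s"
    by (simp_all add: stereo_def s_def)
  have n: "(norm (stereo \<xi>))\<^sup>2 = (2 - s) / s"
    unfolding norm3_sq x using e s by (simp add: power_divide power2_eq_square flip: add_divide_distrib)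
  have "nn (stereo \<xi>) = 2 / s" using s unfolding nn_norm n by (simp add: field_simps)
  then have i: "inn (stereo \<xi>) = s / 2" by (simp add: inn_eq)
  show ?thesis unfolding vec_eq_iff forall_4 stereo_inv_nth i n x using s by (simp add: s_def field_simps)
qed

text \<open>The field divided by \<open>psi\<close> and transplanted to the sphere. It involves the
  first two coordinates only, so \<open>g2\<close> leaves it unchanged, while \<open>g1\<close>
  preserves the sum of squares and rotates the vector; the symmetry becomes visible.\<close>

definition axial :: "(real \<Rightarrow> real) \<Rightarrow> real^4 \<Rightarrow> real^3" where
  "axial w \<xi> = w ((\<xi>$1)\<^sup>2 + (\<xi>$2)\<^sup>2) *\<^sub>R vector [- \<xi>$2, \<xi>$1, 0]"

lemma psi_sq: "(psi x)\<^sup>2 = 2 * inn x" using nn_pos[of x] by (simp add: psi_def inn_eq nn_norm)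

lemma psi_pos: "0 < psi x" using nn_pos[of x] by (simp add: psi_def nn_norm)

lemma amp_psi: "amp x = psi x ^ 3"
proof -
  have "(amp x)\<^sup>2 = ((psi x)\<^sup>2) ^ 3" unfolding amp_sq psi_sq by (simp add: power_mult_distrib)
  also have "\<dots> = (psi x ^ 3)\<^sup>2" by (simp flip: power_mult)
  finally show ?thesis by (rule power2_eq_imp_eq) (use amp_pos[of x] psi_pos[of x] in auto)
qed

text \<open>Dividing psi^3 by \<open>psi\<close> leaves psi^2 = 2 \<open>inn\<close>, and 2
  \<open>inn\<close> x_i is the i-th coordinate of the point on the sphere for i = 1, 2.\<close>

lemma field_axial: "(1 / psi x) *\<^sub>R field w x = axial w (stereo_inv x)"
proof -
  have s: "(stereo_inv x $ 1)\<^sup>2 + (stereo_inv x $ 2)\<^sup>2 = sph x"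
    unfolding stereo_inv_nth by (simp add: sph_def qq_def power_mult_distrib algebra_simps)
  have "FF w x = psi x * ((psi x)\<^sup>2 * w (sph x))" by (simp add: FF_def mnm_def amp_psi power_numeral_reduce)
  then have F: "FF w x = psi x * (2 * inn x * w (sph x))" unfolding psi_sq .
  show ?thesis unfolding axial_def s
    using psi_pos[of x] by (simp add: vec_eq_iff forall_3 field_nth F stereo_inv_nth)
qed

text \<open>If \<open>xi\<close> is the north pole, then \<open>stereo xi = 0\<close> is a junk value, but both sides vanish.\<close>

lemma field_axial_stereo:
  assumes \<xi>: "norm \<xi> = 1"
  shows "(1 / psi (stereo \<xi>)) *\<^sub>R field w (stereo \<xi>) = axial w \<xi>"
proof (cases "\<xi>$4 = 1")
  case True
  have "(\<xi>$1)\<^sup>2 + (\<xi>$2)\<^sup>2 + (\<xi>$3)\<^sup>2 = 0" using norm4_sq[of \<xi>] \<xi> True by simp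
  then have "\<xi>$1 = 0" "\<xi>$2 = 0" by (simp_all add: add_nonneg_eq_0_iff)
  then show ?thesis unfolding field_axial
    by (simp add: axial_def stereo_inv_nth stereo_def)
qed (simp add: field_axial stereo_inv_stereo \<xi>)

lemma axial_diag_act:
  assumes "g1 \<in> SO2" shows "axial w (diag_act g1 g2 \<xi>) = tilde g1 (axial w \<xi>)"
proof -
  obtain a b where 1: "a\<^sup>2 + b\<^sup>2 = 1" "\<And>x y. g1 *v vector [x, y] = vector [a * x - b * y, b * x + a * y]" by (rule SO2E[OF assms(1)]) (rule that; assumption)
  show ?thesis
    by (simp add: axial_def diag_act_def Let_def vector_4 tilde_def 1(2) rotation_sum_sq[OF 1(1)] vec_eq_iff forall_3 algebra_simps)
qed

lemma tilde_scaleR: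
  assumes "g \<in> SO2" shows "tilde g (c *\<^sub>R x) = c *\<^sub>R tilde g x"
proof -
  obtain a b where "\<And>x y. g *v vector [x, y] = vector [a * x - b * y, b * x + a * y]" by (rule SO2E[OF assms(1)]) (rule that; assumption)
  then show ?thesis by (simp add: tilde_def vec_eq_iff forall_3 algebra_simps)
qed

lemma field_symmetric:
  assumes W: "C2_on {0..1} w w1 w2" shows "field w \<in> D_SO22"
proof -
  have "(1 / psi (stereo (diag_act g1 g2 (stereo_inv x)))) *\<^sub>R field w (stereo (diag_act g1 g2 (stereo_inv x)))
      = (1 / psi x) *\<^sub>R tilde g1 (field w x)" if g: "g1 \<in> SO2" "g2 \<in> SO2" for g1 g2 x
    using field_axial_stereo[of "diag_act g1 g2 (stereo_inv x)"] field_axial[of x]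
    by (simp add: norm_diag_act[OF g] norm_stereo_inv axial_diag_act[OF g(1)] flip: tilde_scaleR[OF g(1)])
  then show ?thesis using field_D12[OF W] unfolding D_SO22_def Let_def by simp
qed

lemma FF_tilde:
  assumes g: "g \<in> SO2"
  shows "qq (tilde g x) = qq x" "FF w (tilde g x) = FF w x"
proof -
  obtain a b where 1: "a\<^sup>2 + b\<^sup>2 = 1" "\<And>x y. g *v vector [x, y] = vector [a * x - b * y, b * x + a * y]" by (rule SO2E[OF g]) (rule that; assumption)
  have c: "(tilde g x $ 1)\<^sup>2 + (tilde g x $ 2)\<^sup>2 = (x$1)\<^sup>2 + (x$2)\<^sup>2" "tilde g x $ 3 = x$3"
    by (simp_all add: tilde_def 1(2) rotation_sum_sq[OF 1(1)])
  show q: "qq (tilde g x) = qq x" using c by (simp add: qq_def)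
  have n: "nn (tilde g x) = nn x" using c by (simp add: nn_def)
  show "FF w (tilde g x) = FF w x" by (simp add: FF_def mnm_def amp_def sph_def inn_def q n)
qed

text \<open>Take u = F rho with F = \<open>FF\<close> and rho the distance to the axis. On the axis
  the quotient is 0 by the convention for division by zero and the field vanishes as well, so the
  identity holds at every point.\<close>

lemma axial_form:
  "\<exists>u :: real^3 \<Rightarrow> real. (\<forall>g\<in>SO2. \<forall>x. u (tilde g x) = u x) \<and>
    (AE x in lborel. field w x = (u x / sqrt ((x$1)^2 + (x$2)^2)) *\<^sub>R vector [- x$2, x$1, 0])"
proof (intro exI[of _ "\<lambda>x. FF w x * sqrt (qq x)"] conjI ballI allI AE_I2)
  fix x :: "real^3"
  have "qq x = 0 \<Longrightarrow> x$1 = 0 \<and> x$2 = 0" by (simp add: qq_def add_nonneg_eq_0_iff)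
  then show "field w x = (FF w x * sqrt (qq x) / sqrt ((x$1)^2 + (x$2)^2)) *\<^sub>R vector [- x$2, x$1, 0]"
    unfolding qq_def[symmetric] by (cases "qq x = 0") (auto simp: vec_eq_iff forall_3 field_nth)
qed (simp add: FF_tilde)

lemma solution_exists:
  "\<exists>U. U \<in> D_SO22 \<and> curl_curl_solution U \<and> (real n + 2) * (1 / (3 * 6912 * 40 ^ 8)) \<le> energy U \<and>
     (\<exists>u :: real^3 \<Rightarrow> real. (\<forall>g\<in>SO2. \<forall>x. u (tilde g x) = u x) \<and>
        (AE x in lborel. U x = (u x / sqrt ((x$1)^2 + (x$2)^2)) *\<^sub>R vector [- x$2, x$1, 0]))"
proof -
  \<comment> \<open>The shift by 2 ensures r <= 1/2, as the shooting and energy estimates require;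
    1/r >= n + 2 then drives the energy to infinity.\<close>
  have r1: "0 < 1 / (real n + 2)" "1 / (real n + 2) \<le> 1/2" by (auto simp: field_simps)
  obtain r w w1 w2 where r: "0 < r" "r \<le> 1 / (real n + 2)" and W: "C2_on {0..1} w w1 w2"
    and ode: "\<And>t. t \<in> {0..1} \<Longrightarrow> 4 * t * (1 - t) * w2 t + (8 - 12 * t) * w1 t = 15/4 * w t - t\<^sup>2 * w t ^ 5"
    and lo: "\<And>t. 0 \<le> t \<Longrightarrow> t \<le> r^4 / 80 \<Longrightarrow> 3/4 / r^3 \<le> w t"
    by (rule ode_solutions[OF r1]) (rule that; assumption)
  have r2: "r \<le> 1/2" by (rule order_trans[OF r(2) r1(2)])
  have sol: "curl_curl_solution (field w)" and en: "energy (field w) = 1/3 * integral\<^sup>L lborel (\<lambda>x. norm (field w x) ^ 6)"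
    by (rule field_solution[OF W], rule ode, assumption)+
  have "real n + 2 \<le> 1 / r" using r by (simp add: field_simps)
  then have "(real n + 2) * (1 / (3 * 6912 * 40 ^ 8)) \<le> 1 / r * (1 / (3 * 6912 * 40 ^ 8))" by (rule mult_right_mono) simp
  also have "\<dots> = 1/3 * (1 / (6912 * 40 ^ 8) / r)" by simp
  also have "\<dots> \<le> 1/3 * integral\<^sup>L lborel (\<lambda>x. norm (field w x) ^ 6)"
    by (intro mult_left_mono energy_lower_bound[OF W r(1) r2] lo) auto
  finally have "(real n + 2) * (1 / (3 * 6912 * 40 ^ 8)) \<le> energy (field w)" unfolding en .
  then show ?thesis using field_symmetric[OF W] sol axial_form by blast
qed

theorem theorem4p6:
  "\<exists>U :: nat \<Rightarrow> real^3 \<Rightarrow> real^3.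
     (\<forall>n. U n \<in> D_SO22 \<and> curl_curl_solution (U n)) \<and>
     filterlim (\<lambda>n. energy (U n)) at_top sequentially \<and>
     (\<forall>n. \<exists>u :: real^3 \<Rightarrow> real.
        (\<forall>g\<in>SO2. \<forall>x. u (tilde g x) = u x) \<and>
        (AE x in lborel. U n x =
           (u x / sqrt ((x$1)^2 + (x$2)^2)) *\<^sub>R vector [- x$2, x$1, 0]))"
proof -
  let ?P = "\<lambda>n U. U \<in> D_SO22 \<and> curl_curl_solution U \<and> (real n + 2) * (1 / (3 * 6912 * 40 ^ 8)) \<le> energy U \<and>
     (\<exists>u :: real^3 \<Rightarrow> real. (\<forall>g\<in>SO2. \<forall>x. u (tilde g x) = u x) \<and>
        (AE x in lborel. U x = (u x / sqrt ((x$1)^2 + (x$2)^2)) *\<^sub>R vector [- x$2, x$1, 0]))"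
  have "\<forall>n. \<exists>U. ?P n U" by (rule allI) (rule solution_exists)
  from choice[OF this] obtain U where U: "\<And>n. ?P n (U n)" by blast
  have "filterlim (\<lambda>n. (real n + 2) * (1 / (3 * 6912 * 40 ^ 8))) at_top sequentially"
    using filterlim_tendsto_pos_mult_at_top[OF tendsto_const _ filterlim_tendsto_add_at_top[OF tendsto_const filterlim_real_sequentially, of 2],
      of "1 / (3 * 6912 * 40 ^ 8)"] by (simp add: algebra_simps)
  then have "filterlim (\<lambda>n. energy (U n)) at_top sequentially"
    by (rule filterlim_at_top_mono[OF _ always_eventually]) (use U in blast)
  with U show ?thesis by (intro exI[of _ U]) blast
qed

end
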